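(* Let $\Omega\subseteq\mathbb{R}^d$, $d\ge2$, be a bounded Lipschitz domain, $I=(0,T)$ with $0<T<\infty$, $Q_T=I\times\Omega$, and $q,p\in\mathcal{P}^{\log}(Q_T)$ with $q^-,p^->1$. With the smoothing operators $\mathcal{R}^h_{Q_T}$, $h>0$, and the number $h_1>0$ defined in the context, the following holds for every $\boldsymbol{u}\in\mathcal{X}^{q,p}_{\boldsymbol\varepsilon}(Q_T)$: (i) There exists a constant $c_d>0$ (depending neither on $q,p$ nor on $\boldsymbol{u}$) such that $\sup_{h\in(0,h_1)}|\boldsymbol\varepsilon(\mathcal{R}^h_{Q_T}\boldsymbol{u})|\le c_d\,M_{d+1}(\mathcal{F}_{Q_T}\boldsymbol\varepsilon(\boldsymbol{u}))$ a.e. in $\mathbb{R}^{d+1}$. (ii) For every extension $\overline{p}\in\mathcal{P}^{\log}(\mathbb{R}^{d+1})$ of $p$ with $p^-\le\overline{p}\le p^+$ in $\mathbb{R}^{d+1}$ there exists a constant $c_{\overline{p}}>0$ (depending on $\overline{p}$, not on $\boldsymbol{u}$) such that $$\sup_{h\in(0,h_1)}\|\boldsymbol\varepsilon(\mathcal{R}^h_{Q_T}\boldsymbol{u})\|_{L^{\overline{p}(\cdot,\cdot)}(\mathbb{R}^{d+1})^{d\times d}}\le c_{\overline{p}}\|\boldsymbol\varepsilon(\boldsymbol{u})\|_{L^{p(\cdot,\cdot)}(Q_T)^{d\times d}}.$$ In particular, $\sup_{h\in(0,h_1)}\|\mathcal{R}^h_{Q_T}\boldsymbol{u}\|_{\mathcal{X}^{q,p}_{\boldsymbol\varepsilon}(Q_T)}\le(c_{\overline{q}}+c_{\overline{p}})\|\boldsymbol{u}\|_{\mathcal{X}^{q,p}_{\boldsymbol\varepsilon}(Q_T)}$,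 where, for an extension $\overline{q}\in\mathcal{P}^{\log}(\mathbb{R}^{d+1})$ of $q$ with $q^-\le\overline{q}\le q^+$, $c_{\overline{q}}>0$ is a constant with $\sup_{h>0}\|\mathcal{R}^h_{Q_T}\boldsymbol{v}\|_{L^{\overline{q}(\cdot,\cdot)}(\mathbb{R}^{d+1})^d}\le c_{\overline{q}}\|\boldsymbol{v}\|_{L^{q(\cdot,\cdot)}(Q_T)^d}$ for all $\boldsymbol{v}\in L^{q(\cdot,\cdot)}(Q_T)^d$. (iii) $\mathcal{R}^h_{Q_T}\boldsymbol{u}\to\boldsymbol{u}$ in $\mathcal{X}^{q,p}_{\boldsymbol\varepsilon}(Q_T)$ as $h\to0$; i.e. $C^\infty(\overline{I},C_0^\infty(\Omega)^d)$ is dense in $\mathcal{X}^{q,p}_{\boldsymbol\varepsilon}(Q_T)$.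
   Context: Exponents: for $G\subseteq\mathbb{R}^n$, $\mathcal{P}^{\log}(G)$ is the set of bounded measurable $p:G\to[1,\infty)$ for which there are $c_1,c_2>0$, $p_\infty\in\mathbb{R}$ with $|p(x)-p(y)|\le c_1/\log(e+1/|x-y|)$ for all $x\neq y$ in $G$ and $|p(x)-p_\infty|\le c_2/\log(e+|x|)$ for all $x\in G$; $p^\pm$ are ess sup/ess inf. $L^{p(\cdot)}(G)$ is the space of measurable $f$ with $\rho(f)=\int_G|f|^{p(x)}dx<\infty$ and Luxemburg norm $\inf\{\lambda>0:\rho(f/\lambda)\le1\}$ (Euclidean norm for vector/matrix values). Spaces: $\boldsymbol\varepsilon(\mathbf{u})=\frac12(\nabla\mathbf{u}+\nabla\mathbf{u}^\top)$ (spatial, distributional). $X^{q(\cdot),p(\cdot)}_{\boldsymbol\varepsilon}(\Omega)$ is the closure of $C_0^\infty(\Omega)^d$ with respect to $\|\mathbf{u}\|_{L^{q(\cdot)}}+\|\boldsymbol\varepsilon(\mathbf{u})\|_{L^{p(\cdot)}}$. $\mathcal{X}^{q,p}_{\boldsymbol\varepsilon}(Q_T):=\{\boldsymbol{u}\in L^{q(\cdot,\cdot)}(Q_T)^d:\boldsymbol\varepsilon(\boldsymbol{u})\in L^{p(\cdot,\cdot)}(Q_T,\mathbb{M}^{d\times d}_{\mathrm{sym}}),\ \boldsymbol{u}(t)\in X^{q(t,\cdot),p(t,\cdot)}_{\boldsymbol\varepsilon}(\Omega)\text{ for a.e. }t\in I\}$ with norm $\|\boldsymbol{u}\|_{L^{q(\cdot,\cdot)}(Q_T)^d}+\|\boldsymbol\varepsilon(\boldsymbol{u})\|_{L^{p(\cdot,\cdot)}(Q_T)^{d\times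 d}}$. $C^\infty(\overline I,C_0^\infty(\Omega)^d)$ denotes smooth functions on $\overline I\times\Omega$ with compact support in $\overline I\times\Omega$. Smoothing: let $h_0,c_0>0$ be constants (depending only on $d,\Omega$; such constants exist) such that $|\mathbf{u}(x)|\le c_0\int_{B^d_{2r(x)}(x)\cap\Omega}|\boldsymbol\varepsilon(\mathbf{u})(y)||x-y|^{1-d}dy$ for all $\mathbf{u}\in X^{1,1}_{\boldsymbol\varepsilon}(\Omega)$ and a.e. $x\in\Omega$ with $r(x):=\operatorname{dist}(x,\partial\Omega)\le h_0$; set $h_1:=h_0/4$. $\omega^n\in C_0^\infty(\mathbb{R}^n)$ is the standard mollifier, $\omega^n(x)=c\exp(-1/(1-|x|^2))$ for $|x|<1$, $0$ otherwise, $\int\omega^n=1$, and $\omega^n_h(x)=h^{-n}\omega^n(x/h)$. $\boldsymbol\omega_h:=\omega^{d+1}_h$ (in the variables $(t,x)$). $\Omega_\delta:=\{x\in\Omega:\operatorname{dist}(x,\partial\Omega)>\delta\}$ and $\eta_h:=\omega^d_{h/2}*\chi_{\Omega_{5h/2}}$. $\mathcal{F}_{Q_T}$ is extension by zero from $Q_T$ to $\mathbb{R}^{d+1}$. For $\boldsymbol{u}\in L^{q(\cdot,\cdot)}(Q_T)^d$, $\mathcal{R}^h_{Q_T}\boldsymbol{u}:=\boldsymbol\omega_h*(\eta_h\mathcal{F}_{Q_T}\boldsymbol{u})\in C^\infty(\mathbb{R}^{d+1})^d$ (with $\eta_h$ acting in $x$). $M_{d+1}(f)(z)=\sup_{r>0}\frac1{|B_r(z)|}\int_{B_r(z)}|f|$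 is the Hardy–Littlewood maximal operator on $\mathbb{R}^{d+1}$. *)

theory Defs
  imports "HOL-Analysis.Analysis" "HOL-Probability.Essential_Supremum"
begin

text \<open>
  Points of $\mathbb{R}^d$ are of type \<^typ>\<open>real ^ 'd\<close>, space-time points $(t,x)$ of type
  \<^typ>\<open>real \<times> (real ^ 'd)\<close>, and matrices of type \<^typ>\<open>real ^ 'd ^ 'd\<close>; the library norms on
  these types are the Euclidean ones. Functions on a set \<open>G\<close> are total functions of which only
  the values on \<open>G\<close> (up to null sets) are used, and "measurable" means Lebesgue measurable.
\<close>

section \<open>Smooth functions\<close>

primrec C_k_on :: "nat \<Rightarrow> 'a::euclidean_space set \<Rightarrow> ('a \<Rightarrow> 'b::real_normed_vector) \<Rightarrow> bool" where
  "C_k_on 0 S f \<longleftrightarrow> continuous_on S f"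
| "C_k_on (Suc k) S f \<longleftrightarrow> (\<forall>x\<in>S. f differentiable (at x)) \<and>
     (\<forall>v. C_k_on k S (\<lambda>x. frechet_derivative f (at x) v))"

text \<open>Only meant for open \<open>S\<close>.\<close>

definition smooth_on :: "'a::euclidean_space set \<Rightarrow> ('a \<Rightarrow> 'b::real_normed_vector) \<Rightarrow> bool" where
  "smooth_on S f \<longleftrightarrow> (\<forall>k. C_k_on k S f)"

definition C0_infinity :: "'a::euclidean_space set \<Rightarrow> ('a \<Rightarrow> 'b::real_normed_vector) set" where
  "C0_infinity G = {\<phi>. smooth_on UNIV \<phi> \<and> compact (closure {x. \<phi> x \<noteq> 0}) \<and>
     closure {x. \<phi> x \<noteq> 0} \<subseteq> G}"

section \<open>Variable exponents and variable exponent Lebesgue spaces\<close>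

definition P_log :: "'a::euclidean_space set \<Rightarrow> ('a \<Rightarrow> real) set" where
  "P_log G = {p. p \<in> borel_measurable (lebesgue_on G) \<and> bounded (p ` G) \<and> (\<forall>x\<in>G. 1 \<le> p x) \<and>
     (\<exists>c1>0. \<exists>c2>0. \<exists>p_inf.
        (\<forall>x\<in>G. \<forall>y\<in>G. x \<noteq> y \<longrightarrow> \<bar>p x - p y\<bar> \<le> c1 / ln (exp 1 + 1 / norm (x - y))) \<and>
        (\<forall>x\<in>G. \<bar>p x - p_inf\<bar> \<le> c2 / ln (exp 1 + norm x)))}"

definition exp_plus :: "'a::euclidean_space set \<Rightarrow> ('a \<Rightarrow> real) \<Rightarrow> ereal" where
  "exp_plus G p = esssup (lebesgue_on G) (\<lambda>x. ereal (p x))"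

definition exp_minus :: "'a::euclidean_space set \<Rightarrow> ('a \<Rightarrow> real) \<Rightarrow> ereal" where
  "exp_minus G p = - esssup (lebesgue_on G) (\<lambda>x. - ereal (p x))"

definition log_extension ::
    "'a::euclidean_space set \<Rightarrow> ('a \<Rightarrow> real) \<Rightarrow> ('a \<Rightarrow> real) \<Rightarrow> bool" where
  "log_extension G p pbar \<longleftrightarrow> pbar \<in> P_log UNIV \<and> (\<forall>z\<in>G. pbar z = p z) \<and>
     (\<forall>z. exp_minus G p \<le> ereal (pbar z) \<and> ereal (pbar z) \<le> exp_plus G p)"

definition modular ::
    "'a::euclidean_space set \<Rightarrow> ('a \<Rightarrow> real) \<Rightarrow> ('a \<Rightarrow> 'b::euclidean_space) \<Rightarrow> ennreal" where
  "modular G p f = (\<integral>\<^sup>+x. ennreal (norm (f x) powr p x) \<partial>lebesgue_on G)"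

definition Lp :: "'a::euclidean_space set \<Rightarrow> ('a \<Rightarrow> real) \<Rightarrow> ('a \<Rightarrow> 'b::euclidean_space) set" where
  "Lp G p = {f \<in> borel_measurable (lebesgue_on G). modular G p f < \<infinity>}"

text \<open>The Luxemburg norm takes values in \<^typ>\<open>ennreal\<close>, so that it is \<open>\<infinity>\<close> (the infimum of the
  empty set) for functions whose multiples all have modular larger than \<open>1\<close>.\<close>

definition lux_norm ::
    "'a::euclidean_space set \<Rightarrow> ('a \<Rightarrow> real) \<Rightarrow> ('a \<Rightarrow> 'b::euclidean_space) \<Rightarrow> ennreal" where
  "lux_norm G p f = (INF l\<in>{l. 0 < l \<and> modular G p (\<lambda>x. f x /\<^sub>R l) \<le> 1}. ennreal l)"

section \<open>The distributional symmetric gradient\<close>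

definition loc_integrable ::
    "'a::euclidean_space set \<Rightarrow> ('a \<Rightarrow> 'b::euclidean_space) \<Rightarrow> bool" where
  "loc_integrable G f \<longleftrightarrow> (\<forall>K. compact K \<and> K \<subseteq> G \<longrightarrow> integrable (lebesgue_on K) f)"

text \<open>\<open>e j\<close> is the direction of the \<open>j\<close>-th spatial variable, so that functions on
  $\Omega$ and on space-time are treated at once.\<close>

definition has_weak_eps :: "('d::finite \<Rightarrow> 'a::euclidean_space) \<Rightarrow> 'a set \<Rightarrow>
    ('a \<Rightarrow> real ^ 'd) \<Rightarrow> ('a \<Rightarrow> real ^ 'd ^ 'd) \<Rightarrow> bool" where
  "has_weak_eps e G u E \<longleftrightarrow> loc_integrable G u \<and> loc_integrable G E \<and>
     (\<forall>\<phi>::'a \<Rightarrow> real. \<phi> \<in> C0_infinity G \<longrightarrow> (\<forall>i j.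
        (LINT x|lebesgue_on G. E x $ i $ j * \<phi> x) =
        - (1/2) * (LINT x|lebesgue_on G. u x $ i * frechet_derivative \<phi> (at x) (e j) +
                                         u x $ j * frechet_derivative \<phi> (at x) (e i))))"

text \<open>The symmetric gradient is determined up to null sets only. If it has a continuous
  representative then this one is taken, so that for smooth functions (on open \<open>G\<close>) the
  classical symmetric gradient is obtained everywhere on \<open>G\<close>. This matters where a supremum over
  uncountably many symmetric gradients is formed pointwise.\<close>

definition weak_eps :: "('d::finite \<Rightarrow> 'a::euclidean_space) \<Rightarrow> 'a set \<Rightarrow>
    ('a \<Rightarrow> real ^ 'd) \<Rightarrow> ('a \<Rightarrow> real ^ 'd ^ 'd)" where
  "weak_eps e G u = (SOME E. has_weak_eps e G u E \<and>
     ((\<exists>E'. has_weak_eps e G u E' \<and> continuous_on G E') \<longrightarrow> continuous_on G E))"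

definition dir_x :: "'d::finite \<Rightarrow> real ^ 'd" where
  "dir_x j = axis j 1"

definition dir_tx :: "'d::finite \<Rightarrow> real \<times> (real ^ 'd)" where
  "dir_tx j = (0, axis j 1)"

section \<open>The function spaces\<close>

text \<open>Lipschitz boundary: near each boundary point the domain is the set above the graph of a
  Lipschitz function over the hyperplane orthogonal to some unit vector \<open>\<nu>\<close>.\<close>

definition bounded_lipschitz_domain :: "(real ^ 'd::finite) set \<Rightarrow> bool" where
  "bounded_lipschitz_domain \<Omega> \<longleftrightarrow> open \<Omega> \<and> connected \<Omega> \<and> \<Omega> \<noteq> {} \<and> bounded \<Omega> \<and>
     (\<forall>x0\<in>frontier \<Omega>. \<exists>r>0. \<exists>\<nu> L \<gamma>. norm \<nu> = 1 \<and>
        L-lipschitz_on {y. y \<bullet> \<nu> = 0} (\<gamma> :: real ^ 'd \<Rightarrow> real) \<and>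
        \<Omega> \<inter> ball x0 r = {y \<in> ball x0 r. \<gamma> (y - (y \<bullet> \<nu>) *\<^sub>R \<nu>) < y \<bullet> \<nu>})"

definition X_eps :: "(real ^ 'd::finite) set \<Rightarrow> (real ^ 'd \<Rightarrow> real) \<Rightarrow> (real ^ 'd \<Rightarrow> real) \<Rightarrow>
    (real ^ 'd \<Rightarrow> real ^ 'd) set" where
  "X_eps \<Omega> q p = {u \<in> Lp \<Omega> q. (\<exists>E. has_weak_eps dir_x \<Omega> u E) \<and> weak_eps dir_x \<Omega> u \<in> Lp \<Omega> p \<and>
     (\<forall>\<delta>>0. \<exists>\<phi>\<in>C0_infinity \<Omega>.
        lux_norm \<Omega> q (\<lambda>x. u x - \<phi> x) + lux_norm \<Omega> p (weak_eps dir_x \<Omega> (\<lambda>x. u x - \<phi> x)) < \<delta>)}"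

definition cylinder :: "real \<Rightarrow> (real ^ 'd::finite) set \<Rightarrow> (real \<times> (real ^ 'd)) set" where
  "cylinder T \<Omega> = {0<..<T} \<times> \<Omega>"

definition XX_eps :: "real \<Rightarrow> (real ^ 'd::finite) set \<Rightarrow> (real \<times> (real ^ 'd) \<Rightarrow> real) \<Rightarrow>
    (real \<times> (real ^ 'd) \<Rightarrow> real) \<Rightarrow> (real \<times> (real ^ 'd) \<Rightarrow> real ^ 'd) set" where
  "XX_eps T \<Omega> q p = {u \<in> Lp (cylinder T \<Omega>) q.
     (\<exists>E. has_weak_eps dir_tx (cylinder T \<Omega>) u E) \<and>
     weak_eps dir_tx (cylinder T \<Omega>) u \<in> Lp (cylinder T \<Omega>) p \<and>
     (AE t in lebesgue_on {0<..<T}. (\<lambda>x. u (t, x)) \<in> X_eps \<Omega> (\<lambda>x. q (t, x)) (\<lambda>x. p (t, x)))}"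

definition XX_norm :: "real \<Rightarrow> (real ^ 'd::finite) set \<Rightarrow> (real \<times> (real ^ 'd) \<Rightarrow> real) \<Rightarrow>
    (real \<times> (real ^ 'd) \<Rightarrow> real) \<Rightarrow> (real \<times> (real ^ 'd) \<Rightarrow> real ^ 'd) \<Rightarrow> ennreal" where
  "XX_norm T \<Omega> q p u = lux_norm (cylinder T \<Omega>) q u +
     lux_norm (cylinder T \<Omega>) p (weak_eps dir_tx (cylinder T \<Omega>) u)"

text \<open>$C^\infty(\overline I, C_0^\infty(\Omega)^d)$; smoothness on the non-open set
  $\overline I\times\Omega$ means being the restriction of a smooth function on
  $\mathbb{R}\times\Omega$.\<close>

definition C_infinity_C0 ::
    "real \<Rightarrow> (real ^ 'd::finite) set \<Rightarrow> (real \<times> (real ^ 'd) \<Rightarrow> real ^ 'd) set" where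
  "C_infinity_C0 T \<Omega> = {\<phi>.
     (\<exists>\<psi>. smooth_on (UNIV \<times> \<Omega>) \<psi> \<and> (\<forall>z\<in>{0..T} \<times> \<Omega>. \<phi> z = \<psi> z)) \<and>
     (\<exists>K. compact K \<and> K \<subseteq> {0..T} \<times> \<Omega> \<and> (\<forall>z\<in>{0..T} \<times> \<Omega> - K. \<phi> z = 0))}"

section \<open>The smoothing operators\<close>

definition bump :: "'a::euclidean_space \<Rightarrow> real" where
  "bump x = (if norm x < 1 then exp (- 1 / (1 - (norm x)\<^sup>2)) else 0)"

definition mollifier :: "real \<Rightarrow> 'a::euclidean_space \<Rightarrow> real" where
  "mollifier h x = bump (x /\<^sub>R h) / (LINT y|lebesgue. bump (y::'a)) / h ^ DIM('a)"

definition fun_conv ::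
    "('a::euclidean_space \<Rightarrow> real) \<Rightarrow> ('a \<Rightarrow> 'b::euclidean_space) \<Rightarrow> 'a \<Rightarrow> 'b" where
  "fun_conv k f x = (LINT y|lebesgue. k (x - y) *\<^sub>R f y)"

definition inner_set :: "'a::euclidean_space set \<Rightarrow> real \<Rightarrow> 'a set" where
  "inner_set \<Omega> \<delta> = {x \<in> \<Omega>. infdist x (frontier \<Omega>) > \<delta>}"

definition cutoff :: "'a::euclidean_space set \<Rightarrow> real \<Rightarrow> 'a \<Rightarrow> real" where
  "cutoff \<Omega> h = fun_conv (mollifier (h / 2)) (indicator (inner_set \<Omega> (5 * h / 2)))"

definition zero_ext :: "'a set \<Rightarrow> ('a \<Rightarrow> 'b::euclidean_space) \<Rightarrow> 'a \<Rightarrow> 'b" where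
  "zero_ext G f = (\<lambda>z. if z \<in> G then f z else 0)"

definition smoothing :: "real \<Rightarrow> (real ^ 'd::finite) set \<Rightarrow> real \<Rightarrow>
    (real \<times> (real ^ 'd) \<Rightarrow> real ^ 'd) \<Rightarrow> (real \<times> (real ^ 'd) \<Rightarrow> real ^ 'd)" where
  "smoothing T \<Omega> h u =
     fun_conv (mollifier h) (\<lambda>z. cutoff \<Omega> h (snd z) *\<^sub>R zero_ext (cylinder T \<Omega>) u z)"

definition maximal_function ::
    "('a::euclidean_space \<Rightarrow> 'b::euclidean_space) \<Rightarrow> 'a \<Rightarrow> ennreal" where
  "maximal_function f z = (SUP r\<in>{0<..}.
     (\<integral>\<^sup>+w. ennreal (norm (f w)) \<partial>lebesgue_on (ball z r)) / emeasure lebesgue (ball z r))"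

text \<open>The pointwise estimate near the boundary by which the constants $h_0,c_0$ are introduced.\<close>

definition boundary_estimate :: "(real ^ 'd::finite) set \<Rightarrow> real \<Rightarrow> real \<Rightarrow> bool" where
  "boundary_estimate \<Omega> h0 c0 \<longleftrightarrow> (\<forall>u\<in>X_eps \<Omega> (\<lambda>_. 1) (\<lambda>_. 1).
     AE x in lebesgue_on \<Omega>. infdist x (frontier \<Omega>) \<le> h0 \<longrightarrow>
       ennreal (norm (u x)) \<le> ennreal c0 *
         (\<integral>\<^sup>+y. ennreal (norm (weak_eps dir_x \<Omega> u y) * norm (x - y) powr (1 - real CARD('d)))
            \<partial>lebesgue_on (ball x (2 * infdist x (frontier \<Omega>)) \<inter> \<Omega>)))"

end

theory Submission
  imports Defs
begin

text \<open>
  The symmetric gradient of $R^h u$ is the mollification of $\eta_h\varepsilon(u)$ plus that of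
  the commutator term, the symmetric part of $\nabla\eta_h\otimes u$. The latter lives in a
  boundary strip whose width is comparable to $h$, and $|\nabla\eta_h|\le C/h$. On almost every
  time slice the boundary estimate bounds $|u|$ in that strip by a Riesz potential of
  $|\varepsilon(u)|$ over balls of radius at most $6h$, and the integral of the kernel over such a
  ball compensates the factor $1/h$. Thus $|\varepsilon(R^h u)(z)|$ is at most a constant times
  the mean of $|\varepsilon(u)|$ over the ball of radius $8h$ about $z$. This gives (i).

  For (ii) the boundedness of the maximal operator is not needed. The radius of the ball is the
  same for all $z$ and bounded, so log-Hoelder continuity allows one to freeze the exponent in each
  ball, and by Jensen's inequality the modular of the ball mean is bounded as soon as that of the
  function is.

  For (iii), $\varepsilon(R^h u)-\omega_h*\varepsilon(u)$ is bounded in the same way by the ball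
  mean of the restriction of $|\varepsilon(u)|$ to a boundary strip that shrinks with $h$, whose
  norm vanishes in the limit. The mollifications converge in norm since up to a small error the
  function is bounded, and for uniformly bounded functions on a bounded set convergence in $L^1$
  is enough.
\<close>

section \<open>Smoothness of the bump function\<close>

text \<open>The boundary estimate concerns functions of x alone in the space with both exponents 1,
  while \<open>u\<close> and its gradient live in space-time. So for almost every t the slice of the
  space-time gradient must first be identified with the gradient of the slice. The commutator
  identity, too, is proved slice by slice: mollifier times cutoff is compactly supported in
  \<Omega>, but in general not in the open time interval, so it is no test function on the cylinder.
  As only spatial derivatives occur, no cutoff in time is required.

  Origin of the radii: the set of distance above \<open>5 * h / 2\<close>, mollified at scale
  \<open>h / 2\<close>, gives a cutoff that varies only at distances from \<open>2 * h\<close> to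
  \<open>3 * h\<close>; the latter is below \<open>h0\<close> if \<open>h < h0 / 4\<close>. The
  boundary estimate doubles the distance to \<open>6 * h\<close>, its balls stay within
  \<open>9 * h\<close> of the boundary, and a space-time ball of radius \<open>h\<close> grows to
  \<open>2 * h + 6 * h\<close>.

  The supremum in (i) runs over uncountably many h. It is harmless because \<open>weak_eps\<close>
  prefers a continuous representative, which for the smoothed functions makes every estimate valid
  at every point.\<close>

lemma frechet_derivative_cong_open:
  assumes "open S" "x \<in> S" "\<And>y. y \<in> S \<Longrightarrow> f y = g y"
  shows "frechet_derivative f (at x) = frechet_derivative g (at x)"
proof -
  \<comment> \<open>\<open>frechet_derivative\<close> is a choice among the derivatives at
    \<open>x\<close>, so it suffices that \<open>f\<close> and \<open>g\<close> have the same ones;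
    the equality thus holds also where neither is differentiable.\<close>
  have "(f has_derivative F) (at x) \<longleftrightarrow> (g has_derivative F) (at x)" for F
    using assms by (metis has_derivative_transform_within_open)
  then show ?thesis by (simp add: frechet_derivative_def)
qed

lemma differentiable_cong_open:
  assumes "open S" "x \<in> S" "\<And>y. y \<in> S \<Longrightarrow> f y = g y" "f differentiable (at x)"
  shows "g differentiable (at x)"
  using assms by (metis differentiable_def has_derivative_transform_within_open)

lemma frechet_derivative_eqI:
  "(f has_derivative F) (at x) \<Longrightarrow> frechet_derivative f (at x) v = F v"
  using frechet_derivative_at by metis

lemma C_k_on_cong:
  assumes "open S" "\<And>x. x \<in> S \<Longrightarrow> f x = g x" "C_k_on k S f"
  shows "C_k_on k S g"
  using assms(2,3)
proof (induction k arbitrary: f g)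
  case 0
  then show ?case by (simp cong: continuous_on_cong)
next
  case (Suc k)
  have d: "frechet_derivative f (at x) v = frechet_derivative g (at x) v" if "x \<in> S" for x v
    using frechet_derivative_cong_open[OF assms(1) that] Suc.prems(1) by metis
  show ?case
    using Suc.prems Suc.IH[OF d] differentiable_cong_open[OF assms(1)] by (simp) blast
qed

lemma C_k_on_subset: "C_k_on k S f \<Longrightarrow> T \<subseteq> S \<Longrightarrow> C_k_on k T f"
  by (induction k arbitrary: f) (auto intro: continuous_on_subset)

text \<open>Gluing over two open sets. Later one of them is the complement of a compact support,
  which turns an extension by zero into a smooth function on the whole space.\<close>

lemma C_k_on_Un:
  "open S \<Longrightarrow> open T \<Longrightarrow> C_k_on k S f \<Longrightarrow>
    C_k_on k T f \<Longrightarrow> C_k_on k (S \<union> T) f"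
  by (induction k arbitrary: f) (auto intro: continuous_on_open_Un)

lemma C_k_on_SucD: "C_k_on (Suc k) S f \<Longrightarrow> C_k_on k S f"
proof (induction k arbitrary: f)
  case 0
  then show ?case by (auto intro!: continuous_at_imp_continuous_on differentiable_imp_continuous_within)
qed auto

text \<open>Lets an explicit family \<open>F\<close> stand in for \<open>frechet_derivative\<close>,
  which is defined by choice; uniqueness of the derivative identifies the two. Most closure
  properties below are inductions through this rule.\<close>

lemma C_k_on_SucI:
  assumes "open S" "\<And>x. x \<in> S \<Longrightarrow> (f has_derivative F x) (at x)" "\<And>v. C_k_on k S
    (\<lambda>x. F x v)"
  shows "C_k_on (Suc k) S f"
proof -
  have "C_k_on k S (\<lambda>x. frechet_derivative f (at x) v)" for v
    by (rule C_k_on_cong[OF assms(1) _ assms(3)[of v]])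
       (simp add: frechet_derivative_eqI[OF assms(2)])
  then show ?thesis using assms(2) by (auto simp: differentiable_def)
qed

lemma C_k_on_Suc_has_derivative:
  "C_k_on (Suc k) S f \<Longrightarrow> x \<in> S \<Longrightarrow> (f has_derivative frechet_derivative f (at x))
    (at x)"
  by (simp add: frechet_derivative_works)

lemma C_k_on_const: "C_k_on k S (\<lambda>_. c)"
  by (induction k arbitrary: c) auto

lemma C_k_on_linear:
  assumes "bounded_linear L" "open S"
  shows "C_k_on k S L"
proof (cases k)
  case 0
  then show ?thesis using assms by (simp add: linear_continuous_on)
next
  case (Suc m)
  have "C_k_on (Suc m) S L"
    by (rule C_k_on_SucI[where F = "\<lambda>_. L"])
       (auto simp: assms bounded_linear_imp_has_derivative C_k_on_const)
  then show ?thesis by (simp only: Suc)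
qed

lemma C_k_on_add:
  assumes "open S" "C_k_on k S f" "C_k_on k S g"
  shows "C_k_on k S (\<lambda>x. f x + g x)"
  using assms(2,3)
proof (induction k arbitrary: f g)
  case 0
  then show ?case by (auto intro: continuous_intros)
next
  case (Suc k)
  show ?case
  proof (rule C_k_on_SucI[OF assms(1)])
    show "((\<lambda>x. f x + g x) has_derivative
        (\<lambda>v. frechet_derivative f (at x) v + frechet_derivative g (at x) v)) (at x)" if "x \<in> S" for x
      using that Suc.prems[THEN C_k_on_Suc_has_derivative] by (auto intro: has_derivative_add)
    show "C_k_on k S (\<lambda>x. frechet_derivative f (at x) v + frechet_derivative g (at x) v)" for v
      using Suc by auto
  qed
qed

lemma C_k_on_bounded_linear:
  assumes "bounded_linear L" "open S" "C_k_on k S f"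
  shows "C_k_on k S (\<lambda>x. L (f x))"
  using assms(3)
proof (induction k arbitrary: f)
  case 0
  then show ?case by (simp add: assms(1) bounded_linear.continuous_on)
next
  case (Suc k)
  show ?case
  proof (rule C_k_on_SucI[OF assms(2)])
    show "((\<lambda>x. L (f x)) has_derivative (\<lambda>v. L (frechet_derivative f (at x) v))) (at x)" if "x \<in>
      S" for x
      using that Suc.prems[THEN C_k_on_Suc_has_derivative] bounded_linear.has_derivative[OF assms(1)] by blast
    show "C_k_on k S (\<lambda>x. L (frechet_derivative f (at x) v))" for v
      using Suc by auto
  qed
qed

lemma C_k_on_bilinear:
  assumes "bounded_bilinear B" "open S" "C_k_on k S f" "C_k_on k S g"
  shows "C_k_on k S (\<lambda>x. B (f x) (g x))"
  using assms(3,4)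
proof (induction k arbitrary: f g)
  case 0
  then show ?case by (simp add: assms(1) bounded_bilinear.continuous_on)
next
  case (Suc k)
  show ?case
  proof (rule C_k_on_SucI[OF assms(2)])
    show "((\<lambda>x. B (f x) (g x)) has_derivative
        (\<lambda>v. B (f x) (frechet_derivative g (at x) v) +
          B (frechet_derivative f (at x) v) (g x))) (at x)" if "x \<in> S" for x
      using that Suc.prems[THEN C_k_on_Suc_has_derivative] bounded_bilinear.FDERIV[OF assms(1)] by blast
    show "C_k_on k S (\<lambda>x. B (f x) (frechet_derivative g (at x) v) +
      B (frechet_derivative f (at x) v) (g x))" for v
      \<comment> \<open>In each product of the Leibniz rule one factor is undifferentiated;
        \<open>C_k_on_SucD\<close> lowers it to order \<open>k\<close>, so that the induction
        hypothesis fits both factors.\<close>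
      using Suc.IH Suc.prems Suc.prems[THEN C_k_on_SucD]  by (intro C_k_on_add[OF assms(2)]) auto
  qed
qed

text \<open>The inner map has the constant derivative \<open>A\<close>, so differentiation merely
  replaces \<open>f\<close> by one of its directional derivatives, and the induction gets by without
  a product rule.\<close>

lemma C_k_on_affine:
  assumes "bounded_linear A" "open S'" "\<And>x. x \<in> S' \<Longrightarrow> c + A x \<in> S" "C_k_on k S f"
  shows "C_k_on k S' (\<lambda>x. f (c + A x))"
  using assms(4)
proof (induction k arbitrary: f)
  case 0
  have "continuous_on S' (\<lambda>x. c + A x)"
    by (intro continuous_intros linear_continuous_on assms(1))
  then show ?case using 0 assms(3) by (auto intro: continuous_on_compose2)
next
  case (Suc k)
  have A: "((\<lambda>x. c + A x) has_derivative A) (at x)" for x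
    using has_derivative_add[OF has_derivative_const[of c] bounded_linear_imp_has_derivative[OF assms(1)]] by simp
  show ?case
  proof (rule C_k_on_SucI[OF assms(2)])
    show "((\<lambda>x. f (c + A x)) has_derivative (\<lambda>v. frechet_derivative f (at (c +
      A x)) (A v))) (at x)" if "x \<in> S'" for x
      using has_derivative_compose[OF A C_k_on_Suc_has_derivative[OF Suc.prems]] assms(3)[OF that] by simp
    show "C_k_on k S' (\<lambda>x. frechet_derivative f (at (c + A x)) (A v))" for v
      using Suc by auto
  qed
qed

text \<open>With a real argument of \<open>f\<close> the chain rule is a product of two real
  functions, a derivative of \<open>g\<close> and \<open>f'\<close> after \<open>g\<close>; the
  first is controlled by the assumption on \<open>g\<close>, the second by the induction hypothesis
  applied to \<open>f'\<close>.\<close>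

lemma C_k_on_real_compose:
  fixes f :: "real \<Rightarrow> real"
  assumes "open S" "C_k_on k UNIV f" "C_k_on k S g"
  shows "C_k_on k S (\<lambda>x. f (g x))"
  using assms(2,3)
proof (induction k arbitrary: f g)
  case 0
  then show ?case using continuous_on_compose2 by (auto intro: continuous_on_compose2)
next
  case (Suc k)
  \<comment> \<open>On the real line a derivative is multiplication by its value at
    \<open>1\<close>. This yields one fixed function \<open>f'\<close> to which the induction
    hypothesis can be applied.\<close>
  have d: "(f has_derivative (\<lambda>h. h * frechet_derivative f (at y) 1)) (at y)" for y
  proof -
    have "(f has_derivative frechet_derivative f (at y)) (at y)"
      using C_k_on_Suc_has_derivative[OF Suc.prems(1)] by simp
    moreover from this have "frechet_derivative f (at y) = (\<lambda>h. h * frechet_derivative f (at y) 1)"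
      using linear_scale[OF has_derivative_linear]
        by (metis (no_types, opaque_lifting) mult.right_neutral real_scaleR_def)
    ultimately show ?thesis by metis
  qed
  show ?case
  proof (rule C_k_on_SucI[OF assms(1)])
    show "((\<lambda>x. f (g x)) has_derivative (\<lambda>v. frechet_derivative g (at x) v *
      frechet_derivative f (at (g x)) 1)) (at x)" if "x \<in> S" for x
      using has_derivative_compose[OF C_k_on_Suc_has_derivative[OF Suc.prems(2) that] d] .
    show "C_k_on k S (\<lambda>x. frechet_derivative g (at x) v * frechet_derivative f (at (g x)) 1)" for v
      using Suc.prems C_k_on_SucD[OF Suc.prems(2)]
      by (intro C_k_on_bilinear[OF bounded_bilinear_mult] assms(1) Suc.IH[where f="\<lambda>y. frechet_derivative f
        (at y) 1"]) auto
  qed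
qed

text \<open>The flat function \<open>exp (- (1 / s))\<close> together with all its multiples by
  powers of \<open>1 / s\<close>: up to linear combinations this family is closed under
  differentiation, so one induction proves smoothness of all members. The bump function is the
  member \<open>m = 0\<close> evaluated at 1 minus the squared norm.\<close>

definition exp_inv :: "nat \<Rightarrow> real \<Rightarrow> real" where
  "exp_inv m s = (if 0 < s then (1 / s) ^ m * exp (- (1 / s)) else 0)"

lemma exp_inv_tendsto_0: "(exp_inv m \<longlongrightarrow> 0) (at_right 0)"
proof -
  have "((\<lambda>x::real. x ^ m * exp (- x)) \<longlongrightarrow> 0) at_top"
    using tendsto_power_div_exp_0[of m] by (simp add: exp_minus divide_inverse)
  from filterlim_compose[OF this filterlim_inverse_at_top_right]
  have "((\<lambda>s::real. inverse s ^ m * exp (- inverse s)) \<longlongrightarrow> 0) (at_right 0)" .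
  then show ?thesis
    by (rule Lim_transform_eventually)
       (auto simp: exp_inv_def eventually_at_right_field divide_inverse intro!: exI[of _ 1])
qed

lemma exp_inv_tendsto_0': "(exp_inv m \<longlongrightarrow> 0) (at 0)"
proof -
  have "(exp_inv m \<longlongrightarrow> 0) (at_left 0)"
    by (rule tendsto_eventually) (auto simp: exp_inv_def eventually_at_left_field intro!: exI[of _ "-1"])
  with exp_inv_tendsto_0 show ?thesis by (simp add: filterlim_split_at)
qed

lemma exp_inv_derivative:
  "(exp_inv m has_derivative (\<lambda>v. v * (exp_inv (m + 2) s - real m * exp_inv (m + 1) s))) (at s)"
proof -
  consider "s < 0" | "s = 0" | "0 < s" by linarith
  then show ?thesis
  proof cases
    case 1
    have "((\<lambda>_. 0::real) has_derivative (\<lambda>v. 0)) (at s)" by simp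
    then have "(exp_inv m has_derivative (\<lambda>v. 0)) (at s)"
      by (rule has_derivative_transform_within_open[where s =
        "{..<0}"]) (use 1 in \<open>auto simp: exp_inv_def\<close>)
    then show ?thesis using 1 by (simp add: exp_inv_def)
  next
    case 2
    \<comment> \<open>The difference quotient at 0 is \<open>exp_inv (Suc m)\<close> itself, whose
      limit at 0 is already known.\<close>
    have "((\<lambda>h. exp_inv m h / h) \<longlongrightarrow> 0) (at 0)"
      by (rule Lim_transform_eventually[OF exp_inv_tendsto_0'[of "Suc m"]])
         (auto simp: exp_inv_def eventually_at_filter intro!: always_eventually)
    then have "(exp_inv m has_field_derivative 0) (at 0)"
      by (simp add: has_field_derivative_iff exp_inv_def)
    then show ?thesis using 2 by (simp add: exp_inv_def has_field_derivative_def lambda_zero)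
  next
    case 3
    have "((\<lambda>s. (1 / s) ^ m * exp (- (1 / s))) has_field_derivative
        (exp_inv (m + 2) s - real m * exp_inv (m + 1) s)) (at s)"
      using 3
      by (cases m) (auto intro!: derivative_eq_intros simp: exp_inv_def field_simps power2_eq_square,
          metis One_nat_def power_eq_if)
    then have "(exp_inv m has_field_derivative (exp_inv (m + 2) s - real m * exp_inv (m + 1) s)) (at s)"
      by (rule has_field_derivative_transform_within_open[where S =
        "{0<..}"]) (use 3 in \<open>auto simp: exp_inv_def\<close>)
    then show ?thesis by (simp add: has_field_derivative_def mult.commute[of _ "_ - _"] mult_commute_abs)
  qed
qed

lemma exp_inv_C_k: "C_k_on k UNIV (exp_inv m)"
proof (induction k arbitrary: m)
  case 0
  show ?case
    using exp_inv_derivative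
    by (auto intro!: continuous_at_imp_continuous_on has_derivative_continuous)
next
  case (Suc k)
  show ?case
  proof (rule C_k_on_SucI[OF open_UNIV exp_inv_derivative])
    fix v
    have "C_k_on k UNIV (\<lambda>x. v * (exp_inv (m + 2) x + (- real m) * exp_inv (m + 1) x))"
      by (intro C_k_on_bounded_linear[OF bounded_linear_mult_right] C_k_on_add Suc open_UNIV)
    then show "C_k_on k UNIV (\<lambda>x. v * (exp_inv (m + 2) x - real m * exp_inv (m + 1) x))" by simp
  qed
qed

lemma C_k_on_bump: "C_k_on k UNIV (bump :: 'a::euclidean_space \<Rightarrow> real)"
proof -
  have b: "bump = (\<lambda>x::'a. exp_inv 0 (1 + (- (x \<bullet> x))))"
    by (auto simp: bump_def exp_inv_def fun_eq_iff dot_square_norm abs_square_less_1)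
  show ?thesis unfolding b
    by (intro C_k_on_real_compose[OF _ exp_inv_C_k] C_k_on_add C_k_on_const open_UNIV
         C_k_on_bounded_linear[OF bounded_linear_minus[OF bounded_linear_ident]]
         C_k_on_bilinear[OF bounded_bilinear_inner] C_k_on_linear bounded_linear_ident)
qed

lemma C_k_on_scaled_bump: "C_k_on k UNIV (\<lambda>x::'a::euclidean_space. c * bump ((a - x) /\<^sub>R h))"
proof -
  have "C_k_on k UNIV (\<lambda>x. bump (a /\<^sub>R h + (- (x /\<^sub>R h))))"
    by (rule C_k_on_affine[OF _ open_UNIV _ C_k_on_bump])
       (auto intro!: bounded_linear_minus bounded_linear_scaleR_right)
  then show ?thesis
    by (intro C_k_on_bounded_linear[OF bounded_linear_mult_right]) (auto simp: scaleR_right_diff_distrib)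
qed

section \<open>Test functions, convolutions and mollifiers\<close>

text \<open>The closure of the set of non-zeros is awkward to handle; any compact subset of
  \<open>G\<close> outside of which the function vanishes serves as well.\<close>

lemma C0_infinity_iff:
  "\<phi> \<in> C0_infinity G \<longleftrightarrow> smooth_on UNIV \<phi> \<and> (\<exists>K. compact K \<and> K
    \<subseteq> G \<and> (\<forall>x. x \<notin> K \<longrightarrow> \<phi> x = 0))"
proof
  assume "\<phi> \<in> C0_infinity G"
  then show "smooth_on UNIV \<phi> \<and> (\<exists>K. compact K \<and> K \<subseteq> G \<and> (\<forall>x. x
    \<notin> K \<longrightarrow> \<phi> x = 0))"
    unfolding C0_infinity_def using closure_subset[of "{x. \<phi> x \<noteq> 0}"]
    by (auto intro!: exI[of _ "closure {x. \<phi> x \<noteq> 0}"])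
next
  assume "smooth_on UNIV \<phi> \<and> (\<exists>K. compact K \<and> K \<subseteq> G \<and> (\<forall>x. x \<notin> K
    \<longrightarrow> \<phi> x = 0))"
  then obtain K where K: "smooth_on UNIV \<phi>" "compact K" "K \<subseteq> G" "\<And>x. x \<notin> K
    \<Longrightarrow> \<phi> x = 0" by blast
  have "closure {x. \<phi> x \<noteq> 0} \<subseteq> K"
    using K by (intro closure_minimal compact_imp_closed) auto
  with K show "\<phi> \<in> C0_infinity G"
    unfolding C0_infinity_def
    by (auto intro: compact_closure[THEN iffD2] bounded_subset[OF compact_imp_bounded] closure_subset[THEN
      order_trans])
qed

lemma C0_infinity_smooth: "\<phi> \<in> C0_infinity G \<Longrightarrow> smooth_on UNIV \<phi>"
  by (simp add: C0_infinity_def)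

lemma smooth_on_C_k: "smooth_on S f \<Longrightarrow> C_k_on k S f"
  by (simp add: smooth_on_def)

lemma smooth_on_has_derivative:
  "smooth_on S f \<Longrightarrow> x \<in> S \<Longrightarrow> (f has_derivative frechet_derivative f (at x)) (at x)"
  by (rule C_k_on_Suc_has_derivative[OF smooth_on_C_k])

lemma smooth_on_frechet:
  assumes "smooth_on S f"
  shows "smooth_on S (\<lambda>x. frechet_derivative f (at x) v)"
proof -
  have "C_k_on k S (\<lambda>x. frechet_derivative f (at x) v)" for k
    using smooth_on_C_k[OF assms, of "Suc k"] by simp
  then show ?thesis by (simp add: smooth_on_def)
qed

lemma smooth_on_continuous: "smooth_on S f \<Longrightarrow> continuous_on S f"
  using smooth_on_C_k[of S f 0] by simp

lemma smooth_on_linear_frechet: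
  assumes "smooth_on S f" "x \<in> S"
  shows "bounded_linear (frechet_derivative f (at x))"
  using smooth_on_has_derivative[OF assms] has_derivative_bounded_linear by blast

lemma frechet_derivative_eq_0_outside:
  assumes "closed K" "\<And>x. x \<notin> K \<Longrightarrow> f x = 0" "x \<notin> K"
  shows "frechet_derivative f (at x) v = 0"
proof -
  have "(f has_derivative (\<lambda>_. 0)) (at x)"
    by (rule has_derivative_transform_within_open[OF has_derivative_const[of 0], where s = "- K"])
       (use assms in \<open>auto simp: open_Compl\<close>)
  then show ?thesis by (rule frechet_derivative_eqI)
qed

lemma C0_infinity_frechet:
  assumes "\<phi> \<in> C0_infinity G"
  shows "(\<lambda>x. frechet_derivative \<phi> (at x) v) \<in> C0_infinity G"
proof -
  from assms obtain K where K: "smooth_on UNIV \<phi>" "compact K" "K \<subseteq> G" "\<And>x. x \<notin> K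
    \<Longrightarrow> \<phi> x = 0"
    unfolding C0_infinity_iff by blast
  then show ?thesis
    unfolding C0_infinity_iff using smooth_on_frechet[of UNIV \<phi> v]
      frechet_derivative_eq_0_outside[of K \<phi>] compact_imp_closed[of K] by blast
qed

lemma C0_infinity_bounded:
  assumes "\<phi> \<in> C0_infinity G"
  obtains B where "0 < B" "\<And>x. norm (\<phi> x) \<le> B"
proof -
  from assms obtain K where K: "smooth_on UNIV \<phi>" "compact K" "K \<subseteq> G" "\<And>x. x \<notin> K
    \<Longrightarrow> \<phi> x = 0"
    unfolding C0_infinity_iff by blast
  have "compact (\<phi> ` K)"
    using K smooth_on_continuous continuous_on_subset by (intro compact_continuous_image) blast+
  then obtain B where B: "0 < B" "\<And>x. x \<in> K \<Longrightarrow> norm (\<phi> x) \<le> B"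
    using bounded_pos[of "\<phi> ` K"] compact_imp_bounded by auto
  have "norm (\<phi> x) \<le> B" for x using B K(4)[of x] by (cases "x \<in> K") auto
  with B that show ?thesis by blast
qed

lemma borel_imp_lebesgue: "f \<in> borel_measurable borel \<Longrightarrow> f \<in> borel_measurable lebesgue"
  by (simp add: measurable_completion)

lemma continuous_imp_lebesgue: "continuous_on UNIV f \<Longrightarrow> f \<in> borel_measurable lebesgue"
  by (intro borel_imp_lebesgue borel_measurable_continuous_onI)

lemma C0_infinity_continuous: "\<phi> \<in> C0_infinity G \<Longrightarrow> continuous_on UNIV \<phi>"
  using C0_infinity_smooth smooth_on_continuous by blast

lemma integrable_compact_support:
  fixes f :: "'a::euclidean_space \<Rightarrow> 'b::euclidean_space"
  assumes "continuous_on UNIV f" "compact K" "\<And>x. x \<notin> K \<Longrightarrow> f x = 0"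
  shows "integrable lebesgue f"
proof -
  have "integrable lborel (\<lambda>x. indicator K x *\<^sub>R f x)"
    using assms by (intro borel_integrable_compact) (auto intro: continuous_on_subset)
  moreover have "(\<lambda>x. indicator K x *\<^sub>R f x) = f"
    using assms(3) by (auto simp: indicator_def)
  ultimately have "integrable lborel f" by simp
  then show ?thesis
    using integrable_completion[of f lborel] by (simp add: borel_measurable_integrable)
qed

lemma C0_infinity_integrable:
  fixes \<phi> :: "'a::euclidean_space \<Rightarrow> 'b::euclidean_space"
  shows "\<phi> \<in> C0_infinity G \<Longrightarrow> integrable lebesgue \<phi>"
  by (metis C0_infinity_iff C0_infinity_continuous integrable_compact_support)

lemma C0_infinity_derivative_bound:
  assumes "\<phi> \<in> C0_infinity G"
  obtains L where "0 < L" "\<And>x v. norm (frechet_derivative \<phi> (at x) v) \<le> L * norm v"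
proof -
  have "\<exists>B>0. \<forall>x. norm (frechet_derivative \<phi> (at x) b) \<le> B" for b
    using C0_infinity_bounded[OF C0_infinity_frechet[OF assms]] by metis
  then obtain B where B: "\<And>b. 0 < B b" "\<And>b x. norm (frechet_derivative \<phi> (at x) b) \<le> B b" by metis
  have "norm (frechet_derivative \<phi> (at x) v) \<le> (1 + (\<Sum>b\<in>Basis. B b)) * norm v" for x v
  proof -
    interpret bounded_linear "frechet_derivative \<phi> (at x)"
      using smooth_on_linear_frechet[OF C0_infinity_smooth[OF assms]] by blast
    \<comment> \<open>Compactness bounds the derivative in one direction at a time; expanding
      \<open>v\<close> in the basis combines these finitely many bounds into one that is linear in
      the norm of \<open>v\<close>.\<close>
    have "frechet_derivative \<phi> (at x) v = (\<Sum>b\<in>Basis. (v \<bullet> b) *\<^sub>R frechet_derivative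
      \<phi> (at x) b)"
      by (subst euclidean_representation[of v, symmetric]) (simp add: sum scaleR)
    also have "norm \<dots> \<le> (\<Sum>b\<in>Basis. norm v * B b)"
      using B by (intro sum_norm_le) (auto intro!: mult_mono simp: Basis_le_norm)
    also have "\<dots> \<le> (1 + (\<Sum>b\<in>Basis. B b)) * norm v"
      by (simp add: sum_distrib_left algebra_simps)
    finally show ?thesis .
  qed
  moreover have "0 < 1 + (\<Sum>b\<in>Basis. B b)"
    using B(1) by (intro add_pos_nonneg sum_nonneg) (auto intro: less_imp_le)
  ultimately show ?thesis using that by blast
qed

lemma C0_infinity_Lipschitz:
  assumes "\<phi> \<in> C0_infinity G"
  obtains L where "0 < L" "\<And>x y. norm (\<phi> x - \<phi> y) \<le> L * norm (x - y)"
proof -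
  obtain L where L: "0 < L" "\<And>x v. norm (frechet_derivative \<phi> (at x) v) \<le> L * norm v"
    using C0_infinity_derivative_bound[OF assms] by blast
  have "norm (\<phi> x - \<phi> y) \<le> L * norm (x - y)" for x y
    by (rule differentiable_bound[of UNIV \<phi> "\<lambda>x. frechet_derivative \<phi> (at x)"])
       (use L smooth_on_has_derivative[OF C0_infinity_smooth[OF assms]] in \<open>auto intro!: onorm_le\<close>)
  with L that show ?thesis by blast
qed

text \<open>A remainder that is quadratic uniformly in both points, because each directional
  derivative is again a test function and hence Lipschitz. It makes differentiation of a convolution
  under the integral a direct estimate, with no convergence theorem.\<close>

lemma C0_infinity_Taylor:
  fixes \<phi> :: "'a::euclidean_space \<Rightarrow> 'b::real_normed_vector"
  assumes "\<phi> \<in> C0_infinity G"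
  obtains C where "0 < C"
    "\<And>x y. norm (\<phi> y - \<phi> x - frechet_derivative \<phi> (at x) (y - x)) \<le>
      C * (norm (y - x))\<^sup>2"
proof -
  have "\<exists>L>0. \<forall>x y. norm (frechet_derivative \<phi> (at x) b - frechet_derivative \<phi> (at y) b)
    \<le> L * norm (x - y)" for b
    using C0_infinity_Lipschitz[OF C0_infinity_frechet[OF assms]] by metis
  then obtain L where L: "\<And>b. 0 < L b"
    "\<And>b x y. norm (frechet_derivative \<phi> (at x) b - frechet_derivative \<phi> (at y) b) \<le>
      L b * norm (x - y)" by metis
  define C where "C = 1 + (\<Sum>b\<in>Basis. L b)"
  have C: "0 < C" unfolding C_def using L(1) by (intro add_pos_nonneg sum_nonneg) (auto intro: less_imp_le)
  note lin = smooth_on_linear_frechet[OF C0_infinity_smooth[OF assms] UNIV_I]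
  have on: "norm (frechet_derivative \<phi> (at y) v - frechet_derivative \<phi> (at x) v) \<le>
    (C * norm (y - x)) * norm v" for x y v
  proof -
    interpret bounded_linear "\<lambda>v. frechet_derivative \<phi> (at y) v - frechet_derivative \<phi> (at x) v"
      using bounded_linear_sub[OF lin lin] .
    have "frechet_derivative \<phi> (at y) v - frechet_derivative \<phi> (at x) v =
       (\<Sum>b\<in>Basis. (v \<bullet> b) *\<^sub>R (frechet_derivative \<phi> (at y) b - frechet_derivative \<phi>
         (at x) b))"
      by (subst (1 2) euclidean_representation[of v, symmetric]) (simp only: sum scaleR)
    also have "norm \<dots> \<le> (\<Sum>b\<in>Basis. norm v * (L b * norm (y - x)))"
      using L by (intro sum_norm_le) (auto intro!: mult_mono simp: Basis_le_norm)
    also have "\<dots> = (\<Sum>b\<in>Basis. L b) * (norm v * norm (y - x))"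
      by (simp add: sum_distrib_right sum_distrib_left mult_ac)
    also have "\<dots> \<le> C * (norm v * norm (y - x))"
      unfolding C_def by (intro mult_right_mono) auto
    finally show ?thesis by (simp add: mult_ac)
  qed
  have "norm (\<phi> y - \<phi> x - frechet_derivative \<phi> (at x) (y - x)) \<le>
    C * (norm (y - x))\<^sup>2" for x y
  proof -
    have "norm (\<phi> y - \<phi> x - frechet_derivative \<phi> (at x) (y - x)) \<le>
      norm (y - x) * (C * norm (y - x))"
    proof (rule differentiable_bound_linearization[where S = "cball x (norm (y - x))"])
      show "x + t *\<^sub>R (y - x) \<in> cball x (norm (y - x))" if "t \<in> {0..1}" for t
        using that by (simp add: dist_norm mult_left_le_one_le)
      show "(\<phi> has_derivative frechet_derivative \<phi> (at z)) (at z within cball x (norm (y - x)))" for z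
        using smooth_on_has_derivative[OF C0_infinity_smooth[OF assms] UNIV_I] has_derivative_at_withinI by blast
      show "onorm (frechet_derivative \<phi> (at z) - frechet_derivative \<phi> (at x)) \<le> C * norm (y - x)"
        if "z \<in> cball x (norm (y - x))" for z
      proof (rule onorm_le)
        fix v :: 'a
        have "norm (z - x) \<le> norm (y - x)" using that by (simp add: dist_norm norm_minus_commute)
        then have "(C * norm (z - x)) * norm v \<le> (C * norm (y - x)) * norm v"
          using C by (intro mult_right_mono mult_left_mono) auto
        then show "norm ((frechet_derivative \<phi> (at z) - frechet_derivative \<phi> (at x)) v) \<le>
          C * norm (y - x) * norm v"
          using on[of z v x] by simp
      qed
    qed auto
    then show ?thesis by (simp add: power2_eq_square mult_ac)
  qed
  with C that show ?thesis by blast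
qed

section \<open>Convolution of an integrable function with a test function\<close>

lemma integrable_bounded_scaleR:
  fixes g :: "'a \<Rightarrow> 'b::euclidean_space"
  assumes "integrable M g" "k \<in> borel_measurable M" "\<And>y. \<bar>k y\<bar> \<le> (B::real)"
  shows "integrable M (\<lambda>y. k y *\<^sub>R g y)"
proof (rule Bochner_Integration.integrable_bound[where f = "\<lambda>y. B *\<^sub>R g y"])
  show "AE x in M. norm (k x *\<^sub>R g x) \<le> norm (B *\<^sub>R g x)"
    using assms(3) by (intro AE_I2) (auto intro!: mult_right_mono intro: order_trans[OF _ abs_ge_self])
qed (use assms in auto)

lemma lebesgue_measurable_reflect:
  fixes k :: "'a::euclidean_space \<Rightarrow> 'b::euclidean_space"
  shows "continuous_on UNIV k \<Longrightarrow> (\<lambda>y. k (x - y)) \<in> borel_measurable lebesgue"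
  by (intro continuous_imp_lebesgue) (auto intro!: continuous_intros elim: continuous_on_compose2)

lemma integrable_conv:
  fixes g :: "'a::euclidean_space \<Rightarrow> 'b::euclidean_space"
  assumes "k \<in> C0_infinity G" "integrable lebesgue g"
  shows "integrable lebesgue (\<lambda>y. k (x - y) *\<^sub>R g y)"
proof -
  obtain B where B: "0 < B" "\<And>x. norm (k x) \<le> B"
    using C0_infinity_bounded[OF assms(1)] by blast
  show ?thesis
    by (rule integrable_bounded_scaleR[of _ _ _ B])
       (use B assms C0_infinity_continuous in \<open>auto intro!: lebesgue_measurable_reflect\<close>)
qed

lemma fun_conv_has_derivative:
  fixes g :: "'a::euclidean_space \<Rightarrow> 'b::euclidean_space"
  assumes k: "k \<in> C0_infinity G" and g: "integrable lebesgue g"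
  shows "(fun_conv k g has_derivative (\<lambda>v. fun_conv (\<lambda>x. frechet_derivative k (at x) v) g x)) (at x)"
proof -
  note lin = smooth_on_linear_frechet[OF C0_infinity_smooth[OF k] UNIV_I]
  note [simp] = linear_add[OF bounded_linear.linear[OF lin]] linear_scale[OF bounded_linear.linear[OF lin]]
  note int1 = integrable_conv[OF k g] and int2 = integrable_conv[OF C0_infinity_frechet[OF k] g]
  obtain C where C: "0 < C" "\<And>x y. norm (k y - k x - frechet_derivative k (at x) (y - x)) \<le>
    C * (norm (y - x))\<^sup>2"
    using C0_infinity_Taylor[OF k] by blast
  obtain L where L: "0 < L" "\<And>x v. norm (frechet_derivative k (at x) v) \<le> L * norm v"
    using C0_infinity_derivative_bound[OF k] by blast
  define N where "N = (LINT y|lebesgue. norm (g y))"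
  have N: "N \<ge> 0" by (simp add: N_def)
  have bound: "norm (LINT y|lebesgue. a y *\<^sub>R g y) \<le> c * N"
    if "integrable lebesgue (\<lambda>y. a y *\<^sub>R g y)" "\<And>y. \<bar>a y\<bar> \<le> c" for a c
  proof -
    have "norm (LINT y|lebesgue. a y *\<^sub>R g y) \<le> (LINT y|lebesgue. c * norm (g y))"
      using that g by (intro Bochner_Integration.integral_norm_bound[THEN order_trans] integral_mono integrable_norm)
       (auto intro!: mult_right_mono)
    then show ?thesis by (simp add: N_def)
  qed
  show ?thesis unfolding has_derivative_at_alt
  proof (intro conjI allI impI)
    show "bounded_linear (\<lambda>v. fun_conv (\<lambda>x. frechet_derivative k (at x) v) g x)"
    proof (rule bounded_linear_intro[where K = "L * N"])
      show "norm (fun_conv (\<lambda>x. frechet_derivative k (at x) v) g x) \<le> norm v * (L * N)" for v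
        unfolding fun_conv_def using bound[OF int2, of x v "L * norm v"] L(2)[of _ v] by (simp add: mult_ac)
    qed (use int2 in \<open>simp_all add: fun_conv_def scaleR_add_left flip: scaleR_scaleR\<close>)
    fix e :: real assume e: "0 < e"
    \<comment> \<open>With this radius \<open>C * norm (y - x) * N\<close> stays below
      \<open>e\<close>; \<open>N + 1\<close> replaces the L1 norm \<open>N\<close> so that the
      quotient makes sense when \<open>N = 0\<close>.\<close>
    define d where "d = e / (C * (N + 1))"
    have d: "0 < d" using e C N by (simp add: d_def)
    show "\<exists>d>0. \<forall>y. norm (y - x) < d \<longrightarrow> norm (fun_conv k g y - fun_conv k g x -
      fun_conv (\<lambda>z. frechet_derivative k (at z) (y - x)) g x) \<le> e * norm (y - x)"
    proof (intro exI[of _ d] conjI allI impI d)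
      fix y assume y: "norm (y - x) < d"
      define a where "a w = k (y - w) - k (x - w) - frechet_derivative k (at (x - w)) (y - x)" for w
      have a: "(\<lambda>w. a w *\<^sub>R g w) = (\<lambda>w. k (y - w) *\<^sub>R g w - k (x - w) *\<^sub>R g w -
        frechet_derivative k (at (x - w)) (y - x) *\<^sub>R g w)"
        by (simp add: a_def algebra_simps)
      have "fun_conv k g y - fun_conv k g x - fun_conv (\<lambda>z. frechet_derivative k (at z) (y - x)) g x
          = (LINT w|lebesgue. a w *\<^sub>R g w)"
        unfolding a fun_conv_def by (simp add: int1 int2)
      moreover have "norm (LINT w|lebesgue. a w *\<^sub>R g w) \<le> (C * (norm (y - x))\<^sup>2) * N"
        proof (rule bound)
          show "integrable lebesgue (\<lambda>w. a w *\<^sub>R g w)" unfolding a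
            by (intro Bochner_Integration.integrable_diff int1 int2)
          show "\<bar>a w\<bar> \<le> C * (norm (y - x))\<^sup>2" for w
            using C(2)[of "y - w" "x - w"] by (simp add: a_def)
        qed
      moreover have "(C * (norm (y - x))\<^sup>2) * N \<le> e * norm (y - x)"
      proof -
        have "C * norm (y - x) * N \<le> C * d * (N + 1)"
          using y C N d by (intro mult_mono) auto
        also have "\<dots> = e" using C N by (simp add: d_def)
        finally have "C * norm (y - x) * N * norm (y - x) \<le> e * norm (y - x)"
          by (intro mult_right_mono) auto
        then show ?thesis by (simp add: power2_eq_square mult_ac)
      qed
      ultimately show "norm (fun_conv k g y - fun_conv k g x - fun_conv (\<lambda>z. frechet_derivative k (at z) (y -
        x)) g x) \<le> e * norm (y - x)"
        by simp
    qed
  qed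
qed

text \<open>The derivative of a convolution is the convolution of the same \<open>g\<close> with
  another test function; hence the induction keeps \<open>g\<close> fixed and varies the
  kernel.\<close>

lemma smooth_on_fun_conv:
  fixes g :: "'a::euclidean_space \<Rightarrow> 'b::euclidean_space"
  assumes "k \<in> C0_infinity G" "integrable lebesgue g"
  shows "smooth_on UNIV (fun_conv k g)"
proof -
  have "C_k_on m UNIV (fun_conv k g)" for m
    using assms(1)
  proof (induction m arbitrary: k)
    case 0
    then show ?case
      using fun_conv_has_derivative[OF _ assms(2)]
      by (auto intro!: continuous_at_imp_continuous_on has_derivative_continuous)
  next
    case (Suc m)
    show ?case
      by (rule C_k_on_SucI[OF open_UNIV fun_conv_has_derivative[OF Suc.prems assms(2)]])
         (use Suc.IH C0_infinity_frechet[OF Suc.prems] in blast)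
  qed
  then show ?thesis by (simp add: smooth_on_def)
qed

section \<open>Affine changes of variables and integrals of derivatives\<close>

lemma lebesgue_affine_transfer:
  fixes f :: "'a::euclidean_space \<Rightarrow> 'b::euclidean_space"
  assumes "f \<in> borel_measurable borel" "c \<noteq> 0"
  shows "(LINT x|lebesgue. f x) = \<bar>c\<bar> ^ DIM('a) *\<^sub>R (LINT x|lebesgue. f (t + c *\<^sub>R x))"
proof -
  have "(LINT x|lborel. f x) = (LINT x|density (distr lborel borel (\<lambda>x. t +
    c *\<^sub>R x)) (\<lambda>_. \<bar>c\<bar>^DIM('a)). f x)"
    using lborel_affine[OF assms(2), of t] by simp
  also have "\<dots> = (LINT x|distr lborel borel (\<lambda>x. t +
    c *\<^sub>R x). \<bar>c\<bar>^DIM('a) *\<^sub>R f x)"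
    using assms by (subst integral_density) auto
  also have "\<dots> = \<bar>c\<bar> ^ DIM('a) *\<^sub>R (LINT x|lborel. f (t + c *\<^sub>R x))"
    using assms by (subst integral_distr) auto
  finally show ?thesis
    using assms by (simp add: integral_completion)
qed

lemma nn_lebesgue_affine_transfer:
  fixes f :: "'a::euclidean_space \<Rightarrow> ennreal"
  assumes "f \<in> borel_measurable borel" "c \<noteq> 0"
  shows "(\<integral>\<^sup>+x. f x \<partial>lebesgue) =
    ennreal (\<bar>c\<bar> ^ DIM('a)) * (\<integral>\<^sup>+x. f (t + c *\<^sub>R x) \<partial>lebesgue)"
proof -
  have "(\<integral>\<^sup>+x. f x \<partial>lborel) =
    (\<integral>\<^sup>+x. f x \<partial>density (distr lborel borel (\<lambda>x. t +
    c *\<^sub>R x)) (\<lambda>_. \<bar>c\<bar>^DIM('a)))"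
    using lborel_affine[OF assms(2), of t] by simp
  also have "\<dots> = (\<integral>\<^sup>+x. ennreal (\<bar>c\<bar>^DIM('a)) *
    f x \<partial>distr lborel borel (\<lambda>x. t + c *\<^sub>R x))"
    using assms by (subst nn_integral_density) auto
  also have "\<dots> = ennreal (\<bar>c\<bar> ^ DIM('a)) * (\<integral>\<^sup>+x. f (t +
    c *\<^sub>R x) \<partial>lborel)"
    using assms by (simp add: nn_integral_distr nn_integral_cmult)
  finally show ?thesis
    by (simp add: nn_integral_completion)
qed

lemma integral_reflect:
  fixes f :: "'a::euclidean_space \<Rightarrow> 'b::euclidean_space"
  assumes "f \<in> borel_measurable borel"
  shows "(LINT y|lebesgue. f (x - y)) = (LINT y|lebesgue. f y)"
  using lebesgue_affine_transfer[OF assms, of "-1" x] by simp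

lemma nn_integral_translate:
  fixes f :: "'a::euclidean_space \<Rightarrow> ennreal"
  assumes "f \<in> borel_measurable borel"
  shows "(\<integral>\<^sup>+y. f (y - x) \<partial>lebesgue) = (\<integral>\<^sup>+y. f y \<partial>lebesgue)"
  using nn_lebesgue_affine_transfer[OF assms, of "1" "-x"] by simp

text \<open>Near the origin the convolution with the indicator function of a large ball is constant, and
  its derivative at the origin is the integral in question.\<close>

lemma integral_derivative_eq_0:
  fixes F :: "'a::euclidean_space \<Rightarrow> real"
  assumes "F \<in> C0_infinity G"
  shows "(LINT x|lebesgue. frechet_derivative F (at x) v) = 0"
proof -
  from assms obtain K where K: "smooth_on UNIV F" "compact K" "K \<subseteq> G" "\<And>x. x \<notin> K
    \<Longrightarrow> F x = 0"
    unfolding C0_infinity_iff by blast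
  obtain R where R: "0 < R" "K \<subseteq> ball 0 R"
    using bounded_subset_ballD[OF compact_imp_bounded[OF K(2)]] by blast
  \<comment> \<open>The margin 1 in the radius makes \<open>g\<close> equal to 1 at all points
    \<open>y\<close> with \<open>x - y\<close> in \<open>K\<close>, for every \<open>x\<close> of
    the unit ball.\<close>
  define g :: "'a \<Rightarrow> real" where "g = indicator (cball 0 (R + 1))"
  have g: "integrable lebesgue g"
    unfolding g_def by (intro integrable_real_indicator) (auto intro!: emeasure_bounded_finite[unfolded
      infinity_ennreal_def])
  have eq: "k (x - y) *\<^sub>R g y = k (x - y)" if "\<And>x. x \<notin> K \<Longrightarrow>
    k x = 0" "x \<in> ball 0 1"
    for k :: "'a \<Rightarrow> real" and x y
  proof (cases "x - y \<in> K")
    case True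
    then have "norm (x - y) < R" using R by auto
    then have "norm y < R + 1" using that(2) norm_triangle_ineq4[of x "x - y"] by simp
    then show ?thesis by (simp add: g_def)
  qed (use that in auto)
  have "fun_conv F g x = (LINT y|lebesgue. F y)" if "x \<in> ball 0 1" for x
  proof -
    have "(\<lambda>y. F (x - y) *\<^sub>R g y) = (\<lambda>y. F (x - y))"
      using K(4) that by (intro ext eq) auto
    then show ?thesis unfolding fun_conv_def
      by (simp add: integral_reflect borel_measurable_continuous_onI smooth_on_continuous[OF K(1)])
  qed
  then have "(fun_conv F g has_derivative (\<lambda>_. 0)) (at 0)"
    by (intro has_derivative_transform_within_open[OF has_derivative_const, where s = "ball 0 1"]) auto
  with fun_conv_has_derivative[OF assms g] have "(\<lambda>v. fun_conv (\<lambda>x. frechet_derivative F (at x) v) g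
    0) = (\<lambda>_. 0)"
    by (rule has_derivative_unique)
  then have "fun_conv (\<lambda>x. frechet_derivative F (at x) v) g 0 = 0" by metis
  moreover have "fun_conv (\<lambda>x. frechet_derivative F (at x) v) g 0 =
    (LINT x|lebesgue. frechet_derivative F (at x) v)"
  proof -
    have "fun_conv (\<lambda>x. frechet_derivative F (at x) v) g 0 =
      (LINT y|lebesgue. frechet_derivative F (at (0 - y)) v)"
      unfolding fun_conv_def
      using K by (subst eq) (auto intro!: frechet_derivative_eq_0_outside[of K] compact_imp_closed)
    also have "\<dots> = (LINT x|lebesgue. frechet_derivative F (at x) v)"
      using K by (intro integral_reflect[of "\<lambda>x. frechet_derivative F (at x) v"]
        borel_measurable_continuous_onI smooth_on_continuous smooth_on_frechet) auto
    finally show ?thesis .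
  qed
  ultimately show ?thesis by simp
qed

section \<open>The standard mollifier\<close>

definition bump_mass :: "'a::euclidean_space itself \<Rightarrow> real" where
  "bump_mass _ = (LINT y|lebesgue. bump (y::'a))"

lemma bump_bounds: "0 \<le> bump x" "bump x \<le> 1"
  using abs_square_less_1[of "norm x"] by (auto simp: bump_def)

lemma bump_eq_0: "1 \<le> norm x \<Longrightarrow> bump x = 0"
  by (simp add: bump_def)

lemma bump_C0_infinity: "(bump :: 'a::euclidean_space \<Rightarrow> real) \<in> C0_infinity UNIV"
  unfolding C0_infinity_iff
  by (auto simp: smooth_on_def C_k_on_bump bump_eq_0 intro!: exI[of _ "cball 0 1"])

lemma bump_mass_pos: "0 < bump_mass TYPE('a::euclidean_space)"
proof -
  have i: "integrable lebesgue (bump :: 'a \<Rightarrow> real)"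
    using bump_C0_infinity by (rule C0_infinity_integrable)
  have "bump_mass TYPE('a) \<noteq> 0"
  proof
    assume "bump_mass TYPE('a) = 0"
    \<comment> \<open>A vanishing mass would make the unit ball, on which the bump is positive, a
      null set.\<close>
    then have "AE x::'a in lebesgue. bump x = 0"
      unfolding bump_mass_def using integral_nonneg_eq_0_iff_AE[OF i] bump_bounds by auto
    then have "AE x::'a in lebesgue. x \<notin> ball 0 1"
      by eventually_elim (auto simp: bump_def)
    then have "ball (0::'a) 1 \<in> null_sets lebesgue"
      by (subst (asm) AE_iff_null_sets[symmetric]) auto
    then show False
      using open_not_negligible[of "ball (0::'a) 1"] by (simp add: negligible_iff_null_sets)
  qed
  moreover have "0 \<le> bump_mass TYPE('a)"
    unfolding bump_mass_def using bump_bounds by (intro integral_nonneg_AE) auto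
  ultimately show ?thesis by simp
qed

lemma mollifier_alt:
  "mollifier h (x::'a::euclidean_space) = bump (x /\<^sub>R h) / (bump_mass TYPE('a) * h ^ DIM('a))"
  by (simp add: mollifier_def bump_mass_def)

lemma mollifier_nonneg: "0 < h \<Longrightarrow> 0 \<le> mollifier h x"
  using bump_mass_pos[where 'a='a] by (auto simp: mollifier_alt bump_bounds)

lemma mollifier_eq_0: "0 < h \<Longrightarrow> h \<le> norm x \<Longrightarrow> mollifier h x = 0"
  by (auto simp: mollifier_alt intro!: bump_eq_0) (simp add: divide_simps)

lemma mollifier_le: "0 < h \<Longrightarrow> mollifier h (x::'a::euclidean_space) \<le>
  1 / (bump_mass TYPE('a) * h ^ DIM('a))"
  unfolding mollifier_alt using bump_mass_pos[where 'a='a] by (intro divide_right_mono) (auto simp: bump_bounds)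

lemma C_k_on_mollifier: "C_k_on k UNIV (\<lambda>x. mollifier h (a - x :: 'a::euclidean_space))"
  unfolding mollifier_alt using C_k_on_scaled_bump[where c = "1 / (bump_mass TYPE('a) * h ^ DIM('a))"] by simp

text \<open>The mollifier centred at \<open>a\<close>, seen as a function of the integration
  variable, is a test function on \<open>G\<close> as soon as the ball fits. These are the test
  functions by which weak gradients are compared.\<close>

lemma mollifier_reflect_C0_infinity:
  assumes "0 < h" "cball a h \<subseteq> G"
  shows "(\<lambda>x. mollifier h (a - x)) \<in> C0_infinity G"
  unfolding C0_infinity_iff using assms
  by (auto simp: smooth_on_def C_k_on_mollifier dist_norm intro!: exI[of _ "cball a h"] mollifier_eq_0)

lemma mollifier_minus: "mollifier h (- x) = mollifier h x"
  by (simp add: mollifier_alt bump_def)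

lemma mollifier_C0_infinity: "0 < h \<Longrightarrow> mollifier h \<in> C0_infinity UNIV"
  using mollifier_reflect_C0_infinity[of h 0 UNIV] by (simp add: mollifier_minus)

lemma mollifier_integral:
  assumes "0 < h"
  shows "(LINT x|lebesgue. mollifier h (x::'a::euclidean_space)) = 1"
proof -
  have "(LINT x|lebesgue. mollifier h (x::'a)) = \<bar>h\<bar> ^ DIM('a) *\<^sub>R (LINT x|lebesgue. mollifier h (0 +
    h *\<^sub>R x :: 'a))"
    using assms C0_infinity_continuous[OF mollifier_C0_infinity[OF assms]]
    by (intro lebesgue_affine_transfer borel_measurable_continuous_onI) auto
  also have "\<dots> = h ^ DIM('a) * (bump_mass TYPE('a) / (bump_mass TYPE('a) * h ^ DIM('a)))"
    using assms by (simp add: mollifier_alt bump_mass_def)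
  also have "\<dots> = 1" using assms bump_mass_pos[where 'a='a] by simp
  finally show ?thesis .
qed

text \<open>By scaling from the bump: one derivative costs one more factor \<open>1 / h\<close>,
  with a constant that depends on the dimension alone.\<close>

lemma mollifier_derivative_bound:
  obtains L where "0 < L"
    "\<And>h x v. 0 < h \<Longrightarrow> \<bar>frechet_derivative (mollifier h) (at (x::'a::euclidean_space))
      v\<bar> \<le> L / h ^ (DIM('a) + 1) * norm v"
proof -
  obtain L where L: "0 < L" "\<And>x v. norm (frechet_derivative bump (at (x::'a)) v) \<le> L * norm v"
    using C0_infinity_derivative_bound[OF bump_C0_infinity] by blast
  have *: "\<bar>frechet_derivative (mollifier h) (at (x::'a)) v\<bar> \<le>
    (L / bump_mass TYPE('a)) / h ^ (DIM('a) + 1) * norm v"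
    if h: "0 < h" for h v and x :: 'a
  proof -
    have "((\<lambda>x. x /\<^sub>R h) has_derivative (\<lambda>v. v /\<^sub>R h)) (at x)"
      by (intro bounded_linear_imp_has_derivative bounded_linear_scaleR_right)
    from has_derivative_compose[OF this smooth_on_has_derivative[OF C0_infinity_smooth[OF bump_C0_infinity] UNIV_I]]
    have "((\<lambda>x. bump (x /\<^sub>R h)) has_derivative (\<lambda>v. frechet_derivative bump (at (x /\<^sub>R
      h)) (v /\<^sub>R h))) (at x)" .
    from has_derivative_mult_left[OF this, of "inverse (bump_mass TYPE('a) * h ^ DIM('a))"]
    have "(mollifier h has_derivative (\<lambda>v. frechet_derivative bump (at (x /\<^sub>R h)) (v /\<^sub>R h) /
      (bump_mass TYPE('a) * h ^ DIM('a)))) (at x)"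
      by (simp add: mollifier_alt[abs_def] divide_inverse)
    then have "frechet_derivative (mollifier h) (at x) v =
      frechet_derivative bump (at (x /\<^sub>R h)) (v /\<^sub>R h) / (bump_mass TYPE('a) * h ^ DIM('a))"
      by (rule frechet_derivative_eqI)
    also have "\<bar>\<dots>\<bar> \<le> (L * norm (v /\<^sub>R h)) / (bump_mass TYPE('a) * h ^ DIM('a))"
      using L(2)[of "x /\<^sub>R h" "v /\<^sub>R h"] bump_mass_pos[where 'a='a] h
      by (simp add: abs_mult divide_right_mono)
    also have "\<dots> = (L / bump_mass TYPE('a)) / h ^ (DIM('a) + 1) * norm v"
      using h by (simp add: field_simps)
    finally show ?thesis .
  qed
  show ?thesis by (rule that[of "L / bump_mass TYPE('a)"]) (use L bump_mass_pos[where 'a='a] * in auto)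
qed

lemma lebesgue_sets_ball [measurable]: "ball (x::'a::euclidean_space) r \<in> sets lebesgue"
  by simp

section \<open>Averages over balls and log-Hoelder continuity\<close>

text \<open>Not divided by the volume: the estimates carry the normalising factor as
  \<open>A / r ^ DIM('a)\<close>, so that all dimensional constants are collected in
  \<open>A\<close>.\<close>

abbreviation ball_integral :: "('a::euclidean_space \<Rightarrow> 'b::euclidean_space) \<Rightarrow> 'a \<Rightarrow>
  real \<Rightarrow> ennreal" where
  "ball_integral f x r \<equiv> \<integral>\<^sup>+y. ennreal (norm (f y)) *
    indicator (ball x r) y \<partial>lebesgue"

text \<open>Tonelli and Fubini are applied to the product of Borel-Lebesgue measures, whereas the
  functions at hand are measurable only for the completion. A Borel function that agrees almost
  everywhere bridges the gap, here and in the iterated integrals below.\<close>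

lemma lebesgue_borel_representative:
  fixes f :: "'a::euclidean_space \<Rightarrow> 'b::euclidean_space"
  assumes "f \<in> borel_measurable lebesgue"
  obtains f' where "f' \<in> borel_measurable borel" "AE x in lebesgue. f x = f' x"
proof -
  have "\<exists>g\<in>borel_measurable lborel. (AE x in lborel. f x \<bullet> b = g x)" for b
    using assms by (intro completion_ex_borel_measurable_real) auto
  then obtain g where g: "\<And>b. g b \<in> borel_measurable lborel" "\<And>b. AE x in lborel. f x \<bullet> b = g b
    x"
    by metis
  show ?thesis
  proof
    show "(\<lambda>x. \<Sum>b\<in>Basis. g b x *\<^sub>R b) \<in> borel_measurable borel"
      using g(1) by (auto intro!: borel_measurable_sum borel_measurable_scaleR)
    have "AE x in lborel. \<forall>b\<in>Basis. f x \<bullet> b = g b x"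
      using g(2) by (intro AE_finite_allI) auto
    then have "AE x in lborel. f x = (\<Sum>b\<in>Basis. g b x *\<^sub>R b)"
      by eventually_elim (metis (no_types, lifting) euclidean_representation sum.cong)
    then show "AE x in lebesgue. f x = (\<Sum>b\<in>Basis. g b x *\<^sub>R b)" by (rule AE_completion)
  qed
qed

lemma lebesgue_borel_representative_ennreal:
  fixes f :: "'a::euclidean_space \<Rightarrow> ennreal"
  assumes "f \<in> borel_measurable lebesgue"
  obtains f' where "f' \<in> borel_measurable borel" "AE x in lebesgue. f x = f' x"
proof -
  obtain g where g: "g \<in> borel_measurable lborel" "AE x in lborel. f x = g x"
    using completion_ex_borel_measurable[OF assms] by blast
  show ?thesis by (rule that[of g]) (use g AE_completion[OF g(2)] in auto)
qed

lemma nn_integral_swap: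
  fixes f :: "'a::euclidean_space \<Rightarrow> 'b::euclidean_space \<Rightarrow> ennreal"
  assumes "(\<lambda>(x, y). f x y) \<in> borel_measurable borel"
  shows "(\<integral>\<^sup>+x. \<integral>\<^sup>+y. f x y \<partial>lebesgue \<partial>lebesgue) =
    (\<integral>\<^sup>+y. \<integral>\<^sup>+x. f x y \<partial>lebesgue \<partial>lebesgue)"
proof -
  have "(\<lambda>(x, y). f x y) \<in> borel_measurable (lborel \<Otimes>\<^sub>M lborel)"
    using assms by (simp add: lborel_prod)
  from lborel_pair.Fubini'[OF this] show ?thesis by (simp add: nn_integral_completion)
qed

lemma borel_measurable_nn_integral_lebesgue:
  fixes f :: "'a::euclidean_space \<Rightarrow> 'b::euclidean_space \<Rightarrow> ennreal"
  assumes "(\<lambda>(x, y). f x y) \<in> borel_measurable borel"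
  shows "(\<lambda>x. \<integral>\<^sup>+y. f x y \<partial>lebesgue) \<in> borel_measurable borel"
proof -
  have "(\<lambda>(x, y). f x y) \<in> borel_measurable (lborel \<Otimes>\<^sub>M lborel)"
    using assms by (simp add: lborel_prod)
  from lborel.borel_measurable_nn_integral[OF this]
  show ?thesis by (simp add: nn_integral_completion)
qed

lemma ball_kernel_measurable:
  fixes F :: "'a::euclidean_space \<Rightarrow> ennreal"
  assumes "F \<in> borel_measurable borel"
  shows "(\<lambda>(x, y). F y * indicator (ball x r) y) \<in> borel_measurable borel"
proof -
  have "(\<lambda>(x::'a, y). F y * indicator (ball x r) y) =
      (\<lambda>p. F (snd p) * (if dist (fst p) (snd p) < r then 1 else 0))"
    by (auto simp: fun_eq_iff indicator_def)
  also have "\<dots> \<in> borel_measurable (borel \<Otimes>\<^sub>M borel)"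
    using assms by measurable
  finally show ?thesis by (simp add: borel_prod)
qed

lemma ball_integral_measurable:
  fixes F :: "'a::euclidean_space \<Rightarrow> ennreal"
  assumes "F \<in> borel_measurable lebesgue"
  shows "(\<lambda>x. \<integral>\<^sup>+y. F y * indicator (ball x r) y \<partial>lebesgue) \<in> borel_measurable
    borel"
proof -
  obtain F' where F': "F' \<in> borel_measurable borel" "AE x in lebesgue. F x = F' x"
    using lebesgue_borel_representative_ennreal[OF assms] .
  have "(\<integral>\<^sup>+y. F y * indicator (ball x r) y \<partial>lebesgue) =
    (\<integral>\<^sup>+y. F' y * indicator (ball x r) y \<partial>lebesgue)" for x
    using F'(2) by (intro nn_integral_cong_AE) auto
  then show ?thesis
    using borel_measurable_nn_integral_lebesgue[OF ball_kernel_measurable[OF F'(1)]] by simp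
qed

text \<open>By Tonelli and the symmetry of \<open>dist x y < r\<close>, each point \<open>y\<close>
  is counted by the centres in \<open>ball y r\<close>. The resulting volume is what later cancels
  the normalising factor of ball averages.\<close>

lemma ball_integral_total:
  fixes F :: "'a::euclidean_space \<Rightarrow> ennreal"
  assumes "F \<in> borel_measurable lebesgue" "0 < r"
  shows "(\<integral>\<^sup>+x. \<integral>\<^sup>+y. F y *
    indicator (ball x r) y \<partial>lebesgue \<partial>lebesgue) =
    ennreal (unit_ball_vol (real DIM('a)) * r ^ DIM('a)) * (\<integral>\<^sup>+y. F y \<partial>lebesgue)"
proof -
  obtain F' where F': "F' \<in> borel_measurable borel" "AE x in lebesgue. F x = F' x"
    using lebesgue_borel_representative_ennreal[OF assms(1)] .
  have "(\<integral>\<^sup>+y. F y * indicator (ball x r) y \<partial>lebesgue) =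
    (\<integral>\<^sup>+y. F' y * indicator (ball x r) y \<partial>lebesgue)" for x
    using F'(2) by (intro nn_integral_cong_AE) auto
  then have "(\<integral>\<^sup>+x. \<integral>\<^sup>+y. F y *
    indicator (ball x r) y \<partial>lebesgue \<partial>lebesgue) =
    (\<integral>\<^sup>+x. \<integral>\<^sup>+y. F' y * indicator (ball x r) y \<partial>lebesgue
      \<partial>lebesgue)" by simp
  also have "\<dots> = (\<integral>\<^sup>+y. \<integral>\<^sup>+x. F' y *
    indicator (ball x r) y \<partial>lebesgue \<partial>lebesgue)"
    by (rule nn_integral_swap[OF ball_kernel_measurable[OF F'(1)]])
  also have "\<dots> = (\<integral>\<^sup>+y. F' y * ennreal (unit_ball_vol (real DIM('a)) *
    r ^ DIM('a)) \<partial>lebesgue)"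
  proof (intro nn_integral_cong)
    fix y :: 'a
    have "(\<integral>\<^sup>+x. F' y * indicator (ball x r) y \<partial>lebesgue) =
      (\<integral>\<^sup>+x. F' y * indicator (ball y r) x \<partial>lebesgue)"
      by (intro nn_integral_cong) (auto simp: indicator_def dist_commute)
    also have "\<dots> = F' y * ennreal (unit_ball_vol (real DIM('a)) * r ^ DIM('a))"
      using emeasure_ball[of r y] assms(2) by (subst nn_integral_cmult_indicator) auto
    finally show "(\<integral>\<^sup>+x. F' y * indicator (ball x r) y \<partial>lebesgue) =
      F' y * ennreal (unit_ball_vol (real DIM('a)) * r ^ DIM('a))" .
  qed
  also have "\<dots> = (\<integral>\<^sup>+y. F' y \<partial>lebesgue) *
    ennreal (unit_ball_vol (real DIM('a)) * r ^ DIM('a))"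
    by (rule nn_integral_multc[OF measurable_completion]) (use F' in simp)
  also have "(\<integral>\<^sup>+y. F' y \<partial>lebesgue) = (\<integral>\<^sup>+y. F y \<partial>lebesgue)"
    using F'(2) by (intro nn_integral_cong_AE) auto
  finally show ?thesis by (simp add: mult.commute)
qed

section \<open>Modulars and the logarithmic modulus of continuity\<close>

lemma modular_alt:
  "G \<in> sets lebesgue \<Longrightarrow> modular G p f =
    (\<integral>\<^sup>+x. ennreal (norm (f x) powr p x) * indicator G x \<partial>lebesgue)"
  unfolding modular_def by (subst nn_integral_restrict_space) auto

lemma P_logE:
  assumes "p \<in> P_log G"
  obtains P c where "1 \<le> P" "\<And>x. x \<in> G \<Longrightarrow> 1 \<le>
    p x" "\<And>x. x \<in> G \<Longrightarrow> p x \<le> P" "0 < c"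
    "\<And>x y. x \<in> G \<Longrightarrow> y \<in> G \<Longrightarrow> x \<noteq> y \<Longrightarrow>
      \<bar>p x - p y\<bar> \<le> c / ln (exp 1 + 1 / norm (x - y))"
    "p \<in> borel_measurable (lebesgue_on G)"
proof -
  have b: "bounded (p ` G)" "p \<in> borel_measurable (lebesgue_on G)" "\<forall>x\<in>G. 1 \<le> p x"
    using assms unfolding P_log_def by blast+
  obtain c where c: "0 < c"
    "\<And>x y. x \<in> G \<Longrightarrow> y \<in> G \<Longrightarrow> x \<noteq> y \<Longrightarrow>
      \<bar>p x - p y\<bar> \<le> c / ln (exp 1 + 1 / norm (x - y))"
    using assms unfolding P_log_def by blast
  obtain B where B: "\<And>x. x \<in> G \<Longrightarrow> norm (p x) \<le> B" using b(1) unfolding bounded_iff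
    by blast
  show ?thesis
    by (rule that[of "max 1 B" c]) (use b c B in \<open>force simp: le_max_iff_disj\<close>)+
qed

text \<open>If \<open>s\<close> grows at most like a power of \<open>1 / r\<close>, then
  \<open>ln s\<close> is at most a multiple of \<open>ln (exp 1 + 1 / r)\<close>, which is exactly
  the denominator in the bound for the exponent difference \<open>d\<close>. This denominator is at
  least 1, so it also absorbs the contribution of \<open>ln M\<close>.\<close>

lemma log_Hoelder_powr:
  fixes s r :: real
  assumes "0 < c" "0 < r" "1 \<le> s" "s \<le> M / r ^ n" "0 < M" "\<bar>d\<bar> \<le> c / ln (exp 1 + 1 / r)"
  shows "s powr d \<le> exp ((\<bar>ln M\<bar> + real n) * c)"
proof -
  define L where "L = ln (exp 1 + 1 / r)"
  have "ln (exp 1) \<le> L" unfolding L_def using assms by (subst ln_le_cancel_iff) (auto intro: add_pos_pos)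
  then have L: "1 \<le> L" by simp
  have "ln (1 / r) \<le> L" unfolding L_def using assms by (subst ln_le_cancel_iff) (auto intro: add_pos_pos)
  then have lr: "- ln r \<le> L" using assms by (simp add: ln_div)
  have "ln s \<le> ln (M / r ^ n)" using assms by (subst ln_le_cancel_iff) auto
  also have "\<dots> = ln M + real n * (- ln r)" using assms by (simp add: ln_div ln_realpow)
  also have "\<dots> \<le> \<bar>ln M\<bar> * L + real n * L"
    using L lr mult_left_mono[OF L, of "\<bar>ln M\<bar>"] by (intro add_mono mult_left_mono) auto
  finally have ls: "ln s \<le> (\<bar>ln M\<bar> + real n) * L" by (simp add: algebra_simps)
  have "d * ln s \<le> \<bar>d\<bar> * ln s" using assms by (intro mult_right_mono) auto
  also have "\<dots> \<le> (c / L) * ((\<bar>ln M\<bar> + real n) * L)"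
    using assms ls L by (intro mult_mono) (auto simp: L_def)
  also have "\<dots> = (\<bar>ln M\<bar> + real n) * c" using L by simp
  finally show ?thesis using assms by (simp add: powr_def)
qed

text \<open>Where the ball average exceeds twice the threshold \<open>s\<close> it comes from the part of
  \<open>f\<close> above \<open>s\<close>, which is dominated by \<open>s\<close> to the power \<open>1 -
  p\<close> times \<open>f\<close> to the power \<open>p\<close>; logarithmic Hoelder continuity allows
  to freeze the exponent at the centre of the ball. This replaces the boundedness of the maximal
  operator.\<close>

lemma ball_average_powr_le:
  fixes f :: "'a::euclidean_space \<Rightarrow> 'b::euclidean_space"
  assumes p: "\<And>y. y \<in> G \<Longrightarrow> 1 \<le> p y" "\<And>y. y \<in> G \<Longrightarrow>
    p y \<le> P" and c: "0 < c"
    and lh: "\<And>y z. y \<in> G \<Longrightarrow> z \<in> G \<Longrightarrow> y \<noteq> z \<Longrightarrow>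
      \<bar>p y - p z\<bar> \<le> c / ln (exp 1 + 1 / norm (y - z))"
    and x: "x \<in> G" and r: "0 < r" and A: "0 < A" and N: "0 < N"
    and f: "f \<in> borel_measurable lebesgue" "\<And>y. y \<notin> G \<Longrightarrow> f y = 0"
    and F: "F \<in> borel_measurable lebesgue" "\<And>y. y \<in> G \<Longrightarrow>
      F y = ennreal (norm (f y) powr p y)"
    and I: "ball_integral f x r \<le> ennreal N"
    and g: "ennreal g \<le> ennreal (A / r ^ DIM('a)) * ball_integral f x r"
      "0 \<le> g"
    and \<omega>: "\<omega> = unit_ball_vol (real DIM('a))"
    and D: "D = exp ((\<bar>ln (N / (2 * \<omega>))\<bar> + real DIM('a)) * c)"
  shows "ennreal (g powr p x) \<le> ennreal ((1 + 2 * A * \<omega>) powr P) +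
    ennreal ((1 + 2 * A * \<omega>) powr P * D / (\<omega> * r ^ DIM('a))) * (\<integral>\<^sup>+y. F y *
      indicator (ball x r) y \<partial>lebesgue)"
proof -
  define J where "J = (\<integral>\<^sup>+y. F y * indicator (ball x r) y \<partial>lebesgue)"
  define n where "n = DIM('a)"
  define I where "I = enn2real (ball_integral f x r)"
  have I_eq: "ball_integral f x r = ennreal I"
    unfolding I_def using le_less_trans[OF I ennreal_less_top] by simp
  have I0: "0 \<le> I" by (simp add: I_def)
  have IN: "I \<le> N" using I N I_eq by (simp add: ennreal_le_iff)
  have \<omega>0: "0 < \<omega>" unfolding \<omega> by simp
  have rn: "0 < r ^ n" using r by simp
  have gI: "g \<le> A / r ^ n * I"
    using g A r I0 unfolding I_eq n_def by (simp add: ennreal_mult'[symmetric])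
  \<comment> \<open>Half the mean of \<open>norm (f y)\<close> over the ball: the part of
    \<open>f\<close> below \<open>s\<close> then contributes at most \<open>I / 2\<close> and can be
    absorbed.\<close>
  define s where "s = I / (2 * \<omega> * r ^ n)"
  have I_s: "I = 2 * \<omega> * r ^ n * s" using \<omega>0 r by (simp add: s_def)
  have s0: "0 \<le> s" using I0 \<omega>0 rn by (simp add: s_def)
  have gs: "g \<le> (1 + 2 * A * \<omega>) * s"
  proof -
    have "A / r ^ n * I = 2 * A * \<omega> * s" using r by (simp add: I_s)
    also have "\<dots> \<le> (1 + 2 * A * \<omega>) * s" using s0 by (simp add: algebra_simps)
    finally show ?thesis using gI by linarith
  qed
  have D0: "0 \<le> D" by (simp add: D)
  have px: "1 \<le> p x" "p x \<le> P" using p x by auto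
  have g1: "g powr p x \<le> (1 + 2 * A * \<omega>) powr P * s powr p x"
  proof -
    have "g powr p x \<le> ((1 + 2 * A * \<omega>) * s) powr p x"
      using gs g px by (intro powr_mono2) auto
    also have "\<dots> = (1 + 2 * A * \<omega>) powr p x * s powr p x"
      using A \<omega>0 s0 by (intro powr_mult) 
    also have "\<dots> \<le> (1 + 2 * A * \<omega>) powr P * s powr p x"
      using A \<omega>0 px by (intro mult_right_mono powr_mono) auto
    finally show ?thesis .
  qed
  show ?thesis
  proof (cases "1 \<le> s")
    case False
    \<comment> \<open>A small average is covered by the constant term of the claim alone.\<close>
    have "s powr p x \<le> 1" using False s0 px powr_mono2[of "p x" s 1] by simp
    then have "g powr p x \<le> (1 + 2 * A * \<omega>) powr P"
      using g1 mult_left_mono[of "s powr p x" 1 "(1 + 2 * A * \<omega>) powr P"] by simp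
    then show ?thesis
      by (intro add_increasing2) (auto intro: ennreal_leI)
  next
    case True
    \<comment> \<open>The bound \<open>N\<close> on the integral makes \<open>s\<close> of order
      \<open>1 / r ^ n\<close>, as \<open>log_Hoelder_powr\<close> requires; \<open>D\<close> is the
      price for replacing \<open>p y\<close> by \<open>p x\<close>.\<close>
    have sD: "s powr (p x - p y) \<le> D" if "y \<in> G" "y \<in> ball x r" for y
      unfolding D
    proof (rule log_Hoelder_powr)
      show "s \<le> N / (2 * \<omega>) / r ^ DIM('a)"
        using IN \<omega>0 rn by (simp add: s_def n_def divide_right_mono)
      show "\<bar>p x - p y\<bar> \<le> c / ln (exp 1 + 1 / r)"
      proof (cases "x = y")
        case True
        have "0 < ln (exp 1 + 1 / r)"
          using ln_gt_zero[OF order_less_le_trans[of 1 "exp 1" "exp 1 + 1 / r"]] r by simp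
        then show ?thesis using True c by simp
      next
        case xy: False
        have nr: "norm (x - y) < r" using that by (simp add: dist_norm)
        have "1 < exp 1 + 1 / r" using order_less_le_trans[of 1 "exp 1" "exp 1 + 1 / r"] r by simp
        then have "0 < ln (exp 1 + 1 / r)" by (rule ln_gt_zero)
        moreover have "ln (exp 1 + 1 / r) \<le> ln (exp 1 + 1 / norm (x - y))"
          using nr xy r by (subst ln_le_cancel_iff) (auto intro!: add_pos_pos divide_left_mono)
        ultimately have "c / ln (exp 1 + 1 / norm (x - y)) \<le> c / ln (exp 1 + 1 / r)"
          using c by (intro divide_left_mono) auto
        then show ?thesis using lh[OF x that(1) xy] by linarith
      qed
    qed (use c r True N \<omega>0 in auto)
    \<comment> \<open>Pointwise split at the level \<open>s\<close>. Above it,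
      \<open>norm (f y)\<close> is its power \<open>p y\<close> times its power
      \<open>1 - p y\<close>; the latter exponent is not positive, so the base may be lowered to
      \<open>s\<close>, and \<open>sD\<close> then freezes the exponent at \<open>x\<close>.\<close>
    have pw: "ennreal (norm (f y)) * indicator (ball x r) y \<le>
        ennreal s * indicator (ball x r) y + ennreal (D * s powr (1 - p x)) * (F y * indicator (ball x r) y)" for y
    proof (cases "y \<in> ball x r \<and> s < norm (f y)")
      case y: True
      then have "f y \<noteq> 0" using True by auto
      then have yG: "y \<in> G" using f by blast
      have "norm (f y) = norm (f y) powr p y * norm (f y) powr (1 - p y)"
        using \<open>f y \<noteq> 0\<close> by (simp add: powr_add[symmetric])
      also have "\<dots> \<le> norm (f y) powr p y * s powr (1 - p y)"
        using y p(1)[OF yG] True by (intro mult_left_mono powr_mono2') auto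
      also have "s powr (1 - p y) = s powr (p x - p y) * s powr (1 - p x)"
        using True by (simp add: powr_add[symmetric])
      also have "\<dots> \<le> D * s powr (1 - p x)"
        using sD[OF yG] y by (intro mult_right_mono) auto
      finally have "norm (f y) \<le> norm (f y) powr p y * (D * s powr (1 - p x))"
        by (simp add: mult_left_mono)
      then have "ennreal (norm (f y)) \<le> ennreal (D * s powr (1 - p x) * norm (f y) powr p y)"
        by (intro ennreal_leI) (simp add: mult_ac)
      also have "\<dots> = ennreal (D * s powr (1 - p x)) * ennreal (norm (f y) powr p y)"
        using D0 by (intro ennreal_mult) auto
      finally have "ennreal (norm (f y)) \<le> ennreal (D * s powr (1 - p x)) * ennreal (norm (f y) powr p y)" .
      then show ?thesis using y F(2)[OF yG] by (simp add: add_increasing)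
    next
      case False
      then show ?thesis by (auto simp: indicator_def intro!: add_increasing2 ennreal_leI)
    qed
    have "ennreal I \<le> (\<integral>\<^sup>+y. ennreal s * indicator (ball x r) y +
      ennreal (D * s powr (1 - p x)) * (F y * indicator (ball x r) y) \<partial>lebesgue)"
      unfolding I_eq[symmetric] by (intro nn_integral_mono pw)
    also have "\<dots> = (\<integral>\<^sup>+y. ennreal s * indicator (ball x r) y \<partial>lebesgue) +
      (\<integral>\<^sup>+y. ennreal (D * s powr (1 - p x)) * (F y * indicator (ball x r) y) \<partial>lebesgue)"
      using F(1) by (intro nn_integral_add; measurable)
    also have "(\<integral>\<^sup>+y. ennreal s * indicator (ball x r) y \<partial>lebesgue) =
      ennreal (s * (\<omega> * r ^ n))"
      using emeasure_ball[of r x] r s0 \<omega>0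
      by (subst nn_integral_cmult_indicator) (auto simp: \<omega> n_def intro!: ennreal_mult[symmetric])
    also have "(\<integral>\<^sup>+y. ennreal (D * s powr (1 - p x)) * (F y *
      indicator (ball x r) y) \<partial>lebesgue) = ennreal (D * s powr (1 - p x)) * J"
      unfolding J_def using F(1) by (intro nn_integral_cmult) auto
    also have "s * (\<omega> * r ^ n) = I / 2" unfolding I_s by simp
    finally have IJ: "ennreal I \<le> ennreal (I / 2) + ennreal (D * s powr (1 - p x)) * J" .
    have "ennreal I = ennreal (I / 2) + ennreal (I / 2)"
      using I0 ennreal_plus[of "I / 2" "I / 2"] by simp
    with IJ have half: "ennreal (I / 2) \<le> ennreal (D * s powr (1 - p x)) * J"
      by (simp only: ennreal_add_left_cancel_le) auto
    \<comment> \<open>Multiplying \<open>half\<close> by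
      \<open>s powr (p x - 1) / (\<omega> * r ^ n)\<close> turns its left-hand side into
      \<open>s powr p x\<close> and removes the power of \<open>s\<close> on the right, so that
      \<open>D / (\<omega> * r ^ n)\<close> remains in front of \<open>J\<close>.\<close>
    have "s powr (p x - 1) * s powr 1 = s powr (p x - 1 + 1)" by (rule powr_add[symmetric])
    then have s1: "s powr (p x - 1) * s = s powr p x" using True by simp
    have "s powr (p x - 1) * s powr (1 - p x) = s powr (p x - 1 + (1 - p x))" by (rule powr_add[symmetric])
    then have s2: "s powr (p x - 1) * s powr (1 - p x) = 1" using True by simp
    have "s powr (p x - 1) / (\<omega> * r ^ n) * (I / 2) = s powr (p x - 1) * s"
      using \<omega>0 r by (simp add: I_s)
    then have "ennreal (s powr p x) = ennreal (s powr (p x - 1) / (\<omega> * r ^ n) * (I / 2))"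
      using s1 by simp
    also have "\<dots> = ennreal (s powr (p x - 1) / (\<omega> * r ^ n)) * ennreal (I / 2)"
      using I0 \<omega>0 rn by (intro ennreal_mult) auto
    also have "\<dots> \<le> ennreal (s powr (p x - 1) / (\<omega> * r ^ n)) * (ennreal (D * s powr (1 - p x)) * J)"
      by (intro mult_left_mono half) auto
    also have "\<dots> = ennreal (s powr (p x - 1) / (\<omega> * r ^ n)) * ennreal (D * s powr (1 - p x)) * J"
      by (simp only: mult.assoc)
    also have "ennreal (s powr (p x - 1) / (\<omega> * r ^ n)) * ennreal (D * s powr (1 - p x)) =
        ennreal (s powr (p x - 1) / (\<omega> * r ^ n) * (D * s powr (1 - p x)))"
      using \<omega>0 rn D0 by (intro ennreal_mult[symmetric]) auto
    also have "s powr (p x - 1) / (\<omega> * r ^ n) * (D * s powr (1 - p x)) =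
        D / (\<omega> * r ^ n) * (s powr (p x - 1) * s powr (1 - p x))" by simp
    finally have sJ: "ennreal (s powr p x) \<le> ennreal (D / (\<omega> * r ^ n)) * J" unfolding s2 by simp
    have "ennreal (g powr p x) \<le> ennreal ((1 + 2 * A * \<omega>) powr P * s powr p x)"
      by (intro ennreal_leI g1)
    also have "\<dots> = ennreal ((1 + 2 * A * \<omega>) powr P) * ennreal (s powr p x)"
      by (intro ennreal_mult) auto
    also have "\<dots> \<le> ennreal ((1 + 2 * A * \<omega>) powr P) * (ennreal (D / (\<omega> * r ^ n)) * J)"
      by (intro mult_left_mono sJ) auto
    also have "\<dots> = ennreal ((1 + 2 * A * \<omega>) powr P) * ennreal (D / (\<omega> * r ^ n)) * J"
      by (simp only: mult.assoc)
    also have "ennreal ((1 + 2 * A * \<omega>) powr P) * ennreal (D / (\<omega> * r ^ n)) =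
        ennreal ((1 + 2 * A * \<omega>) powr P * (D / (\<omega> * r ^ n)))"
      using \<omega>0 rn D0 by (intro ennreal_mult[symmetric]) auto
    also have "(1 + 2 * A * \<omega>) powr P * (D / (\<omega> * r ^ n)) =
      (1 + 2 * A * \<omega>) powr P * D / (\<omega> * r ^ n)" by simp
    finally show ?thesis by (intro add_increasing) (auto simp: J_def n_def)
  qed
qed

text \<open>Integrates the pointwise estimate of \<open>ball_average_powr_le\<close>. Confining
  \<open>f\<close> to \<open>ball 0 R\<close> serves twice: it bounds the integral of
  \<open>f\<close> through its modular, and it lets the constant term contribute only on
  \<open>ball 0 (R + R1)\<close>, whose volume is finite. \<open>C\<close> is fixed before
  \<open>f\<close>, \<open>g\<close> and \<open>r\<close>.\<close>

lemma modular_ball_average: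
  fixes G :: "'a::euclidean_space set"
  assumes G: "G \<in> sets lebesgue" and p: "p \<in> P_log G" and A: "0 < A" and R: "0 < R" and R1: "0 < R1"
  obtains C where "1 \<le> C"
    "\<And>(f :: 'a \<Rightarrow> 'b::euclidean_space) (g :: 'a \<Rightarrow> 'c::euclidean_space) r.
       f \<in> borel_measurable lebesgue \<Longrightarrow> (\<And>y. y \<notin> G \<inter> ball 0 R \<Longrightarrow>
         f y = 0) \<Longrightarrow> 0 < r \<Longrightarrow> r \<le> R1 \<Longrightarrow>
       modular G p f \<le> 1 \<Longrightarrow>
       (\<And>x. x \<in> G \<Longrightarrow> ennreal (norm (g x)) \<le>
          ennreal (A / r ^ DIM('a)) * ball_integral f x r) \<Longrightarrow>
       modular G p g \<le> ennreal C"
proof -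
  obtain P c where P: "1 \<le> P" "\<And>x. x \<in> G \<Longrightarrow>
    1 \<le> p x" "\<And>x. x \<in> G \<Longrightarrow> p x \<le> P" "0 < c"
    "\<And>x y. x \<in> G \<Longrightarrow> y \<in> G \<Longrightarrow> x \<noteq> y \<Longrightarrow>
      \<bar>p x - p y\<bar> \<le> c / ln (exp 1 + 1 / norm (x - y))"
    "p \<in> borel_measurable (lebesgue_on G)" using P_logE[OF p] by blast
  define \<omega> where "\<omega> = unit_ball_vol (real DIM('a))"
  have \<omega>0: "0 < \<omega>" unfolding \<omega>_def by simp
  \<comment> \<open>Bounds the integral of \<open>norm (f y)\<close>: for \<open>p \<ge> 1\<close> a
    number \<open>t \<ge> 0\<close> is at most \<open>1 + t powr p\<close>, and the modular is at
    most 1.\<close>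
  define N where "N = \<omega> * R ^ DIM('a) + 1"
  have N: "0 < N" using \<omega>0 R by (simp add: N_def add_pos_pos)
  define D where "D = exp ((\<bar>ln (N / (2 * \<omega>))\<bar> + real DIM('a)) * c)"
  define Q where "Q = (1 + 2 * A * \<omega>) powr P"
  define C where "C = 1 + (Q * (\<omega> * (R + R1) ^ DIM('a)) + Q * D)"
  have Q: "0 \<le> Q" by (simp add: Q_def)
  have D: "0 \<le> D" by (simp add: D_def)
  have C: "1 \<le> C" using Q D \<omega>0 R R1 by (simp add: C_def)
  show ?thesis
  proof (rule that[OF C])
    fix f :: "'a \<Rightarrow> 'b" and g :: "'a \<Rightarrow> 'c" and r :: real
    assume f: "f \<in> borel_measurable lebesgue" "\<And>y. y \<notin> G \<inter> ball 0 R \<Longrightarrow> f y = 0"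
      and r: "0 < r" "r \<le> R1" and mf: "modular G p f \<le> 1"
      and g: "\<And>x. x \<in> G \<Longrightarrow> ennreal (norm (g x)) \<le>
          ennreal (A / r ^ DIM('a)) * ball_integral f x r"
    define F where "F y = ennreal (norm (f y) powr p y) * indicator G y" for y
    have F: "F \<in> borel_measurable lebesgue"
    proof -
      have "(\<lambda>y. ennreal (norm (f y) powr p y)) \<in> borel_measurable (lebesgue_on G)"
      proof -
        have [measurable]: "f \<in> borel_measurable (lebesgue_on G)" using f(1) by (rule measurable_restrict_space1)
        note [measurable] = P(6)
        show ?thesis by measurable
      qed
      then show ?thesis unfolding F_def[abs_def]
        using G by (subst borel_measurable_restrict_space_iff_ennreal[symmetric]) auto
    qed
    have FI: "(\<integral>\<^sup>+y. F y \<partial>lebesgue) \<le> 1" using mf unfolding modular_alt[OF G] F_def .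
    define Jx where "Jx x = (\<integral>\<^sup>+y. F y * indicator (ball x r) y \<partial>lebesgue)" for x
    have Jm: "Jx \<in> borel_measurable lebesgue"
      unfolding Jx_def[abs_def] using ball_integral_measurable[OF F] by (rule borel_imp_lebesgue)
    have fN: "(\<integral>\<^sup>+y. ennreal (norm (f y)) \<partial>lebesgue) \<le> ennreal N"
    proof -
      have "(\<integral>\<^sup>+y. ennreal (norm (f y)) \<partial>lebesgue) \<le>
        (\<integral>\<^sup>+y. indicator (ball 0 R) y + F y \<partial>lebesgue)"
      proof (intro nn_integral_mono)
        fix y
        show "ennreal (norm (f y)) \<le> indicator (ball 0 R) y + F y"
        proof (cases "y \<in> G \<inter> ball 0 R")
          case True
          have "norm (f y) \<le> 1 + norm (f y) powr p y"
            using powr_mono[of 1 "p y" "norm (f y)"] P(2)[of y] True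
            by (cases "norm (f y) \<le> 1") (auto simp: add_increasing2)
          then have "ennreal (norm (f y)) \<le> ennreal (1 + norm (f y) powr p y)" by (rule ennreal_leI)
          then show ?thesis using True by (simp add: F_def ennreal_plus)
        qed (use f(2) in auto)
      qed
      also have "\<dots> = (\<integral>\<^sup>+y. indicator (ball 0 R) y \<partial>(lebesgue :: 'a measure)) +
        (\<integral>\<^sup>+y. F y \<partial>lebesgue)"
        using F by (intro nn_integral_add borel_measurable_indicator) auto
      also have "(\<integral>\<^sup>+y. indicator (ball 0 R) y \<partial>(lebesgue :: 'a measure)) =
        ennreal (\<omega> * R ^ DIM('a))"
        using emeasure_ball[of R "0::'a"] R by (simp add: \<omega>_def)
      also have "\<dots> + (\<integral>\<^sup>+y. F y \<partial>lebesgue) \<le> ennreal (\<omega> * R ^ DIM('a)) + 1"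
        by (intro add_left_mono FI)
      also have "\<dots> = ennreal N" using \<omega>0 R by (simp add: N_def ennreal_plus)
      finally show ?thesis .
    qed
    have IN: "ball_integral f x r \<le> ennreal N" for x
      by (rule order_trans[OF nn_integral_mono fN]) (auto simp: indicator_def)
    have pw: "ennreal (norm (g x) powr p x) * indicator G x \<le>
        ennreal Q * indicator (ball 0 (R + R1)) x + ennreal (Q * D / (\<omega> * r ^ DIM('a))) * Jx x" for x
    proof (cases "x \<in> G \<and> x \<in> ball 0 (R + R1)")
      case True
      then have "ennreal (norm (g x) powr p x) \<le> ennreal Q + ennreal (Q * D / (\<omega> * r ^ DIM('a))) * Jx x"
      proof -
        have "f y = 0" if "y \<notin> G" for y using f(2) that by blast
        moreover have "F y = ennreal (norm (f y) powr p y)" if "y \<in> G" for y using that by (simp add: F_def)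
        ultimately show ?thesis
          unfolding Q_def Jx_def
          using ball_average_powr_le[OF P(2) P(3) P(4) P(5) _ r(1) A N f(1) _ F _ IN g norm_ge_zero \<omega>_def
            D_def] True by blast
      qed
      then show ?thesis using True by simp
    next
      case False
      show ?thesis
      proof (cases "x \<in> G")
        case True
        \<comment> \<open>Balls with centre outside \<open>ball 0 (R + R1)\<close> meet only zeros
          of \<open>f\<close>, because \<open>r \<le> R1\<close>.\<close>
        have "ball_integral f x r = (\<integral>\<^sup>+y. 0 \<partial>(lebesgue :: 'a measure))"
        proof (intro nn_integral_cong)
          fix y
          have "f y = 0" if "y \<in> ball x r"
          proof (rule f(2))
            have "dist x y < r" using that by simp
            moreover have "R + R1 \<le> norm x" using False True by simp
            moreover have "norm x \<le> norm y + dist x y" using norm_triangle_sub[of x y] by (simp add: dist_norm)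
            ultimately show "y \<notin> G \<inter> ball 0 R" using r by simp
          qed
          then show "ennreal (norm (f y)) * indicator (ball x r) y = 0" by (auto simp: indicator_def)
        qed
        with g[OF True] show ?thesis by simp
      qed simp
    qed
    have "modular G p g \<le> (\<integral>\<^sup>+x. ennreal Q * indicator (ball 0 (R + R1)) x +
      ennreal (Q * D / (\<omega> * r ^ DIM('a))) * Jx x \<partial>lebesgue)"
      unfolding modular_alt[OF G] by (intro nn_integral_mono pw)
    also have "\<dots> = (\<integral>\<^sup>+x. ennreal Q * indicator (ball 0 (R +
      R1)) x \<partial>(lebesgue :: 'a measure)) + (\<integral>\<^sup>+x. ennreal (Q * D / (\<omega> *
      r ^ DIM('a))) * Jx x \<partial>lebesgue)"
      using Jm by (intro nn_integral_add; measurable)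
    also have "(\<integral>\<^sup>+x. ennreal Q * indicator (ball 0 (R +
      R1)) x \<partial>(lebesgue :: 'a measure)) = ennreal (Q * (\<omega> * (R + R1) ^ DIM('a)))"
      using emeasure_ball[of "R + R1" "0::'a"] R R1 Q \<omega>0
      by (subst nn_integral_cmult_indicator) (auto simp: \<omega>_def ennreal_mult')
    also have "(\<integral>\<^sup>+x. ennreal (Q * D / (\<omega> * r ^ DIM('a))) * Jx x \<partial>lebesgue) =
      ennreal (Q * D / (\<omega> * r ^ DIM('a))) * (\<integral>\<^sup>+x. Jx x \<partial>lebesgue)"
      using Jm by (intro nn_integral_cmult)
    also have "\<dots> = ennreal (Q * D / (\<omega> * r ^ DIM('a))) * (ennreal (\<omega> * r ^ DIM('a)) *
      (\<integral>\<^sup>+y. F y \<partial>lebesgue))"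
      unfolding Jx_def ball_integral_total[OF F r(1)] \<omega>_def ..
    \<comment> \<open>The volume from \<open>ball_integral_total\<close> cancels
      \<open>\<omega> * r ^ DIM('a)\<close>; this is why the constant does not depend on
      \<open>r\<close>.\<close>
    also have "\<dots> = ennreal (Q * D) * (\<integral>\<^sup>+y. F y \<partial>lebesgue)"
      using \<omega>0 r Q D by (simp add: mult.assoc[symmetric] ennreal_mult'[symmetric])
    also have "\<dots> \<le> ennreal (Q * D) * 1" by (intro mult_left_mono FI) auto
    also have "ennreal (Q * (\<omega> * (R + R1) ^ DIM('a))) + ennreal (Q * D) * 1 \<le> ennreal C"
      using Q D \<omega>0 R R1 by (simp add: C_def ennreal_plus[symmetric] ennreal_leI del: ennreal_plus)
    finally show "modular G p g \<le> ennreal C" by (simp add: add_left_mono)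
  qed
qed

section \<open>The Luxemburg norm\<close>

lemma lux_norm_le: "0 < l \<Longrightarrow> modular G p (\<lambda>x. f x /\<^sub>R l) \<le> 1 \<Longrightarrow>
  lux_norm G p f \<le> ennreal l"
  unfolding lux_norm_def by (rule INF_lower) simp

text \<open>An estimate for every admissible scaling \<open>l\<close> passes to the infimum.
  Division by \<open>C\<close> within \<open>ennreal\<close> also settles the case of an infinite
  norm, where no \<open>l\<close> is admissible.\<close>

lemma lux_norm_transfer:
  assumes C: "0 < C"
    and le: "\<And>l. 0 < l \<Longrightarrow> modular G p (\<lambda>x. f x /\<^sub>R l) \<le>
      1 \<Longrightarrow> lux_norm H q g \<le> ennreal (C * l)"
  shows "lux_norm H q g \<le> ennreal C * lux_norm G p f"
proof -
  have "lux_norm H q g / ennreal C \<le> lux_norm G p f"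
    unfolding lux_norm_def[of G p f]
  proof (rule INF_greatest)
    fix l assume "l \<in> {l. 0 < l \<and> modular G p (\<lambda>x. f x /\<^sub>R l) \<le> 1}"
    then have l: "0 < l" "modular G p (\<lambda>x. f x /\<^sub>R l) \<le> 1" by auto
    show "lux_norm H q g / ennreal C \<le> ennreal l"
      using le[OF l] C l by (intro divide_le_posI_ennreal) (auto simp: ennreal_mult mult.commute)
  qed
  then have "ennreal C * (lux_norm H q g / ennreal C) \<le> ennreal C * lux_norm G p f"
    by (intro mult_left_mono) auto
  moreover have "ennreal C * (lux_norm H q g / ennreal C) = lux_norm H q g"
    using C by (simp add: ennreal_times_divide mult.commute[of "ennreal C"] ennreal_mult_divide_eq)
  ultimately show ?thesis by simp
qed

lemma modular_mono_AE:
  assumes "AE x in lebesgue_on G. norm (h x) \<le> norm (f x)" "\<And>x. x \<in> G \<Longrightarrow> 0 \<le> p x"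
  shows "modular G p h \<le> modular G p f"
  unfolding modular_def
proof (rule nn_integral_mono_AE)
  show "AE x in lebesgue_on G. ennreal (norm (h x) powr p x) \<le> ennreal (norm (f x) powr p x)"
    using assms(1) AE_space
    by eventually_elim (auto intro!: ennreal_leI powr_mono2 assms(2) simp: space_restrict_space)
qed

lemma lux_norm_mono_AE:
  assumes "AE x in lebesgue_on G. norm (h x) \<le> norm (f x)" "\<And>x. x \<in> G \<Longrightarrow> 0 \<le> p x"
  shows "lux_norm G p h \<le> lux_norm G p f"
proof -
  have "modular G p (\<lambda>x. h x /\<^sub>R l) \<le> modular G p (\<lambda>x. f x /\<^sub>R l)" if "0 < l" for l
    using assms(1) by (intro modular_mono_AE assms(2)) (use that in \<open>auto elim!: eventually_mono intro:
      divide_right_mono mult_left_mono\<close>)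
  then show ?thesis
    unfolding lux_norm_def by (intro INF_superset_mono) (auto intro: order_trans)
qed

lemma P_log_ge_1: "p \<in> P_log G \<Longrightarrow> x \<in> G \<Longrightarrow> 1 \<le> p x"
  by (simp add: P_log_def)

lemma P_log_nonneg: "p \<in> P_log G \<Longrightarrow> x \<in> G \<Longrightarrow> 0 \<le> p x"
  by (simp add: P_log_def order_trans[OF zero_le_one])

lemma powr_norm_measurable:
  assumes "p \<in> P_log G" "f \<in> borel_measurable (lebesgue_on G)"
  shows "(\<lambda>x. ennreal (norm (f x) powr p x)) \<in> borel_measurable (lebesgue_on G)"
proof -
  note [measurable] = assms(2)
  have [measurable]: "p \<in> borel_measurable (lebesgue_on G)" using assms(1) by (erule_tac P_logE)
  show ?thesis by measurable
qed

text \<open>As exponents are at least 1, dividing the function by \<open>C \<ge> 1\<close> divides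
  the modular by at least \<open>C\<close>. This converts modular bounds into norm bounds.\<close>

lemma modular_scale_down:
  assumes p: "p \<in> P_log G" and f: "f \<in> borel_measurable (lebesgue_on G)" and C: "1 \<le> C"
    and m: "modular G p f \<le> ennreal C"
  shows "modular G p (\<lambda>x. f x /\<^sub>R C) \<le> 1"
proof -
  note p1 = P_log_ge_1[OF p]
  have "modular G p (\<lambda>x. f x /\<^sub>R C) \<le> (\<integral>\<^sup>+x. ennreal (1 / C) *
    ennreal (norm (f x) powr p x) \<partial>lebesgue_on G)"
    unfolding modular_def
  proof (intro nn_integral_mono)
    fix x assume "x \<in> space (lebesgue_on G)"
    then have x: "1 \<le> p x" using p1 by (simp add: space_restrict_space)
    have "norm (f x /\<^sub>R C) powr p x = (1 / C) powr p x * norm (f x) powr p x"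
      using C by (simp add: powr_mult[symmetric] divide_inverse)
    also have "\<dots> \<le> (1 / C) powr 1 * norm (f x) powr p x"
      using C x by (intro mult_right_mono powr_mono') auto
    finally show "ennreal (norm (f x /\<^sub>R C) powr p x) \<le> ennreal (1 / C) * ennreal (norm (f x) powr p x)"
      using C by (simp add: ennreal_mult[symmetric] ennreal_leI)
  qed
  also have "\<dots> = ennreal (1 / C) * modular G p f"
    unfolding modular_def by (rule nn_integral_cmult[OF powr_norm_measurable[OF p f]])
  also have "\<dots> \<le> ennreal (1 / C) * ennreal C" by (intro mult_left_mono m) auto
  also have "\<dots> = 1" using C by (simp add: ennreal_mult[symmetric])
  finally show ?thesis .
qed

text \<open>For \<open>e \<le> 1\<close>, dividing by \<open>e\<close> enlarges the modular by at
  most the factor \<open>e powr (- P)\<close>. Thus, for exponents bounded by \<open>P\<close>,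
  convergence of modulars to 0 gives convergence in norm.\<close>

lemma lux_norm_small:
  assumes p: "p \<in> P_log G" and P: "\<And>x. x \<in> G \<Longrightarrow> p x \<le> P"
    and f: "f \<in> borel_measurable (lebesgue_on G)" and e: "0 < e" "e \<le> 1"
    and m: "modular G p f \<le> ennreal (e powr P)"
  shows "lux_norm G p f \<le> ennreal e"
proof (rule lux_norm_le[OF e(1)])
  have "modular G p (\<lambda>x. f x /\<^sub>R e) \<le> (\<integral>\<^sup>+x. ennreal (e powr (- P)) *
    ennreal (norm (f x) powr p x) \<partial>lebesgue_on G)"
    unfolding modular_def
  proof (intro nn_integral_mono)
    fix x assume "x \<in> space (lebesgue_on G)"
    then have x: "p x \<le> P" using P by (simp add: space_restrict_space)
    have "norm (f x /\<^sub>R e) powr p x = (1 / e) powr p x * norm (f x) powr p x"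
      using e by (simp add: powr_mult[symmetric] divide_inverse)
    also have "\<dots> \<le> (1 / e) powr P * norm (f x) powr p x"
      using e x by (intro mult_right_mono powr_mono) auto
    also have "(1 / e) powr P = e powr (- P)" using e
      by (simp add: powr_minus powr_divide divide_inverse inverse_powr)
    finally show "ennreal (norm (f x /\<^sub>R e) powr p x) \<le>
      ennreal (e powr (- P)) * ennreal (norm (f x) powr p x)"
      using e by (simp add: ennreal_mult[symmetric] ennreal_leI)
  qed
  also have "\<dots> = ennreal (e powr (- P)) * modular G p f"
    unfolding modular_def by (rule nn_integral_cmult[OF powr_norm_measurable[OF p f]])
  also have "\<dots> \<le> ennreal (e powr (- P)) * ennreal (e powr P)" by (intro mult_left_mono m) auto
  also have "\<dots> = 1" using e by (simp add: ennreal_mult[symmetric] powr_add[symmetric])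
  finally show "modular G p (\<lambda>x. f x /\<^sub>R e) \<le> 1" .
qed

lemma modular_le_1_mono:
  assumes p: "p \<in> P_log G" and "0 < l" "l \<le> l'" "modular G p (\<lambda>x. f x /\<^sub>R l) \<le> 1"
  shows "modular G p (\<lambda>x. f x /\<^sub>R l') \<le> 1"
proof (rule order_trans[OF modular_mono_AE assms(4)])
  show "AE x in lebesgue_on G. norm (f x /\<^sub>R l') \<le> norm (f x /\<^sub>R l)"
    using assms by (auto intro!: mult_right_mono le_imp_inverse_le)
qed (use P_log_nonneg[OF p] in blast)

text \<open>The strict inequality provides an admissible scaling below \<open>e\<close>, and
  admissibility is inherited by larger scalings; whether the infimum is attained does not
  matter.\<close>

lemma lux_norm_lessE:
  assumes p: "p \<in> P_log G" and "lux_norm G p f < ennreal e"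
  shows "modular G p (\<lambda>x. f x /\<^sub>R e) \<le> 1"
proof -
  obtain l where l: "0 < l" "modular G p (\<lambda>x. f x /\<^sub>R l) \<le> 1" "ennreal l < ennreal e"
    using assms(2) unfolding lux_norm_def INF_less_iff by blast
  have "l \<le> e" using l by (simp add: ennreal_less_iff less_imp_le)
  with modular_le_1_mono[OF p l(1) _ l(2)] show ?thesis by blast
qed

text \<open>A substitute for the triangle inequality with a worse constant, good enough for limits.
  The sum is at most twice the maximum, so division by \<open>4 * e\<close> leaves a factor 1/2 in
  front of the maximum divided by \<open>e\<close>; as \<open>p \<ge> 1\<close>, this factor
  survives in the modular and halves both contributions.\<close>

lemma lux_norm_small_add:
  assumes p: "p \<in> P_log G" and e: "0 < e"
    and f: "f \<in> borel_measurable (lebesgue_on G)" and g: "g \<in> borel_measurable (lebesgue_on G)"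
    and h: "AE x in lebesgue_on G. norm (h x) \<le> norm (f x) + norm (g x)"
    and lf: "lux_norm G p f < ennreal e" and lg: "lux_norm G p g < ennreal e"
  shows "lux_norm G p h \<le> ennreal (4 * e)"
proof (rule lux_norm_le)
  note p1 = P_log_ge_1[OF p]
  let ?f = "\<lambda>x. ennreal (norm (f x /\<^sub>R e) powr p x)"
    and ?g = "\<lambda>x. ennreal (norm (g x /\<^sub>R e) powr p x)"
  have fm [measurable]: "?f \<in> borel_measurable (lebesgue_on G)"
    using f by (intro powr_norm_measurable[OF p]; measurable)
  have gm [measurable]: "?g \<in> borel_measurable (lebesgue_on G)"
    using g by (intro powr_norm_measurable[OF p]; measurable)
  have "modular G p (\<lambda>x. h x /\<^sub>R (4 * e)) \<le>
    (\<integral>\<^sup>+x. ennreal (1 / 2) * ?f x + ennreal (1 / 2) * ?g x \<partial>lebesgue_on G)"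
    unfolding modular_def
  proof (intro nn_integral_mono_AE)
    have "ennreal (norm (h x /\<^sub>R (4 * e)) powr p x) \<le> ennreal (1 / 2) * ?f x + ennreal (1 / 2) * ?g x"
      if h: "norm (h x) \<le> norm (f x) + norm (g x)" and x: "x \<in> G" for x
    proof -
      define m where "m = max (norm (f x)) (norm (g x))"
      have m: "0 \<le> m" by (auto simp: m_def max_def)
      have px: "1 \<le> p x" using p1[OF x] .
      have "norm (h x /\<^sub>R (4 * e)) \<le> (1 / 2) * (m / e)"
        using h e by (auto simp: m_def field_simps)
      then have "norm (h x /\<^sub>R (4 * e)) powr p x \<le> ((1 / 2) * (m / e)) powr p x"
        using px by (intro powr_mono2) auto
      also have "\<dots> = (1 / 2) powr p x * (m / e) powr p x"
        using m e by (subst powr_mult) auto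
      also have "\<dots> \<le> (1 / 2) powr 1 * (m / e) powr p x"
        using px by (intro mult_right_mono powr_mono') auto
      also have "\<dots> \<le> (1 / 2) * (norm (f x /\<^sub>R e) powr p x + norm (g x /\<^sub>R e) powr p x)"
      proof -
        have "norm (f x /\<^sub>R e) = norm (f x) / e" "norm (g x /\<^sub>R e) = norm (g x) / e"
          using e by (simp_all add: divide_inverse)
        moreover have "m = norm (f x) \<or> m = norm (g x)" by (auto simp: m_def)
        ultimately have "(m / e) powr p x \<le> norm (f x /\<^sub>R e) powr p x + norm (g x /\<^sub>R e) powr p x"
          by (elim disjE) (simp_all only: le_add_same_cancel1 le_add_same_cancel2 powr_ge_zero)
        then show ?thesis by simp
      qed
      finally have "ennreal (norm (h x /\<^sub>R (4 * e)) powr p x) \<le>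
          ennreal ((1 / 2) * (norm (f x /\<^sub>R e) powr p x) + (1 / 2) * (norm (g x /\<^sub>R e) powr p x))"
        by (intro ennreal_leI) (simp add: distrib_left)
      also have "\<dots> = ennreal (1 / 2) * ?f x + ennreal (1 / 2) * ?g x"
      proof -
        have "ennreal (1 / 2 * a + 1 / 2 * b) = ennreal (1 / 2 * a) + ennreal (1 / 2 * b)" if "0 \<le>
          a" "0 \<le> b" for a b :: real
          using that by (intro ennreal_plus) auto
        then show ?thesis by (simp only: ennreal_mult''[OF powr_ge_zero] powr_ge_zero)
      qed
      finally show ?thesis .
    qed
    with h AE_space[of "lebesgue_on G"] show "AE x in lebesgue_on G. ennreal (norm (h x /\<^sub>R (4 *
      e)) powr p x) \<le> ennreal (1 / 2) * ?f x + ennreal (1 / 2) * ?g x"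
      by (auto elim!: eventually_elim2 simp: space_restrict_space)
  qed
  also have "\<dots> = ennreal (1 / 2) * modular G p (\<lambda>x. f x /\<^sub>R e) +
    ennreal (1 / 2) * modular G p (\<lambda>x. g x /\<^sub>R e)"
  proof -
    have "(\<integral>\<^sup>+x. ennreal (1 / 2) * ?f x + ennreal (1 / 2) * ?g x \<partial>lebesgue_on G) =
        (\<integral>\<^sup>+x. ennreal (1 / 2) * ?f x \<partial>lebesgue_on G) +
          (\<integral>\<^sup>+x. ennreal (1 / 2) * ?g x \<partial>lebesgue_on G)"
      by (rule nn_integral_add) measurable
    then show ?thesis unfolding modular_def by (simp only: nn_integral_cmult[OF fm] nn_integral_cmult[OF gm])
  qed
  also have "\<dots> \<le> ennreal (1 / 2) * 1 + ennreal (1 / 2) * 1"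
    by (intro add_mono mult_left_mono lux_norm_lessE[OF p] lf lg) auto
  also have "\<dots> = 1"
  proof -
    have "ennreal (1 / 2 + 1 / 2) = ennreal (1 / 2) + ennreal (1 / 2)" by (rule ennreal_plus) auto
    then have "ennreal (1 / 2) + ennreal (1 / 2) = ennreal (1 / 2 + 1 / 2)" by (rule sym)
    also have "(1 / 2 + 1 / 2 :: real) = 1" by simp
    finally show ?thesis by (simp only: mult_1_right ennreal_1)
  qed
  finally show "modular G p (\<lambda>x. h x /\<^sub>R (4 * e)) \<le> 1" .
qed (use e in simp)

text \<open>The pointwise hypothesis is homogeneous: scaling \<open>f\<close> and \<open>g\<close>
  by the same \<open>l\<close> preserves it, and so the modular estimate turns into a norm
  estimate.\<close>

lemma lux_norm_ball_average:
  fixes G :: "'a::euclidean_space set"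
  assumes G: "G \<in> sets lebesgue" and p: "p \<in> P_log G" and A: "0 < A" and R: "0 < R" and R1: "0 < R1"
  obtains C where "0 < C"
    "\<And>(f :: 'a \<Rightarrow> 'b::euclidean_space) (g :: 'a \<Rightarrow> 'c::euclidean_space) r.
       f \<in> borel_measurable lebesgue \<Longrightarrow> (\<And>y. y \<notin> G \<inter> ball 0 R \<Longrightarrow>
         f y = 0) \<Longrightarrow> 0 < r \<Longrightarrow> r \<le> R1 \<Longrightarrow>
       g \<in> borel_measurable (lebesgue_on G) \<Longrightarrow>
       (\<And>x. x \<in> G \<Longrightarrow> ennreal (norm (g x)) \<le>
          ennreal (A / r ^ DIM('a)) * ball_integral f x r) \<Longrightarrow>
       lux_norm G p g \<le> ennreal C * lux_norm G p f"
proof -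
  obtain C where C: "1 \<le> C"
    "\<And>(f :: 'a \<Rightarrow> 'b::euclidean_space) (g :: 'a \<Rightarrow> 'c::euclidean_space) r.
       f \<in> borel_measurable lebesgue \<Longrightarrow> (\<And>y. y \<notin> G \<inter> ball 0 R \<Longrightarrow>
         f y = 0) \<Longrightarrow> 0 < r \<Longrightarrow> r \<le> R1 \<Longrightarrow>
       modular G p f \<le> 1 \<Longrightarrow>
       (\<And>x. x \<in> G \<Longrightarrow> ennreal (norm (g x)) \<le>
          ennreal (A / r ^ DIM('a)) * ball_integral f x r) \<Longrightarrow>
       modular G p g \<le> ennreal C"
    using modular_ball_average[OF assms] by blast
  show ?thesis
  proof (rule that)
    show "0 < C" using C(1) by simp
    fix f :: "'a \<Rightarrow> 'b" and g :: "'a \<Rightarrow> 'c" and r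
    assume f: "f \<in> borel_measurable lebesgue" "\<And>y. y \<notin> G \<inter> ball 0 R \<Longrightarrow> f y = 0"
      and r: "0 < r" "r \<le> R1" and gm: "g \<in> borel_measurable (lebesgue_on G)"
      and g: "\<And>x. x \<in> G \<Longrightarrow> ennreal (norm (g x)) \<le>
          ennreal (A / r ^ DIM('a)) * ball_integral f x r"
    show "lux_norm G p g \<le> ennreal C * lux_norm G p f"
    proof (rule lux_norm_transfer[OF \<open>0 < C\<close>])
      fix l :: real assume l: "0 < l" "modular G p (\<lambda>x. f x /\<^sub>R l) \<le> 1"
      have "modular G p (\<lambda>x. g x /\<^sub>R l) \<le> ennreal C"
      proof (rule C(2)[OF _ _ r l(2)])
        show "(\<lambda>x. f x /\<^sub>R l) \<in> borel_measurable lebesgue" using f(1) by measurable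
        show "f y /\<^sub>R l = 0" if "y \<notin> G \<inter> ball 0 R" for y using f(2)[OF that] by simp
        fix x assume x: "x \<in> G"
        have "ennreal (norm (g x /\<^sub>R l)) = ennreal (inverse l) * ennreal (norm (g x))"
          using l by (simp add: ennreal_mult)
        also have "\<dots> \<le> ennreal (inverse l) * (ennreal (A / r ^ DIM('a)) * ball_integral f x r)"
          by (intro mult_left_mono g x) auto
        also have "\<dots> = ennreal (A / r ^ DIM('a)) * (ennreal (inverse l) * ball_integral f x r)"
          by (simp only: mult_ac)
        also have "ennreal (inverse l) * ball_integral f x r =
            (\<integral>\<^sup>+y. ennreal (inverse l) * (ennreal (norm (f y)) *
              indicator (ball x r) y) \<partial>lebesgue)"
          using f(1) by (subst nn_integral_cmult; measurable)
        also have "\<dots> = ball_integral (\<lambda>y. f y /\<^sub>R l) x r"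
          using l by (simp add: ennreal_mult mult.assoc)
        finally show "ennreal (norm (g x /\<^sub>R l)) \<le> ennreal (A / r ^ DIM('a)) *
            (ball_integral (\<lambda>y. f y /\<^sub>R l) x r)" .
      qed
      then have "modular G p (\<lambda>x. (g x /\<^sub>R l) /\<^sub>R C) \<le> 1"
        using gm by (intro modular_scale_down[OF p _ C(1)]; measurable)
      then show "lux_norm G p g \<le> ennreal (C * l)"
        using l \<open>0 < C\<close> by (intro lux_norm_le) (auto simp: mult.commute)
    qed
  qed
qed

section \<open>Convergence of mollifications\<close>

lemma fun_conv_norm_le:
  fixes g :: "'a::euclidean_space \<Rightarrow> 'b::euclidean_space"
  assumes "\<And>x. 0 \<le> k x"
  shows "ennreal (norm (fun_conv k g x)) \<le> (\<integral>\<^sup>+y. ennreal (k (x - y)) *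
    ennreal (norm (g y)) \<partial>lebesgue)"
proof (cases "integrable lebesgue (\<lambda>y. k (x - y) *\<^sub>R g y)")
  case True
  from integral_norm_bound_ennreal[OF this] show ?thesis
    using assms by (simp add: fun_conv_def ennreal_mult)
\<comment> \<open>A convolution integral that does not exist has the value 0, for which the bound is
  trivial.\<close>
qed (simp add: fun_conv_def not_integrable_integral_eq)

text \<open>The kernel is replaced by its peak value on its support; here the constant
  \<open>1 / bump_mass\<close> of the later estimates originates.\<close>

lemma mollifier_conv_norm_le:
  fixes g :: "'a::euclidean_space \<Rightarrow> 'b::euclidean_space"
  assumes h: "0 < h" and g: "g \<in> borel_measurable lebesgue"
  shows "ennreal (norm (fun_conv (mollifier h) g x)) \<le>
    ennreal (1 / bump_mass TYPE('a) / h ^ DIM('a)) * ball_integral g x h"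
proof -
  have "ennreal (norm (fun_conv (mollifier h) g x)) \<le> (\<integral>\<^sup>+y. ennreal (mollifier h (x - y)) *
    ennreal (norm (g y)) \<partial>lebesgue)"
    by (rule fun_conv_norm_le[OF mollifier_nonneg[OF h]])
  also have "\<dots> \<le> (\<integral>\<^sup>+y. ennreal (1 / bump_mass TYPE('a) / h ^ DIM('a)) *
    (ennreal (norm (g y)) * indicator (ball x h) y) \<partial>lebesgue)"
  proof (intro nn_integral_mono)
    fix y
    show "ennreal (mollifier h (x - y)) * ennreal (norm (g y)) \<le>
        ennreal (1 / bump_mass TYPE('a) / h ^ DIM('a)) * (ennreal (norm (g y)) * indicator (ball x h) y)"
    proof (cases "y \<in> ball x h")
      case True
      then show ?thesis using mollifier_le[OF h, of "x - y"] by (auto intro!: mult_right_mono ennreal_leI)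
    next
      case False
      then have "mollifier h (x - y) = 0" by (intro mollifier_eq_0 h) (simp add: dist_norm)
      then show ?thesis by simp
    qed
  qed
  also have "\<dots> = ennreal (1 / bump_mass TYPE('a) / h ^ DIM('a)) * ball_integral g x h"
    using g by (intro nn_integral_cmult; measurable)
  finally show ?thesis .
qed

lemma fun_conv_cong_AE:
  assumes "AE y in lebesgue. g y = g' y" "g \<in> borel_measurable lebesgue" "g' \<in> borel_measurable lebesgue"
    "continuous_on UNIV k"
  shows "fun_conv k g x = fun_conv k g' x"
  unfolding fun_conv_def
  by (rule integral_cong_AE) (use assms lebesgue_measurable_reflect[OF assms(4)] in \<open>auto intro!:
    borel_measurable_scaleR\<close>)

text \<open>Young's inequality for a kernel of mass 1, by Tonelli for a Borel representative of
  \<open>g\<close>.\<close>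

lemma fun_conv_L1_le:
  fixes g :: "'a::euclidean_space \<Rightarrow> 'b::euclidean_space"
  assumes k: "\<And>x. 0 \<le> k x" "k \<in> C0_infinity UNIV" "(LINT x|lebesgue. k x) = 1"
    and g: "g \<in> borel_measurable lebesgue"
  shows "(\<integral>\<^sup>+x. ennreal (norm (fun_conv k g x)) \<partial>lebesgue) \<le>
    (\<integral>\<^sup>+x. ennreal (norm (g x)) \<partial>lebesgue)"
proof -
  have kc: "continuous_on UNIV k" using C0_infinity_continuous[OF k(2)] .
  have [measurable]: "k \<in> borel_measurable borel" using kc by (rule borel_measurable_continuous_onI)
  obtain g' where g': "g' \<in> borel_measurable borel" "AE x in lebesgue. g x = g' x"
    using lebesgue_borel_representative[OF g] .
  note [measurable] = g'(1)
  have "(\<integral>\<^sup>+x. ennreal (norm (fun_conv k g x)) \<partial>lebesgue) =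
    (\<integral>\<^sup>+x. ennreal (norm (fun_conv k g' x)) \<partial>lebesgue)"
    by (simp add: fun_conv_cong_AE[OF g'(2) g borel_imp_lebesgue[OF g'(1)] kc])
  also have "\<dots> \<le> (\<integral>\<^sup>+x. \<integral>\<^sup>+y. ennreal (k (x - y)) *
    ennreal (norm (g' y)) \<partial>lebesgue \<partial>lebesgue)"
    by (intro nn_integral_mono fun_conv_norm_le k(1))
  also have "\<dots> = (\<integral>\<^sup>+y. \<integral>\<^sup>+x. ennreal (k (x - y)) *
    ennreal (norm (g' y)) \<partial>lebesgue \<partial>lebesgue)"
  proof (rule nn_integral_swap)
    have "(\<lambda>(x, y). ennreal (k (x - y)) * ennreal (norm (g' y))) \<in> borel_measurable (borel
      \<Otimes>\<^sub>M borel)" by measurable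
    then show "(\<lambda>(x, y). ennreal (k (x - y)) * ennreal (norm (g' y))) \<in> borel_measurable borel"
      by (simp add: borel_prod)
  qed
  also have "\<dots> = (\<integral>\<^sup>+y. ennreal (norm (g' y)) \<partial>lebesgue)"
  proof (intro nn_integral_cong)
    fix y
    have "(\<integral>\<^sup>+x. ennreal (k (x - y)) * ennreal (norm (g' y)) \<partial>lebesgue) =
      (\<integral>\<^sup>+x. ennreal (k (x - y)) \<partial>lebesgue) * ennreal (norm (g' y))"
      by (rule nn_integral_multc) (intro borel_imp_lebesgue, measurable)
    also have "(\<integral>\<^sup>+x. ennreal (k (x - y)) \<partial>lebesgue) =
      (\<integral>\<^sup>+x. ennreal (k x) \<partial>lebesgue)"
      by (rule nn_integral_translate) measurable
    also have "\<dots> = 1" using k by (subst nn_integral_eq_integral) (auto intro: C0_infinity_integrable)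
    finally show "(\<integral>\<^sup>+x. ennreal (k (x - y)) * ennreal (norm (g' y)) \<partial>lebesgue) =
      ennreal (norm (g' y))" by simp
  qed
  also have "\<dots> = (\<integral>\<^sup>+y. ennreal (norm (g y)) \<partial>lebesgue)"
    using g'(2) by (intro nn_integral_cong_AE) auto
  finally show ?thesis .
qed

section \<open>Approximation in L1 by compactly supported continuous functions\<close>

lemma integrable_approx_truncation:
  fixes g :: "'a::euclidean_space \<Rightarrow> 'b::euclidean_space"
  assumes g: "integrable lebesgue g" and e: "0 < e"
  obtains n :: nat where "0 < n"
    "(LINT x|lebesgue. norm (g x - (if norm x \<le> real n \<and> norm (g x) \<le> real n then g x else 0))) < e"
proof -
  let ?t = "\<lambda>n x. if norm x \<le> real n \<and> norm (g x) \<le> real n then g x else 0"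
  have [measurable]: "g \<in> borel_measurable lebesgue" using g by auto
  have [measurable]: "(\<lambda>x::'a. norm x) \<in> borel_measurable lebesgue"
    by (intro borel_imp_lebesgue) measurable
  have "(\<lambda>n. LINT x|lebesgue. norm (g x - ?t n x)) \<longlonglongrightarrow> (LINT x|(lebesgue :: 'a
    measure). 0)"
  proof (rule integral_dominated_convergence[where w = "\<lambda>x. norm (g x)"])
    show "(\<lambda>x. norm (g x - ?t n x)) \<in> borel_measurable lebesgue" for n by measurable
    show "AE x in lebesgue. (\<lambda>n. norm (g x - ?t n x)) \<longlonglongrightarrow> 0"
    proof (intro AE_I2 tendsto_eventually)
      fix x
      obtain N :: nat where N: "max (norm x) (norm (g x)) \<le> real N" using real_arch_simple by blast
      show "\<forall>\<^sub>F n in sequentially. norm (g x - ?t n x) = 0"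
        using eventually_ge_at_top[of N] by eventually_elim (use N in auto)
    qed
  qed (use g in auto)
  then have "\<forall>\<^sub>F n in sequentially. (LINT x|lebesgue. norm (g x - ?t n x)) < e"
    using e by (auto dest: order_tendstoD(2))
  then have "\<forall>\<^sub>F n in sequentially. 0 < n \<and> (LINT x|lebesgue. norm (g x - ?t n x)) < e"
    using eventually_gt_at_top[of "0::nat"] by eventually_elim auto
  then show ?thesis using that by (auto simp: eventually_sequentially)
qed

lemma integrable_approx_continuous:
  fixes g :: "'a::euclidean_space \<Rightarrow> 'b::euclidean_space"
  assumes g: "integrable lebesgue g" and e: "0 < e"
  obtains \<phi> R where "continuous_on UNIV \<phi>" "0 < R" "\<And>x. x \<notin> ball 0 R \<Longrightarrow>
    \<phi> x = 0"
    "(LINT x|lebesgue. norm (g x - \<phi> x)) < e"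
proof -
  obtain n where n: "0 < n" "(LINT x|lebesgue. norm (g x - (if norm x \<le> real n \<and> norm (g x) \<le>
    real n then g x else 0))) < e / 2"
    using integrable_approx_truncation[OF g, of "e / 2"] e by auto
  define t where "t x = (if norm x \<le> real n \<and> norm (g x) \<le> real n then g x else 0)" for x
  have [measurable]: "g \<in> borel_measurable lebesgue" using g by auto
  have [measurable]: "(\<lambda>x::'a. norm x) \<in> borel_measurable lebesgue"
    by (intro borel_imp_lebesgue) measurable
  have tm [measurable]: "t \<in> borel_measurable lebesgue" unfolding t_def[abs_def] by measurable
  have ti: "integrable lebesgue t"
    by (rule Bochner_Integration.integrable_bound[OF g]) (auto simp: t_def)
  \<comment> \<open>This form of measurability supplies continuous functions that converge to
    \<open>t\<close> off a negligible set, but without any domination; \<open>\<theta>\<close> and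
    the projection in \<open>\<phi>\<close> provide it.\<close>
  have "t measurable_on UNIV"
    using tm by (intro lebesgue_measurable_imp_measurable_on) auto
  then obtain N \<psi> where \<psi>: "negligible N" "\<And>k. continuous_on UNIV (\<psi> k)" "\<And>x. x \<notin> N
    \<Longrightarrow> (\<lambda>k. \<psi> k x) \<longlonglongrightarrow> t x"
    unfolding measurable_on_def by auto
  \<comment> \<open>Two continuous corrections that do not change the limit: the projection onto
    \<open>cball 0 (real n)\<close>, where \<open>t\<close> takes its values, bounds the range, and
    \<open>\<theta>\<close> is 1 wherever \<open>t\<close> can be non-zero and vanishes from radius
    \<open>n + 1\<close> on.\<close>
  define \<theta> where "\<theta> x = max 0 (min 1 (real n + 1 - norm x))" for x :: 'a
  define \<phi> where "\<phi> k x = \<theta> x *\<^sub>R closest_point (cball 0 (real n)) (\<psi> k x)" for k x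
  have cl: "continuous_on UNIV (closest_point (cball (0::'b) (real n)))"
    by (intro continuous_on_closest_point) auto
  have \<phi>c: "continuous_on UNIV (\<phi> k)" for k
    unfolding \<phi>_def \<theta>_def
    by (intro continuous_intros continuous_on_compose2[OF cl] \<psi>) auto
  have [measurable]: "\<phi> k \<in> borel_measurable lebesgue" for k by (intro continuous_imp_lebesgue \<phi>c)
  have cb: "norm (closest_point (cball 0 (real n)) y) \<le> real n" for y :: 'b
    using closest_point_in_set[of "cball (0::'b) (real n)" y] by simp
  have \<theta>b: "0 \<le> \<theta> x" "\<theta> x \<le> 1" for x by (auto simp: \<theta>_def)
  have \<phi>0: "\<phi> k x = 0" if "x \<notin> ball 0 (real n + 1)" for k x
    using that by (auto simp: \<phi>_def \<theta>_def)
  have "(\<lambda>k. LINT x|lebesgue. norm (t x - \<phi> k x)) \<longlonglongrightarrow> (LINT x|(lebesgue :: 'a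
    measure). 0)"
  proof (rule integral_dominated_convergence[where w =
    "\<lambda>x. norm (t x) + real n * indicator (ball 0 (real n + 1)) x"])
    show "integrable lebesgue (\<lambda>x. norm (t x) + real n * indicator (ball 0 (real n + 1)) x)"
      using ti by (intro Bochner_Integration.integrable_add integrable_norm integrable_mult_right
        integrable_real_indicator)
        (auto intro!: emeasure_bounded_finite[unfolded infinity_ennreal_def])
    show "AE x in lebesgue. (\<lambda>k. norm (t x - \<phi> k x)) \<longlonglongrightarrow> 0"
    proof -
      have "(\<lambda>k. norm (t x - \<phi> k x)) \<longlonglongrightarrow> 0" if x: "x \<notin> N" for x
      proof -
        have "(\<lambda>k. closest_point (cball 0 (real n)) (\<psi> k x)) \<longlonglongrightarrow> closest_point
          (cball 0 (real n)) (t x)"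
          by (rule continuous_on_tendsto_compose[OF cl \<psi>(3)[OF x]]) auto
        also have "closest_point (cball 0 (real n)) (t x) = t x"
          by (intro closest_point_self) (auto simp: t_def)
        finally have "(\<lambda>k. \<theta> x *\<^sub>R closest_point (cball 0 (real n)) (\<psi> k x))
          \<longlonglongrightarrow> \<theta> x *\<^sub>R t x"
          by (intro tendsto_intros)
        moreover have "\<theta> x *\<^sub>R t x = t x" by (auto simp: \<theta>_def t_def)
        ultimately have "(\<lambda>k. \<phi> k x) \<longlonglongrightarrow> t x" by (simp add: \<phi>_def)
        then have "(\<lambda>k. norm (t x - \<phi> k x)) \<longlonglongrightarrow> norm (t x - t x)"
          by (intro tendsto_intros)
        then show ?thesis by simp
      qed
      moreover have "AE x in lebesgue. x \<notin> N"
        using \<psi>(1) by (simp add: negligible_iff_null_sets AE_not_in)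
      ultimately show ?thesis by (auto elim!: eventually_mono)
    qed
    show "AE x in lebesgue. norm (norm (t x - \<phi> k x)) \<le>
      norm (t x) + real n * indicator (ball 0 (real n + 1)) x" for k
    proof (intro AE_I2)
      fix x
      have "norm (\<phi> k x) \<le> real n * indicator (ball 0 (real n + 1)) x"
        using \<phi>0[of x k] cb[of "\<psi> k x"] \<theta>b[of x] mult_mono[of "\<theta> x" 1 "norm (closest_point
          (cball 0 (real n)) (\<psi> k x))" "real n"]
        by (cases "x \<in> ball 0 (real n + 1)") (auto simp: \<phi>_def)
      then show "norm (norm (t x - \<phi> k x)) \<le> norm (t x) + real n * indicator (ball 0 (real n + 1)) x"
        using norm_triangle_ineq4[of "t x" "\<phi> k x"] by simp
    qed
  qed (auto; measurable)+
  from order_tendstoD(2)[OF this, of "e / 2"]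
  have "\<forall>\<^sub>F k in sequentially. (LINT x|lebesgue. norm (t x - \<phi> k x)) < e / 2"
    using e by simp
  then obtain k where k: "(LINT x|lebesgue. norm (t x - \<phi> k x)) < e / 2"
    by (auto simp: eventually_sequentially)
  have \<phi>i: "integrable lebesgue (\<phi> k)"
    by (rule integrable_compact_support[OF \<phi>c, of "cball 0 (real n + 1)"]) (auto intro!: \<phi>0)
  have "(LINT x|lebesgue. norm (g x - \<phi> k x)) \<le> (LINT x|lebesgue. norm (g x - t x) +
    norm (t x - \<phi> k x))"
  proof (intro integral_mono)
    show "norm (g x - \<phi> k x) \<le> norm (g x - t x) + norm (t x - \<phi> k x)" for x
      using norm_triangle_ineq[of "g x - t x" "t x - \<phi> k x"] by simp
  qed (use g ti \<phi>i in auto)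
  also have "\<dots> = (LINT x|lebesgue. norm (g x - t x)) + (LINT x|lebesgue. norm (t x - \<phi> k x))"
    using g ti \<phi>i by simp
  also have "\<dots> < e" using n(2) k by (simp add: t_def)
  finally show ?thesis using \<phi>c \<phi>0 that[of "\<phi> k" "real n + 1"] by auto
qed

section \<open>Uniform and L1 convergence of mollifications\<close>

lemma fun_conv_diff:
  fixes g :: "'a::euclidean_space \<Rightarrow> 'b::euclidean_space"
  assumes "k \<in> C0_infinity G" "integrable lebesgue f" "integrable lebesgue g"
  shows "fun_conv k (\<lambda>y. f y - g y) x = fun_conv k f x - fun_conv k g x"
  unfolding fun_conv_def using integrable_conv[OF assms(1,2)] integrable_conv[OF assms(1,3)]
  by (simp add: scaleR_diff_right)

lemma mollifier_reflect_integral: "0 < h \<Longrightarrow> (LINT y|lebesgue. mollifier h (x - y)) = 1"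
  by (simp add: integral_reflect mollifier_integral borel_measurable_continuous_onI C0_infinity_continuous[OF
    mollifier_C0_infinity])

text \<open>The kernel is non-negative with integral 1, so the mollification is a mean of nearby
  values. The vector \<open>c\<close> is arbitrary on purpose: \<open>c = \<phi> x\<close> gives
  convergence, \<open>c = 0\<close> gives supremum bounds and locates the support.\<close>

lemma mollifier_conv_minus_le:
  fixes \<phi> :: "'a::euclidean_space \<Rightarrow> 'b::euclidean_space"
  assumes h: "0 < h" and i: "integrable lebesgue \<phi>"
    and e: "\<And>y. y \<in> ball x h \<Longrightarrow> norm (\<phi> y - c) \<le> e"
  shows "norm (fun_conv (mollifier h) \<phi> x - c) \<le> e"
proof -
  have mi: "integrable lebesgue (\<lambda>y. mollifier h (x - y))"
    using mollifier_reflect_C0_infinity[of h x UNIV] h by (intro C0_infinity_integrable) auto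
  have "fun_conv (mollifier h) \<phi> x - c = (LINT y|lebesgue. mollifier h (x - y) *\<^sub>R \<phi> y) - (LINT
    y|lebesgue. mollifier h (x - y) *\<^sub>R c)"
    unfolding fun_conv_def using mi by (simp add: mollifier_reflect_integral[OF h])
  also have "\<dots> = (LINT y|lebesgue. mollifier h (x - y) *\<^sub>R (\<phi> y - c))"
    using integrable_conv[OF mollifier_C0_infinity[OF h] i, of x] mi by (simp add: scaleR_diff_right)
  also have "norm \<dots> \<le> (LINT y|lebesgue. mollifier h (x - y) * e)"
  proof (rule Bochner_Integration.integral_norm_bound[THEN order_trans], rule integral_mono)
    show "integrable lebesgue (\<lambda>y. norm (mollifier h (x - y) *\<^sub>R (\<phi> y - c)))"
      using integrable_conv[OF mollifier_C0_infinity[OF h] i, of x] mi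
        by (intro integrable_norm) (simp add: scaleR_diff_right)
    show "norm (mollifier h (x - y) *\<^sub>R (\<phi> y - c)) \<le> mollifier h (x - y) * e" for y
    proof (cases "y \<in> ball x h")
      case True
      then show ?thesis using e mollifier_nonneg[OF h, of "x - y"] by (auto intro: mult_left_mono)
    next
      case False
      then have "mollifier h (x - y) = 0" by (intro mollifier_eq_0 h) (simp add: dist_norm)
      then show ?thesis by simp
    qed
  qed (use mi in simp)
  also have "\<dots> = e" using mi by (simp add: mollifier_reflect_integral[OF h])
  finally show ?thesis .
qed

lemma mollifier_uniform:
  fixes \<phi> :: "'a::euclidean_space \<Rightarrow> 'b::euclidean_space"
  assumes c: "continuous_on UNIV \<phi>" and R: "\<And>x. x \<notin> ball 0 R \<Longrightarrow> \<phi> x = 0"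
    and e: "0 < e"
  obtains d where "0 < d" "d \<le> 1" "\<And>h x. 0 < h \<Longrightarrow> h < d \<Longrightarrow>
    norm (fun_conv (mollifier h) \<phi> x - \<phi> x) \<le> e"
    "\<And>h x. 0 < h \<Longrightarrow> h < d \<Longrightarrow> x \<notin> ball 0 (R + 1) \<Longrightarrow>
      fun_conv (mollifier h) \<phi> x - \<phi> x = 0"
proof -
  have i: "integrable lebesgue \<phi>"
    by (rule integrable_compact_support[OF c, of "cball 0 R"]) (auto intro!: R)
  \<comment> \<open>The radius leaves room for \<open>x\<close> in \<open>ball 0 (R + 1)\<close> and
    \<open>y\<close> within distance 1 of it; farther out both values are 0.\<close>
  have "uniformly_continuous_on (cball 0 (R + 2)) \<phi>"
    using c by (intro compact_uniformly_continuous) (auto intro: continuous_on_subset)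
  then obtain d where d: "0 < d" "\<And>x y. x \<in> cball 0 (R + 2) \<Longrightarrow>
    y \<in> cball 0 (R + 2) \<Longrightarrow> dist y x < d \<Longrightarrow> dist (\<phi> y) (\<phi> x) < e"
    using e unfolding uniformly_continuous_on_def by metis
  have far: "\<phi> y = 0" if "x \<notin> ball 0 (R + 1)" "dist x y < 1" for x y
  proof (rule R)
    have "norm x \<le> norm y + dist x y" using norm_triangle_sub[of x y] by (simp add: dist_norm)
    then show "y \<notin> ball 0 R" using that by simp
  qed
  show ?thesis
  proof (rule that[of "min d 1"])
    fix h x assume h: "0 < h" "h < min d 1"
    show "norm (fun_conv (mollifier h) \<phi> x - \<phi> x) \<le> e"
    proof (rule mollifier_conv_minus_le[OF h(1) i])
      fix y assume y: "y \<in> ball x h"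
      show "norm (\<phi> y - \<phi> x) \<le> e"
      proof (cases "x \<in> ball 0 (R + 1)")
        case True
        have "norm y \<le> norm x + dist x y" using norm_triangle_sub[of y x]
          by (simp add: dist_norm norm_minus_commute)
        then show ?thesis using d(2)[of x y] y h True by (simp add: dist_norm norm_minus_commute)
      next
        case False
        then show ?thesis using far[of x y] far[of x x] y h e by simp
      qed
    qed
    assume x: "x \<notin> ball 0 (R + 1)"
    have "norm (fun_conv (mollifier h) \<phi> x - 0) \<le> 0"
      by (rule mollifier_conv_minus_le[OF h(1) i]) (use far[OF x] h in simp)
    then show "fun_conv (mollifier h) \<phi> x - \<phi> x = 0" using far[OF x, of x] by simp
  qed (use d in auto)
qed

lemma mollifier_tendsto_L1:
  fixes g :: "'a::euclidean_space \<Rightarrow> 'b::euclidean_space"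
  assumes g: "integrable lebesgue g" and e: "0 < e"
  obtains d where "0 < d" "\<And>h. 0 < h \<Longrightarrow> h < d \<Longrightarrow>
    (\<integral>\<^sup>+x. ennreal (norm (fun_conv (mollifier h) g x - g x)) \<partial>lebesgue) \<le> ennreal e"
proof -
  obtain \<phi> R where \<phi>: "continuous_on UNIV \<phi>" "0 < R" "\<And>x. x \<notin> ball 0 R \<Longrightarrow>
    \<phi> x = 0"
    "(LINT x|lebesgue. norm (g x - \<phi> x)) < e / 3"
    using integrable_approx_continuous[OF g, of "e / 3"] e by auto
  have \<phi>i: "integrable lebesgue \<phi>"
    by (rule integrable_compact_support[OF \<phi>(1), of "cball 0 R"]) (auto intro!: \<phi>)
  \<comment> \<open>The volume of the ball outside of which the error for \<open>\<phi>\<close>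
    vanishes; it turns the uniform error \<open>e / 3 / V\<close> into the L1 error
    \<open>e / 3\<close>.\<close>
  define V where "V = unit_ball_vol (real DIM('a)) * (R + 1) ^ DIM('a)"
  have V: "0 < V" using \<phi>(2) by (simp add: V_def)
  obtain d where d: "0 < d" "d \<le> 1" "\<And>h x. 0 < h \<Longrightarrow> h < d \<Longrightarrow>
    norm (fun_conv (mollifier h) \<phi> x - \<phi> x) \<le> e / 3 / V"
    "\<And>h x. 0 < h \<Longrightarrow> h < d \<Longrightarrow> x \<notin> ball 0 (R + 1) \<Longrightarrow>
      fun_conv (mollifier h) \<phi> x - \<phi> x = 0"
    using mollifier_uniform[OF \<phi>(1,3), of R "e / 3 / V"] e V by auto
  show ?thesis
  proof (rule that[OF d(1)])
    fix h assume h: "0 < h" "h < d"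
    let ?K = "mollifier h :: 'a \<Rightarrow> real"
    have K: "?K \<in> C0_infinity UNIV" using mollifier_C0_infinity[OF h(1)] .
    have dm: "integrable lebesgue (\<lambda>x. g x - \<phi> x)" using g \<phi>i by simp
    have [measurable]: "g \<in> borel_measurable lebesgue" "\<phi> \<in> borel_measurable lebesgue"
      using g \<phi>i by auto
    have [measurable]: "fun_conv ?K f \<in> borel_measurable lebesgue" if "integrable lebesgue f" for f :: "'a
      \<Rightarrow> 'b"
      using smooth_on_continuous[OF smooth_on_fun_conv[OF K that]] by (rule continuous_imp_lebesgue)
    note m [measurable] = this[OF dm] this[OF \<phi>i]
    have "(\<integral>\<^sup>+x. ennreal (norm (fun_conv ?K g x - g x)) \<partial>lebesgue) \<le>
      (\<integral>\<^sup>+x. ennreal (norm (fun_conv ?K (\<lambda>x. g x - \<phi> x) x)) +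
        (ennreal (norm (fun_conv ?K \<phi> x - \<phi> x)) + ennreal (norm (g x - \<phi> x))) \<partial>lebesgue)"
    proof (intro nn_integral_mono)
      fix x
      have "fun_conv ?K g x - g x = fun_conv ?K (\<lambda>x. g x - \<phi> x) x +
        ((fun_conv ?K \<phi> x - \<phi> x) - (g x - \<phi> x))"
        by (simp add: fun_conv_diff[OF K g \<phi>i])
      also have "norm \<dots> \<le> norm (fun_conv ?K (\<lambda>x. g x - \<phi> x) x) +
        (norm (fun_conv ?K \<phi> x - \<phi> x) + norm (g x - \<phi> x))"
        by (meson add_left_mono norm_triangle_ineq norm_triangle_ineq4 order_trans)
      finally show "ennreal (norm (fun_conv ?K g x - g x)) \<le>
        ennreal (norm (fun_conv ?K (\<lambda>x. g x - \<phi> x) x)) +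
        (ennreal (norm (fun_conv ?K \<phi> x - \<phi> x)) + ennreal (norm (g x - \<phi> x)))"
        by (simp add: ennreal_plus[symmetric] ennreal_leI del: ennreal_plus)
    qed
    also have "\<dots> = (\<integral>\<^sup>+x. ennreal (norm (fun_conv ?K (\<lambda>x. g x - \<phi> x) x))
      \<partial>lebesgue) +
        ((\<integral>\<^sup>+x. ennreal (norm (fun_conv ?K \<phi> x - \<phi> x)) \<partial>lebesgue) +
          (\<integral>\<^sup>+x. ennreal (norm (g x - \<phi> x)) \<partial>lebesgue))"
      by (subst nn_integral_add; (subst nn_integral_add)?; measurable?) simp?
    also have "\<dots> \<le> ennreal (e / 3) + (ennreal (e / 3) + ennreal (e / 3))"
    proof (intro add_mono)
      have n: "(\<integral>\<^sup>+x. ennreal (norm (g x - \<phi> x)) \<partial>lebesgue) =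
        ennreal (LINT x|lebesgue. norm (g x - \<phi> x))"
        using dm by (intro nn_integral_eq_integral) auto
      then show "(\<integral>\<^sup>+x. ennreal (norm (g x - \<phi> x)) \<partial>lebesgue) \<le> ennreal (e / 3)"
        using \<phi>(4) by (simp add: ennreal_leI)
      moreover have "(\<integral>\<^sup>+x. ennreal (norm (fun_conv ?K (\<lambda>x. g x - \<phi> x) x))
        \<partial>lebesgue) \<le> (\<integral>\<^sup>+x. ennreal (norm (g x - \<phi> x)) \<partial>lebesgue)"
        by (rule fun_conv_L1_le[OF mollifier_nonneg[OF h(1)] K mollifier_integral[OF h(1)]]) measurable
      ultimately show "(\<integral>\<^sup>+x. ennreal (norm (fun_conv ?K (\<lambda>x. g x - \<phi> x) x))
        \<partial>lebesgue) \<le> ennreal (e / 3)" by (rule order_trans[rotated])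
      have "(\<integral>\<^sup>+x. ennreal (norm (fun_conv ?K \<phi> x - \<phi> x)) \<partial>lebesgue) \<le>
        (\<integral>\<^sup>+x. ennreal (e / 3 / V) * indicator (ball 0 (R + 1)) x \<partial>(lebesgue :: 'a measure))"
        using d(3,4)[OF h] by (intro nn_integral_mono) (auto simp: indicator_def intro!: ennreal_leI)
      also have "\<dots> = ennreal (e / 3 / V) * ennreal V"
        using emeasure_ball[of "R + 1" "0::'a"] \<phi>(2) by (subst nn_integral_cmult_indicator) (auto simp: V_def)
      also have "\<dots> = ennreal (e / 3)" using V e by (simp add: ennreal_mult[symmetric])
      finally show "(\<integral>\<^sup>+x. ennreal (norm (fun_conv ?K \<phi> x - \<phi> x)) \<partial>lebesgue) \<le>
        ennreal (e / 3)" .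
    qed
    also have "\<dots> = ennreal e" using e by (simp add: ennreal_plus[symmetric] del: ennreal_plus)
    finally show "(\<integral>\<^sup>+x. ennreal (norm (fun_conv ?K g x - g x)) \<partial>lebesgue) \<le> ennreal e" .
  qed
qed

text \<open>Countably many test functions suffice, which is needed to pass to almost every time
  slice.\<close>

lemma mollifier_tests_imp_AE_0:
  fixes g :: "'a::euclidean_space \<Rightarrow> 'b::euclidean_space"
  assumes G: "open G" and g: "loc_integrable G g"
    and D: "\<And>X::'a set. open X \<Longrightarrow> X \<noteq> {} \<Longrightarrow>
      \<exists>d\<in>D. d \<in> X" "countable D"
    and test: "\<And>a n. a \<in> D \<Longrightarrow> cball a (1 / real (Suc n)) \<subseteq> G \<Longrightarrow>
      (LINT x|lebesgue_on G. mollifier (1 / real (Suc n)) (a - x) *\<^sub>R g x) = 0"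
  shows "AE x in lebesgue_on G. g x = 0"
proof -
  have loc: "AE x in lebesgue. x \<in> ball a (1 / real (Suc m)) \<longrightarrow> g x = 0"
    if a: "a \<in> D" and am: "cball a (2 / real (Suc m)) \<subseteq> G" for a m
  proof -
    \<comment> \<open>The mollification is examined at points of the ball of radius
      \<open>\<rho>\<close>. Doubling the radius for \<open>K\<close> ensures that mollifiers of
      radius below \<open>\<rho>\<close> about such points see only places where \<open>g'\<close>
      agrees with \<open>g\<close>.\<close>
    define \<rho> where "\<rho> = 1 / real (Suc m)"
    have \<rho>: "0 < \<rho>" by (simp add: \<rho>_def)
    define K where "K = cball a (2 * \<rho>)"
    have K: "compact K" "K \<subseteq> G" using am by (auto simp: K_def \<rho>_def)
    define g' where "g' x = indicator K x *\<^sub>R g x" for x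
    have g': "integrable lebesgue g'"
      using g K unfolding loc_integrable_def g'_def
      by (subst integrable_restrict_space[symmetric]) (auto intro: lmeasurable_compact fmeasurableD)
    \<comment> \<open>The mollification of \<open>g'\<close> is continuous and, by the tests, zero
      at the points of the dense set \<open>D\<close> in the ball; hence it is zero on the whole
      ball.\<close>
    have conv0: "fun_conv (mollifier (1 / real (Suc n))) g' x = 0" if n: "1 / real (Suc n) < \<rho>"
      and x: "x \<in> ball a \<rho>" for n x
    proof -
      let ?h = "1 / real (Suc n)"
      let ?c = "fun_conv (mollifier ?h) g'"
      have c: "continuous_on UNIV ?c"
        using smooth_on_continuous[OF smooth_on_fun_conv[OF mollifier_C0_infinity g']] by simp
      have d0: "?c b = 0" if b: "b \<in> D" "b \<in> ball a \<rho>" for b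
      proof -
        have bK: "cball b ?h \<subseteq> K"
        proof
          fix y assume "y \<in> cball b ?h"
          then show "y \<in> K" using b n dist_triangle[of a y b] by (simp add: K_def)
        qed
        have "0 = (LINT x|lebesgue_on G. mollifier ?h (b - x) *\<^sub>R g x)"
          using test[OF b(1), of n] bK K by auto
        also have "\<dots> = (LINT x|lebesgue. indicator G x *\<^sub>R (mollifier ?h (b - x) *\<^sub>R g x))"
          using G by (intro integral_restrict_space) auto
        also have "\<dots> = ?c b"
          unfolding fun_conv_def
        proof (intro Bochner_Integration.integral_cong refl)
          fix y
          show "indicator G y *\<^sub>R (mollifier ?h (b - y) *\<^sub>R g y) = mollifier ?h (b - y) *\<^sub>R g' y"
          proof (cases "y \<in> cball b ?h")
            case True
            then have "y \<in> K" "y \<in> G" using bK K(2) by blast+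
            then show ?thesis by (simp add: g'_def)
          next
            case False
            then have "mollifier ?h (b - y) = 0" by (intro mollifier_eq_0) (auto simp: dist_norm)
            then show ?thesis by simp
          qed
        qed
        finally show ?thesis by simp
      qed
      show ?thesis
      proof (rule ccontr)
        assume "?c x \<noteq> 0"
        moreover have "open (?c -` (- {0}))"
          using c by (intro open_vimage) auto
        ultimately have "open (?c -` (- {0}) \<inter> ball a \<rho>)" "?c -` (- {0}) \<inter> ball a \<rho> \<noteq>
          {}"
          using x by auto
        from D(1)[OF this] d0 show False by auto
      qed
    qed
    have m: "g' \<in> borel_measurable lebesgue" using g' by auto
    \<comment> \<open>Where the mollification vanishes, its error is \<open>g'\<close> itself; so
      the L1 error dominates the integral of \<open>norm (g' x)\<close> over the ball.\<close>
    have le: "ball_integral g' a \<rho> \<le> ennreal e" if e: "0 < e" for e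
    proof -
      obtain d where d: "0 < d" "\<And>h. 0 < h \<Longrightarrow> h < d \<Longrightarrow>
        (\<integral>\<^sup>+x. ennreal (norm (fun_conv (mollifier h) g' x - g' x)) \<partial>lebesgue) \<le>
        ennreal e"
        using mollifier_tendsto_L1[OF g' e] by blast
      obtain n where n: "1 / real (Suc n) < min d \<rho>"
        using reals_Archimedean[of "min d \<rho>"] d \<rho> by (auto simp: inverse_eq_divide)
      have "ball_integral g' a \<rho> \<le>
          (\<integral>\<^sup>+x. ennreal (norm (fun_conv (mollifier (1 / real (Suc n))) g' x - g' x))
            \<partial>lebesgue)"
      proof (intro nn_integral_mono)
        fix x
        show "ennreal (norm (g' x)) * indicator (ball a \<rho>) x \<le>
          ennreal (norm (fun_conv (mollifier (1 / real (Suc n))) g' x - g' x))"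
          using conv0[of n x] n by (cases "x \<in> ball a \<rho>") auto
      qed
      also have "\<dots> \<le> ennreal e" using n by (intro d) auto
      finally show ?thesis .
    qed
    have "ball_integral g' a \<rho> \<le> 0"
      by (rule ennreal_le_epsilon) (use le in simp)
    then have z: "ball_integral g' a \<rho> = 0"
      by (rule order_antisym) (rule zero_le)
    have "(\<lambda>x. ennreal (norm (g' x)) * indicator (ball a \<rho>) x) \<in> borel_measurable lebesgue"
      using m by measurable
    from nn_integral_0_iff_AE[OF this] z
    have "AE x in lebesgue. ennreal (norm (g' x)) * indicator (ball a \<rho>) x = 0" by (rule iffD1)
    then show ?thesis
    proof eventually_elim
      case (elim x)
      show ?case
      proof
        assume x: "x \<in> ball a (1 / real (Suc m))"
        then have "dist a x < \<rho>" by (simp add: \<rho>_def)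
        then have "x \<in> K" using \<rho> by (simp add: K_def)
        then show "g x = 0" using elim x by (simp add: g'_def \<rho>_def)
      qed
    qed
  qed
  have "AE x in lebesgue. \<forall>a\<in>D. \<forall>m. cball a (2 / real (Suc m)) \<subseteq> G \<longrightarrow> x
    \<in> ball a (1 / real (Suc m)) \<longrightarrow> g x = 0"
  proof -
    have "AE x in lebesgue. cball a (2 / real (Suc m)) \<subseteq> G \<longrightarrow> x \<in> ball a (1 / real (Suc
      m)) \<longrightarrow> g x = 0" if "a \<in> D" for a m
      using loc[OF that, of m] by (cases "cball a (2 / real (Suc m)) \<subseteq> G") auto
    then show ?thesis unfolding AE_ball_countable[OF D(2)] AE_all_countable by blast
  qed
  then have "AE x in lebesgue. x \<in> G \<longrightarrow> g x = 0"
  proof eventually_elim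
    case (elim x)
    show ?case
    proof
      assume "x \<in> G"
      then obtain e where e: "0 < e" "ball x e \<subseteq> G" using G open_contains_ball by blast
      obtain m where m: "1 / real (Suc m) < e / 4"
        using reals_Archimedean[of "e / 4"] e by (auto simp: inverse_eq_divide)
      obtain a where a: "a \<in> D" "a \<in> ball x (1 / real (Suc m))"
        using D(1)[of "ball x (1 / real (Suc m))"] by auto
      \<comment> \<open>The distance of \<open>a\<close> from \<open>x\<close> and the radius add up
        to less than \<open>3 / real (Suc m)\<close>, which is below \<open>e\<close> by the choice
        of \<open>m\<close>.\<close>
      have "cball a (2 / real (Suc m)) \<subseteq> ball x e"
      proof
        fix y assume "y \<in> cball a (2 / real (Suc m))"
        then have "dist x y < 1 / real (Suc m) + 2 / real (Suc m)"
          using a(2) dist_triangle[of x y a] by simp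
        also have "\<dots> = 3 * (1 / real (Suc m))" by (simp add: field_simps)
        also have "\<dots> < e" using m e by linarith
        finally show "y \<in> ball x e" by simp
      qed
      then have "cball a (2 / real (Suc m)) \<subseteq> G" using e by auto
      moreover have "x \<in> ball a (1 / real (Suc m))" using a(2) by (simp add: dist_commute)
      ultimately show "g x = 0" using elim a(1) by blast
    qed
  qed
  then show ?thesis using G by (subst AE_restrict_space_iff) auto
qed

section \<open>Time slices and the Riesz kernel\<close>

lemma AE_slices:
  fixes P :: "'a::euclidean_space \<times> 'b::euclidean_space \<Rightarrow> bool"
  assumes "AE z in lebesgue. P z"
  shows "AE s in lebesgue. AE y in lebesgue. P (s, y)"
proof -
  have "AE z in lborel. P z" using assms by (simp add: AE_completion_iff)
  then have "AE z in (lborel :: 'a measure) \<Otimes>\<^sub>M (lborel :: 'b measure). P z" by (simp only: lborel_prod)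
  from lborel_pair.AE_pair[OF this] show ?thesis by (simp add: AE_completion_iff)
qed

text \<open>Fubini for the completed measure. A Lebesgue measurable function may have non-measurable
  slices for a null set of parameters, hence the first claim holds for almost every \<open>s\<close>
  only.\<close>

lemma integral_slices:
  fixes f :: "'a::euclidean_space \<times> 'b::euclidean_space \<Rightarrow> 'c::euclidean_space"
  assumes f: "integrable lebesgue f"
  shows "AE s in lebesgue. integrable lebesgue (\<lambda>y. f (s, y))"
    "(LINT z|lebesgue. f z) = (LINT s|lebesgue. LINT y|lebesgue. f (s, y))"
    "integrable lebesgue (\<lambda>s. LINT y|lebesgue. f (s, y))"
proof -
  obtain f' where f': "f' \<in> borel_measurable borel" "AE z in lebesgue. f z = f' z"
    using lebesgue_borel_representative[of f] f by auto
  have "integrable lebesgue f'"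
    using integrable_cong_AE[of f lebesgue f'] f f' borel_imp_lebesgue[OF f'(1)] by auto
  then have f'i: "integrable (lborel \<Otimes>\<^sub>M lborel) f'"
    using integrable_completion[of f' lborel] f'(1) by (simp add: lborel_prod)
  have ae: "AE s in lebesgue. AE y in lebesgue. f' (s, y) = f (s, y)"
    using AE_slices[OF f'(2)] by (auto elim!: eventually_mono)
  have sm: "(\<lambda>y. f' (s, y)) \<in> borel_measurable borel" for s
    using f'(1) by measurable
  have 1: "AE s in lborel. integrable lborel (\<lambda>y. f' (s, y))"
    using lborel_pair.AE_integrable_fst'[OF f'i] .
  then have "AE s in lebesgue. integrable lebesgue (\<lambda>y. f' (s, y))"
    using sm by (simp add: AE_completion_iff integrable_completion)
  with ae show i1: "AE s in lebesgue. integrable lebesgue (\<lambda>y. f (s, y))"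
  proof eventually_elim
    case (elim s)
    have "(\<lambda>y. f (s, y)) \<in> borel_measurable lebesgue"
      using borel_measurable_AE[OF borel_imp_lebesgue[OF sm] elim(1)] .
    then show ?case
      using integrable_cong_AE[OF borel_imp_lebesgue[OF sm] _ elim(1)] elim(2) by blast
  qed
  have e: "AE s in lebesgue. (LINT y|lebesgue. f' (s, y)) = (LINT y|lebesgue. f (s, y))"
    using ae
  proof eventually_elim
    case (elim s)
    have "(\<lambda>y. f (s, y)) \<in> borel_measurable lebesgue"
      using borel_measurable_AE[OF borel_imp_lebesgue[OF sm] elim] .
    then show ?case using elim by (intro integral_cong_AE borel_imp_lebesgue[OF sm])
  qed
  have i3: "integrable lborel (\<lambda>s. LINT y|lborel. f' (s, y))"
    using lborel_pair.integrable_fst'[OF f'i] .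
  have i4: "integrable lebesgue (\<lambda>s. LINT y|lebesgue. f' (s, y))"
    using i3 sm by (simp add: integrable_completion integral_completion borel_measurable_integrable)
  have m: "(\<lambda>s. LINT y|lebesgue. f (s, y)) \<in> borel_measurable lebesgue"
    by (rule borel_measurable_AE[OF borel_measurable_integrable[OF i4] e])
  show "integrable lebesgue (\<lambda>s. LINT y|lebesgue. f (s, y))"
    using integrable_cong_AE[OF borel_measurable_integrable[OF i4] m e] i4 by blast
  have "(LINT z|lebesgue. f z) = (LINT z|lebesgue. f' z)"
    using f f' by (intro integral_cong_AE) (auto intro: borel_imp_lebesgue)
  also have "\<dots> = (LINT z|(lborel \<Otimes>\<^sub>M lborel). f' z)"
    using f' by (simp add: integral_completion lborel_prod)
  also have "\<dots> = (LINT s|lborel. LINT y|lborel. f' (s, y))"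
    using lborel_pair.integral_fst'[OF f'i] by simp
  also have "\<dots> = (LINT s|lebesgue. LINT y|lebesgue. f' (s, y))"
    using sm i3 by (simp add: integral_completion borel_measurable_integrable)
  also have "\<dots> = (LINT s|lebesgue. LINT y|lebesgue. f (s, y))"
    using i4 m e by (intro integral_cong_AE) auto
  finally show "(LINT z|lebesgue. f z) = (LINT s|lebesgue. LINT y|lebesgue. f (s, y))" .
qed

section \<open>Integrals of the Riesz kernel over balls\<close>

lemma dyadic_bracket:
  fixes a R :: real
  assumes "0 < a" "a < R"
  obtains k where "R / 2 ^ Suc k \<le> a" "a < R / 2 ^ k"
proof -
  obtain n where "(1 / 2) ^ n < a / R"
    using real_arch_pow_inv[of "a / R" "1 / 2"] assms by auto
  then have n: "R / 2 ^ n \<le> a" using assms by (simp add: power_one_over field_simps)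
  define m where "m = (LEAST n. R / 2 ^ n \<le> a)"
  have m: "R / 2 ^ m \<le> a" unfolding m_def by (rule LeastI[of "\<lambda>n. R / 2 ^ n \<le> a", OF n])
  have "m \<noteq> 0" using m assms by (intro notI) simp
  then obtain k where k: "m = Suc k" using not0_implies_Suc by blast
  have "\<not> R / 2 ^ k \<le> a"
    using not_less_Least[of k "\<lambda>n. R / 2 ^ n \<le> a"] k by (simp add: m_def)
  then show ?thesis using that[of k] m k by simp
qed

lemma ennreal_le_suminf: "f k \<le> (\<Sum>k. f k :: ennreal)"
  using sum_le_suminf[of f "{k}"] by (simp add: summableI)

text \<open>The left-hand side bounds the integral of the kernel over the shell between the radii
  \<open>R / 2 ^ Suc k\<close> and \<open>R / 2 ^ k\<close>: the value at the inner radius times the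
  volume of the outer ball. It decays geometrically because the powers \<open>1 - d\<close> and
  \<open>d\<close> of the radius add up to 1.\<close>

lemma dyadic_shell_eq:
  fixes R :: real
  assumes R: "0 < R"
  shows "(R / 2 ^ Suc k) powr (1 - real d) * (\<omega> * (R / 2 ^ k) ^ d) =
    \<omega> * 2 powr (real d - 1) * R * (1 / 2) ^ k"
proof -
  define S where "S = R / 2 ^ k"
  have S: "0 < S" using R by (simp add: S_def)
  have "(S / 2) powr (1 - real d) = S powr (1 - real d) / 2 powr (1 - real d)" by (rule powr_divide)
  moreover have "2 powr (real d - 1) = 1 / 2 powr (1 - real d)"
    using powr_minus_divide[of 2 "1 - real d"] by simp
  moreover have "S powr (1 - real d) * S powr real d = S"
    using S by (subst powr_add[symmetric]) simp
  moreover have "S ^ d = S powr real d" using S by (simp add: powr_realpow)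
  ultimately have "(S / 2) powr (1 - real d) * (\<omega> * S ^ d) = \<omega> * 2 powr (real d - 1) * S"
    by (simp add: mult.commute mult.left_commute)
  then show ?thesis by (simp add: S_def power_one_over mult.commute[of 2])
qed

text \<open>Sum over dyadic shells. Each shell is enlarged to the full outer ball, so that only
  volumes of balls enter.\<close>

lemma Riesz_kernel_bound:
  obtains C where "0 < C" "\<And>R (z :: 'a::euclidean_space). 0 < R \<Longrightarrow>
    (\<integral>\<^sup>+y. ennreal (norm (y - z) powr (1 - real DIM('a))) *
      indicator (ball z R) y \<partial>lebesgue) \<le> ennreal (C * R)"
proof -
  define d where "d = DIM('a)"
  have d: "1 \<le> real d" using DIM_ge_Suc0[where 'a='a] by (simp add: d_def)
  define \<omega> where "\<omega> = unit_ball_vol (real DIM('a))"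
  have \<omega>: "0 < \<omega>" by (simp add: \<omega>_def)
  define C where "C = \<omega> * 2 powr (real d - 1) * 2"
  show ?thesis
  proof (rule that)
    show "0 < C" using \<omega> by (simp add: C_def)
    fix R :: real and z :: 'a assume R: "0 < R"
    let ?f = "\<lambda>w::'a. ennreal (norm w powr (1 - real d)) * indicator (ball 0 R) w"
    let ?t = "\<lambda>k (w::'a). ennreal ((R / 2 ^ Suc k) powr (1 - real d)) * indicator (ball 0 (R / 2 ^ k)) w"
    have "(\<integral>\<^sup>+y. ennreal (norm (y - z) powr (1 - real DIM('a))) *
      indicator (ball z R) y \<partial>lebesgue) = (\<integral>\<^sup>+y. ?f (y - z) \<partial>lebesgue)"
      by (intro nn_integral_cong) (simp add: indicator_def dist_norm norm_minus_commute d_def)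
    also have "\<dots> = (\<integral>\<^sup>+w. ?f w \<partial>lebesgue)"
    proof (rule nn_integral_translate)
      have "(\<lambda>w::'a. ennreal (norm w powr (1 - real d))) \<in> borel_measurable borel" by measurable
      moreover have "(indicator (ball 0 R) :: 'a \<Rightarrow> ennreal) \<in> borel_measurable borel"
        by (rule borel_measurable_indicator) simp
      ultimately show "?f \<in> borel_measurable borel" by (rule borel_measurable_times_ennreal)
    qed
    also have "\<dots> \<le> (\<integral>\<^sup>+w. (\<Sum>k. ?t k w) \<partial>lebesgue)"
    proof (intro nn_integral_mono)
      fix w :: 'a
      show "?f w \<le> (\<Sum>k. ?t k w)"
      proof (cases "w \<noteq> 0 \<and> norm w < R")
        case True
        then obtain k where k: "R / 2 ^ Suc k \<le> norm w" "norm w < R / 2 ^ k"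
          using dyadic_bracket[of "norm w" R] by auto
        have "norm w powr (1 - real d) \<le> (R / 2 ^ Suc k) powr (1 - real d)"
          using k(1) R d by (intro powr_mono2') auto
        then have "?f w \<le> ?t k w" using k(2) True by (auto intro!: ennreal_leI)
        also have "\<dots> \<le> (\<Sum>k. ?t k w)"
          by (rule ennreal_le_suminf)
        finally show ?thesis .
      next
        case False
        \<comment> \<open>At the centre the kernel has the value 0 and not \<infinity>, since
          \<open>0 powr a = 0\<close> for every \<open>a\<close>.\<close>
        then have "?f w = 0" by (cases "w = 0") (simp_all add: indicator_def)
        then show ?thesis by (simp only: zero_le)
      qed
    qed
    also have "\<dots> = (\<Sum>k. \<integral>\<^sup>+w. ?t k w \<partial>lebesgue)"
      by (rule nn_integral_suminf) measurable
    also have "\<dots> = (\<Sum>k. ennreal (\<omega> * 2 powr (real d - 1) * R * (1 / 2) ^ k))"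
    proof (intro suminf_cong)
      fix k
      have "(\<integral>\<^sup>+w. ?t k w \<partial>lebesgue) =
        ennreal ((R / 2 ^ Suc k) powr (1 - real d)) * ennreal (\<omega> * (R / 2 ^ k) ^ d)"
        using emeasure_ball[of "R / 2 ^ k" "0::'a"] R
          by (subst nn_integral_cmult_indicator) (auto simp: \<omega>_def d_def)
      also have "\<dots> = ennreal ((R / 2 ^ Suc k) powr (1 - real d) * (\<omega> * (R / 2 ^ k) ^ d))"
        using \<omega> R by (intro ennreal_mult[symmetric]) auto
      also have "(R / 2 ^ Suc k) powr (1 - real d) * (\<omega> * (R / 2 ^ k) ^ d) =
        \<omega> * 2 powr (real d - 1) * R * (1 / 2) ^ k"
        by (rule dyadic_shell_eq[OF R])
      finally show "(\<integral>\<^sup>+w. ?t k w \<partial>lebesgue) =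
        ennreal (\<omega> * 2 powr (real d - 1) * R * (1 / 2) ^ k)" .
    qed
    also have "\<dots> = ennreal (C * R)"
    proof (rule suminf_ennreal_eq)
      have "(\<lambda>k. (1 / 2 :: real) ^ k) sums 2" using geometric_sums[of "1 / 2 :: real"] by simp
      from sums_mult[OF this, of "\<omega> * 2 powr (real d - 1) * R"]
      show "(\<lambda>k. \<omega> * 2 powr (real d - 1) * R * (1 / 2) ^ k) sums (C * R)"
        by (simp add: C_def mult_ac)
      show "0 \<le> \<omega> * 2 powr (real d - 1) * R * (1 / 2) ^ k" for k
        using \<omega> R by (intro mult_nonneg_nonneg) auto
    qed
    finally show "(\<integral>\<^sup>+y. ennreal (norm (y - z) powr (1 - real DIM('a))) *
      indicator (ball z R) y \<partial>lebesgue) \<le> ennreal (C * R)" .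
  qed
qed

section \<open>The distributional symmetric gradient\<close>

lemma sets_lebesgue_compact: "compact (K :: 'a::euclidean_space set) \<Longrightarrow> K \<in> sets lebesgue"
  by (blast intro: lmeasurable_compact fmeasurableD)

lemma sets_lebesgue_open: "open (G :: 'a::euclidean_space set) \<Longrightarrow> G \<in> sets lebesgue"
  by simp

lemma integrable_lebesgue_on_iff:
  fixes f :: "'a::euclidean_space \<Rightarrow> 'b::euclidean_space"
  shows "G \<in> sets lebesgue \<Longrightarrow> integrable (lebesgue_on G) f \<longleftrightarrow> integrable
    lebesgue (\<lambda>x. indicator G x *\<^sub>R f x)"
  by (subst integrable_restrict_space) auto

lemma integral_lebesgue_on_eq:
  fixes f :: "'a::euclidean_space \<Rightarrow> 'b::euclidean_space"
  shows "G \<in> sets lebesgue \<Longrightarrow> (LINT x|lebesgue_on G. f x) =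
    (LINT x|lebesgue. indicator G x *\<^sub>R f x)"
  by (subst integral_restrict_space) auto

lemma loc_integrable_continuous:
  fixes f :: "'a::euclidean_space \<Rightarrow> 'b::euclidean_space"
  assumes "continuous_on G f"
  shows "loc_integrable G f"
  unfolding loc_integrable_def
proof (intro allI impI)
  fix K assume K: "compact K \<and> K \<subseteq> G"
  then have "integrable lborel (\<lambda>x. indicator K x *\<^sub>R f x)"
    using assms by (intro borel_integrable_compact) (auto intro: continuous_on_subset)
  then have "integrable lebesgue (\<lambda>x. indicator K x *\<^sub>R f x)"
    using integrable_completion[of "\<lambda>x. indicator K x *\<^sub>R f x" lborel] borel_measurable_integrable
      by blast
  then show "integrable (lebesgue_on K) f"
    using K by (simp add: integrable_lebesgue_on_iff sets_lebesgue_compact)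
qed

lemma loc_integrable_integrable:
  fixes f :: "'a::euclidean_space \<Rightarrow> 'b::euclidean_space"
  assumes "integrable (lebesgue_on G) f" "G \<in> sets lebesgue"
  shows "loc_integrable G f"
  unfolding loc_integrable_def
proof (intro allI impI)
  fix K assume K: "compact K \<and> K \<subseteq> G"
  then have Ks: "K \<in> sets lebesgue" using sets_lebesgue_compact by blast
  have "integrable lebesgue (\<lambda>x. indicator G x *\<^sub>R f x)"
    using assms by (simp add: integrable_lebesgue_on_iff)
  from integrable_mult_indicator[OF Ks this]
  have "integrable lebesgue (\<lambda>x. indicator K x *\<^sub>R (indicator G x *\<^sub>R f x))" .
  moreover have "(\<lambda>x. indicator K x *\<^sub>R (indicator G x *\<^sub>R f x)) =
    (\<lambda>x. indicator K x *\<^sub>R f x)"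
    using K by (auto simp: fun_eq_iff indicator_def)
  ultimately show "integrable (lebesgue_on K) f"
    using Ks by (simp add: integrable_lebesgue_on_iff)
qed

lemma loc_integrable_diff: "loc_integrable G f \<Longrightarrow> loc_integrable G g \<Longrightarrow>
  loc_integrable G (\<lambda>x. f x - g x)"
  unfolding loc_integrable_def by simp

lemma loc_integrable_test:
  fixes f :: "'a::euclidean_space \<Rightarrow> 'b::euclidean_space" and \<phi> :: "'a \<Rightarrow> real"
  assumes G: "G \<in> sets lebesgue" and f: "loc_integrable G f" and \<phi>: "\<phi> \<in> C0_infinity G"
  shows "integrable (lebesgue_on G) (\<lambda>x. \<phi> x *\<^sub>R f x)"
proof -
  obtain K where K: "compact K" "K \<subseteq> G" "\<And>x. x \<notin> K \<Longrightarrow> \<phi> x = 0"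
    using \<phi> unfolding C0_infinity_iff by blast
  obtain B where B: "0 < B" "\<And>x. norm (\<phi> x) \<le> B" using C0_infinity_bounded[OF \<phi>] by blast
  have "integrable (lebesgue_on K) f" using f K unfolding loc_integrable_def by blast
  then have "integrable lebesgue (\<lambda>x. indicator K x *\<^sub>R f x)"
    using K by (simp add: integrable_lebesgue_on_iff sets_lebesgue_compact)
  from integrable_bounded_scaleR[OF this continuous_imp_lebesgue[OF C0_infinity_continuous[OF \<phi>]], of B]
  have "integrable lebesgue (\<lambda>x. \<phi> x *\<^sub>R (indicator K x *\<^sub>R f x))"
    using B by simp
  moreover have "(\<lambda>x. \<phi> x *\<^sub>R (indicator K x *\<^sub>R f x)) =
    (\<lambda>x. indicator G x *\<^sub>R (\<phi> x *\<^sub>R f x))"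
  proof
    fix x show "\<phi> x *\<^sub>R (indicator K x *\<^sub>R f x) = indicator G x *\<^sub>R (\<phi> x *\<^sub>R f x)"
      using K by (cases "x \<in> K") auto
  qed
  ultimately show ?thesis using G by (simp add: integrable_lebesgue_on_iff)
qed

lemma loc_integrable_test_comp:
  fixes u :: "'a::euclidean_space \<Rightarrow> real ^ 'd" and E :: "'a \<Rightarrow> real ^ 'd ^ 'd"
    and \<phi> :: "'a \<Rightarrow> real"
  assumes "G \<in> sets lebesgue" "\<phi> \<in> C0_infinity G"
  shows "loc_integrable G u \<Longrightarrow> integrable (lebesgue_on G) (\<lambda>x. u x $ i * \<phi> x)"
    and "loc_integrable G E \<Longrightarrow> integrable (lebesgue_on G) (\<lambda>x. E x $ i $ j * \<phi> x)"
    and "loc_integrable G u \<Longrightarrow> integrable (lebesgue_on G) (\<lambda>x. u x $ i *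
      frechet_derivative \<phi> (at x) v)"
proof -
  assume u: "loc_integrable G u"
  have *: "integrable (lebesgue_on G) (\<lambda>x. u x $ i *
    \<psi> x)" if "\<psi> \<in> C0_infinity G" for \<psi> :: "'a \<Rightarrow> real"
    using integrable_bounded_linear[OF bounded_linear_vec_nth loc_integrable_test[OF assms(1) u that], of i]
    by (simp add: mult.commute)
  show "integrable (lebesgue_on G) (\<lambda>x. u x $ i * \<phi> x)"
    "integrable (lebesgue_on G) (\<lambda>x. u x $ i * frechet_derivative \<phi> (at x) v)"
    using *[OF assms(2)] *[OF C0_infinity_frechet[OF assms(2)]] by auto
next
  assume E: "loc_integrable G E"
  show "integrable (lebesgue_on G) (\<lambda>x. E x $ i $ j * \<phi> x)"
    using integrable_bounded_linear[OF bounded_linear_vec_nth integrable_bounded_linear[OF bounded_linear_vec_nth[of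
      i] loc_integrable_test[OF assms(1) E assms(2)]], of j]
    by (simp add: mult.commute)
qed

lemma AE_eq_by_mollifier_tests:
  fixes E F :: "'a::euclidean_space \<Rightarrow> real ^ 'd ^ 'd"
  assumes G: "open G" and E: "loc_integrable G E" and F: "loc_integrable G F"
    and D: "\<And>X::'a set. open X \<Longrightarrow> X \<noteq> {} \<Longrightarrow>
      \<exists>d\<in>D. d \<in> X" "countable D"
    and test: "\<And>a n i j. a \<in> D \<Longrightarrow> cball a (1 / real (Suc n)) \<subseteq> G \<Longrightarrow>
      (LINT x|lebesgue_on G. E x $ i $ j * mollifier (1 / real (Suc n)) (a - x)) =
      (LINT x|lebesgue_on G. F x $ i $ j * mollifier (1 / real (Suc n)) (a - x))"
  shows "AE x in lebesgue_on G. E x = F x"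
proof -
  have "AE x in lebesgue_on G. E x - F x = 0"
  proof (rule mollifier_tests_imp_AE_0[OF G loc_integrable_diff[OF E F] D])
    fix a n assume a: "a \<in> D" "cball a (1 / real (Suc n)) \<subseteq> G"
    let ?m = "\<lambda>x. mollifier (1 / real (Suc n)) (a - x)"
    have m: "?m \<in> C0_infinity G" by (rule mollifier_reflect_C0_infinity) (use a in auto)
    note Gs = sets_lebesgue_open[OF G]
    note i = loc_integrable_test[OF Gs loc_integrable_diff[OF E F] m]
    show "(LINT x|lebesgue_on G. ?m x *\<^sub>R (E x - F x)) = 0"
    proof (intro vec_eq_iff[THEN iffD2] allI)
      fix i' j'
      have "(LINT x|lebesgue_on G. ?m x *\<^sub>R (E x - F x)) $ i' $ j' =
        (LINT x|lebesgue_on G. (?m x *\<^sub>R (E x - F x)) $ i' $ j')"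
        unfolding integral_bounded_linear[OF bounded_linear_vec_nth i, symmetric]
          integral_bounded_linear[OF bounded_linear_vec_nth integrable_bounded_linear[OF bounded_linear_vec_nth i],
            symmetric] ..
      also have "\<dots> = (LINT x|lebesgue_on G. E x $ i' $ j' * ?m x - F x $ i' $ j' * ?m x)"
        by (simp add: algebra_simps)
      also have "\<dots> = 0"
        using test[OF a, of i' j'] loc_integrable_test_comp(2)[OF Gs m E] loc_integrable_test_comp(2)[OF Gs m F]
          by simp
      finally show "(LINT x|lebesgue_on G. ?m x *\<^sub>R (E x - F x)) $ i' $ j' = 0 $ i' $ j'" by simp
    qed
  qed
  then show ?thesis by simp
qed

lemma has_weak_epsD:
  fixes \<phi> :: "'a::euclidean_space \<Rightarrow> real"
  assumes "has_weak_eps e G u E" "\<phi> \<in> C0_infinity G"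
  shows "(LINT x|lebesgue_on G. E x $ i $ j * \<phi> x) =
        - (1/2) * (LINT x|lebesgue_on G. u x $ i * frechet_derivative \<phi> (at x) (e j) +
                                         u x $ j * frechet_derivative \<phi> (at x) (e i))"
  using assms unfolding has_weak_eps_def by blast

lemma has_weak_eps_loc_integrable:
  assumes "has_weak_eps e G u E"
  shows "loc_integrable G u" "loc_integrable G E"
  using assms unfolding has_weak_eps_def by blast+

lemma weak_eps_unique:
  fixes u :: "'a::euclidean_space \<Rightarrow> real ^ 'd"
  assumes G: "open G" and E: "has_weak_eps e G u E" and F: "has_weak_eps e G u F"
  shows "AE x in lebesgue_on G. E x = F x"
proof -
  obtain D :: "'a set" where D: "countable D" "\<And>X. open X \<Longrightarrow>
    X \<noteq> {} \<Longrightarrow> \<exists>d\<in>D. d \<in> X"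
    using countable_dense_setE by blast
  show ?thesis
  proof (rule AE_eq_by_mollifier_tests[OF G has_weak_eps_loc_integrable(2)[OF E] has_weak_eps_loc_integrable(2)[OF F]
    D(2,1)])
    fix a n i j assume "a \<in> D" "cball a (1 / real (Suc n)) \<subseteq> G"
    then have "(\<lambda>x. mollifier (1 / real (Suc n)) (a - x)) \<in> C0_infinity G"
      by (intro mollifier_reflect_C0_infinity) auto
    from has_weak_epsD[OF E this] has_weak_epsD[OF F this]
    show "(LINT x|lebesgue_on G. E x $ i $ j * mollifier (1 / real (Suc n)) (a - x)) =
      (LINT x|lebesgue_on G. F x $ i $ j * mollifier (1 / real (Suc n)) (a - x))" by simp
  qed
qed

text \<open>The continuity clause in the choice is an implication, so an admissible choice exists
  whether or not there is a continuous representative.\<close>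

lemma has_weak_eps_weak_eps:
  assumes "has_weak_eps e G u E"
  shows "has_weak_eps e G u (weak_eps e G u)"
    "\<And>E'. has_weak_eps e G u E' \<Longrightarrow> continuous_on G E' \<Longrightarrow>
      continuous_on G (weak_eps e G u)"
proof -
  have "\<exists>E. has_weak_eps e G u E \<and> ((\<exists>E'. has_weak_eps e G u E' \<and> continuous_on G E')
    \<longrightarrow> continuous_on G E)"
    using assms by (cases "\<exists>E'. has_weak_eps e G u E' \<and> continuous_on G E'") blast+
  from someI_ex[OF this] show "has_weak_eps e G u (weak_eps e G u)"
    "\<And>E'. has_weak_eps e G u E' \<Longrightarrow> continuous_on G E' \<Longrightarrow>
      continuous_on G (weak_eps e G u)"
    unfolding weak_eps_def by blast+
qed

lemma weak_eps_AE:
  "open G \<Longrightarrow> has_weak_eps e G u E \<Longrightarrow> AE x in lebesgue_on G. weak_eps e G u x = E x"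
  using weak_eps_unique has_weak_eps_weak_eps(1) by blast

text \<open>The set where \<open>f\<close> and \<open>g\<close> differ is open, and a non-empty open
  set is not negligible.\<close>

lemma continuous_AE_eq:
  fixes f g :: "'a::euclidean_space \<Rightarrow> 'b::euclidean_space"
  assumes G: "open G" and c: "continuous_on G f" "continuous_on G g" and ae: "AE x in lebesgue_on G. f x = g x"
    and x: "x \<in> G"
  shows "f x = g x"
proof (rule ccontr)
  assume ne: "f x \<noteq> g x"
  define U where "U = G \<inter> (\<lambda>x. f x - g x) -` (- {0})"
  have "open U" unfolding U_def
    using G c by (intro continuous_open_preimage continuous_intros) auto
  moreover have "x \<in> U" using ne x by (simp add: U_def)
  ultimately have "\<not> negligible U" using open_not_negligible by blast
  have "AE x in lebesgue. x \<notin> U"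
    using ae G by (subst (asm) AE_restrict_space_iff) (auto simp: U_def elim!: eventually_mono)
  then have "U \<in> null_sets lebesgue"
    using \<open>open U\<close> by (subst AE_iff_null_sets) auto
  then show False using \<open>\<not> negligible U\<close> by (simp add: negligible_iff_null_sets)
qed

text \<open>Upgrades agreement almost everywhere to agreement at each point, as both representatives
  are continuous.\<close>

lemma weak_eps_continuous:
  assumes "open G" "has_weak_eps e G u E" "continuous_on G E" "x \<in> G"
  shows "weak_eps e G u x = E x"
  using continuous_AE_eq[OF assms(1) has_weak_eps_weak_eps(2)[OF assms(2) assms(2,3)] assms(3) weak_eps_AE[OF
    assms(1,2)] assms(4)] .

lemma has_weak_eps_diff:
  fixes u v :: "'a::euclidean_space \<Rightarrow> real ^ 'd"
  assumes G: "open G" and u: "has_weak_eps e G u E" and v: "has_weak_eps e G v F"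
  shows "has_weak_eps e G (\<lambda>x. u x - v x) (\<lambda>x. E x - F x)"
  unfolding has_weak_eps_def
proof (intro conjI allI impI)
  note lu = has_weak_eps_loc_integrable[OF u] and lv = has_weak_eps_loc_integrable[OF v]
  show "loc_integrable G (\<lambda>x. u x - v x)" "loc_integrable G (\<lambda>x. E x - F x)"
    using lu lv by (auto intro: loc_integrable_diff)
  fix \<phi> :: "'a \<Rightarrow> real" and i j assume \<phi>: "\<phi> \<in> C0_infinity G"
  note c = loc_integrable_test_comp[OF sets_lebesgue_open[OF G] \<phi>]
  have "(LINT x|lebesgue_on G. (E x - F x) $ i $ j * \<phi> x) =
    (LINT x|lebesgue_on G. E x $ i $ j * \<phi> x) - (LINT x|lebesgue_on G. F x $ i $ j * \<phi> x)"
    using c(2)[OF lu(2)] c(2)[OF lv(2)] by (simp add: left_diff_distrib)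
  also have "\<dots> = - (1/2) * ((LINT x|lebesgue_on G. u x $ i * frechet_derivative \<phi> (at x) (e j) +
    u x $ j * frechet_derivative \<phi> (at x) (e i))
      - (LINT x|lebesgue_on G. v x $ i * frechet_derivative \<phi> (at x) (e j) +
        v x $ j * frechet_derivative \<phi> (at x) (e i)))"
    unfolding has_weak_epsD[OF u \<phi>] has_weak_epsD[OF v \<phi>] by (simp add: algebra_simps)
  also have "(LINT x|lebesgue_on G. u x $ i * frechet_derivative \<phi> (at x) (e j) +
    u x $ j * frechet_derivative \<phi> (at x) (e i))
      - (LINT x|lebesgue_on G. v x $ i * frechet_derivative \<phi> (at x) (e j) +
        v x $ j * frechet_derivative \<phi> (at x) (e i)) =
      (LINT x|lebesgue_on G. (u x $ i * frechet_derivative \<phi> (at x) (e j) +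
        u x $ j * frechet_derivative \<phi> (at x) (e i))
      - (v x $ i * frechet_derivative \<phi> (at x) (e j) + v x $ j * frechet_derivative \<phi> (at x) (e i)))"
    by (intro Bochner_Integration.integral_diff[symmetric] Bochner_Integration.integrable_add c(3) lu lv)
  also have "\<dots> = (LINT x|lebesgue_on G. (u x - v x) $ i * frechet_derivative \<phi> (at x) (e j) +
    (u x - v x) $ j * frechet_derivative \<phi> (at x) (e i))"
    by (intro Bochner_Integration.integral_cong refl) (simp add: algebra_simps)
  finally show "(LINT x|lebesgue_on G. (E x - F x) $ i $ j * \<phi> x) =
        - (1/2) * (LINT x|lebesgue_on G. (u x - v x) $ i * frechet_derivative \<phi> (at x) (e j) +
                                         (u x - v x) $ j * frechet_derivative \<phi> (at x) (e i))" .
qed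

section \<open>Smooth functions: classical and distributional symmetric gradient\<close>

definition classical_eps :: "('d::finite \<Rightarrow> 'a::euclidean_space) \<Rightarrow> ('a \<Rightarrow> real ^
  'd) \<Rightarrow> 'a \<Rightarrow> real ^ 'd ^ 'd" where
  "classical_eps e u x = (\<chi> i j. (frechet_derivative u (at x) (e j) $ i +
    frechet_derivative u (at x) (e i) $ j) / 2)"

lemma continuous_classical_eps:
  assumes "smooth_on G u"
  shows "continuous_on G (classical_eps e u)"
  unfolding classical_eps_def
  by (intro continuous_on_vec_lambda continuous_intros smooth_on_continuous smooth_on_frechet assms) auto

text \<open>\<open>w\<close> may be wild near the boundary of \<open>G\<close>, but
  \<open>\<phi>\<close> already vanishes there; gluing with 0 on the complement of the support gives
  smoothness everywhere.\<close>

lemma smooth_on_times_test: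
  fixes w \<phi> :: "'a::euclidean_space \<Rightarrow> real"
  assumes G: "open G" and w: "smooth_on G w" and \<phi>: "\<phi> \<in> C0_infinity G"
  shows "(\<lambda>x. if x \<in> G then w x * \<phi> x else 0) \<in> C0_infinity G"
proof -
  obtain K where K: "compact K" "K \<subseteq> G" "\<And>x. x \<notin> K \<Longrightarrow> \<phi> x = 0"
    using \<phi> unfolding C0_infinity_iff by blast
  let ?F = "\<lambda>x. if x \<in> G then w x * \<phi> x else 0"
  have "C_k_on k (G \<union> - K) ?F" for k
  proof (rule C_k_on_Un)
    show "open (- K)" using K by (simp add: compact_imp_closed open_Compl)
    have "C_k_on k G (\<lambda>x. w x * \<phi> x)"
      by (intro C_k_on_bilinear[OF bounded_bilinear_mult G] smooth_on_C_k[OF w]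
          C_k_on_subset[OF smooth_on_C_k[OF C0_infinity_smooth[OF \<phi>]]]) auto
    then show "C_k_on k G ?F" by (rule C_k_on_cong[OF G, rotated]) auto
    show "C_k_on k (- K) ?F"
      by (rule C_k_on_cong[OF \<open>open (- K)\<close> _ C_k_on_const[of k _ 0]]) (auto simp: K)
  qed (rule G)
  moreover have "G \<union> - K = UNIV" using K by blast
  ultimately have "smooth_on UNIV ?F" by (simp add: smooth_on_def)
  then show ?thesis unfolding C0_infinity_iff using K by (auto intro!: exI[of _ K])
qed

text \<open>A component of \<open>u\<close> times \<open>\<phi>\<close>, extended by zero, is a test
  function, and the integral of its derivative vanishes; no boundary term can arise.\<close>

lemma integration_by_parts:
  fixes u :: "'a::euclidean_space \<Rightarrow> real ^ 'd" and \<phi> :: "'a \<Rightarrow> real"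
  assumes G: "open G" and u: "smooth_on G u" and \<phi>: "\<phi> \<in> C0_infinity G"
  shows "(LINT x|lebesgue_on G. frechet_derivative u (at x) v $ i * \<phi> x) =
    - (LINT x|lebesgue_on G. u x $ i * frechet_derivative \<phi> (at x) v)"
proof -
  let ?F = "\<lambda>x. if x \<in> G then u x $ i * \<phi> x else 0"
  have ui: "smooth_on G (\<lambda>x. u x $ i)"
    unfolding smooth_on_def using C_k_on_bounded_linear[OF bounded_linear_vec_nth G] smooth_on_C_k[OF u] by blast
  have F: "?F \<in> C0_infinity G" by (rule smooth_on_times_test[OF G ui \<phi>])
  note c = loc_integrable_test_comp[OF sets_lebesgue_open[OF G] \<phi>]
  have i1: "integrable (lebesgue_on G) (\<lambda>x. frechet_derivative u (at x) v $ i * \<phi> x)"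
    by (rule c(1)) (intro loc_integrable_continuous smooth_on_continuous smooth_on_frechet u)
  have i2: "integrable (lebesgue_on G) (\<lambda>x. u x $ i * frechet_derivative \<phi> (at x) v)"
    by (rule c(3)) (intro loc_integrable_continuous smooth_on_continuous u)
  have d: "frechet_derivative ?F (at x) v = u x $ i * frechet_derivative \<phi> (at x) v +
    frechet_derivative u (at x) v $ i * \<phi> x" if x: "x \<in> G" for x
  proof -
    have "((\<lambda>x. u x $ i * \<phi> x) has_derivative (\<lambda>v. u x $ i *
      frechet_derivative \<phi> (at x) v + frechet_derivative u (at x) v $ i * \<phi> x)) (at x)"
      by (intro has_derivative_mult bounded_linear.has_derivative[OF bounded_linear_vec_nth]
        smooth_on_has_derivative[OF u x]
          smooth_on_has_derivative[OF C0_infinity_smooth[OF \<phi>]] UNIV_I)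
    then have "(?F has_derivative (\<lambda>v. u x $ i * frechet_derivative \<phi> (at x) v +
      frechet_derivative u (at x) v $ i * \<phi> x)) (at x)"
      by (rule has_derivative_transform_within_open[OF _ G x]) auto
    then show ?thesis by (rule frechet_derivative_eqI)
  qed
  have d0: "frechet_derivative ?F (at x) v = 0" if x: "x \<notin> G" for x
  proof -
    obtain K where K: "compact K" "K \<subseteq> G" "\<And>x. x \<notin> K \<Longrightarrow> ?F x = 0"
      using F unfolding C0_infinity_iff by blast
    show ?thesis
      by (rule frechet_derivative_eq_0_outside[OF compact_imp_closed[OF K(1)] K(3)]) (use K x in auto)
  qed
  have "0 = (LINT x|lebesgue. frechet_derivative ?F (at x) v)"
    using integral_derivative_eq_0[OF F] by simp
  also have "\<dots> = (LINT x|lebesgue. indicator G x *\<^sub>R (u x $ i *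
    frechet_derivative \<phi> (at x) v + frechet_derivative u (at x) v $ i * \<phi> x))"
  proof (intro Bochner_Integration.integral_cong refl)
    fix x show "frechet_derivative ?F (at x) v = indicator G x *\<^sub>R (u x $ i *
      frechet_derivative \<phi> (at x) v + frechet_derivative u (at x) v $ i * \<phi> x)"
      using d[of x] d0[of x] by (cases "x \<in> G") simp_all
  qed
  also have "\<dots> = (LINT x|lebesgue_on G. u x $ i * frechet_derivative \<phi> (at x) v +
    frechet_derivative u (at x) v $ i * \<phi> x)"
    using G by (simp only: integral_lebesgue_on_eq sets_lebesgue_open)
  also have "\<dots> = (LINT x|lebesgue_on G. u x $ i * frechet_derivative \<phi> (at x) v) +
    (LINT x|lebesgue_on G. frechet_derivative u (at x) v $ i * \<phi> x)"
    using i1 i2 by (intro Bochner_Integration.integral_add)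
  finally show ?thesis by simp
qed

lemma has_weak_eps_smooth:
  fixes u :: "'a::euclidean_space \<Rightarrow> real ^ 'd"
  assumes G: "open G" and u: "smooth_on G u"
  shows "has_weak_eps e G u (classical_eps e u)"
  unfolding has_weak_eps_def
proof (intro conjI allI impI)
  show "loc_integrable G u" "loc_integrable G (classical_eps e u)"
    using u by (auto intro!: loc_integrable_continuous smooth_on_continuous continuous_classical_eps)
  fix \<phi> :: "'a \<Rightarrow> real" and i j assume \<phi>: "\<phi> \<in> C0_infinity G"
  note c = loc_integrable_test_comp[OF sets_lebesgue_open[OF G] \<phi>]
  have i1: "integrable (lebesgue_on G) (\<lambda>x. frechet_derivative u (at x) v $ i * \<phi> x)" for v i
    by (rule c(1)) (intro loc_integrable_continuous smooth_on_continuous smooth_on_frechet u)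
  have i2: "integrable (lebesgue_on G) (\<lambda>x. u x $ i * frechet_derivative \<phi> (at x) v)" for v i
    by (rule c(3)) (intro loc_integrable_continuous smooth_on_continuous u)
  have "(LINT x|lebesgue_on G. classical_eps e u x $ i $ j * \<phi> x) =
      (LINT x|lebesgue_on G. (1/2) * (frechet_derivative u (at x) (e j) $ i * \<phi> x +
        frechet_derivative u (at x) (e i) $ j * \<phi> x))"
    by (intro Bochner_Integration.integral_cong refl) (simp add: classical_eps_def algebra_simps)
  also have "\<dots> = (1/2) * ((LINT x|lebesgue_on G. frechet_derivative u (at x) (e j) $ i * \<phi> x) +
    (LINT x|lebesgue_on G. frechet_derivative u (at x) (e i) $ j * \<phi> x))"
    using i1 by simp
  also have "\<dots> = - (1/2) * ((LINT x|lebesgue_on G. u x $ i * frechet_derivative \<phi> (at x) (e j)) +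
    (LINT x|lebesgue_on G. u x $ j * frechet_derivative \<phi> (at x) (e i)))"
    unfolding integration_by_parts[OF G u \<phi>] by (simp add: field_simps)
  also have "\<dots> = - (1/2) * (LINT x|lebesgue_on G. u x $ i * frechet_derivative \<phi> (at x) (e j) +
    u x $ j * frechet_derivative \<phi> (at x) (e i))"
    using i2 by simp
  finally show "(LINT x|lebesgue_on G. classical_eps e u x $ i $ j * \<phi> x) =
      - (1/2) * (LINT x|lebesgue_on G. u x $ i * frechet_derivative \<phi> (at x) (e j) +
        u x $ j * frechet_derivative \<phi> (at x) (e i))" .
qed

lemma weak_eps_smooth:
  "open G \<Longrightarrow> smooth_on G u \<Longrightarrow> x \<in> G \<Longrightarrow>
    weak_eps e G u x = classical_eps e u x"
  by (intro weak_eps_continuous has_weak_eps_smooth continuous_classical_eps)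

section \<open>Restriction of the distributional gradient to time slices\<close>

lemma tensor_C0_infinity:
  fixes \<psi> :: "'a::euclidean_space \<Rightarrow> real" and \<phi> :: "'b::euclidean_space \<Rightarrow> real"
  assumes \<psi>: "\<psi> \<in> C0_infinity G" and \<phi>: "\<phi> \<in> C0_infinity H"
  shows "(\<lambda>z. \<psi> (fst z) * \<phi> (snd z)) \<in> C0_infinity (G \<times> H)"
proof -
  obtain K where K: "compact K" "K \<subseteq> G" "\<And>x. x \<notin> K \<Longrightarrow> \<psi> x = 0"
    using \<psi> unfolding C0_infinity_iff by blast
  obtain L where L: "compact L" "L \<subseteq> H" "\<And>x. x \<notin> L \<Longrightarrow> \<phi> x = 0"
    using \<phi> unfolding C0_infinity_iff by blast
  have "C_k_on k UNIV (\<lambda>z::'a\<times>'b. \<psi> (0 +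
    fst z))" "C_k_on k UNIV (\<lambda>z::'a\<times>'b. \<phi> (0 + snd z))" for k
    by (rule C_k_on_affine[OF bounded_linear_fst open_UNIV UNIV_I smooth_on_C_k[OF C0_infinity_smooth[OF \<psi>]]],
        rule C_k_on_affine[OF bounded_linear_snd open_UNIV UNIV_I smooth_on_C_k[OF C0_infinity_smooth[OF \<phi>]]])
  then have "smooth_on UNIV (\<lambda>z::'a\<times>'b. \<psi> (fst z) * \<phi> (snd z))"
    unfolding smooth_on_def by (auto intro!: C_k_on_bilinear[OF bounded_bilinear_mult])
  then show ?thesis unfolding C0_infinity_iff using K L
    by (intro conjI exI[of _ "K \<times> L"] compact_Times) auto
qed

text \<open>In a purely spatial direction the time factor is a constant; therefore testing with
  tensor products decouples time from space.\<close>

lemma frechet_derivative_tensor: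
  fixes \<psi> :: "'a::euclidean_space \<Rightarrow> real" and \<phi> :: "'b::euclidean_space \<Rightarrow> real"
  assumes \<psi>: "\<psi> \<in> C0_infinity G" and \<phi>: "\<phi> \<in> C0_infinity H"
  shows "frechet_derivative (\<lambda>z. \<psi> (fst z) * \<phi> (snd z)) (at z) (0, v) =
    \<psi> (fst z) * frechet_derivative \<phi> (at (snd z)) v"
proof -
  note d = smooth_on_has_derivative[OF C0_infinity_smooth UNIV_I]
  have "((\<lambda>z. \<psi> (fst z) * \<phi> (snd z)) has_derivative
      (\<lambda>v. \<psi> (fst z) * frechet_derivative \<phi> (at (snd z)) (snd v) +
        frechet_derivative \<psi> (at (fst z)) (fst v) * \<phi> (snd z))) (at z)"
    by (intro has_derivative_mult has_derivative_compose[OF has_derivative_fst[OF has_derivative_ident] d[OF \<psi>]]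
        has_derivative_compose[OF has_derivative_snd[OF has_derivative_ident] d[OF \<phi>]])
  from frechet_derivative_eqI[OF this, of "(0, v)"] show ?thesis
    using linear_0[OF bounded_linear.linear[OF smooth_on_linear_frechet[OF C0_infinity_smooth[OF \<psi>] UNIV_I]]]
      by simp
qed

lemma open_cylinder: "open \<Omega> \<Longrightarrow> open (cylinder T \<Omega>)"
  by (simp add: cylinder_def open_Times)

lemma mem_cylinder: "(t, x) \<in> cylinder T \<Omega> \<longleftrightarrow> 0 < t \<and> t < T \<and> x \<in>
  \<Omega>"
  by (auto simp: cylinder_def)

lemma C0_infinity_snd_measurable:
  fixes \<phi> :: "'b::euclidean_space \<Rightarrow> real"
  assumes "continuous_on UNIV \<phi>"
  shows "(\<lambda>z::'a::euclidean_space \<times> 'b. \<phi> (snd z)) \<in> borel_measurable lebesgue"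
  by (intro continuous_imp_lebesgue continuous_on_compose2[OF assms] continuous_intros) auto

lemma integrable_times_snd:
  fixes \<phi> :: "'b::euclidean_space \<Rightarrow> real"
    and f :: "'a::euclidean_space \<times> 'b \<Rightarrow> real"
  assumes f: "integrable lebesgue f" and \<phi>: "\<phi> \<in> C0_infinity G"
  shows "integrable lebesgue (\<lambda>z. f z * \<phi> (snd z))"
proof -
  obtain B where B: "0 < B" "\<And>x. norm (\<phi> x) \<le> B" using C0_infinity_bounded[OF \<phi>] by blast
  from integrable_bounded_scaleR[OF f C0_infinity_snd_measurable[OF C0_infinity_continuous[OF \<phi>]], of B]
  show ?thesis using B by (simp add: mult.commute)
qed

lemma integrable_times_fst:
  fixes \<psi> :: "'a::euclidean_space \<Rightarrow> real"
    and f :: "'a \<times> 'b::euclidean_space \<Rightarrow> real"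
  assumes f: "integrable lebesgue f" and \<psi>: "\<psi> \<in> C0_infinity G"
  shows "integrable lebesgue (\<lambda>z. f z * \<psi> (fst z))"
proof -
  obtain B where B: "0 < B" "\<And>x. norm (\<psi> x) \<le> B" using C0_infinity_bounded[OF \<psi>] by blast
  have "(\<lambda>z::'a \<times> 'b. \<psi> (fst z)) \<in> borel_measurable lebesgue"
    by (intro continuous_imp_lebesgue continuous_on_compose2[OF C0_infinity_continuous[OF \<psi>]] continuous_intros)
      auto
  from integrable_bounded_scaleR[OF f this, of B]
  show ?thesis using B by (simp add: mult.commute)
qed

lemma integrable_vec_nth:
  fixes u :: "'a \<Rightarrow> real ^ 'd"
  shows "integrable M u \<Longrightarrow> integrable M (\<lambda>x. u x $ i)"
  by (rule integrable_bounded_linear[OF bounded_linear_vec_nth])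

lemma integrable_mat_nth:
  fixes E :: "'a \<Rightarrow> real ^ 'd ^ 'd"
  shows "integrable M E \<Longrightarrow> integrable M (\<lambda>x. E x $ i $ j)"
  by (rule integrable_bounded_linear[OF bounded_linear_vec_nth integrable_bounded_linear[OF bounded_linear_vec_nth]])

text \<open>\<open>b\<close> is the defect of the weak formulation on a slice for one fixed
  \<open>\<phi>\<close>. Testing on the cylinder with the product of \<open>\<phi>\<close> and a
  mollifier in time shows that its spatial integral is annihilated by these mollifiers, hence is 0
  for almost every time. The exceptional times still depend on \<open>\<phi>\<close>.\<close>

lemma weak_eps_slice_functional:
  fixes u :: "real \<times> (real ^ 'd) \<Rightarrow> real ^ 'd"
    and E :: "real \<times> (real ^ 'd) \<Rightarrow> real ^ 'd ^ 'd"
  assumes \<Omega>: "open \<Omega>" and w: "has_weak_eps dir_tx (cylinder T \<Omega>) u E"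
    and u: "integrable (lebesgue_on (cylinder T \<Omega>)) u"
      and E: "integrable (lebesgue_on (cylinder T \<Omega>)) E"
    and \<phi>: "\<phi> \<in> C0_infinity \<Omega>"
    and b_def: "\<And>z. b z = zero_ext (cylinder T \<Omega>) E z $ i $ j * \<phi> (snd z) + (1/2) *
      (zero_ext (cylinder T \<Omega>) u z $ i * frechet_derivative \<phi> (at (snd z)) (dir_x j) +
       zero_ext (cylinder T \<Omega>) u z $ j * frechet_derivative \<phi> (at (snd z)) (dir_x i))"
  shows "AE t in lebesgue_on {0<..<T}. (LINT x|lebesgue. b (t, x)) = 0"
proof -
  let ?Q = "cylinder T \<Omega>"
  note Q = open_cylinder[OF \<Omega>, of T] and Qs = sets_lebesgue_open[OF open_cylinder[OF \<Omega>, of T]]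
  have ze: "zero_ext ?Q f = (\<lambda>z. indicator ?Q z *\<^sub>R f z)" for f :: "real \<times> (real ^ 'd)
    \<Rightarrow> 'e::euclidean_space"
    by (auto simp: zero_ext_def indicator_def)
  have U: "integrable lebesgue (zero_ext ?Q u)" and EE: "integrable lebesgue (zero_ext ?Q E)"
    using u E Qs by (simp_all add: ze integrable_lebesgue_on_iff)
  have b: "integrable lebesgue b"
    unfolding b_def[abs_def]
    by (intro Bochner_Integration.integrable_add integrable_mult_right integrable_times_snd[OF integrable_mat_nth[OF
      EE] \<phi>]
       integrable_times_snd[OF integrable_vec_nth[OF U] C0_infinity_frechet[OF \<phi>]])
  define B where "B t = (LINT x|lebesgue. b (t, x))" for t
  have Bi: "integrable lebesgue B" unfolding B_def[abs_def] by (rule integral_slices(3)[OF b])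
  obtain D :: "real set" where D: "countable D" "\<And>X. open X \<Longrightarrow>
    X \<noteq> {} \<Longrightarrow> \<exists>d\<in>D. d \<in> X"
    using countable_dense_setE by blast
  have I: "{0<..<T} \<in> sets lebesgue" by simp
  have "AE t in lebesgue_on {0<..<T}. B t = 0"
  proof (rule mollifier_tests_imp_AE_0[OF _ _ D(2,1)])
    show "loc_integrable {0<..<T} B"
      using I integrable_mult_indicator[OF I Bi]
        by (intro loc_integrable_integrable) (simp_all add: integrable_lebesgue_on_iff)
    fix a n assume a: "a \<in> D" "cball a (1 / real (Suc n)) \<subseteq> {0<..<T}"
    define \<psi> where "\<psi> t = mollifier (1 / real (Suc n)) (a - t)" for t
    have \<psi>: "\<psi> \<in> C0_infinity {0<..<T}"
      unfolding \<psi>_def[abs_def] by (rule mollifier_reflect_C0_infinity) (use a in auto)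
    have \<psi>0: "\<psi> t = 0" if "t \<notin> {0<..<T}" for t
      using \<psi> that unfolding C0_infinity_iff by blast
    let ?\<theta> = "\<lambda>z. \<psi> (fst z) * \<phi> (snd z)"
    have \<theta>: "?\<theta> \<in> C0_infinity ?Q"
      unfolding cylinder_def by (rule tensor_C0_infinity[OF \<psi> \<phi>])
    note lw = has_weak_eps_loc_integrable[OF w] and c = loc_integrable_test_comp[OF Qs \<theta>]
    have d: "frechet_derivative ?\<theta> (at z) (dir_tx k) =
      \<psi> (fst z) * frechet_derivative \<phi> (at (snd z)) (dir_x k)" for z k
      unfolding dir_tx_def dir_x_def by (rule frechet_derivative_tensor[OF \<psi> \<phi>])
    have "0 = (LINT z|lebesgue_on ?Q. E z $ i $ j * ?\<theta> z) + (1/2) *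
      (LINT z|lebesgue_on ?Q. u z $ i * frechet_derivative ?\<theta> (at z) (dir_tx j) +
        u z $ j * frechet_derivative ?\<theta> (at z) (dir_tx i))"
      unfolding has_weak_epsD[OF w \<theta>] by simp
    also have "\<dots> = (LINT z|lebesgue_on ?Q. E z $ i $ j * ?\<theta> z +
      (1/2) * (u z $ i * frechet_derivative ?\<theta> (at z) (dir_tx j) +
      u z $ j * frechet_derivative ?\<theta> (at z) (dir_tx i)))"
      using c(2)[OF lw(2)] c(3)[OF lw(1)] by (subst Bochner_Integration.integral_add) simp_all
    also have "\<dots> = (LINT z|lebesgue. b z * \<psi> (fst z))"
      unfolding integral_lebesgue_on_eq[OF Qs] d
      by (intro Bochner_Integration.integral_cong refl) (simp add: b_def zero_ext_def indicator_def algebra_simps)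
    also have "\<dots> = (LINT t|lebesgue. LINT x|lebesgue. b (t, x) * \<psi> t)"
      using integral_slices(2)[OF integrable_times_fst[OF b \<psi>]] by simp
    also have "\<dots> = (LINT t|lebesgue. \<psi> t * B t)"
      by (simp add: B_def mult.commute)
    also have "\<dots> = (LINT t|lebesgue_on {0<..<T}. \<psi> t *\<^sub>R B t)"
      unfolding integral_lebesgue_on_eq[OF I]
      by (intro Bochner_Integration.integral_cong refl) (use \<psi>0 in \<open>auto simp: indicator_def\<close>)
    finally show "(LINT t|lebesgue_on {0<..<T}. mollifier (1 / real (Suc n)) (a - t) *\<^sub>R B t) = 0"
      unfolding \<psi>_def by simp
  qed simp
  then show ?thesis by (simp add: B_def)
qed

lemma AE_lebesgue_on_I: "AE x in lebesgue. P x \<Longrightarrow> G \<in> sets lebesgue \<Longrightarrow>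
  AE x in lebesgue_on G. P x"
  by (subst AE_restrict_space_iff) (auto elim: eventually_mono)

lemma has_weak_eps_cong_AE:
  fixes u :: "'a::euclidean_space \<Rightarrow> real ^ 'd"
  assumes G: "G \<in> sets lebesgue" and u: "has_weak_eps e G u E" and ae: "AE x in lebesgue_on G. E x = F x"
    and F: "loc_integrable G F"
  shows "has_weak_eps e G u F"
  unfolding has_weak_eps_def
proof (intro conjI allI impI F has_weak_eps_loc_integrable(1)[OF u])
  fix \<phi> :: "'a \<Rightarrow> real" and i j assume \<phi>: "\<phi> \<in> C0_infinity G"
  have "(LINT x|lebesgue_on G. F x $ i $ j * \<phi> x) = (LINT x|lebesgue_on G. E x $ i $ j * \<phi> x)"
    using loc_integrable_test_comp(2)[OF G \<phi> F] loc_integrable_test_comp(2)[OF G \<phi>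
      has_weak_eps_loc_integrable(2)[OF u]] ae
    by (intro integral_cong_AE borel_measurable_integrable) (auto elim: eventually_mono)
  then show "(LINT x|lebesgue_on G. F x $ i $ j * \<phi> x) =
        - (1/2) * (LINT x|lebesgue_on G. u x $ i * frechet_derivative \<phi> (at x) (e j) +
          u x $ j * frechet_derivative \<phi> (at x) (e i))"
    using has_weak_epsD[OF u \<phi>] by simp
qed

text \<open>The exceptional times must not depend on the test function, so only countably many
  mollifiers are used. They do not yield the weak formulation for all test functions at once, but
  they suffice to compare the slice of \<open>E\<close> with a weak gradient \<open>E'\<close> of
  the slice that is already known to exist. Hence the conditional form; membership of the slices in
  \<open>X_eps\<close> later supplies \<open>E'\<close>.\<close>

lemma weak_eps_slices:
  fixes u :: "real \<times> (real ^ 'd) \<Rightarrow> real ^ 'd"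
    and E :: "real \<times> (real ^ 'd) \<Rightarrow> real ^ 'd ^ 'd"
  assumes \<Omega>: "open \<Omega>" and w: "has_weak_eps dir_tx (cylinder T \<Omega>) u E"
    and u: "integrable (lebesgue_on (cylinder T \<Omega>)) u"
      and E: "integrable (lebesgue_on (cylinder T \<Omega>)) E"
  shows "AE t in lebesgue_on {0<..<T}. \<forall>E'. has_weak_eps dir_x \<Omega> (\<lambda>x. u (t, x)) E'
    \<longrightarrow>
    (AE x in lebesgue_on \<Omega>. E' x = E (t, x)) \<and> has_weak_eps dir_x \<Omega> (\<lambda>x. u (t, x))
      (\<lambda>x. E (t, x))"
proof -
  let ?Q = "cylinder T \<Omega>"
  note Q = open_cylinder[OF \<Omega>, of T] and Qs = sets_lebesgue_open[OF open_cylinder[OF \<Omega>, of T]]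
  have I: "{0<..<T} \<in> sets lebesgue" and Os: "\<Omega> \<in> sets lebesgue" using \<Omega> by simp_all
  have ze: "zero_ext ?Q f = (\<lambda>z. indicator ?Q z *\<^sub>R f z)" for f :: "real \<times> (real ^ 'd)
    \<Rightarrow> 'e::euclidean_space"
    by (auto simp: zero_ext_def indicator_def)
  have EE: "integrable lebesgue (zero_ext ?Q E)"
    using E Qs by (simp add: ze integrable_lebesgue_on_iff)
  obtain D :: "(real ^ 'd) set" where D: "countable D" "\<And>X. open X \<Longrightarrow>
    X \<noteq> {} \<Longrightarrow> \<exists>d\<in>D. d \<in> X"
    using countable_dense_setE by blast
  define m where "m a n x = mollifier (1 / real (Suc n)) (a - x)" for a x :: "real ^ 'd" and n
  define b where "b a n i j z = zero_ext ?Q E z $ i $ j * m a n (snd z) + (1/2) *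
      (zero_ext ?Q u z $ i * frechet_derivative (m a n) (at (snd z)) (dir_x j) +
       zero_ext ?Q u z $ j * frechet_derivative (m a n) (at (snd z)) (dir_x i))" for a n i j z
  have m: "m a n \<in> C0_infinity \<Omega>" if "cball a (1 / real (Suc n)) \<subseteq> \<Omega>" for a n
    unfolding m_def[abs_def] by (rule mollifier_reflect_C0_infinity) (use that in auto)
  have "AE t in lebesgue_on {0<..<T}. cball a (1 / real (Suc n)) \<subseteq> \<Omega> \<longrightarrow> (LINT
    x|lebesgue. b a n i j (t, x)) = 0" for a n i j
    using weak_eps_slice_functional[OF \<Omega> w u E m b_def, of a n i j]
      by (cases "cball a (1 / real (Suc n)) \<subseteq> \<Omega>") simp_all
  then have "AE t in lebesgue_on {0<..<T}. \<forall>i\<in>UNIV. \<forall>j\<in>UNIV. cball a (1 / real (Suc n))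
    \<subseteq> \<Omega> \<longrightarrow> (LINT x|lebesgue. b a n i j (t, x)) = 0" for a n
    by (intro AE_finite_allI) auto
  then have "\<forall>a\<in>D. \<forall>n. AE t in lebesgue_on {0<..<T}. \<forall>i\<in>UNIV. \<forall>j\<in>UNIV.
    cball a (1 / real (Suc n)) \<subseteq> \<Omega> \<longrightarrow> (LINT x|lebesgue. b a n i j (t, x)) = 0"
    by blast
  then have ae: "AE t in lebesgue_on {0<..<T}. \<forall>a\<in>D. \<forall>n. \<forall>i\<in>UNIV.
    \<forall>j\<in>UNIV. cball a (1 / real (Suc n)) \<subseteq> \<Omega> \<longrightarrow> (LINT x|lebesgue. b a n i
    j (t, x)) = 0"
    unfolding AE_all_countable[symmetric] AE_ball_countable[OF D(1)] by blast
  have "AE t in lebesgue_on {0<..<T}. integrable lebesgue (\<lambda>x. zero_ext ?Q E (t, x))"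
    by (rule AE_lebesgue_on_I[OF integral_slices(1)[OF EE] I])
  moreover have "AE t in lebesgue_on {0<..<T}. t \<in> {0<..<T}"
    using AE_space[of "lebesgue_on {0<..<T}"] by simp
  ultimately show ?thesis using ae
  proof eventually_elim
    case (elim t)
    show ?case
    proof (intro allI impI)
      fix E' assume E': "has_weak_eps dir_x \<Omega> (\<lambda>x. u (t, x)) E'"
      have "(\<lambda>x. zero_ext ?Q E (t, x)) = (\<lambda>x. indicator \<Omega> x *\<^sub>R E (t, x))"
        using elim(2) by (auto simp: zero_ext_def mem_cylinder indicator_def)
      then have Ei: "integrable (lebesgue_on \<Omega>) (\<lambda>x. E (t, x))"
        using elim(1) Os by (simp add: integrable_lebesgue_on_iff)
      note El = loc_integrable_integrable[OF Ei Os]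
      have ae: "AE x in lebesgue_on \<Omega>. E' x = E (t, x)"
      proof (rule AE_eq_by_mollifier_tests[OF \<Omega> has_weak_eps_loc_integrable(2)[OF E'] El D(2,1)])
        fix a n i j assume a: "a \<in> D" "cball a (1 / real (Suc n)) \<subseteq> \<Omega>"
        note ma = m[OF a(2)]
        note c = loc_integrable_test_comp[OF Os ma] and lu = has_weak_eps_loc_integrable(1)[OF E']
        have "0 = (LINT x|lebesgue. b a n i j (t, x))" using elim(3) a by auto
        also have "\<dots> = (LINT x|lebesgue_on \<Omega>. E (t, x) $ i $ j * m a n x +
          (1/2) * (u (t, x) $ i * frechet_derivative (m a n) (at x) (dir_x j) +
          u (t, x) $ j * frechet_derivative (m a n) (at x) (dir_x i)))"
          unfolding integral_lebesgue_on_eq[OF Os]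
          by (intro Bochner_Integration.integral_cong refl) (use elim(2) in \<open>simp add: b_def zero_ext_def
            indicator_def mem_cylinder\<close>)
        also have "\<dots> = (LINT x|lebesgue_on \<Omega>. E (t, x) $ i $ j * m a n x) +
          (1/2) * (LINT x|lebesgue_on \<Omega>. u (t, x) $ i * frechet_derivative (m a n) (at x) (dir_x j) +
          u (t, x) $ j * frechet_derivative (m a n) (at x) (dir_x i))"
          using c(2)[OF El] c(3)[OF lu] by (subst Bochner_Integration.integral_add) simp_all
        finally have "(LINT x|lebesgue_on \<Omega>. E (t, x) $ i $ j * m a n x) =
          (LINT x|lebesgue_on \<Omega>. E' x $ i $ j * m a n x)"
          unfolding has_weak_epsD[OF E' ma] by simp
        then show "(LINT x|lebesgue_on \<Omega>. E' x $ i $ j * mollifier (1 / real (Suc n)) (a - x)) =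
            (LINT x|lebesgue_on \<Omega>. E (t, x) $ i $ j * mollifier (1 / real (Suc n)) (a - x))"
          unfolding m_def by simp
      qed
      show "(AE x in lebesgue_on \<Omega>. E' x = E (t, x)) \<and> has_weak_eps dir_x \<Omega> (\<lambda>x. u (t, x))
        (\<lambda>x. E (t, x))"
        using ae has_weak_eps_cong_AE[OF Os E' ae El] by blast
    qed
  qed
qed

section \<open>The cutoff function\<close>

text \<open>By connectedness of the ball: a point of it outside \<Omega> would produce a frontier
  point closer to \<open>x\<close> than the distance to the frontier.\<close>

lemma ball_infdist_frontier_subset:
  fixes \<Omega> :: "'a::euclidean_space set"
  assumes "x \<in> \<Omega>"
  shows "ball x (infdist x (frontier \<Omega>)) \<subseteq> \<Omega>"
proof (rule ccontr)
  assume n: "\<not> ?thesis"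
  then have "ball x (infdist x (frontier \<Omega>)) - \<Omega> \<noteq> {}" by blast
  moreover from this have "x \<in> ball x (infdist x (frontier \<Omega>))" using n
    by (auto simp: not_less infdist_nonneg intro: le_neq_trans)
  then have "ball x (infdist x (frontier \<Omega>)) \<inter> \<Omega> \<noteq> {}" using assms by blast
  ultimately have "ball x (infdist x (frontier \<Omega>)) \<inter> frontier \<Omega> \<noteq> {}"
    by (intro connected_Int_frontier connected_ball)
  then obtain y where "dist x y < infdist x (frontier \<Omega>)" "y \<in> frontier \<Omega>" by auto
  then show False using infdist_le[of y "frontier \<Omega>" x] by simp
qed

lemma infdist_lipschitz: "infdist y A \<le> infdist x A + dist x y"
  using infdist_triangle[of y A x] by (simp add: dist_commute)

lemma inner_set_open: "open \<Omega> \<Longrightarrow> open (inner_set \<Omega> \<delta>)"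
proof -
  assume "open \<Omega>"
  moreover have "open {x. \<delta> < infdist x (frontier \<Omega>)}"
    by (intro open_Collect_less continuous_intros)
  moreover have "inner_set \<Omega> \<delta> = \<Omega> \<inter> {x. \<delta> < infdist x (frontier \<Omega>)}"
    by (auto simp: inner_set_def)
  ultimately show ?thesis by auto
qed

lemma frontier_bounded_nonempty:
  fixes \<Omega> :: "'a::euclidean_space set"
  shows "bounded \<Omega> \<Longrightarrow> \<Omega> \<noteq> {} \<Longrightarrow> frontier \<Omega> \<noteq> {}"
  using frontier_eq_empty[of \<Omega>] not_bounded_UNIV by auto

lemma infdist_frontier_pos:
  fixes \<Omega> :: "'a::euclidean_space set"
  assumes "open \<Omega>" "bounded \<Omega>" "x \<in> \<Omega>"
  shows "0 < infdist x (frontier \<Omega>)"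
proof -
  have "x \<notin> frontier \<Omega>" using assms by (auto simp: frontier_def interior_open)
  then show ?thesis
    using infdist_pos_not_in_closed[of "frontier \<Omega>" x] frontier_bounded_nonempty[of \<Omega>] assms by auto
qed

lemma inner_closed_compact:
  fixes \<Omega> :: "'a::euclidean_space set"
  assumes "open \<Omega>" "bounded \<Omega>" "0 < \<delta>"
  shows "compact {x \<in> \<Omega>. \<delta> \<le> infdist x (frontier \<Omega>)}"
proof -
  \<comment> \<open>Frontier points have distance 0 and are excluded by \<open>0 < \<delta>\<close>,
    so \<Omega> may be replaced by its closure, which exhibits the set as closed and
    bounded.\<close>
  have "{x \<in> \<Omega>. \<delta> \<le> infdist x (frontier \<Omega>)} =
    closure \<Omega> \<inter> {x. \<delta> \<le> infdist x (frontier \<Omega>)}"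
  proof -
    have "x \<in> \<Omega>" if "x \<in> closure \<Omega>" "\<delta> \<le> infdist x (frontier \<Omega>)" for x
    proof (rule ccontr)
      assume "x \<notin> \<Omega>"
      then have "x \<in> frontier \<Omega>" using that(1) assms(1) by (simp add: frontier_def interior_open)
      then show False using that(2) assms(3) by simp
    qed
    then show ?thesis using closure_subset by blast
  qed
  moreover have "closed {x. \<delta> \<le> infdist x (frontier \<Omega>)}"
    by (intro closed_Collect_le continuous_intros)
  ultimately show ?thesis using assms(2) by (simp add: compact_Int_closed)
qed

lemma integrable_indicator_open:
  fixes S :: "'a::euclidean_space set"
  assumes "open S" "bounded S"
  shows "integrable lebesgue (indicator S :: 'a \<Rightarrow> real)"
  using assms by (intro integrable_real_indicator) (auto intro!: emeasure_bounded_finite[unfolded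
    infinity_ennreal_def])

lemma fun_conv_bounded:
  fixes g :: "'a::euclidean_space \<Rightarrow> real"
  assumes "\<And>x. \<bar>k x\<bar> \<le> B" "\<And>x. r \<le> norm x \<Longrightarrow>
    k x = 0" "0 \<le> B" "0 < r" "\<And>x. \<bar>g x\<bar> \<le> 1"
  shows "\<bar>fun_conv k g x\<bar> \<le> B * (unit_ball_vol (real DIM('a)) * r ^ DIM('a))"
proof (cases "integrable lebesgue (\<lambda>y. k (x - y) *\<^sub>R g y)")
  case True
  have "ennreal (norm (fun_conv k g x)) \<le> (\<integral>\<^sup>+y. ennreal (norm (k (x - y) *\<^sub>R g y))
    \<partial>lebesgue)"
    unfolding fun_conv_def by (rule integral_norm_bound_ennreal[OF True])
  also have "\<dots> \<le> (\<integral>\<^sup>+y. ennreal B * indicator (ball x r) y \<partial>lebesgue)"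
  proof (intro nn_integral_mono)
    fix y
    show "ennreal (norm (k (x - y) *\<^sub>R g y)) \<le> ennreal B * indicator (ball x r) y"
    proof (cases "y \<in> ball x r")
      case True
      have "\<bar>k (x - y)\<bar> * \<bar>g y\<bar> \<le> B * 1" using assms by (intro mult_mono) auto
      then show ?thesis using True by (simp add: abs_mult ennreal_leI)
    next
      case False
      then have "k (x - y) = 0" by (intro assms(2)) (simp add: dist_norm)
      then show ?thesis by simp
    qed
  qed
  also have "\<dots> = ennreal (B * (unit_ball_vol (real DIM('a)) * r ^ DIM('a)))"
    using emeasure_ball[of r x] assms by (subst nn_integral_cmult_indicator) (auto simp: ennreal_mult')
  finally show ?thesis using assms by (simp add: ennreal_le_iff)
qed (use assms in \<open>simp add: fun_conv_def not_integrable_integral_eq\<close>)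

lemma cutoff_smooth:
  assumes "open \<Omega>" "bounded \<Omega>" "0 < h"
  shows "smooth_on UNIV (cutoff \<Omega> h)"
  unfolding cutoff_def
  using assms by (intro smooth_on_fun_conv[OF mollifier_C0_infinity] integrable_indicator_open inner_set_open)
    (auto intro: bounded_subset simp: inner_set_def)

lemma cutoff_nonneg: "0 < h \<Longrightarrow> 0 \<le> cutoff \<Omega> h x"
  unfolding cutoff_def fun_conv_def by (intro integral_nonneg_AE) (auto simp: mollifier_nonneg)

lemma cutoff_le_1:
  fixes x :: "'a::euclidean_space"
  assumes h: "0 < h"
  shows "cutoff \<Omega> h x \<le> 1"
proof -
  have mi: "integrable lebesgue (\<lambda>y. mollifier (h / 2) (x - y))"
    using mollifier_reflect_C0_infinity[of "h / 2" x UNIV] h by (intro C0_infinity_integrable) auto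
  show ?thesis
  proof (cases "integrable lebesgue (\<lambda>y. mollifier (h / 2) (x - y) *\<^sub>R (indicator (inner_set \<Omega>
    (5 * h / 2)) y :: real))")
    case True
    have "cutoff \<Omega> h x \<le> (LINT y|lebesgue. mollifier (h / 2) (x - y))"
      unfolding cutoff_def fun_conv_def using True mi h
      by (intro integral_mono) (auto simp: indicator_def mollifier_nonneg)
    also have "\<dots> = 1" using h by (simp add: mollifier_reflect_integral)
    finally show ?thesis .
  qed (simp add: cutoff_def fun_conv_def not_integrable_integral_eq)
qed

text \<open>The mollified set keeps the distance \<open>5 * h / 2\<close> from the frontier and the
  mollifier reaches \<open>h / 2\<close>, so the cutoff lives at distance at least
  \<open>2 * h\<close>.\<close>

lemma cutoff_eq_0:
  assumes h: "0 < h" and x: "\<not> (x \<in> \<Omega> \<and> 2 * h \<le> infdist x (frontier \<Omega>))"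
  shows "cutoff \<Omega> h x = 0"
proof -
  have "mollifier (h / 2) (x - y) *\<^sub>R indicator (inner_set \<Omega> (5 * h / 2)) y = (0::real)" for y
  proof (cases "y \<in> inner_set \<Omega> (5 * h / 2) \<and> dist y x < h / 2")
    case True
    then have y: "y \<in> \<Omega>" "5 * h / 2 < infdist y (frontier \<Omega>)" by (auto simp: inner_set_def)
    have "x \<in> ball y (infdist y (frontier \<Omega>))" using True y h by simp
    then have "x \<in> \<Omega>" using ball_infdist_frontier_subset[OF y(1)] by blast
    moreover have "2 * h \<le> infdist x (frontier \<Omega>)"
      using infdist_lipschitz[of y "frontier \<Omega>" x] y True by (simp add: dist_commute)
    ultimately show ?thesis using x by blast
  next
    case False
    then show ?thesis
      using mollifier_eq_0[of "h / 2" "x - y"] h by (auto simp: indicator_def dist_norm norm_minus_commute)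
  qed
  then show ?thesis unfolding cutoff_def fun_conv_def by (simp only: Bochner_Integration.integral_zero)
qed

text \<open>The other edge of the transition layer, at \<open>5 * h / 2 + h / 2 = 3 * h\<close>:
  beyond it the mollifier sees only points of the mollified set.\<close>

lemma cutoff_eq_1:
  assumes h: "0 < h" and x: "x \<in> \<Omega>" "3 * h < infdist x (frontier \<Omega>)"
  shows "cutoff \<Omega> h x = 1"
proof -
  have "mollifier (h / 2) (x - y) *\<^sub>R indicator (inner_set \<Omega> (5 * h / 2)) y =
    mollifier (h / 2) (x - y)" for y
  proof (cases "dist x y < h / 2")
    case True
    then have "y \<in> ball x (infdist x (frontier \<Omega>))" using x h by simp
    then have "y \<in> \<Omega>" using ball_infdist_frontier_subset[OF x(1)] by blast
    moreover have "5 * h / 2 < infdist y (frontier \<Omega>)"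
      using infdist_lipschitz[of x "frontier \<Omega>" y] x True by (simp add: dist_commute)
    ultimately show ?thesis by (simp add: inner_set_def)
  next
    case False
    then show ?thesis
      using mollifier_eq_0[of "h / 2" "x - y"] h by (auto simp: dist_norm)
  qed
  then show ?thesis unfolding cutoff_def fun_conv_def using h by (simp only: mollifier_reflect_integral half_gt_zero)
qed

lemma cutoff_C0_infinity:
  assumes "open \<Omega>" "bounded \<Omega>" "0 < h"
  shows "cutoff \<Omega> h \<in> C0_infinity \<Omega>"
  unfolding C0_infinity_iff
  using cutoff_smooth[OF assms] cutoff_eq_0[OF assms(3)] inner_closed_compact[OF assms(1,2), of "2 * h"] assms(3)
  by (intro conjI exI[of _ "{x \<in> \<Omega>. 2 * h \<le> infdist x (frontier \<Omega>)}"]) auto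

lemma cutoff_derivative_eq_0:
  assumes \<Omega>: "open \<Omega>" "bounded \<Omega>" and h: "0 < h"
    and x: "\<not> (x \<in> \<Omega> \<and> 2 * h \<le> infdist x (frontier \<Omega>) \<and> infdist x (frontier
      \<Omega>) \<le> 3 * h)"
  shows "frechet_derivative (cutoff \<Omega> h) (at x) v = 0"
proof (cases "x \<in> inner_set \<Omega> (3 * h)")
  case True
  have "(cutoff \<Omega> h has_derivative (\<lambda>_. 0)) (at x)"
    by (rule has_derivative_transform_within_open[OF has_derivative_const[of 1] inner_set_open[OF \<Omega>(1)] True])
       (use h in \<open>auto simp: inner_set_def cutoff_eq_1\<close>)
  then show ?thesis by (rule frechet_derivative_eqI)
next
  case False
  show ?thesis
    by (rule frechet_derivative_eq_0_outside[of "{x \<in> \<Omega>. 2 * h \<le> infdist x (frontier \<Omega>)}"])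
      (use False x h \<Omega> in \<open>auto simp: inner_set_def cutoff_eq_0 intro!: compact_imp_closed
        inner_closed_compact\<close>)
qed

text \<open>The derivative falls on the mollifier at scale \<open>h / 2\<close>; there it is bounded
  by a multiple of \<open>1 / (h / 2) ^ (DIM('a) + 1)\<close>, on a ball of volume proportional to
  \<open>(h / 2) ^ DIM('a)\<close>. \<open>L\<close> is the same for all domains.\<close>

lemma cutoff_derivative_bound:
  obtains L where "0 < L"
    "\<And>\<Omega> h x v. open \<Omega> \<Longrightarrow> bounded \<Omega> \<Longrightarrow>
      0 < h \<Longrightarrow> \<bar>frechet_derivative (cutoff \<Omega> h) (at (x::'a::euclidean_space)) v\<bar>
      \<le> L / h * norm v"
proof -
  obtain L where L: "0 < L" "\<And>h x v. 0 < h \<Longrightarrow> \<bar>frechet_derivative (mollifier h) (at (x::'a))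
    v\<bar> \<le> L / h ^ (DIM('a) + 1) * norm v"
    using mollifier_derivative_bound by blast
  define \<omega> where "\<omega> = unit_ball_vol (real DIM('a))"
  have \<omega>: "0 < \<omega>" by (simp add: \<omega>_def)
  have "\<bar>frechet_derivative (cutoff \<Omega> h) (at x) v\<bar> \<le> (2 * L * \<omega>) / h * norm v"
    if \<Omega>: "open \<Omega>" "bounded \<Omega>" and h: "0 < h" for \<Omega> h and x v :: 'a
  proof -
    let ?S = "inner_set \<Omega> (5 * h / 2)"
    have m: "mollifier (h / 2) \<in> C0_infinity (UNIV :: 'a set)" using h by (intro mollifier_C0_infinity) simp
    have i: "integrable lebesgue (indicator ?S :: 'a \<Rightarrow> real)"
      using \<Omega> by (intro integrable_indicator_open inner_set_open) (auto intro: bounded_subset simp: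
        inner_set_def)
    have "frechet_derivative (cutoff \<Omega> h) (at x) v =
      fun_conv (\<lambda>x. frechet_derivative (mollifier (h / 2)) (at x) v) (indicator ?S) x"
      unfolding cutoff_def by (rule frechet_derivative_eqI[OF fun_conv_has_derivative[OF m i]])
    also have "\<bar>\<dots>\<bar> \<le> (L / (h / 2) ^ (DIM('a) + 1) * norm v) * (\<omega> * (h / 2) ^ DIM('a))"
      unfolding \<omega>_def
    proof (rule fun_conv_bounded)
      show "frechet_derivative (mollifier (h / 2)) (at y) v = 0" if "h / 2 \<le> norm y" for y :: 'a
      proof -
        have cl: "frechet_derivative (mollifier (h / 2)) (at y) v = 0" if "y \<notin> cball 0 (h / 2)" for y :: 'a
          by (rule frechet_derivative_eq_0_outside[of "cball 0 (h / 2)"]) (use that h in \<open>auto intro!: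
            mollifier_eq_0\<close>)
        \<comment> \<open>\<open>cl\<close> covers only the exterior of the closed ball. On the
          sphere itself the derivative vanishes by continuity, as the multiples
          \<open>c *\<^sub>R y\<close> with \<open>c\<close> slightly above 1 lie outside.\<close>
        show ?thesis
        proof (rule ccontr)
          let ?d = "\<lambda>y::'a. frechet_derivative (mollifier (h / 2)) (at y) v"
          assume ne: "?d y \<noteq> 0"
          have "continuous_on UNIV ?d"
            by (rule C0_infinity_continuous[OF C0_infinity_frechet[OF m]])
          then have "open (?d -` (- {0}))" by (intro open_vimage) auto
          then obtain e where e: "0 < e" "ball y e \<subseteq> ?d -` (- {0})" using ne open_contains_ball by blast
          have yn: "0 < norm y" using that h by linarith
          define c where "c = 1 + e / (2 * norm y)"
          have "dist y (c *\<^sub>R y) = e / 2"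
            using yn e by (simp add: c_def dist_norm scaleR_left_distrib)
          then have "c *\<^sub>R y \<in> ball y e" using e by simp
          moreover have "norm (c *\<^sub>R y) > norm y" using yn e by (simp add: c_def)
          then have "c *\<^sub>R y \<notin> cball 0 (h / 2)" using that by simp
          ultimately show False using cl e by blast
        qed
      qed
      show "\<bar>frechet_derivative (mollifier (h / 2)) (at y) v\<bar> \<le>
        L / (h / 2) ^ (DIM('a) + 1) * norm v" for y
        by (rule L(2)) (use h in simp)
      show "0 \<le> L / (h / 2) ^ (DIM('a) + 1) * norm v" using L h by simp
    qed (use h in \<open>auto simp: indicator_def\<close>)
    also have "\<dots> = (2 * L * \<omega>) / h * norm v"
      using h by (simp add: field_simps)
    finally show ?thesis .
  qed
  with L \<omega> show ?thesis by (intro that[of "2 * L * \<omega>"]) auto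
qed

text \<open>For \<open>h\<close> beyond the size of \<Omega> no point is far enough from the
  frontier, and the smoothing is identically 0. This reduces a supremum over all
  \<open>h > 0\<close> to a bounded range of radii.\<close>

lemma cutoff_large_eq_0:
  fixes \<Omega> :: "'a::euclidean_space set"
  assumes "bounded \<Omega>" "\<Omega> \<noteq> {}"
  obtains H where "0 < H" "\<And>h x. H < h \<Longrightarrow> cutoff \<Omega> h x = 0"
proof -
  have "bounded (closure \<Omega>)" using assms(1) by (rule bounded_closure)
  then obtain R where R: "0 < R" "\<And>x. x \<in> closure \<Omega> \<Longrightarrow> norm x \<le> R"
    by (meson bounded_pos)
  obtain y where y: "y \<in> frontier \<Omega>" using frontier_bounded_nonempty[OF assms] by blast
  show ?thesis
  proof (rule that[OF R(1)])
    fix h x assume h: "R < h"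
    have "infdist x (frontier \<Omega>) < 2 * h" if "x \<in> \<Omega>"
    proof -
      have "infdist x (frontier \<Omega>) \<le> dist x y" using y by (rule infdist_le)
      also have "\<dots> \<le> norm x + norm y" by (simp add: dist_norm norm_triangle_ineq4)
      also have "\<dots> \<le> R + R"
        using R(2)[of x] R(2)[of y] that y closure_subset by (intro add_mono) (auto simp: frontier_def)
      finally show ?thesis using h by simp
    qed
    then show "cutoff \<Omega> h x = 0" using R h by (intro cutoff_eq_0) auto
  qed
qed

section \<open>The symmetric gradient of the smoothing\<close>

text \<open>For fixed \<open>z\<close> and \<open>s\<close> the kernel of the smoothing is, in the
  spatial variable, a test function on \<Omega> thanks to the cutoff, wherever \<open>z\<close>
  lies. The minus sign in the derivative stems from the reflection in
  \<open>z - (s, y)\<close>.\<close>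

lemma smoothing_C0_test:
  fixes \<Omega> :: "(real ^ 'd) set" and z :: "real \<times> (real ^ 'd)" and s :: real
  assumes \<Omega>: "open \<Omega>" "bounded \<Omega>" and h: "0 < h"
  defines "\<theta> \<equiv> \<lambda>y. mollifier h (z - (s, y)) * cutoff \<Omega> h y"
  shows "\<theta> \<in> C0_infinity \<Omega>"
    "frechet_derivative \<theta> (at y) v =
      - frechet_derivative (mollifier h) (at (z - (s, y))) (0, v) * cutoff \<Omega> h y +
      mollifier h (z - (s, y)) * frechet_derivative (cutoff \<Omega> h) (at y) v"
proof -
  let ?m = "mollifier h :: real \<times> (real ^ 'd) \<Rightarrow> real"
  have m: "?m \<in> C0_infinity UNIV" by (rule mollifier_C0_infinity[OF h])
  have \<eta>: "cutoff \<Omega> h \<in> C0_infinity \<Omega>" by (rule cutoff_C0_infinity[OF \<Omega> h])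
  have A: "bounded_linear (\<lambda>y::real^'d. (0::real, - y))"
    by (intro bounded_linear_Pair bounded_linear_zero bounded_linear_minus bounded_linear_ident)
  define c where "c = z - (s, 0)"
  have eq: "z - (s, y) = c + (0, - y)" for y by (simp add: c_def prod_eq_iff)
  have "C_k_on k UNIV \<theta>" for k
    unfolding \<theta>_def eq
    by (intro C_k_on_bilinear[OF bounded_bilinear_mult] C_k_on_affine[OF A open_UNIV UNIV_I]
        smooth_on_C_k C0_infinity_smooth[OF m] C0_infinity_smooth[OF \<eta>] open_UNIV)
  moreover obtain K where "compact K" "K \<subseteq> \<Omega>" "\<And>x. x \<notin> K \<Longrightarrow>
    cutoff \<Omega> h x = 0"
    using \<eta> unfolding C0_infinity_iff by blast
  ultimately show "\<theta> \<in> C0_infinity \<Omega>"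
    unfolding C0_infinity_iff smooth_on_def by (auto simp: \<theta>_def intro!: exI[of _ K])
  have dA: "((\<lambda>y. z - (s, y)) has_derivative (\<lambda>v. (0, - v))) (at y)"
    unfolding eq by (auto intro!: derivative_eq_intros bounded_linear_imp_has_derivative[OF A])
  have "(\<theta> has_derivative (\<lambda>v. ?m (z - (s, y)) * frechet_derivative (cutoff \<Omega> h) (at y) v +
      frechet_derivative ?m (at (z - (s, y))) (0, - v) * cutoff \<Omega> h y)) (at y)"
    unfolding \<theta>_def
    by (intro has_derivative_mult has_derivative_compose[OF dA] smooth_on_has_derivative[OF C0_infinity_smooth[OF m]]
        smooth_on_has_derivative[OF C0_infinity_smooth[OF \<eta>]] UNIV_I)
  from frechet_derivative_eqI[OF this, of v] show "frechet_derivative \<theta> (at y) v =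
      - frechet_derivative (mollifier h) (at (z - (s, y))) (0, v) * cutoff \<Omega> h y +
      mollifier h (z - (s, y)) * frechet_derivative (cutoff \<Omega> h) (at y) v"
    using linear_neg[OF bounded_linear.linear[OF smooth_on_linear_frechet[OF C0_infinity_smooth[OF m] UNIV_I]], of "z
      - (s, y)" "(0, v)"]
    by simp
qed

definition cutoff_commutator :: "(real ^ 'd::finite) set \<Rightarrow> real \<Rightarrow> (real \<times> (real ^ 'd)
  \<Rightarrow> real ^ 'd) \<Rightarrow>
    real \<times> (real ^ 'd) \<Rightarrow> real ^ 'd ^ 'd" where
  "cutoff_commutator \<Omega> h U w = (\<chi> i j. (1/2) *
    (frechet_derivative (cutoff \<Omega> h) (at (snd w)) (dir_x j) * U w $ i +
     frechet_derivative (cutoff \<Omega> h) (at (snd w)) (dir_x i) * U w $ j))"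

lemma zero_ext_integrable:
  fixes f :: "'a::euclidean_space \<Rightarrow> 'b::euclidean_space"
  shows "G \<in> sets lebesgue \<Longrightarrow> integrable lebesgue (zero_ext G f) \<longleftrightarrow> integrable
    (lebesgue_on G) f"
proof -
  have ze: "zero_ext G f = (\<lambda>z. indicator G z *\<^sub>R f z)"
    by (auto simp: zero_ext_def indicator_def)
  show "G \<in> sets lebesgue \<Longrightarrow> integrable lebesgue (zero_ext G f) \<longleftrightarrow> integrable
    (lebesgue_on G) f"
    by (simp add: ze integrable_lebesgue_on_iff)
qed

lemma zero_ext_measurable:
  fixes f :: "'a::euclidean_space \<Rightarrow> 'b::euclidean_space"
  assumes "G \<in> sets lebesgue"
  shows "zero_ext G f \<in> borel_measurable lebesgue \<longleftrightarrow> f \<in> borel_measurable (lebesgue_on G)"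
  using borel_measurable_if[OF assms, of f] by (simp add: zero_ext_def[abs_def])

lemma zero_ext_norm_le: "norm (zero_ext G f x) \<le> norm (f x)"
  by (simp add: zero_ext_def)

lemma integrable_scaleR_snd:
  fixes f :: "'a::euclidean_space \<times> 'b::euclidean_space \<Rightarrow> 'c::euclidean_space"
  assumes f: "integrable lebesgue f" and \<phi>: "\<phi> \<in> C0_infinity G"
  shows "integrable lebesgue (\<lambda>z. \<phi> (snd z) *\<^sub>R f z)"
proof -
  obtain B where B: "0 < B" "\<And>x. norm (\<phi> x) \<le> B" using C0_infinity_bounded[OF \<phi>] by blast
  from integrable_bounded_scaleR[OF f C0_infinity_snd_measurable[OF C0_infinity_continuous[OF \<phi>]], of B]
  show ?thesis using B by simp
qed

lemma norm_vec_le_sum: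
  fixes v :: "('b::euclidean_space) ^ 'd"
  assumes "\<And>i. norm (v $ i) \<le> B"
  shows "norm v \<le> real CARD('d) * B"
proof -
  have "norm v \<le> (\<Sum>i\<in>UNIV. norm (v $ i))" unfolding norm_vec_def by (rule L2_set_le_sum) simp
  also have "\<dots> \<le> (\<Sum>i\<in>(UNIV::'d set). B)" by (intro sum_mono assms)
  finally show ?thesis by simp
qed

lemma integrable_matI:
  fixes E :: "'a \<Rightarrow> real ^ 'd ^ 'd"
  assumes "\<And>i j. integrable M (\<lambda>x. E x $ i $ j)"
  shows "integrable M E"
proof -
  have v: "integrable M v" if "\<And>i. integrable M (\<lambda>x. v x $ i)" for v :: "'a \<Rightarrow>
    ('e::euclidean_space) ^ 'd"
  proof -
    have "bounded_linear (\<lambda>x::'e. axis i x :: 'e ^ 'd)" for i :: 'd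
    proof (rule bounded_linear_intro[where K = "real CARD('d)"])
      fix x :: 'e
      have "norm ((axis i x :: 'e ^ 'd) $ k) \<le> norm x" for k by (simp add: axis_def)
      then show "norm (axis i x :: 'e ^ 'd) \<le> norm x * real CARD('d)"
        using norm_vec_le_sum[of "axis i x :: 'e ^ 'd" "norm x"] by (simp add: mult.commute)
      fix y :: 'e and r :: real
      show "(axis i (x + y) :: 'e ^ 'd) = axis i x + axis i y" by (simp add: vec_eq_iff axis_def)
      show "(axis i (r *\<^sub>R x) :: 'e ^ 'd) = r *\<^sub>R axis i x" by (simp add: vec_eq_iff axis_def)
    qed
    then have "integrable M (\<lambda>x. \<Sum>i\<in>UNIV. axis i (v x $ i))"
      using that by (intro Bochner_Integration.integrable_sum integrable_bounded_linear[of "axis _"])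
    moreover have "(\<Sum>i\<in>UNIV. axis i (v x $ i)) = v x" for x
      by (simp add: vec_eq_iff axis_def if_distrib cong: if_cong)
    ultimately show ?thesis by simp
  qed
  show ?thesis by (intro v assms)
qed

lemma cutoff_commutator_integrable:
  assumes "open \<Omega>" "bounded \<Omega>" "0 < h" "integrable lebesgue U"
  shows "integrable lebesgue (cutoff_commutator \<Omega> h U)"
  unfolding cutoff_commutator_def
  by (rule integrable_matI)
     (auto simp: mult.commute[of "frechet_derivative _ _ _"] intro!: integrable_times_snd[OF integrable_vec_nth[OF
       assms(4)] C0_infinity_frechet[OF cutoff_C0_infinity[OF assms(1-3)]]])

lemma integral_mat_nth:
  fixes E :: "'a \<Rightarrow> real ^ 'd ^ 'd"
  assumes "integrable M E"
  shows "integral\<^sup>L M E $ i $ j = (LINT x|M. E x $ i $ j)"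
  unfolding integral_bounded_linear[OF bounded_linear_vec_nth assms, symmetric]
    integral_bounded_linear[OF bounded_linear_vec_nth integrable_bounded_linear[OF bounded_linear_vec_nth assms],
      symmetric] ..

lemma smoothing_smooth:
  assumes "open \<Omega>" "bounded \<Omega>" "0 < h" "integrable (lebesgue_on (cylinder T \<Omega>)) u"
  shows "smooth_on UNIV (smoothing T \<Omega> h u)"
    and "frechet_derivative (smoothing T \<Omega> h u) (at z) v =
      (LINT w|lebesgue. frechet_derivative (mollifier h) (at (z - w)) v *\<^sub>R (cutoff \<Omega> h (snd w)
        *\<^sub>R zero_ext (cylinder T \<Omega>) u w))"
proof -
  have i: "integrable lebesgue (\<lambda>z. cutoff \<Omega> h (snd z) *\<^sub>R zero_ext (cylinder T \<Omega>) u z)"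
    using assms by (intro integrable_scaleR_snd[OF _ cutoff_C0_infinity[OF assms(1-3)]])
      (simp add: zero_ext_integrable sets_lebesgue_open[OF open_cylinder])
  show "smooth_on UNIV (smoothing T \<Omega> h u)"
    unfolding smoothing_def by (rule smooth_on_fun_conv[OF mollifier_C0_infinity[OF assms(3)] i])
  show "frechet_derivative (smoothing T \<Omega> h u) (at z) v =
      (LINT w|lebesgue. frechet_derivative (mollifier h) (at (z - w)) v *\<^sub>R (cutoff \<Omega> h (snd w)
        *\<^sub>R zero_ext (cylinder T \<Omega>) u w))"
    unfolding smoothing_def frechet_derivative_eqI[OF fun_conv_has_derivative[OF mollifier_C0_infinity[OF assms(3)]
      i]]
    by (simp add: fun_conv_def)
qed

text \<open>Differentiating the smoothing puts the derivative on the mollifier. On almost every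
  slice the function of \<open>smoothing_C0_test\<close> is inserted into the weak formulation,
  which trades this term for one with \<open>E\<close> and one with the gradient of the cutoff;
  integration over \<open>s\<close> gives the identity at every \<open>z\<close>.\<close>

lemma eps_smoothing:
  fixes u :: "real \<times> (real ^ 'd) \<Rightarrow> real ^ 'd"
    and E :: "real \<times> (real ^ 'd) \<Rightarrow> real ^ 'd ^ 'd"
  assumes \<Omega>: "open \<Omega>" "bounded \<Omega>" and h: "0 < h"
    and u: "integrable (lebesgue_on (cylinder T \<Omega>)) u"
      and E: "integrable (lebesgue_on (cylinder T \<Omega>)) E"
    and w: "AE t in lebesgue_on {0<..<T}. has_weak_eps dir_x \<Omega> (\<lambda>x. u (t, x)) (\<lambda>x. E (t, x))"
  shows "classical_eps dir_tx (smoothing T \<Omega> h u) z =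
    fun_conv (mollifier h) (\<lambda>w. cutoff \<Omega> h (snd w) *\<^sub>R zero_ext (cylinder T \<Omega>) E w) z +
    fun_conv (mollifier h) (cutoff_commutator \<Omega> h (zero_ext (cylinder T \<Omega>) u)) z"
proof (intro vec_eq_iff[THEN iffD2] allI)
  fix i j :: 'd
  let ?Q = "cylinder T \<Omega>"
  let ?m = "mollifier h :: real \<times> (real ^ 'd) \<Rightarrow> real"
  note Qs = sets_lebesgue_open[OF open_cylinder[OF \<Omega>(1), of T]]
  define U where "U = zero_ext ?Q u"
  define EE where "EE = zero_ext ?Q E"
  define \<eta> where "\<eta> = cutoff \<Omega> h"
  have U: "integrable lebesgue U" and EE: "integrable lebesgue EE"
    using u E Qs by (simp_all add: U_def EE_def zero_ext_integrable)
  have m: "?m \<in> C0_infinity UNIV" by (rule mollifier_C0_infinity[OF h])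
  have \<eta>: "\<eta> \<in> C0_infinity \<Omega>" unfolding \<eta>_def by (rule cutoff_C0_infinity[OF \<Omega> h])
  define Dm where "Dm k w = frechet_derivative ?m (at (z - w)) (dir_tx k)" for k w
  define D\<eta> where "D\<eta> k y = frechet_derivative \<eta> (at y) (dir_x k)" for k y
  have U\<eta>: "integrable lebesgue (\<lambda>w. U w $ k * \<eta> (snd w))" for k
    by (intro integrable_times_snd[OF integrable_vec_nth[OF U] \<eta>])
  have UD\<eta>: "integrable lebesgue (\<lambda>w. U w $ k * D\<eta> l (snd w))" for k l
    unfolding D\<eta>_def by (intro integrable_times_snd[OF integrable_vec_nth[OF U] C0_infinity_frechet[OF \<eta>]])
  have iD: "integrable lebesgue (\<lambda>w. Dm l w * (U w $ k * \<eta> (snd w)))" for k l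
    using integrable_conv[OF C0_infinity_frechet[OF m] U\<eta>] by (simp add: Dm_def)
  have i\<eta>: "integrable lebesgue (\<lambda>w. ?m (z - w) * (U w $ k * D\<eta> l (snd w)))" for k l
    using integrable_conv[OF m UD\<eta>] by simp
  have iE: "integrable lebesgue (\<lambda>w. ?m (z - w) * (EE w $ i $ j * \<eta> (snd w)))"
    using integrable_conv[OF m integrable_times_snd[OF integrable_mat_nth[OF EE] \<eta>]] by simp
  \<comment> \<open>The weak formulation on the slices, written as one integrand on space-time: its
    integral over almost every slice is 0, and so is its total integral.\<close>
  define b where "b w = ?m (z - w) * (EE w $ i $ j * \<eta> (snd w)) +
    (1/2) * ((?m (z - w) * (U w $ i * D\<eta> j (snd w)) - Dm j w * (U w $ i * \<eta> (snd w))) +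
             (?m (z - w) * (U w $ j * D\<eta> i (snd w)) - Dm i w * (U w $ j * \<eta> (snd w))))" for w
  have b: "integrable lebesgue b"
    unfolding b_def[abs_def]
    by (intro Bochner_Integration.integrable_add Bochner_Integration.integrable_diff integrable_mult_right iD i\<eta>
      iE)
  have I: "{0<..<T} \<in> sets lebesgue" and Os: "\<Omega> \<in> sets lebesgue" using \<Omega> by simp_all
  have "AE s in lebesgue. s \<in> {0<..<T} \<longrightarrow> has_weak_eps dir_x \<Omega> (\<lambda>x. u (s, x))
    (\<lambda>x. E (s, x))"
    using w I by (subst (asm) AE_restrict_space_iff) auto
  then have "AE s in lebesgue. (LINT y|lebesgue. b (s, y)) = 0"
  proof eventually_elim
    case (elim s)
    show ?case
    proof (cases "s \<in> {0<..<T}")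
      \<comment> \<open>Outside the time interval all terms vanish by the extension with zero, so
        the ends of the interval cause no extra term.\<close>
      case False
      then have "(s, y) \<notin> ?Q" for y by (auto simp: mem_cylinder)
      then have "b (s, y) = 0" for y
        by (simp add: b_def U_def EE_def zero_ext_def)
      then show ?thesis by simp
    next
      case True
      with elim have we: "has_weak_eps dir_x \<Omega> (\<lambda>x. u (s, x)) (\<lambda>x. E (s, x))" by blast
      note lw = has_weak_eps_loc_integrable[OF we]
      let ?\<theta> = "\<lambda>y. mollifier h (z - (s, y)) * cutoff \<Omega> h y"
      note \<theta> = smoothing_C0_test(1)[OF \<Omega> h, of z s]
      note c = loc_integrable_test_comp[OF Os \<theta>]
      have d: "frechet_derivative ?\<theta> (at y) (dir_x k) =
        - Dm k (s, y) * \<eta> y + ?m (z - (s, y)) * D\<eta> k y" for k y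
        unfolding smoothing_C0_test(2)[OF \<Omega> h]
          by (simp add: Dm_def D\<eta>_def \<eta>_def dir_x_def dir_tx_def)
      have "(LINT y|lebesgue. b (s, y)) = (LINT y|lebesgue_on \<Omega>. E (s, y) $ i $ j * ?\<theta> y +
          (1/2) * (u (s, y) $ i * frechet_derivative ?\<theta> (at y) (dir_x j) +
            u (s, y) $ j * frechet_derivative ?\<theta> (at y) (dir_x i)))"
        unfolding integral_lebesgue_on_eq[OF Os] d
        by (intro Bochner_Integration.integral_cong refl)
           (use True in \<open>simp add: b_def U_def EE_def zero_ext_def mem_cylinder indicator_def \<eta>_def
             algebra_simps\<close>)
      also have "\<dots> = (LINT y|lebesgue_on \<Omega>. E (s, y) $ i $ j * ?\<theta> y) +
          (1/2) * (LINT y|lebesgue_on \<Omega>. u (s, y) $ i * frechet_derivative ?\<theta> (at y) (dir_x j) +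
            u (s, y) $ j * frechet_derivative ?\<theta> (at y) (dir_x i))"
        using c(2)[OF lw(2)] c(3)[OF lw(1)] by (subst Bochner_Integration.integral_add) simp_all
      also have "\<dots> = 0" unfolding has_weak_epsD[OF we \<theta>] by simp
      finally show ?thesis .
    qed
  qed
  then have "(LINT w|lebesgue. b w) = 0"
    unfolding integral_slices(2)[OF b]
      using integral_cong_AE[of _ lebesgue "\<lambda>_. 0"] integral_slices(3)[OF b] by auto
  then have b0: "(LINT w|lebesgue. ?m (z - w) * (EE w $ i $ j * \<eta> (snd w))) +
    (1/2) * (((LINT w|lebesgue. ?m (z - w) * (U w $ i * D\<eta> j (snd w))) - (LINT w|lebesgue. Dm j w *
      (U w $ i * \<eta> (snd w)))) +
             ((LINT w|lebesgue. ?m (z - w) * (U w $ j * D\<eta> i (snd w))) - (LINT w|lebesgue. Dm i w *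
               (U w $ j * \<eta> (snd w))))) = 0"
    unfolding b_def[abs_def] using iD i\<eta> iE by simp
  have W: "integrable lebesgue (\<lambda>w. \<eta> (snd w) *\<^sub>R U w)"
    by (rule integrable_scaleR_snd[OF U \<eta>])
  have comp: "frechet_derivative (smoothing T \<Omega> h u) (at z) (dir_tx l) $ k =
    (LINT w|lebesgue. Dm l w * (U w $ k * \<eta> (snd w)))" for k l
  proof -
    have "frechet_derivative (smoothing T \<Omega> h u) (at z) (dir_tx l) $ k =
      (LINT w|lebesgue. Dm l w *\<^sub>R (\<eta> (snd w) *\<^sub>R U w)) $ k"
      unfolding smoothing_smooth(2)[OF \<Omega> h u] by (simp add: Dm_def U_def \<eta>_def)
    also have "\<dots> = (LINT w|lebesgue. (Dm l w *\<^sub>R (\<eta> (snd w) *\<^sub>R U w)) $ k)"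
      unfolding Dm_def by (rule integral_bounded_linear[OF bounded_linear_vec_nth integrable_conv[OF
        C0_infinity_frechet[OF m] W], symmetric])
    also have "\<dots> = (LINT w|lebesgue. Dm l w * (U w $ k * \<eta> (snd w)))" by (simp add: mult_ac)
    finally show ?thesis .
  qed
  have f1: "fun_conv ?m (\<lambda>w. \<eta> (snd w) *\<^sub>R EE w) z $ i $ j =
    (LINT w|lebesgue. ?m (z - w) * (EE w $ i $ j * \<eta> (snd w)))"
    unfolding fun_conv_def
    by (subst integral_mat_nth[OF integrable_conv[OF m integrable_scaleR_snd[OF EE \<eta>]]]) (simp add: mult_ac)
  have "fun_conv ?m (cutoff_commutator \<Omega> h U) z $ i $ j =
      (LINT w|lebesgue. (1/2) * (?m (z - w) * (U w $ i * D\<eta> j (snd w)) +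
        ?m (z - w) * (U w $ j * D\<eta> i (snd w))))"
    unfolding fun_conv_def
    by (subst integral_mat_nth[OF integrable_conv[OF m cutoff_commutator_integrable[OF \<Omega> h U]]])
       (simp add: cutoff_commutator_def D\<eta>_def \<eta>_def algebra_simps)
  also have "\<dots> = (1/2) * ((LINT w|lebesgue. ?m (z - w) * (U w $ i * D\<eta> j (snd w))) +
    (LINT w|lebesgue. ?m (z - w) * (U w $ j * D\<eta> i (snd w))))"
    using i\<eta> by simp
  finally have f2: "fun_conv ?m (cutoff_commutator \<Omega> h U) z $ i $ j =
      (1/2) * ((LINT w|lebesgue. ?m (z - w) * (U w $ i * D\<eta> j (snd w))) +
        (LINT w|lebesgue. ?m (z - w) * (U w $ j * D\<eta> i (snd w))))" .
  have "classical_eps dir_tx (smoothing T \<Omega> h u) z $ i $ j =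
      (1/2) * ((LINT w|lebesgue. Dm j w * (U w $ i * \<eta> (snd w))) +
        (LINT w|lebesgue. Dm i w * (U w $ j * \<eta> (snd w))))"
    by (simp add: classical_eps_def comp)
  also have "\<dots> = fun_conv ?m (\<lambda>w. \<eta> (snd w) *\<^sub>R EE w) z $ i $ j +
    fun_conv ?m (cutoff_commutator \<Omega> h U) z $ i $ j"
  proof -
    have "(1/2) * (C1 + C2) = A + (1/2) * (B1 + B2)" if "A + (1/2) * ((B1 - C1) + (B2 - C2)) =
      0" for A B1 B2 C1 C2 :: real
      using that by (simp add: field_simps)
    from this[OF b0] show ?thesis unfolding f1 f2 .
  qed
  finally show "classical_eps dir_tx (smoothing T \<Omega> h u) z $ i $ j =
    (fun_conv ?m (\<lambda>w. cutoff \<Omega> h (snd w) *\<^sub>R zero_ext ?Q E w) z +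
      fun_conv ?m (cutoff_commutator \<Omega> h (zero_ext ?Q u)) z) $ i $ j"
    unfolding U_def EE_def \<eta>_def by simp
qed

text \<open>Entrywise bound; the factor \<open>real CARD('d)\<close> enters twice, for the rows and
  for the entries of a row.\<close>

lemma cutoff_commutator_bound:
  obtains L where "0 < L" "\<And>\<Omega> h (U :: real \<times> (real ^ 'd) \<Rightarrow> real ^ 'd) w. open \<Omega>
    \<Longrightarrow> bounded \<Omega> \<Longrightarrow> 0 < h \<Longrightarrow>
    norm (cutoff_commutator \<Omega> h U w) \<le> L / h * (norm (U w) *
      indicator {y \<in> \<Omega>. 2 * h \<le> infdist y (frontier \<Omega>) \<and> infdist y (frontier \<Omega>)
        \<le> 3 * h} (snd w))"
proof -
  obtain L where L: "0 < L" "\<And>\<Omega> h x v. open \<Omega> \<Longrightarrow>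
    bounded \<Omega> \<Longrightarrow> 0 < h \<Longrightarrow>
     \<bar>frechet_derivative (cutoff \<Omega> h) (at (x::real ^ 'd)) v\<bar> \<le> L / h * norm v"
    using cutoff_derivative_bound by blast
  let ?d = "real CARD('d)"
  have "norm (cutoff_commutator \<Omega> h U w) \<le> (?d * (?d * L)) / h * (norm (U w) *
      indicator {y \<in> \<Omega>. 2 * h \<le> infdist y (frontier \<Omega>) \<and> infdist y (frontier \<Omega>)
        \<le> 3 * h} (snd w))"
    if \<Omega>: "open \<Omega>" "bounded \<Omega>" "0 < h" for \<Omega> h
      and U :: "real \<times> (real ^ 'd) \<Rightarrow> real ^ 'd" and w
  proof (cases "snd w \<in> {y \<in> \<Omega>. 2 * h \<le>
    infdist y (frontier \<Omega>) \<and> infdist y (frontier \<Omega>) \<le> 3 * h}")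
    case True
    have "norm (cutoff_commutator \<Omega> h U w $ i $ j) \<le> L / h * norm (U w)" for i j
    proof -
      have e: "\<bar>frechet_derivative (cutoff \<Omega> h) (at (snd w)) (dir_x k) * U w $ l\<bar> \<le>
        L / h * norm (U w)" for k l
        unfolding abs_mult using L(2)[OF \<Omega>, of "snd w" "dir_x k"] component_le_norm_cart[of "U w" l] L(1)
          \<Omega>(3)
        by (intro mult_mono) (auto simp: dir_x_def norm_axis_1)
      have half: "norm ((1/2) * (a + b)) \<le> X" if "\<bar>a\<bar> \<le> X" "\<bar>b\<bar> \<le> X" for a b X :: real
        using that by (simp add: abs_le_iff)
      show ?thesis
        unfolding cutoff_commutator_def vec_lambda_beta by (rule half[OF e e])
    qed
    then have "norm (cutoff_commutator \<Omega> h U w $ i) \<le> ?d * (L / h * norm (U w))" for i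
      by (rule norm_vec_le_sum)
    then have "norm (cutoff_commutator \<Omega> h U w) \<le> ?d * (?d * (L / h * norm (U w)))"
      by (rule norm_vec_le_sum)
    then show ?thesis using True by (simp add: mult_ac)
  next
    case False
    then have "cutoff_commutator \<Omega> h U w = 0"
      using cutoff_derivative_eq_0[OF \<Omega>, of "snd w"] by (simp add: cutoff_commutator_def vec_eq_iff)
    then show ?thesis using L \<Omega> by simp
  qed
  then show ?thesis using L by (intro that[of "?d * (?d * L)"]) auto
qed

lemma nn_integral_prod:
  fixes f :: "'a::euclidean_space \<times> 'b::euclidean_space \<Rightarrow> ennreal"
  assumes "f \<in> borel_measurable borel"
  shows "(\<integral>\<^sup>+w. f w \<partial>lebesgue) =
    (\<integral>\<^sup>+s. \<integral>\<^sup>+y. f (s, y) \<partial>lebesgue \<partial>lebesgue)"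
proof -
  have "f \<in> borel_measurable (lborel \<Otimes>\<^sub>M lborel)" using assms by (simp add: lborel_prod)
  from lborel.nn_integral_fst[OF this] show ?thesis by (simp add: nn_integral_completion lborel_prod)
qed

text \<open>Integrating a slicewise Riesz potential estimate over a space-time ball; Tonelli moves the
  kernel to the inner integral, whose value is proportional to the radius.\<close>

lemma strip_potential_bound:
  fixes U :: "real \<times> (real ^ 'd) \<Rightarrow> 'b::euclidean_space"
    and E :: "real \<times> (real ^ 'd) \<Rightarrow> 'c::euclidean_space"
  assumes U: "U \<in> borel_measurable lebesgue" and E: "E \<in> borel_measurable lebesgue"
    and A: "A \<in> sets borel" and S: "S \<in> sets borel" and \<rho>: "0 < \<rho>"
    and C: "\<And>R (z :: real ^ 'd). 0 < R \<Longrightarrow>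
      (\<integral>\<^sup>+y. ennreal (norm (y - z) powr (1 - real DIM(real ^ 'd))) *
        indicator (ball z R) y \<partial>lebesgue) \<le> ennreal (C * R)"
    and ae: "AE s in lebesgue. AE y in lebesgue. ennreal (norm (U (s, y))) * indicator A y \<le> ennreal c0 *
      (\<integral>\<^sup>+y'. ennreal (norm (E (s, y'))) * ennreal (norm (y - y') powr (1 - real DIM(real ^ 'd))) *
         (if dist y y' < \<rho> then 1 else 0) * indicator S y' \<partial>lebesgue)"
  shows "(\<integral>\<^sup>+w. ennreal (norm (U w)) * indicator A (snd w) *
    indicator (ball z r) w \<partial>lebesgue) \<le>
    ennreal c0 * (ennreal (C * \<rho>) * (\<integral>\<^sup>+w. ennreal (norm (E w)) * indicator S (snd w) *
      indicator (ball z (2 * r + \<rho>)) w \<partial>lebesgue))"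
proof -
  define t where "t = fst z"
  define x where "x = snd z"
  have "(\<lambda>w. ennreal (norm (U w))) \<in> borel_measurable lebesgue" using U by measurable
  then obtain fU where fU0: "fU \<in> borel_measurable borel" "AE w in lebesgue. ennreal (norm (U w)) = fU w"
    by (rule lebesgue_borel_representative_ennreal)
  have "(\<lambda>w. ennreal (norm (E w))) \<in> borel_measurable lebesgue" using E by measurable
  then obtain fE where fE0: "fE \<in> borel_measurable borel" "AE w in lebesgue. ennreal (norm (E w)) = fE w"
    by (rule lebesgue_borel_representative_ennreal)
  have [measurable]: "fU \<in> borel_measurable (borel \<Otimes>\<^sub>M borel)" "fE \<in> borel_measurable (borel
    \<Otimes>\<^sub>M borel)"
    using fU0(1) fE0(1) by (simp_all add: borel_prod)
  note [measurable] = A S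
  let ?k = "\<lambda>y y'. ennreal (norm (y - y') powr (1 - real DIM(real ^ 'd))) *
    (if dist y y' < \<rho> then 1 else 0 :: ennreal)"
  \<comment> \<open>The space-time ball is enlarged to the product of a time interval and a spatial
    ball of the same radius \<open>r\<close>, so that Tonelli can be applied in space for fixed
    time.\<close>
  define I where "I s = (if dist t s < r then 1 else 0 :: ennreal)" for s
  define J where "J y = (if dist x y < r then 1 else 0 :: ennreal)" for y
  have [measurable]: "I \<in> borel_measurable borel" "J \<in> borel_measurable borel"
    unfolding I_def[abs_def] J_def[abs_def] by measurable
  have ae2: "AE s in lebesgue. AE y in lebesgue. fU (s, y) * indicator A y \<le> ennreal c0 *
      (\<integral>\<^sup>+y'. fE (s, y') * ?k y y' * indicator S y' \<partial>lebesgue)"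
    using ae AE_slices[OF fU0(2)] AE_slices[OF fE0(2)]
  proof eventually_elim
    case (elim s)
    have "(\<integral>\<^sup>+y'. ennreal (norm (E (s, y'))) *
      ennreal (norm (y - y') powr (1 - real DIM(real ^ 'd))) *
         (if dist y y' < \<rho> then 1 else 0) * indicator S y' \<partial>lebesgue) =
           (\<integral>\<^sup>+y'. fE (s, y') * ?k y y' * indicator S y' \<partial>lebesgue)" for y
      using elim(3) by (intro nn_integral_cong_AE) (auto elim!: eventually_mono simp: mult.assoc)
    with elim(1,2) show ?case by (auto elim!: eventually_elim2)
  qed
  \<comment> \<open>Integrated over \<open>y\<close> first, the kernel is a Riesz kernel on the ball
    of radius \<open>\<rho>\<close> about \<open>y'\<close>, and only points \<open>y'\<close>
    within \<open>r + \<rho>\<close> of \<open>x\<close> contribute.\<close>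
  have inner: "(\<integral>\<^sup>+y. J y * ?k y y' \<partial>lebesgue) \<le>
    ennreal (C * \<rho>) * (if dist x y' < r + \<rho> then 1 else 0)" for y'
  proof (cases "dist x y' < r + \<rho>")
    case True
    have "(\<integral>\<^sup>+y. J y * ?k y y' \<partial>lebesgue) \<le>
      (\<integral>\<^sup>+y. ennreal (norm (y - y') powr (1 - real DIM(real ^ 'd))) *
      indicator (ball y' \<rho>) y \<partial>lebesgue)"
      by (intro nn_integral_mono) (auto simp: J_def indicator_def dist_commute)
    also have "\<dots> \<le> ennreal (C * \<rho>)" by (rule C[OF \<rho>])
    finally show ?thesis using True by simp
  next
    case False
    have "(\<integral>\<^sup>+y. J y * ?k y y' \<partial>lebesgue) =
      (\<integral>\<^sup>+y. 0 \<partial>(lebesgue :: (real ^ 'd) measure))"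
    proof (intro nn_integral_cong)
      fix y show "J y * ?k y y' = 0"
        using False dist_triangle[of x y' y] by (auto simp: J_def)
    qed
    then show ?thesis by simp
  qed
  have "(\<integral>\<^sup>+w. ennreal (norm (U w)) * indicator A (snd w) *
    indicator (ball z r) w \<partial>lebesgue) =
      (\<integral>\<^sup>+w. fU w * indicator A (snd w) * indicator (ball z r) w \<partial>lebesgue)"
    using fU0(2) by (intro nn_integral_cong_AE) (auto elim!: eventually_mono)
  also have "\<dots> \<le> (\<integral>\<^sup>+w. I (fst w) * (J (snd w) * (fU w *
    indicator A (snd w))) \<partial>lebesgue)"
  proof (intro nn_integral_mono)
    fix w :: "real \<times> (real ^ 'd)"
    have "dist t (fst w) \<le> dist z w" "dist x (snd w) \<le> dist z w"
      unfolding t_def x_def by (rule dist_fst_le dist_snd_le)+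
    then show "fU w * indicator A (snd w) * indicator (ball z r) w \<le>
      I (fst w) * (J (snd w) * (fU w * indicator A (snd w)))"
      by (auto simp: I_def J_def indicator_def)
  qed
  also have "\<dots> = (\<integral>\<^sup>+s. \<integral>\<^sup>+y. I s * (J y * (fU (s, y) *
    indicator A y)) \<partial>lebesgue \<partial>lebesgue)"
  proof -
    have "(\<lambda>w. I (fst w) * (J (snd w) * (fU w * indicator A (snd w)))) \<in> borel_measurable (borel
      \<Otimes>\<^sub>M borel)" by measurable
    then show ?thesis by (subst nn_integral_prod) (simp_all add: borel_prod)
  qed
  also have "\<dots> \<le> (\<integral>\<^sup>+s. I s * (ennreal c0 * (\<integral>\<^sup>+y'. fE (s, y') *
    indicator S y' * (ennreal (C * \<rho>) * (if dist x y' < r +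
    \<rho> then 1 else 0)) \<partial>lebesgue)) \<partial>lebesgue)"
  proof (rule nn_integral_mono_AE)
    from ae2 show "AE s in lebesgue. (\<integral>\<^sup>+y. I s * (J y * (fU (s, y) *
      indicator A y)) \<partial>lebesgue) \<le>
       I s * (ennreal c0 * (\<integral>\<^sup>+y'. fE (s, y') * indicator S y' * (ennreal (C * \<rho>) *
         (if dist x y' < r + \<rho> then 1 else 0)) \<partial>lebesgue))"
    proof eventually_elim
      case (elim s)
      let ?P = "\<lambda>y y'. J y * (fE (s, y') * ?k y y' * indicator S y')"
      have [measurable]: "(\<lambda>y'. fE (s, y')) \<in> borel_measurable borel" by measurable
      have km: "(\<lambda>y'. fE (s, y') * ?k y y' * indicator S y') \<in> borel_measurable lebesgue" for y
        by (intro borel_imp_lebesgue) measurable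
      have km2: "(\<lambda>y. J y * ?k y y') \<in> borel_measurable lebesgue" for y'
        by (intro borel_imp_lebesgue) measurable
      have "(\<lambda>(y, y'). ?P y y') \<in> borel_measurable (borel \<Otimes>\<^sub>M borel)" by measurable
      then have jm: "(\<lambda>(y, y'). ?P y y') \<in> borel_measurable borel" by (simp add: borel_prod)
      have sw: "(\<integral>\<^sup>+y. \<integral>\<^sup>+y'. ?P y y' \<partial>lebesgue \<partial>lebesgue) \<le>
          (\<integral>\<^sup>+y'. fE (s, y') * indicator S y' * (ennreal (C * \<rho>) * (if dist x y' < r +
            \<rho> then 1 else 0)) \<partial>lebesgue)"
        unfolding nn_integral_swap[OF jm]
      proof (intro nn_integral_mono)
        fix y'
        have "(\<integral>\<^sup>+y. ?P y y' \<partial>lebesgue) =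
          (\<integral>\<^sup>+y. fE (s, y') * indicator S y' * (J y * ?k y y') \<partial>lebesgue)"
          by (intro nn_integral_cong) (simp only: mult_ac)
        then have "(\<integral>\<^sup>+y. ?P y y' \<partial>lebesgue) =
          fE (s, y') * indicator S y' * (\<integral>\<^sup>+y. J y * ?k y y' \<partial>lebesgue)"
          unfolding nn_integral_cmult[OF km2] .
        then show "(\<integral>\<^sup>+y. ?P y y' \<partial>lebesgue) \<le>
          fE (s, y') * indicator S y' * (ennreal (C * \<rho>) * (if dist x y' < r + \<rho> then 1 else 0))"
          using mult_left_mono[OF inner[of y'], of "fE (s, y') * indicator S y'"] by (simp only: zero_le)
      qed
      have "(\<integral>\<^sup>+y. J y * (fU (s, y) * indicator A y) \<partial>lebesgue) \<le>
          (\<integral>\<^sup>+y. ennreal c0 * (\<integral>\<^sup>+y'. ?P y y' \<partial>lebesgue) \<partial>lebesgue)"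
        using elim
      proof (intro nn_integral_mono_AE, eventually_elim)
        case (elim y)
        have "J y * (fU (s, y) * indicator A y) \<le> J y * (ennreal c0 * (\<integral>\<^sup>+y'. fE (s, y') *
          ?k y y' * indicator S y' \<partial>lebesgue))"
          by (intro mult_left_mono elim) simp
        then show ?case unfolding nn_integral_cmult[OF km] by (simp only: mult_ac)
      qed
      then have *: "(\<integral>\<^sup>+y. J y * (fU (s, y) * indicator A y) \<partial>lebesgue) \<le>
          ennreal c0 * (\<integral>\<^sup>+y'. fE (s, y') * indicator S y' * (ennreal (C * \<rho>) *
            (if dist x y' < r + \<rho> then 1 else 0)) \<partial>lebesgue)"
        unfolding nn_integral_cmult[OF borel_imp_lebesgue[OF borel_measurable_nn_integral_lebesgue[OF jm]]]
        by (rule order_trans[OF _ mult_left_mono[OF sw]]) simp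
      have "(\<integral>\<^sup>+y. I s * (J y * (fU (s, y) * indicator A y)) \<partial>lebesgue) \<le>
        I s * (\<integral>\<^sup>+y. J y * (fU (s, y) * indicator A y) \<partial>lebesgue)"
        by (simp add: I_def)
      also have "\<dots> \<le> I s * (ennreal c0 * (\<integral>\<^sup>+y'. fE (s, y') * indicator S y' *
        (ennreal (C * \<rho>) * (if dist x y' < r + \<rho> then 1 else 0)) \<partial>lebesgue))"
        by (intro mult_left_mono *) auto
      finally show ?case .
    qed
  qed
  also have "\<dots> = ennreal c0 * (ennreal (C * \<rho>) * (\<integral>\<^sup>+s. \<integral>\<^sup>+y'. I s *
    (fE (s, y') * indicator S y' * (if dist x y' < r + \<rho> then 1 else 0)) \<partial>lebesgue \<partial>lebesgue))"
  proof -
    have jm: "(\<lambda>(s, y'). I s * (fE (s, y') * indicator S y' * (if dist x y' < r +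
      \<rho> then 1 else 0))) \<in> borel_measurable borel"
    proof -
      have "(\<lambda>(s, y'). I s * (fE (s, y') * indicator S y' * (if dist x y' < r +
        \<rho> then 1 else 0))) \<in> borel_measurable (borel \<Otimes>\<^sub>M borel)" by measurable
      then show ?thesis by (simp add: borel_prod)
    qed
    have "I s * (ennreal c0 * (\<integral>\<^sup>+y'. fE (s, y') * indicator S y' * (ennreal (C * \<rho>) *
      (if dist x y' < r + \<rho> then 1 else 0)) \<partial>lebesgue)) =
        ennreal c0 * (ennreal (C * \<rho>) * (\<integral>\<^sup>+y'. I s * (fE (s, y') * indicator S y' *
          (if dist x y' < r + \<rho> then 1 else 0)) \<partial>lebesgue))" for s
    proof -
      have m: "(\<lambda>y'. fE (s, y') * indicator S y' * (if dist x y' < r +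
        \<rho> then 1 else 0)) \<in> borel_measurable lebesgue"
        by (intro borel_imp_lebesgue) measurable
      have "(\<integral>\<^sup>+y'. fE (s, y') * indicator S y' * (ennreal (C * \<rho>) * (if dist x y' < r +
        \<rho> then 1 else 0)) \<partial>lebesgue) =
          (\<integral>\<^sup>+y'. ennreal (C * \<rho>) * (fE (s, y') * indicator S y' * (if dist x y' < r +
            \<rho> then 1 else 0)) \<partial>lebesgue)"
        by (intro nn_integral_cong) (simp only: mult_ac)
      also have "\<dots> = ennreal (C * \<rho>) * (\<integral>\<^sup>+y'. fE (s, y') * indicator S y' *
        (if dist x y' < r + \<rho> then 1 else 0) \<partial>lebesgue)"
        by (rule nn_integral_cmult[OF m])
      finally show ?thesis unfolding nn_integral_cmult[OF m] by (simp only: mult_ac)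
    qed
    moreover note m2 = borel_imp_lebesgue[OF borel_measurable_nn_integral_lebesgue[OF jm]]
    ultimately show ?thesis
      by (simp only: nn_integral_cmult[OF m2] nn_integral_cmult[OF borel_measurable_times_ennreal[OF
        borel_measurable_const m2]])
  qed
  finally have bnd: "(\<integral>\<^sup>+w. ennreal (norm (U w)) * indicator A (snd w) *
    indicator (ball z r) w \<partial>lebesgue) \<le>
    ennreal c0 * (ennreal (C * \<rho>) * (\<integral>\<^sup>+s. \<integral>\<^sup>+y'. I s * (fE (s, y') *
      indicator S y' * (if dist x y' < r + \<rho> then 1 else 0)) \<partial>lebesgue \<partial>lebesgue))" .
  have "(\<integral>\<^sup>+s. \<integral>\<^sup>+y'. I s * (fE (s, y') * indicator S y' * (if dist x y' < r +
    \<rho> then 1 else 0)) \<partial>lebesgue \<partial>lebesgue) =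
      (\<integral>\<^sup>+w. I (fst w) * (fE w * indicator S (snd w) * (if dist x (snd w) < r +
        \<rho> then 1 else 0)) \<partial>lebesgue)"
  proof -
    have "(\<lambda>w. I (fst w) * (fE w * indicator S (snd w) * (if dist x (snd w) < r +
      \<rho> then 1 else 0))) \<in> borel_measurable (borel \<Otimes>\<^sub>M borel)" by measurable
    then show ?thesis by (subst nn_integral_prod) (simp_all add: borel_prod)
  qed
  also have "\<dots> \<le> (\<integral>\<^sup>+w. fE w * indicator S (snd w) * indicator (ball z (2 * r +
    \<rho>)) w \<partial>lebesgue)"
  proof (intro nn_integral_mono)
    fix w :: "real \<times> (real ^ 'd)"
    \<comment> \<open>Back from the product to a ball: less than \<open>r\<close> in time plus less
      than \<open>r + \<rho>\<close> in space stays below \<open>2 * r + \<rho>\<close>.\<close>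
    have "dist z w \<le> dist t (fst w) + dist x (snd w)"
    proof -
      have "z - w = (fst z - fst w, snd z - snd w)" by (simp add: prod_eq_iff)
      then show ?thesis
        unfolding dist_norm t_def x_def using norm_Pair_le[of "fst z - fst w" "snd z - snd w"]
          by (simp only: real_norm_def)
    qed
    then show "I (fst w) * (fE w * indicator S (snd w) * (if dist x (snd w) < r + \<rho> then 1 else 0)) \<le>
      fE w * indicator S (snd w) * indicator (ball z (2 * r + \<rho>)) w"
      by (auto simp: I_def indicator_def)
  qed
  also have "\<dots> = (\<integral>\<^sup>+w. ennreal (norm (E w)) * indicator S (snd w) *
    indicator (ball z (2 * r + \<rho>)) w \<partial>lebesgue)"
    using fE0(2) by (intro nn_integral_cong_AE) (auto elim!: eventually_mono)
  finally show ?thesis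
    by (intro order_trans[OF bnd] mult_left_mono) simp_all
qed

section \<open>Slices of functions in the parabolic spaces\<close>

lemma P_log_continuous:
  fixes p :: "'a::euclidean_space \<Rightarrow> real"
  assumes p: "p \<in> P_log G"
  shows "continuous_on G p"
proof -
  obtain c where c: "0 < c" "\<And>x y. x \<in> G \<Longrightarrow> y \<in> G \<Longrightarrow>
    x \<noteq> y \<Longrightarrow> \<bar>p x - p y\<bar> \<le> c / ln (exp 1 + 1 / norm (x - y))"
    using p unfolding P_log_def by blast
  show ?thesis unfolding continuous_on_iff
  proof (intro ballI allI impI)
    fix x and e :: real assume x: "x \<in> G" and e: "0 < e"
    \<comment> \<open>The radius \<open>d = exp (- (c / e))\<close> solves
      \<open>c / ln (1 / d) = e\<close>.\<close>
    show "\<exists>d>0. \<forall>x'\<in>G. dist x' x < d \<longrightarrow> dist (p x') (p x) < e"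
    proof (intro exI[of _ "exp (- (c / e))"] conjI ballI impI)
      fix y assume y: "y \<in> G" "dist y x < exp (- (c / e))"
      show "dist (p y) (p x) < e"
      proof (cases "y = x")
        case False
        then have n: "0 < norm (y - x)" by simp
        have "exp (c / e) < 1 / norm (y - x)"
          using y(2) n by (simp add: dist_norm exp_minus field_simps)
        also have "\<dots> < exp 1 + 1 / norm (y - x)" by simp
        finally have "ln (exp (c / e)) < ln (exp 1 + 1 / norm (y - x))"
          using n by (subst ln_less_cancel_iff) (auto intro: add_pos_pos)
        then have "c / e < ln (exp 1 + 1 / norm (y - x))" by simp
        moreover have "0 < c / e" using c e by simp
        moreover have "c / X < e" if "c / e < X" "0 < c / e" for X
        proof -
          have "0 < X" using that by linarith
          moreover have "c < X * e" using that e by (simp add: pos_divide_less_eq)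
          ultimately show ?thesis by (simp add: pos_divide_less_eq mult.commute)
        qed
        ultimately have "c / ln (exp 1 + 1 / norm (y - x)) < e" by blast
        then show ?thesis using c(2)[OF y(1) x False] by (simp add: dist_real_def)
      qed (use e in simp)
    qed simp
  qed
qed

lemma continuous_measurable_on:
  fixes f :: "'a::euclidean_space \<Rightarrow> 'b::euclidean_space"
  shows "continuous_on G f \<Longrightarrow> G \<in> sets lebesgue \<Longrightarrow>
    f \<in> borel_measurable (lebesgue_on G)"
  by (rule continuous_imp_measurable_on_sets_lebesgue)

text \<open>Every slice is admissible and not only almost every one, because measurability comes
  from continuity of \<open>p\<close>. The constants carry over since \<open>(t, x)\<close> and
  \<open>(t, y)\<close> are as far apart as \<open>x\<close> and \<open>y\<close>, and since
  \<open>norm x \<le> norm (t, x)\<close>.\<close>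

lemma P_log_slice:
  fixes \<Omega> :: "(real ^ 'd) set"
  assumes p: "p \<in> P_log (cylinder T \<Omega>)" and t: "0 < t" "t < T" and \<Omega>: "open \<Omega>"
  shows "(\<lambda>x. p (t, x)) \<in> P_log \<Omega>"
proof -
  have Q: "(t, x) \<in> cylinder T \<Omega> \<longleftrightarrow> x \<in> \<Omega>" for x using t
    by (simp add: mem_cylinder)
  obtain c1 c2 pinf where c: "0 < c1" "0 < c2"
    "\<And>x y. x \<in> cylinder T \<Omega> \<Longrightarrow> y \<in> cylinder T \<Omega> \<Longrightarrow>
      x \<noteq> y \<Longrightarrow> \<bar>p x - p y\<bar> \<le> c1 / ln (exp 1 + 1 / norm (x - y))"
    "\<And>x. x \<in> cylinder T \<Omega> \<Longrightarrow> \<bar>p x - pinf\<bar> \<le> c2 / ln (exp 1 + norm x)"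
    using p unfolding P_log_def by blast
  have "continuous_on \<Omega> (\<lambda>x. p (t, x))"
    by (rule continuous_on_compose2[OF P_log_continuous[OF p]]) (auto intro!: continuous_intros simp: Q)
  then have "(\<lambda>x. p (t, x)) \<in> borel_measurable (lebesgue_on \<Omega>)"
    using \<Omega> by (intro continuous_measurable_on) auto
  moreover have "bounded ((\<lambda>x. p (t, x)) ` \<Omega>)"
    using p unfolding P_log_def by (auto intro: bounded_subset[of "p ` cylinder T \<Omega>"] simp: Q)
  moreover have "\<forall>x\<in>\<Omega>. 1 \<le> p (t, x)" using P_log_ge_1[OF p] Q by blast
  moreover have "\<bar>p (t, x) - p (t, y)\<bar> \<le> c1 / ln (exp 1 +
    1 / norm (x - y))" if "x \<in> \<Omega>" "y \<in> \<Omega>" "x \<noteq> y" for x y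
    using c(3)[of "(t, x)" "(t, y)"] that Q by simp
  moreover have "\<bar>p (t, x) - pinf\<bar> \<le> c2 / ln (exp 1 + norm x)" if "x \<in> \<Omega>" for x
  proof -
    have n: "norm x \<le> norm (t, x)" by (rule norm_snd_le)
    have g: "1 < exp 1 + norm x" by (rule order_less_le_trans[of _ "exp 1"]) simp_all
    have "0 < ln (exp 1 + norm x)" using g by (rule ln_gt_zero)
    moreover have "ln (exp 1 + norm x) \<le> ln (exp 1 + norm (t, x))"
      using g n by (subst ln_le_cancel_iff) auto
    ultimately have "c2 / ln (exp 1 + norm (t, x)) \<le> c2 / ln (exp 1 + norm x)"
      using c(2) by (intro divide_left_mono) auto
    then show ?thesis using c(4)[of "(t, x)"] that Q by simp
  qed
  ultimately show ?thesis using c(1,2) unfolding P_log_def by blast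
qed

lemma P_log_one: "(\<lambda>_. 1) \<in> P_log (G :: 'a::euclidean_space set)"
proof -
  have pos: "0 \<le> 1 / ln (exp 1 + a)" if "0 \<le> a" for a :: real
  proof -
    have "1 \<le> exp 1 + a" using that one_le_exp_iff[of 1] by linarith
    then show ?thesis by simp
  qed
  have "bounded ((\<lambda>_. 1::real) ` G)" by (rule bounded_subset[of "{1}"]) auto
  moreover have "\<bar>1 - 1\<bar> \<le> 1 / ln (exp 1 + 1 / norm (x - y))" "\<bar>1 - 1\<bar> \<le>
    1 / ln (exp 1 + norm x)" for x y :: 'a
    using pos[of "1 / norm (x - y)"] pos[of "norm x"] by simp_all
  ultimately show ?thesis unfolding P_log_def
    by (intro CollectI conjI exI[of _ "1::real"]) simp_all
qed

lemma emeasure_bounded_set: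
  fixes G :: "'a::euclidean_space set"
  assumes "bounded G" "G \<in> sets lebesgue"
  obtains \<mu> where "0 \<le> \<mu>" "emeasure lebesgue G = ennreal \<mu>"
proof -
  have "emeasure lebesgue G \<noteq> top" by (rule fmeasurableD2[OF bounded_set_imp_lmeasurable[OF assms]])
  then show ?thesis using that by (cases "emeasure lebesgue G") auto
qed

lemma modular_one_le:
  fixes f :: "'a::euclidean_space \<Rightarrow> 'b::euclidean_space"
  assumes p: "p \<in> P_log G" and G: "G \<in> sets lebesgue" and f: "f \<in> borel_measurable (lebesgue_on G)"
  shows "modular G (\<lambda>_. 1) f \<le> emeasure lebesgue G + modular G p f"
proof -
  have "modular G (\<lambda>_. 1) f \<le> (\<integral>\<^sup>+x. 1 +
    ennreal (norm (f x) powr p x) \<partial>lebesgue_on G)"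
    unfolding modular_def
  proof (intro nn_integral_mono)
    fix x assume "x \<in> space (lebesgue_on G)"
    then have x: "1 \<le> p x" using P_log_ge_1[OF p] by (simp add: space_restrict_space)
    have "norm (f x) powr 1 \<le> 1 + norm (f x) powr p x"
      using powr_mono[OF x, of "norm (f x)"] by (cases "norm (f x) \<le> 1") (auto simp: add_increasing2)
    then have "ennreal (norm (f x) powr 1) \<le> ennreal (1 + norm (f x) powr p x)" by (rule ennreal_leI)
    then show "ennreal (norm (f x) powr 1) \<le> 1 + ennreal (norm (f x) powr p x)" by (simp add: ennreal_plus)
  qed
  also have "\<dots> = (\<integral>\<^sup>+x. 1 \<partial>lebesgue_on G) + modular G p f"
    unfolding modular_def using powr_norm_measurable[OF p f] by (intro nn_integral_add) auto
  also have "(\<integral>\<^sup>+x. 1 \<partial>lebesgue_on G) = emeasure lebesgue G"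
    using G by (simp add: emeasure_restrict_space space_restrict_space)
  finally show ?thesis .
qed

lemma Lp_integrable:
  fixes f :: "'a::euclidean_space \<Rightarrow> 'b::euclidean_space"
  assumes p: "p \<in> P_log G" and G: "bounded G" "G \<in> sets lebesgue" and f: "f \<in> Lp G p"
  shows "integrable (lebesgue_on G) f"
proof (rule integrableI_bounded)
  have m: "f \<in> borel_measurable (lebesgue_on G)" "modular G p f < \<infinity>" using f by (auto simp: Lp_def)
  obtain \<mu> where \<mu>: "emeasure lebesgue G = ennreal \<mu>" using emeasure_bounded_set[OF G] by blast
  have "(\<integral>\<^sup>+x. ennreal (norm (f x)) \<partial>lebesgue_on G) = modular G (\<lambda>_. 1) f"
    by (simp add: modular_def)
  also have "\<dots> \<le> emeasure lebesgue G + modular G p f" by (rule modular_one_le[OF p G(2) m(1)])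
  also have "\<dots> < \<infinity>" using m(2) \<mu> by simp
  finally show "(\<integral>\<^sup>+x. ennreal (norm (f x)) \<partial>lebesgue_on G) < \<infinity>" .
  show "f \<in> borel_measurable (lebesgue_on G)" by (rule m)
qed

lemma Lp_subset_L1:
  assumes p: "p \<in> P_log G" and G: "bounded G" "G \<in> sets lebesgue" and f: "f \<in> Lp G p"
  shows "f \<in> Lp G (\<lambda>_. 1)"
proof -
  have m: "f \<in> borel_measurable (lebesgue_on G)" "modular G p f < \<infinity>" using f by (auto simp: Lp_def)
  obtain \<mu> where \<mu>: "emeasure lebesgue G = ennreal \<mu>" using emeasure_bounded_set[OF G] by blast
  have "modular G (\<lambda>_. 1) f \<le> emeasure lebesgue G + modular G p f"
    by (rule modular_one_le[OF p G(2) m(1)])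
  also have "\<dots> < \<infinity>" using m(2) \<mu> by simp
  finally show ?thesis using m by (simp add: Lp_def)
qed

text \<open>The constant comes from the measure of \<open>G\<close> alone, so it can be chosen
  before the exponent.\<close>

lemma lux_norm_one_le:
  fixes G :: "'a::euclidean_space set"
  assumes G: "bounded G" "G \<in> sets lebesgue"
  obtains C where "0 < C" "\<And>p (f :: 'a \<Rightarrow> 'b::euclidean_space). p \<in> P_log G \<Longrightarrow> f
    \<in> borel_measurable (lebesgue_on G) \<Longrightarrow>
    lux_norm G (\<lambda>_. 1) f \<le> ennreal C * lux_norm G p f"
proof -
  obtain \<mu> where \<mu>: "0 \<le> \<mu>" "emeasure lebesgue G = ennreal \<mu>" using emeasure_bounded_set[OF G]
    by blast
  show ?thesis
  proof (rule that[of "\<mu> + 1"])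
    show "0 < \<mu> + 1" using \<mu> by simp
    fix p and f :: "'a \<Rightarrow> 'b" assume p: "p \<in> P_log G" and f: "f \<in> borel_measurable (lebesgue_on G)"
    show "lux_norm G (\<lambda>_. 1) f \<le> ennreal (\<mu> + 1) * lux_norm G p f"
    proof (rule lux_norm_transfer)
      show "0 < \<mu> + 1" using \<mu> by simp
      fix l :: real assume l: "0 < l" "modular G p (\<lambda>x. f x /\<^sub>R l) \<le> 1"
      have m: "(\<lambda>x. f x /\<^sub>R l) \<in> borel_measurable (lebesgue_on G)" using f by measurable
      have "modular G (\<lambda>_. 1) (\<lambda>x. f x /\<^sub>R l) \<le>
        emeasure lebesgue G + modular G p (\<lambda>x. f x /\<^sub>R l)"
        by (rule modular_one_le[OF p G(2) m])
      also have "\<dots> \<le> ennreal \<mu> + 1" unfolding \<mu> by (intro add_left_mono l)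
      also have "\<dots> = ennreal (\<mu> + 1)" using \<mu> by (simp add: ennreal_plus)
      finally have "modular G (\<lambda>_. 1) (\<lambda>x. (f x /\<^sub>R l) /\<^sub>R (\<mu> + 1)) \<le> 1"
        using \<mu> by (intro modular_scale_down[OF P_log_one m]) auto
      then show "lux_norm G (\<lambda>_. 1) f \<le> ennreal ((\<mu> + 1) * l)"
        using l \<mu> by (intro lux_norm_le) (auto simp: mult.commute)
    qed
  qed
qed

text \<open>Local integrability speaks of compact subsets only; measurability on all of
  \<open>G\<close> follows along an exhaustion by compact sets.\<close>

lemma loc_integrable_measurable:
  fixes f :: "'a::euclidean_space \<Rightarrow> 'b::euclidean_space"
  assumes G: "open G" and f: "loc_integrable G f"
  shows "f \<in> borel_measurable (lebesgue_on G)"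
proof -
  obtain C where C: "\<And>n. compact (C n)" "\<And>n. C n \<subseteq> G" "\<And>n. C n \<subseteq> interior (C (Suc
    n))" "\<Union>(range C) = G"
    using open_Union_compact_subsets[OF G] by metis
  have mono: "C m \<subseteq> C n" if "m \<le> n" for m n
    using that by (induction n rule: dec_induct) (use C(3) interior_subset in blast)+
  have "integrable lebesgue (\<lambda>x. indicator (C n) x *\<^sub>R f x)" for n
    using f C unfolding loc_integrable_def by (simp add: integrable_lebesgue_on_iff[symmetric] sets_lebesgue_compact)
  then have m: "(\<lambda>x. indicator (C n) x *\<^sub>R f x) \<in> borel_measurable lebesgue" for n
    by (rule borel_measurable_integrable)
  have "(\<lambda>x. indicator G x *\<^sub>R f x) \<in> borel_measurable lebesgue"
  proof (rule borel_measurable_LIMSEQ_metric[OF m])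
    fix x
    show "(\<lambda>n. indicator (C n) x *\<^sub>R f x) \<longlonglongrightarrow> indicator G x *\<^sub>R f x"
    proof (cases "x \<in> G")
      case True
      then obtain m where m: "x \<in> C m" using C(4) by blast
      have "\<forall>\<^sub>F n in sequentially. indicator (C n) x *\<^sub>R f x = indicator G x *\<^sub>R f x"
      proof (rule eventually_sequentiallyI[of m])
        fix n assume "m \<le> n"
        then have "x \<in> C n" using mono m by blast
        then show "indicator (C n) x *\<^sub>R f x = indicator G x *\<^sub>R f x" using True by simp
      qed
      then show ?thesis by (rule tendsto_eventually)
    next
      case False
      then have "x \<notin> C n" for n using C(2) by blast
      then show ?thesis using False by simp
    qed
  qed
  then show ?thesis
    using borel_measurable_restrict_space_iff[of G lebesgue f] G by (simp add: scaleR_conv_of_real)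
qed

lemma smooth_on_subset: "smooth_on S f \<Longrightarrow> T \<subseteq> S \<Longrightarrow> smooth_on T f"
  unfolding smooth_on_def using C_k_on_subset by blast

lemma smooth_on_cong: "open S \<Longrightarrow> (\<And>x. x \<in> S \<Longrightarrow>
  f x = g x) \<Longrightarrow> smooth_on S f \<Longrightarrow> smooth_on S g"
  unfolding smooth_on_def using C_k_on_cong by blast

lemma X_eps_has_weak_eps:
  "u \<in> X_eps \<Omega> q p \<Longrightarrow> has_weak_eps dir_x \<Omega> u (weak_eps dir_x \<Omega> u)"
  unfolding X_eps_def using has_weak_eps_weak_eps(1) by blast

text \<open>The boundary estimate is available for both exponents equal to 1. On a bounded set the
  norms with exponent 1 are dominated by the others, so the approximating test functions remain
  approximating.\<close>

lemma X_eps_subset_X_1: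
  fixes \<Omega> :: "(real ^ 'd) set"
  assumes \<Omega>: "open \<Omega>" "bounded \<Omega>" and q: "q \<in> P_log \<Omega>"
    and p: "p \<in> P_log \<Omega>" and u: "u \<in> X_eps \<Omega> q p"
  shows "u \<in> X_eps \<Omega> (\<lambda>_. 1) (\<lambda>_. 1)"
proof -
  note Os = sets_lebesgue_open[OF \<Omega>(1)]
  obtain C1 where C1: "0 < C1" "\<And>p (f :: real ^ 'd \<Rightarrow> real ^ 'd). p \<in> P_log \<Omega>
    \<Longrightarrow> f \<in> borel_measurable (lebesgue_on \<Omega>) \<Longrightarrow>
    lux_norm \<Omega> (\<lambda>_. 1) f \<le> ennreal C1 *
      lux_norm \<Omega> p f" using lux_norm_one_le[OF \<Omega>(2) Os] by blast
  obtain C2 where C2: "0 < C2" "\<And>p (f :: real ^ 'd \<Rightarrow> real ^ 'd ^ 'd). p \<in> P_log \<Omega>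
    \<Longrightarrow> f \<in> borel_measurable (lebesgue_on \<Omega>) \<Longrightarrow>
    lux_norm \<Omega> (\<lambda>_. 1) f \<le> ennreal C2 *
      lux_norm \<Omega> p f" using lux_norm_one_le[OF \<Omega>(2) Os] by blast
  define C where "C = max C1 C2"
  have C: "0 < C" using C1 by (simp add: C_def)
  note w = X_eps_has_weak_eps[OF u]
  have uL: "u \<in> Lp \<Omega> q" "weak_eps dir_x \<Omega> u \<in> Lp \<Omega> p" using u by (auto simp: X_eps_def)
  show ?thesis
    unfolding X_eps_def
  proof (intro CollectI conjI allI impI)
    show "u \<in> Lp \<Omega> (\<lambda>_. 1)" "weak_eps dir_x \<Omega> u \<in> Lp \<Omega> (\<lambda>_. 1)"
      using Lp_subset_L1[OF q \<Omega>(2) Os uL(1)] Lp_subset_L1[OF p \<Omega>(2) Os uL(2)] by auto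
    show "\<exists>E. has_weak_eps dir_x \<Omega> u E" using w by blast
    fix \<delta> :: ennreal assume \<delta>: "0 < \<delta>"
    \<comment> \<open>The minimum with 1 keeps the tolerance finite, as \<open>\<delta>\<close> is
      an extended real.\<close>
    define \<delta>' where "\<delta>' = min \<delta> 1 / ennreal C"
    have C\<delta>: "ennreal C * \<delta>' = min \<delta> 1"
      unfolding \<delta>'_def using C
        by (simp add: ennreal_times_divide mult.commute[of "ennreal C"] ennreal_mult_divide_eq)
    have "0 < \<delta>'"
    proof (rule ccontr)
      assume "\<not> 0 < \<delta>'"
      then have "\<delta>' = 0" by simp
      then show False using C\<delta> \<delta> by (simp add: min_def split: if_splits)
    qed
    then obtain \<phi> where \<phi>: "\<phi> \<in> C0_infinity \<Omega>"
      "lux_norm \<Omega> q (\<lambda>x. u x - \<phi> x) + lux_norm \<Omega> p (weak_eps dir_x \<Omega> (\<lambda>x. u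
        x - \<phi> x)) < \<delta>'"
      using u unfolding X_eps_def by blast
    have sm: "smooth_on \<Omega> \<phi>" using C0_infinity_smooth[OF \<phi>(1)] by (rule smooth_on_subset) simp
    note wd = has_weak_eps_weak_eps(1)[OF has_weak_eps_diff[OF \<Omega>(1) w has_weak_eps_smooth[OF \<Omega>(1) sm]]]
    have m1: "(\<lambda>x. u x - \<phi> x) \<in> borel_measurable (lebesgue_on \<Omega>)"
      "weak_eps dir_x \<Omega> (\<lambda>x. u x - \<phi> x) \<in> borel_measurable (lebesgue_on \<Omega>)"
      using has_weak_eps_loc_integrable[OF wd] loc_integrable_measurable[OF \<Omega>(1)] by blast+
    have "lux_norm \<Omega> (\<lambda>_. 1) (\<lambda>x. u x - \<phi> x) +
      lux_norm \<Omega> (\<lambda>_. 1) (weak_eps dir_x \<Omega> (\<lambda>x. u x - \<phi> x)) \<le>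
        ennreal C * lux_norm \<Omega> q (\<lambda>x. u x - \<phi> x) +
          ennreal C * lux_norm \<Omega> p (weak_eps dir_x \<Omega> (\<lambda>x. u x - \<phi> x))"
      by (intro add_mono order_trans[OF C1(2)[OF q m1(1)]] order_trans[OF C2(2)[OF p m1(2)]] mult_right_mono)
         (auto simp: C_def intro: ennreal_leI)
    also have "\<dots> = ennreal C * (lux_norm \<Omega> q (\<lambda>x. u x - \<phi> x) +
      lux_norm \<Omega> p (weak_eps dir_x \<Omega> (\<lambda>x. u x - \<phi> x)))"
      by (simp add: distrib_left)
    also have "\<dots> < ennreal C * \<delta>'"
      using C \<phi>(2) by (intro ennreal_mult_strict_left_mono) auto
    also have "\<dots> \<le> \<delta>" unfolding C\<delta> by simp
    finally show "\<exists>\<phi>\<in>C0_infinity \<Omega>. lux_norm \<Omega> (\<lambda>_. 1) (\<lambda>x. u x -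
      \<phi> x) + lux_norm \<Omega> (\<lambda>_. 1) (weak_eps dir_x \<Omega> (\<lambda>x. u x - \<phi> x)) < \<delta>"
      using \<phi>(1) by blast
  qed
qed

lemma XX_eps_weak_eps:
  "u \<in> XX_eps T \<Omega> q p \<Longrightarrow> has_weak_eps dir_tx (cylinder T \<Omega>) u (weak_eps dir_tx
    (cylinder T \<Omega>) u)"
  unfolding XX_eps_def using has_weak_eps_weak_eps(1) by blast

lemma bounded_cylinder: "bounded \<Omega> \<Longrightarrow> bounded (cylinder T \<Omega>)"
  unfolding cylinder_def by (intro bounded_Times) auto

lemma XX_eps_integrable:
  fixes \<Omega> :: "(real ^ 'd) set"
  assumes \<Omega>: "open \<Omega>" "bounded \<Omega>" and q: "q \<in> P_log (cylinder T \<Omega>)"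
    and p: "p \<in> P_log (cylinder T \<Omega>)"
    and u: "u \<in> XX_eps T \<Omega> q p"
  shows "integrable (lebesgue_on (cylinder T \<Omega>)) u"
    "integrable (lebesgue_on (cylinder T \<Omega>)) (weak_eps dir_tx (cylinder T \<Omega>) u)"
  using u Lp_integrable[OF q bounded_cylinder[OF \<Omega>(2)] sets_lebesgue_open[OF open_cylinder[OF \<Omega>(1)]]]
    Lp_integrable[OF p bounded_cylinder[OF \<Omega>(2)] sets_lebesgue_open[OF open_cylinder[OF \<Omega>(1)]]]
  by (auto simp: XX_eps_def)

text \<open>The boundary estimate comes with a gradient chosen separately at each time. Replacing it
  by the slices of the single space-time gradient \<open>E\<close> is what allows the estimate to be
  integrated over time.\<close>

lemma XX_eps_slices:
  fixes \<Omega> :: "(real ^ 'd) set"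
  assumes \<Omega>: "open \<Omega>" "bounded \<Omega>" and be: "boundary_estimate \<Omega> h0 c0"
    and q: "q \<in> P_log (cylinder T \<Omega>)" and p: "p \<in> P_log (cylinder T \<Omega>)"
    and u: "u \<in> XX_eps T \<Omega> q p"
  defines "E \<equiv> weak_eps dir_tx (cylinder T \<Omega>) u"
  shows "AE t in lebesgue_on {0<..<T}. has_weak_eps dir_x \<Omega> (\<lambda>x. u (t, x)) (\<lambda>x. E (t, x))
    \<and>
    (AE x in lebesgue_on \<Omega>. infdist x (frontier \<Omega>) \<le> h0 \<longrightarrow>
       ennreal (norm (u (t, x))) \<le> ennreal c0 *
         (\<integral>\<^sup>+y. ennreal (norm (E (t, y)) * norm (x - y) powr (1 - real CARD('d)))
            \<partial>lebesgue_on (ball x (2 * infdist x (frontier \<Omega>)) \<inter> \<Omega>)))"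
proof -
  have X: "AE t in lebesgue_on {0<..<T}. (\<lambda>x. u (t, x)) \<in> X_eps \<Omega> (\<lambda>x. q (t, x))
    (\<lambda>x. p (t, x))"
    using u by (simp add: XX_eps_def)
  have sl: "AE t in lebesgue_on {0<..<T}. \<forall>E'. has_weak_eps dir_x \<Omega> (\<lambda>x. u (t, x)) E'
    \<longrightarrow>
    (AE x in lebesgue_on \<Omega>. E' x = E (t, x)) \<and> has_weak_eps dir_x \<Omega> (\<lambda>x. u (t, x))
      (\<lambda>x. E (t, x))"
    unfolding E_def
    by (rule weak_eps_slices[OF \<Omega>(1) XX_eps_weak_eps[OF u] XX_eps_integrable[OF \<Omega> q p u]])
  have "AE t in lebesgue_on {0<..<T}. t \<in> {0<..<T}"
    using AE_space[of "lebesgue_on {0<..<T}"] by simp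
  with X sl show ?thesis
  proof eventually_elim
    case (elim t)
    then have t: "0 < t" "t < T" by auto
    have u1: "(\<lambda>x. u (t, x)) \<in> X_eps \<Omega> (\<lambda>_. 1) (\<lambda>_. 1)"
      by (rule X_eps_subset_X_1[OF \<Omega> P_log_slice[OF q t \<Omega>(1)] P_log_slice[OF p t \<Omega>(1)] elim(1)])
    let ?E = "weak_eps dir_x \<Omega> (\<lambda>x. u (t, x))"
    have ae: "AE x in lebesgue_on \<Omega>. ?E x = E (t, x)"
      and w: "has_weak_eps dir_x \<Omega> (\<lambda>x. u (t, x)) (\<lambda>x. E (t, x))"
      using elim(2) X_eps_has_weak_eps[OF u1] by blast+
    have "AE x in lebesgue_on \<Omega>. infdist x (frontier \<Omega>) \<le> h0 \<longrightarrow>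
       ennreal (norm (u (t, x))) \<le> ennreal c0 *
         (\<integral>\<^sup>+y. ennreal (norm (?E y) * norm (x - y) powr (1 - real CARD('d)))
            \<partial>lebesgue_on (ball x (2 * infdist x (frontier \<Omega>)) \<inter> \<Omega>))"
      by (rule bspec[OF be[unfolded boundary_estimate_def] u1])
    moreover have "(\<integral>\<^sup>+y. ennreal (norm (?E y) *
      norm (x - y) powr (1 - real CARD('d))) \<partial>lebesgue_on (ball x r \<inter> \<Omega>)) =
        (\<integral>\<^sup>+y. ennreal (norm (E (t, y)) * norm (x - y) powr (1 - real CARD('d)))
          \<partial>lebesgue_on (ball x r \<inter> \<Omega>))" for x r
    proof (rule nn_integral_cong_AE)
      have b: "open (ball x r \<inter> \<Omega>)" using \<Omega> by auto
      have "AE y in lebesgue_on (ball x r \<inter> \<Omega>). ?E y = E (t, y)"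
        using ae \<Omega>(1) b by (simp add: AE_restrict_space_iff) (auto elim!: eventually_mono)
      then show "AE y in lebesgue_on (ball x r \<inter> \<Omega>). ennreal (norm (?E y) *
        norm (x - y) powr (1 - real CARD('d))) =
        ennreal (norm (E (t, y)) * norm (x - y) powr (1 - real CARD('d)))" by eventually_elim simp
    qed
    ultimately show ?case using w by simp
  qed
qed

section \<open>The commutator of cutoff and symmetric gradient\<close>

text \<open>The width \<open>9 * h\<close> is the outer distance \<open>3 * h\<close> of the
  transition layer of the cutoff plus the largest radius \<open>6 * h\<close> of the balls in the
  boundary estimate.\<close>

definition strip_part :: "(real ^ 'd::finite) set \<Rightarrow> real \<Rightarrow> (real \<times> (real ^ 'd)
  \<Rightarrow> 'b::real_vector) \<Rightarrow> real \<times> (real ^ 'd) \<Rightarrow> 'b" where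
  "strip_part \<Omega> h f w = indicator {y. infdist y (frontier \<Omega>) \<le> 9 * h} (snd w) *\<^sub>R f w"

lemma infdist_le_sets: "{y :: 'a::euclidean_space. infdist y A \<le> c} \<in> sets borel"
  by (intro borel_closed closed_Collect_le continuous_intros)

lemma strip_part_measurable:
  fixes f :: "real \<times> (real ^ 'd) \<Rightarrow> 'b::euclidean_space"
  assumes "f \<in> borel_measurable lebesgue"
  shows "strip_part \<Omega> h f \<in> borel_measurable lebesgue"
proof -
  have "(\<lambda>w :: real \<times> (real ^ 'd). indicator {y. infdist y (frontier \<Omega>) \<le>
    9 * h} (snd w) :: real) \<in> borel_measurable (borel \<Otimes>\<^sub>M borel)"
    using infdist_le_sets[of "frontier \<Omega>" "9 * h"] by measurable
  then have "(\<lambda>w :: real \<times> (real ^ 'd). indicator {y. infdist y (frontier \<Omega>) \<le>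
    9 * h} (snd w) :: real) \<in> borel_measurable lebesgue"
    by (intro borel_imp_lebesgue) (simp add: borel_prod)
  then show ?thesis unfolding strip_part_def[abs_def] using assms by (rule borel_measurable_scaleR)
qed

text \<open>The factor \<open>L / h\<close> from the gradient of the cutoff meets
  \<open>C * (6 * h)\<close> from the kernel, so that no power of \<open>h\<close> remains except
  the normalisation of the mollifier. \<open>A\<close> is chosen before \<open>T\<close>, the
  exponents and \<open>u\<close>.\<close>

lemma commutator_strip_bound:
  fixes \<Omega> :: "(real ^ 'd) set"
  assumes \<Omega>: "open \<Omega>" "bounded \<Omega>" and be: "boundary_estimate \<Omega> h0 c0" and c0: "0 < c0"
  obtains A where "0 < A" "\<And>T q p u h z. q \<in> P_log (cylinder T \<Omega>) \<Longrightarrow>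
    p \<in> P_log (cylinder T \<Omega>) \<Longrightarrow> u \<in> XX_eps T \<Omega> q p \<Longrightarrow>
    0 < h \<Longrightarrow> h < h0 / 4 \<Longrightarrow>
    ennreal (norm (fun_conv (mollifier h) (cutoff_commutator \<Omega> h (zero_ext (cylinder T \<Omega>) u)) z)) \<le>
    ennreal (A / h ^ DIM(real \<times> (real ^ 'd))) * ball_integral (strip_part \<Omega> h (zero_ext (cylinder T
      \<Omega>) (weak_eps dir_tx (cylinder T \<Omega>) u))) z (8 * h)"
proof -
  obtain C where C: "0 < C" "\<And>R (z :: real ^ 'd). 0 < R \<Longrightarrow>
    (\<integral>\<^sup>+y. ennreal (norm (y - z) powr (1 - real DIM(real ^ 'd))) *
      indicator (ball z R) y \<partial>lebesgue) \<le> ennreal (C * R)"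
    using Riesz_kernel_bound by blast
  obtain L where L: "0 < L" "\<And>\<Omega> h (U :: real \<times> (real ^ 'd) \<Rightarrow> real ^ 'd) w. open
    \<Omega> \<Longrightarrow> bounded \<Omega> \<Longrightarrow> 0 < h \<Longrightarrow>
    norm (cutoff_commutator \<Omega> h U w) \<le> L / h * (norm (U w) *
      indicator {y \<in> \<Omega>. 2 * h \<le> infdist y (frontier \<Omega>) \<and> infdist y (frontier \<Omega>)
        \<le> 3 * h} (snd w))"
    using cutoff_commutator_bound by blast
  let ?b = "bump_mass TYPE(real \<times> (real ^ 'd))"
  let ?n = "DIM(real \<times> (real ^ 'd))"
  have b: "0 < ?b" by (rule bump_mass_pos)
  define A where "A = 6 * L * c0 * C / ?b"
  have dim: "DIM(real ^ 'd) = CARD('d)" by simp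
  show ?thesis
  proof (rule that)
    show "0 < A" using L C c0 b by (simp add: A_def)
    fix T q p u h z
    assume q: "q \<in> P_log (cylinder T \<Omega>)" and p: "p \<in> P_log (cylinder T \<Omega>)"
      and u: "u \<in> XX_eps T \<Omega> q p" and h: "0 < h" "h < h0 / 4"
    let ?Q = "cylinder T \<Omega>"
    note Qs = sets_lebesgue_open[OF open_cylinder[OF \<Omega>(1), of T]]
    define E where "E = weak_eps dir_tx ?Q u"
    define U where "U = zero_ext ?Q u"
    define EE where "EE = zero_ext ?Q E"
    have Ui: "integrable lebesgue U" and EEi: "integrable lebesgue EE"
      using XX_eps_integrable[OF \<Omega> q p u] Qs by (simp_all add: U_def EE_def E_def zero_ext_integrable)
    have Um: "U \<in> borel_measurable lebesgue" and EEm: "EE \<in> borel_measurable lebesgue" using Ui EEi by auto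
    define S where "S = {y. infdist y (frontier \<Omega>) \<le> 9 * h}"
    \<comment> \<open>The transition layer of the cutoff. By \<open>h < h0 / 4\<close> its points
      have distance at most \<open>3 * h \<le> h0\<close> from the frontier, so the boundary
      estimate applies to them.\<close>
    define B where "B = {y \<in> \<Omega>. 2 * h \<le> infdist y (frontier \<Omega>) \<and> infdist y (frontier
      \<Omega>) \<le> 3 * h}"
    have Sb: "S \<in> sets borel" unfolding S_def by (rule infdist_le_sets)
    have Bb: "B \<in> sets borel"
    proof -
      have "B = \<Omega> \<inter> ({y. 2 * h \<le> infdist y (frontier \<Omega>)} \<inter> {y. infdist y (frontier
        \<Omega>) \<le> 3 * h})" by (auto simp: B_def)
      moreover have "closed ({y. 2 * h \<le> infdist y (frontier \<Omega>)} \<inter> {y. infdist y (frontier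
        \<Omega>) \<le> 3 * h})"
        by (intro closed_Int closed_Collect_le continuous_intros)
      ultimately show ?thesis using \<Omega>(1) by (metis borel_closed borel_open sets.Int)
    qed
    have I: "{0<..<T} \<in> sets lebesgue" and Os: "\<Omega> \<in> sets lebesgue" using \<Omega> by simp_all
    have "AE s in lebesgue. s \<in> {0<..<T} \<longrightarrow> (AE x in lebesgue. x \<in> \<Omega> \<longrightarrow>
      infdist x (frontier \<Omega>) \<le> h0 \<longrightarrow>
       ennreal (norm (u (s, x))) \<le> ennreal c0 *
         (\<integral>\<^sup>+y. ennreal (norm (E (s, y)) * norm (x - y) powr (1 - real CARD('d)))
            \<partial>lebesgue_on (ball x (2 * infdist x (frontier \<Omega>)) \<inter> \<Omega>)))"
    proof -
      have "AE s in lebesgue_on {0<..<T}. AE x in lebesgue_on \<Omega>. infdist x (frontier \<Omega>) \<le>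
        h0 \<longrightarrow>
       ennreal (norm (u (s, x))) \<le> ennreal c0 *
         (\<integral>\<^sup>+y. ennreal (norm (E (s, y)) * norm (x - y) powr (1 - real CARD('d)))
            \<partial>lebesgue_on (ball x (2 * infdist x (frontier \<Omega>)) \<inter> \<Omega>))"
        using XX_eps_slices[OF \<Omega> be q p u] by (auto simp: E_def elim!: eventually_mono)
      then show ?thesis using I Os by (simp add: AE_restrict_space_iff)
    qed
    then have ae: "AE s in lebesgue. AE y in lebesgue. ennreal (norm (U (s, y))) * indicator B y \<le> ennreal c0 *
      (\<integral>\<^sup>+y'. ennreal (norm (EE (s, y'))) * ennreal (norm (y - y') powr (1 - real DIM(real ^ 'd))) *
         (if dist y y' < 6 * h then 1 else 0) * indicator S y' \<partial>lebesgue)"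
    proof eventually_elim
      case (elim s)
      show ?case
      proof (cases "s \<in> {0<..<T}")
        case False
        then have "U (s, y) = 0" for y by (auto simp: U_def zero_ext_def mem_cylinder)
        then show ?thesis by simp
      next
        case True
        with elim have "AE x in lebesgue. x \<in> \<Omega> \<longrightarrow> infdist x (frontier \<Omega>) \<le> h0
          \<longrightarrow>
          ennreal (norm (u (s, x))) \<le> ennreal c0 *
         (\<integral>\<^sup>+y. ennreal (norm (E (s, y)) * norm (x - y) powr (1 - real CARD('d)))
            \<partial>lebesgue_on (ball x (2 * infdist x (frontier \<Omega>)) \<inter> \<Omega>))" by blast
        then show ?thesis
        proof eventually_elim
          case (elim y)
          show ?case
          proof (cases "y \<in> B")
            case yB: True
            let ?K = "ball y (2 * infdist y (frontier \<Omega>)) \<inter> \<Omega>"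
            have K: "?K \<in> sets lebesgue" using \<Omega>(1) by auto
            have "ennreal (norm (U (s, y))) * indicator B y \<le> ennreal (norm (u (s, y)))"
              using yB zero_ext_norm_le[of ?Q u "(s, y)"] by (simp add: U_def ennreal_leI)
            also have "\<dots> \<le> ennreal c0 * (\<integral>\<^sup>+y'. ennreal (norm (E (s, y')) *
              norm (y - y') powr (1 - real CARD('d))) \<partial>lebesgue_on ?K)"
              using elim yB h by (auto simp: B_def)
            also have "(\<integral>\<^sup>+y'. ennreal (norm (E (s, y')) *
              norm (y - y') powr (1 - real CARD('d))) \<partial>lebesgue_on ?K) =
                (\<integral>\<^sup>+y'. ennreal (norm (E (s, y')) * norm (y - y') powr (1 - real CARD('d))) *
                  indicator ?K y' \<partial>lebesgue)"
              using K by (subst nn_integral_restrict_space) auto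
            finally have le: "ennreal (norm (U (s, y))) * indicator B y \<le>
              ennreal c0 * (\<integral>\<^sup>+y'. ennreal (norm (E (s, y')) *
              norm (y - y') powr (1 - real CARD('d))) * indicator ?K y' \<partial>lebesgue)" .
            have "(\<integral>\<^sup>+y'. ennreal (norm (E (s, y')) * norm (y - y') powr (1 - real CARD('d))) *
              indicator ?K y' \<partial>lebesgue) \<le>
              (\<integral>\<^sup>+y'. ennreal (norm (EE (s, y'))) *
                ennreal (norm (y - y') powr (1 - real DIM(real ^ 'd))) *
               (if dist y y' < 6 * h then 1 else 0) * indicator S y' \<partial>lebesgue)"
            proof (intro nn_integral_mono)
              fix y'
              show "ennreal (norm (E (s, y')) * norm (y - y') powr (1 - real CARD('d))) * indicator ?K y' \<le>
                ennreal (norm (EE (s, y'))) * ennreal (norm (y - y') powr (1 - real DIM(real ^ 'd))) *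
                (if dist y y' < 6 * h then 1 else 0) * indicator S y'"
              proof (cases "y' \<in> ?K")
                case y': True
                \<comment> \<open>The ball of the boundary estimate has twice the distance of
                  \<open>y\<close> as its radius, and that distance is at most \<open>3 * h\<close>;
                  its points therefore stay within \<open>9 * h\<close> of the frontier.\<close>
                have "dist y y' < 6 * h" using y' yB by (auto simp: B_def)
                moreover have "y' \<in> S"
                  using infdist_lipschitz[of y' "frontier \<Omega>" y] calculation yB by (auto simp: B_def S_def)
                moreover have "EE (s, y') = E (s, y')"
                  using True y' by (auto simp: EE_def zero_ext_def mem_cylinder)
                ultimately show ?thesis using y' by (simp add: ennreal_mult'')
              qed simp
            qed
            then show ?thesis by (intro order_trans[OF le] mult_left_mono) simp_all
          qed simp
        qed
      qed
    qed
    have h6: "0 < 6 * h" using h by simp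
    have pot: "(\<integral>\<^sup>+w. ennreal (norm (U w)) * indicator B (snd w) *
      indicator (ball z h) w \<partial>lebesgue) \<le>
      ennreal c0 * (ennreal (C * (6 * h)) * (\<integral>\<^sup>+w. ennreal (norm (EE w)) *
        indicator S (snd w) * indicator (ball z (2 * h + 6 * h)) w \<partial>lebesgue))"
      by (rule strip_potential_bound[OF Um EEm Bb Sb h6 C(2) ae])
    let ?G = "cutoff_commutator \<Omega> h U"
    have Gm: "?G \<in> borel_measurable lebesgue"
      by (rule borel_measurable_integrable[OF cutoff_commutator_integrable[OF \<Omega> h(1) Ui]])
    have "ball_integral ?G z h \<le>
        (\<integral>\<^sup>+w. ennreal (L / h) * (ennreal (norm (U w)) * indicator B (snd w) *
          indicator (ball z h) w) \<partial>lebesgue)"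
    proof (intro nn_integral_mono)
      fix w
      have "ennreal (norm (?G w)) \<le> ennreal (L / h) * (ennreal (norm (U w)) * indicator B (snd w))"
      proof (cases "snd w \<in> B")
        case True
        then have "norm (?G w) \<le> L / h * norm (U w)"
          using L(2)[OF \<Omega> h(1), of U w] by (simp add: B_def)
        then have "ennreal (norm (?G w)) \<le> ennreal (L / h * norm (U w))" by (rule ennreal_leI)
        also have "\<dots> = ennreal (L / h) * ennreal (norm (U w))" by (rule ennreal_mult'') simp
        finally show ?thesis using True by simp
      next
        case False
        then have "norm (?G w) \<le> 0"
          using L(2)[OF \<Omega> h(1), of U w] by (auto simp: B_def)
        then show ?thesis by simp
      qed
      then show "ennreal (norm (?G w)) * indicator (ball z h) w \<le>
        ennreal (L / h) * (ennreal (norm (U w)) * indicator B (snd w) * indicator (ball z h) w)"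
        by (auto simp: indicator_def)
    qed
    also have "\<dots> = ennreal (L / h) * (\<integral>\<^sup>+w. ennreal (norm (U w)) * indicator B (snd w) *
      indicator (ball z h) w \<partial>lebesgue)"
    proof (rule nn_integral_cmult)
      have "(\<lambda>w :: real \<times> (real ^ 'd). indicator B (snd w) :: ennreal) \<in> borel_measurable (borel
        \<Otimes>\<^sub>M borel)"
        using Bb by measurable
      then have "(\<lambda>w :: real \<times> (real ^ 'd). indicator B (snd w) :: ennreal) \<in> borel_measurable
        lebesgue"
        by (intro borel_imp_lebesgue) (simp add: borel_prod)
      with Um show "(\<lambda>w. ennreal (norm (U w)) * indicator B (snd w) *
        indicator (ball z h) w) \<in> borel_measurable lebesgue"
        by measurable
    qed
    also have "\<dots> \<le> ennreal (L / h) * (ennreal c0 * (ennreal (C * (6 * h)) *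
      (\<integral>\<^sup>+w. ennreal (norm (EE w)) * indicator S (snd w) * indicator (ball z (2 * h +
      6 * h)) w \<partial>lebesgue)))"
      by (intro mult_left_mono pot) simp
    also have "\<dots> = ennreal (L / h) * ennreal c0 * ennreal (C * (6 * h)) *
      ball_integral (strip_part \<Omega> h EE) z (8 * h)"
    proof -
      have "ennreal (norm (EE w)) * indicator S (snd w) * indicator (ball z (2 * h + 6 * h)) w =
          ennreal (norm (strip_part \<Omega> h EE w)) * indicator (ball z (8 * h)) w" for w
        by (simp add: strip_part_def S_def indicator_def)
      then show ?thesis by (simp add: mult.assoc)
    qed
    also have "ennreal (L / h) * ennreal c0 * ennreal (C * (6 * h)) = ennreal (6 * L * c0 * C)"
      using L h c0 C by (simp add: ennreal_mult[symmetric] mult_ac)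
    finally have G: "ball_integral ?G z h \<le>
      ennreal (6 * L * c0 * C) * ball_integral (strip_part \<Omega> h EE) z (8 * h)" .
    have "ennreal (norm (fun_conv (mollifier h) ?G z)) \<le> ennreal (1 / ?b / h ^ ?n) * ball_integral ?G z h"
      by (rule mollifier_conv_norm_le[OF h(1) Gm])
    also have "\<dots> \<le> ennreal (1 / ?b / h ^ ?n) * (ennreal (6 * L * c0 * C) *
      ball_integral (strip_part \<Omega> h EE) z (8 * h))"
      by (intro mult_left_mono G) simp
    also have "\<dots> = ennreal (1 / ?b / h ^ ?n) * ennreal (6 * L * c0 * C) *
      ball_integral (strip_part \<Omega> h EE) z (8 * h)"
      by (simp only: mult.assoc)
    also have "ennreal (1 / ?b / h ^ ?n) * ennreal (6 * L * c0 * C) = ennreal (A / h ^ ?n)"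
      using L h c0 C b by (simp add: ennreal_mult[symmetric] A_def mult_ac)
    finally show "ennreal (norm (fun_conv (mollifier h) (cutoff_commutator \<Omega> h (zero_ext ?Q u)) z)) \<le>
      ennreal (A / h ^ ?n) * ball_integral (strip_part \<Omega> h (zero_ext ?Q (weak_eps dir_tx ?Q u))) z (8 * h)"
      by (simp only: U_def EE_def E_def)
  qed
qed

section \<open>Norm estimates and convergence of the smoothing\<close>

lemma lux_norm_zero:
  assumes "\<And>x. x \<in> G \<Longrightarrow> f x = 0"
  shows "lux_norm G p f = 0"
proof -
  have "modular G p (\<lambda>x. f x /\<^sub>R l) = (\<integral>\<^sup>+x. 0 \<partial>lebesgue_on G)" for l
    unfolding modular_def using assms by (intro nn_integral_cong) (auto simp: space_restrict_space)
  then have "modular G p (\<lambda>x. f x /\<^sub>R l) \<le> 1" for l by simp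
  then have m: "modular G p (\<lambda>x. f x /\<^sub>R l) \<le> 1" for l .
  have "lux_norm G p f \<le> 0"
  proof (rule ennreal_le_epsilon)
    fix e :: real assume "0 < e"
    then show "lux_norm G p f \<le> 0 + ennreal e" using lux_norm_le[OF _ m] by simp
  qed
  then show ?thesis by simp
qed

lemma Lp_bounded:
  fixes f :: "'a::euclidean_space \<Rightarrow> 'b::euclidean_space"
  assumes p: "p \<in> P_log G" and G: "bounded G" "G \<in> sets lebesgue"
    and f: "f \<in> borel_measurable (lebesgue_on G)"
    and B: "\<And>x. x \<in> G \<Longrightarrow> norm (f x) \<le> B"
  shows "f \<in> Lp G p"
proof -
  obtain P c where P: "\<And>x. x \<in> G \<Longrightarrow> 1 \<le> p x" "\<And>x. x \<in> G \<Longrightarrow>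
    p x \<le> P" by (rule P_logE[OF p]) blast
  obtain \<mu> where \<mu>: "0 \<le> \<mu>" "emeasure lebesgue G = ennreal \<mu>" using emeasure_bounded_set[OF G]
    by blast
  have "modular G p f \<le> (\<integral>\<^sup>+x. ennreal ((1 + \<bar>B\<bar>) powr P) \<partial>lebesgue_on G)"
    unfolding modular_def
  proof (intro nn_integral_mono ennreal_leI)
    fix x assume "x \<in> space (lebesgue_on G)"
    then have x: "x \<in> G" by (simp add: space_restrict_space)
    have "norm (f x) powr p x \<le> (1 + \<bar>B\<bar>) powr p x"
      using B[OF x] P(1)[OF x] by (intro powr_mono2) auto
    also have "\<dots> \<le> (1 + \<bar>B\<bar>) powr P" using P(2)[OF x] by (intro powr_mono) auto
    finally show "norm (f x) powr p x \<le> (1 + \<bar>B\<bar>) powr P" .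
  qed
  also have "\<dots> = ennreal ((1 + \<bar>B\<bar>) powr P) * ennreal \<mu>"
    using G \<mu> by (simp add: emeasure_restrict_space space_restrict_space)
  also have "\<dots> < \<infinity>" by (simp add: ennreal_mult_less_top)
  finally show ?thesis using f by (simp add: Lp_def)
qed

lemma lux_norm_zero_ext:
  fixes G :: "'a::euclidean_space set"
  assumes "G \<in> sets lebesgue" "\<And>x. x \<in> G \<Longrightarrow> pbar x = p x"
  shows "lux_norm UNIV pbar (zero_ext G f) = lux_norm G p f"
proof -
  have "modular UNIV pbar (\<lambda>x. zero_ext G f x /\<^sub>R l) = modular G p (\<lambda>x. f x /\<^sub>R l)" for l
    unfolding modular_alt[OF assms(1)] modular_alt[OF sets_lebesgue_open[OF open_UNIV]]
    by (intro nn_integral_cong) (use assms(2) in \<open>auto simp: zero_ext_def indicator_def\<close>)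
  then show ?thesis by (simp add: lux_norm_def)
qed

lemma lux_norm_restrict_le:
  fixes G :: "'a::euclidean_space set"
  assumes "G \<in> sets lebesgue" "\<And>x. x \<in> G \<Longrightarrow> pbar x = p x"
  shows "lux_norm G p f \<le> lux_norm UNIV pbar f"
proof -
  have "modular G p (\<lambda>x. f x /\<^sub>R l) \<le> modular UNIV pbar (\<lambda>x. f x /\<^sub>R l)" for l
    unfolding modular_alt[OF assms(1)] modular_alt[OF sets_lebesgue_open[OF open_UNIV]]
    by (intro nn_integral_mono) (use assms(2) in \<open>auto simp: indicator_def\<close>)
  then show ?thesis unfolding lux_norm_def by (intro INF_superset_mono) (auto intro: order_trans)
qed

section \<open>Compactly supported smooth functions belong to the spaces\<close>

lemma smooth_on_compact_ext:
  fixes w :: "'a::euclidean_space \<Rightarrow> 'b::real_normed_vector"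
  assumes G: "open G" and w: "smooth_on G w" and K: "compact K" "K \<subseteq> G" "\<And>x. x \<in> G - K
    \<Longrightarrow> w x = 0"
  shows "(\<lambda>x. if x \<in> G then w x else 0) \<in> C0_infinity G"
proof -
  let ?F = "\<lambda>x. if x \<in> G then w x else 0"
  have "C_k_on k (G \<union> - K) ?F" for k
  proof (rule C_k_on_Un)
    show o: "open (- K)" using K by (simp add: compact_imp_closed open_Compl)
    show "C_k_on k G ?F" by (rule C_k_on_cong[OF G _ smooth_on_C_k[OF w]]) auto
    show "C_k_on k (- K) ?F"
      by (rule C_k_on_cong[OF o _ C_k_on_const[of k _ 0]]) (use K in auto)
  qed (rule G)
  moreover have "G \<union> - K = UNIV" using K by blast
  ultimately have "smooth_on UNIV ?F" by (simp add: smooth_on_def)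
  then show ?thesis unfolding C0_infinity_iff using K by (auto intro!: exI[of _ K])
qed

lemma classical_eps_cong:
  assumes "open S" "x \<in> S" "\<And>y. y \<in> S \<Longrightarrow> f y = g y"
  shows "classical_eps e f x = classical_eps e g x"
  unfolding classical_eps_def using frechet_derivative_cong_open[OF assms] by simp

lemma classical_eps_bounded:
  assumes u: "smooth_on G u" and G: "open G" and K: "compact K" "K \<subseteq> G" "\<And>x. x \<in> G - K
    \<Longrightarrow> u x = 0"
  obtains B where "\<And>x. x \<in> G \<Longrightarrow> norm (u x) \<le>
    B" "\<And>x. x \<in> G \<Longrightarrow> norm (classical_eps e u x) \<le> B"
proof -
  have z: "classical_eps e u x = 0" if "x \<in> G - K" for x
  proof -
    have "open (G - K)" using G K by (simp add: open_Diff compact_imp_closed)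
    from classical_eps_cong[OF this that, of u "\<lambda>_. 0" e] K(3)
    show ?thesis by (simp add: classical_eps_def vec_eq_iff)
  qed
  have "bounded (u ` K)" "bounded (classical_eps e u ` K)"
    using continuous_on_subset[OF smooth_on_continuous[OF u] K(2)] continuous_on_subset[OF
      continuous_classical_eps[OF u] K(2)] K(1)
    by (auto intro!: compact_imp_bounded compact_continuous_image)
  then obtain B1 B2 where B: "\<And>x. x \<in> K \<Longrightarrow> norm (u x) \<le>
    B1" "\<And>x. x \<in> K \<Longrightarrow> norm (classical_eps e u x) \<le> B2"
    unfolding bounded_iff by auto
  show ?thesis
  proof (rule that[of "max 0 (max B1 B2)"])
    fix x assume x: "x \<in> G"
    show "norm (u x) \<le> max 0 (max B1 B2)"
      using B(1)[of x] K(3)[of x] x by (cases "x \<in> K") auto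
    show "norm (classical_eps e u x) \<le> max 0 (max B1 B2)"
      using B(2)[of x] z[of x] x by (cases "x \<in> K") auto
  qed
qed

text \<open>The compact set \<open>K\<close> is a subset of \<open>H\<close> but possibly not of
  \<open>G\<close>; the bounds come from the extension \<open>v\<close>, which is smooth around all
  of \<open>K\<close>.\<close>

lemma smooth_compact_weak_eps_Lp:
  fixes u :: "'a::euclidean_space \<Rightarrow> real ^ 'd"
  assumes u: "smooth_on G u" and G: "open G" "bounded G"
    and K: "compact K" "K \<subseteq> H" "\<And>x. x \<in> G - K \<Longrightarrow> u x = 0"
    and v: "open H" "smooth_on H v" "\<And>x. x \<in> G \<Longrightarrow>
      u x = v x" "\<And>x. x \<in> H - K \<Longrightarrow> v x = 0" "G \<subseteq> H"
    and q: "q \<in> P_log G" and p: "p \<in> P_log G"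
  shows "u \<in> Lp G q" "weak_eps e G u \<in> Lp G p"
proof -
  note Gs = sets_lebesgue_open[OF G(1)]
  obtain B where B: "\<And>x. x \<in> H \<Longrightarrow> norm (v x) \<le>
    B" "\<And>x. x \<in> H \<Longrightarrow> norm (classical_eps e v x) \<le> B"
    using classical_eps_bounded[OF v(2,1) K(1,2) v(4)] by blast
  show "u \<in> Lp G q"
  proof (rule Lp_bounded[OF q G(2) Gs continuous_measurable_on[OF smooth_on_continuous[OF u] Gs]])
    show "norm (u x) \<le> B" if "x \<in> G" for x using B(1)[of x] v(3)[OF that] v(5) that by auto
  qed
  have w: "weak_eps e G u x = classical_eps e u x" if "x \<in> G" for x
    by (rule weak_eps_smooth[OF G(1) u that])
  have c: "continuous_on G (weak_eps e G u)"
    using continuous_classical_eps[OF u] w by (simp cong: continuous_on_cong)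
  show "weak_eps e G u \<in> Lp G p"
  proof (rule Lp_bounded[OF p G(2) Gs continuous_measurable_on[OF c Gs]])
    show "norm (weak_eps e G u x) \<le> B" if "x \<in> G" for x
      using B(2)[of x] w[OF that] classical_eps_cong[OF G(1) that v(3), where e = e] v(5) that by auto
  qed
qed

text \<open>The support may touch the times 0 and \<open>T\<close>, so it is in general no compact
  subset of the open cylinder. Bounds are therefore taken on \<open>K\<close> from the smooth
  extension \<open>\<psi>\<close>, whereas on each slice the function itself is a test
  function.\<close>

lemma C_infinity_C0_subset_XX_eps:
  fixes \<Omega> :: "(real ^ 'd) set"
  assumes \<Omega>: "open \<Omega>" "bounded \<Omega>" and q: "q \<in> P_log (cylinder T \<Omega>)"
    and p: "p \<in> P_log (cylinder T \<Omega>)"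
  shows "C_infinity_C0 T \<Omega> \<subseteq> XX_eps T \<Omega> q p"
proof
  fix \<phi> assume "\<phi> \<in> C_infinity_C0 T \<Omega>"
  then have ex: "\<exists>\<psi>. smooth_on (UNIV \<times> \<Omega>) \<psi> \<and> (\<forall>z\<in>{0..T} \<times>
    \<Omega>. \<phi> z = \<psi> z)"
    "\<exists>K. compact K \<and> K \<subseteq> {0..T} \<times> \<Omega> \<and> (\<forall>z\<in>{0..T} \<times>
      \<Omega> - K. \<phi> z = 0)"
    unfolding C_infinity_C0_def by (simp_all only: mem_Collect_eq)
  from ex(1) obtain \<psi> where \<psi>': "smooth_on (UNIV \<times> \<Omega>) \<psi> \<and> (\<forall>z\<in>{0..T}
    \<times> \<Omega>. \<phi> z = \<psi> z)" by (rule exE)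
  note \<psi> = conjunct1[OF \<psi>'] bspec[OF conjunct2[OF \<psi>']]
  from ex(2) obtain K where K': "compact K \<and> K \<subseteq> {0..T} \<times> \<Omega> \<and>
    (\<forall>z\<in>{0..T} \<times> \<Omega> - K. \<phi> z = 0)" by (rule exE)
  note K = conjunct1[OF K'] conjunct1[OF conjunct2[OF K']] bspec[OF conjunct2[OF conjunct2[OF K']]]
  let ?Q = "cylinder T \<Omega>"
  note Q = open_cylinder[OF \<Omega>(1), of T] and Qb = bounded_cylinder[OF \<Omega>(2), of T]
  note Qs = sets_lebesgue_open[OF Q]
  have QI: "?Q \<subseteq> {0..T} \<times> \<Omega>" "?Q \<subseteq> UNIV \<times> \<Omega>"
    by (auto simp: cylinder_def)
  have UO: "open ((UNIV :: real set) \<times> \<Omega>)" using \<Omega> by (simp add: open_Times)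
  have sm: "smooth_on ?Q \<phi>"
    by (rule smooth_on_cong[OF Q _ smooth_on_subset[OF \<psi>(1) QI(2)]]) (use \<psi>(2) QI in auto)
  note w = has_weak_eps_smooth[OF Q sm, of dir_tx]
  have KQ: "K \<subseteq> UNIV \<times> \<Omega>" using K(2) by auto
  have eq: "weak_eps dir_tx ?Q \<phi> x = classical_eps dir_tx \<psi> x" if "x \<in> ?Q" for x
    using weak_eps_smooth[OF Q sm that] classical_eps_cong[OF Q that, of \<phi> \<psi> dir_tx] \<psi>(2) QI by auto
  have cw: "continuous_on ?Q (weak_eps dir_tx ?Q \<phi>)"
    using continuous_classical_eps[OF sm] weak_eps_smooth[OF Q sm] by (simp cong: continuous_on_cong)
  have "bounded (\<psi> ` K)" "bounded (classical_eps dir_tx \<psi> ` K)"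
    using continuous_on_subset[OF smooth_on_continuous[OF \<psi>(1)] KQ] continuous_on_subset[OF
      continuous_classical_eps[OF \<psi>(1)] KQ] K(1)
    by (auto intro!: compact_imp_bounded compact_continuous_image)
  then obtain B1 B2 where B: "\<And>x. x \<in> K \<Longrightarrow> norm (\<psi> x) \<le>
    B1" "\<And>x. x \<in> K \<Longrightarrow> norm (classical_eps dir_tx \<psi> x) \<le> B2"
    unfolding bounded_iff by auto
  have z: "classical_eps dir_tx \<psi> x = 0" if x: "x \<in> ?Q - K" for x
  proof -
    have o: "open (?Q - K)" using Q K by (simp add: open_Diff compact_imp_closed)
    have "\<psi> y = 0" if "y \<in> ?Q - K" for y
    proof -
      have y: "y \<in> {0..T} \<times> \<Omega> - K" "y \<in> {0..T} \<times> \<Omega>" using that QI by blast+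
      show ?thesis using \<psi>(2)[OF y(2)] K(3)[OF y(1)] by simp
    qed
    from classical_eps_cong[OF o x this, where e = dir_tx]
    show ?thesis by (simp add: classical_eps_def vec_eq_iff)
  qed
  show "\<phi> \<in> XX_eps T \<Omega> q p"
    unfolding XX_eps_def
  proof (intro CollectI conjI)
    show "\<phi> \<in> Lp ?Q q"
    proof (rule Lp_bounded[OF q Qb Qs continuous_measurable_on[OF smooth_on_continuous[OF sm] Qs]])
      fix x assume x: "x \<in> ?Q"
      then have xI: "x \<in> {0..T} \<times> \<Omega>" using QI by blast
      show "norm (\<phi> x) \<le> max 0 B1"
        using K(3)[of x] B(1)[of x] \<psi>(2)[OF xI] xI by (cases "x \<in> K") auto
    qed
    show "\<exists>E. has_weak_eps dir_tx ?Q \<phi> E" using w by blast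
    show "weak_eps dir_tx ?Q \<phi> \<in> Lp ?Q p"
    proof (rule Lp_bounded[OF p Qb Qs continuous_measurable_on[OF cw Qs]])
      fix x assume x: "x \<in> ?Q"
      show "norm (weak_eps dir_tx ?Q \<phi> x) \<le> max 0 B2"
        using eq[OF x] B(2)[of x] z[of x] x by (cases "x \<in> K") auto
    qed
    have "(\<lambda>x. \<phi> (t, x)) \<in> X_eps \<Omega> (\<lambda>x. q (t, x)) (\<lambda>x. p (t, x))" if t: "0 <
      t" "t < T" for t
    proof -
      define f where "f x = \<psi> (t, x)" for x
      define Kt where "Kt = snd ` (K \<inter> ({t} \<times> UNIV))"
      have Kt: "compact Kt" "Kt \<subseteq> \<Omega>"
        unfolding Kt_def using K(1,2)
        by (auto intro!: compact_continuous_image continuous_intros compact_Int_closed closed_Times)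
      have f\<phi>: "\<phi> (t, x) = f x" if "x \<in> \<Omega>" for x using \<psi>(2)[of "(t, x)"] that t
        by (simp add: f_def)
      have f0: "f x = 0" if "x \<in> \<Omega> - Kt" for x
      proof -
        have "(t, x) \<in> {0..T} \<times> \<Omega> - K" using that t by (force simp: Kt_def)
        from K(3)[OF this] f\<phi>[of x] that show ?thesis by simp
      qed
      have A: "bounded_linear (\<lambda>x::real^'d. (0::real, x))"
        by (intro bounded_linear_Pair bounded_linear_zero bounded_linear_ident)
      have fs: "smooth_on \<Omega> f"
        unfolding smooth_on_def
      proof
        fix k
        have "C_k_on k \<Omega> (\<lambda>x. \<psi> ((t, 0) + (0, x)))"
          by (rule C_k_on_affine[OF A \<Omega>(1) _ smooth_on_C_k[OF \<psi>(1)]]) auto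
        then show "C_k_on k \<Omega> f" by (simp add: f_def[abs_def])
      qed
      let ?u = "\<lambda>x. \<phi> (t, x)"
      have us: "smooth_on \<Omega> ?u" by (rule smooth_on_cong[OF \<Omega>(1) _ fs]) (simp add: f\<phi>)
      note q' = P_log_slice[OF q t \<Omega>(1)] and p' = P_log_slice[OF p t \<Omega>(1)]
      note L = smooth_compact_weak_eps_Lp[OF us \<Omega> Kt _ \<Omega>(1) fs f\<phi> f0 order_refl q' p']
      have u0: "?u x = 0" if "x \<in> \<Omega> - Kt" for x using f0[OF that] f\<phi>[of x] that by simp
      \<comment> \<open>The slice extended by zero is a test function that agrees with the slice on
        \<Omega>, so the approximation demanded by \<open>X_eps\<close> is exact.\<close>
      define F where "F x = (if x \<in> \<Omega> then f x else 0)" for x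
      have F: "F \<in> C0_infinity \<Omega>" unfolding F_def[abs_def]
        by (rule smooth_on_compact_ext[OF \<Omega>(1) fs Kt f0])
      have d0: "?u x - F x = 0" if "x \<in> \<Omega>" for x using f\<phi>[OF that] that by (simp add: F_def)
      have ds: "smooth_on \<Omega> (\<lambda>x. ?u x - F x)"
        by (rule smooth_on_cong[OF \<Omega>(1), of "\<lambda>_. 0"]) (use d0 in \<open>auto simp: smooth_on_def
          C_k_on_const\<close>)
      have "weak_eps dir_x \<Omega> (\<lambda>x. ?u x - F x) x = 0" if x: "x \<in> \<Omega>" for x
      proof -
        have "classical_eps dir_x (\<lambda>x. ?u x - F x) x = classical_eps dir_x (\<lambda>_. 0) x"
          by (rule classical_eps_cong[OF \<Omega>(1) x]) (rule d0)
        also have "\<dots> = 0" by (simp add: classical_eps_def vec_eq_iff)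
        finally show ?thesis using weak_eps_smooth[OF \<Omega>(1) ds x, of dir_x] by simp
      qed
      then have l0: "lux_norm \<Omega> (\<lambda>x. q (t, x)) (\<lambda>x. ?u x - F x) +
        lux_norm \<Omega> (\<lambda>x. p (t, x)) (weak_eps dir_x \<Omega> (\<lambda>x. ?u x - F x)) = 0"
        using lux_norm_zero[of \<Omega> "\<lambda>x. ?u x - F x"] lux_norm_zero[of \<Omega> "weak_eps dir_x \<Omega>
          (\<lambda>x. ?u x - F x)"] d0 by simp
      show ?thesis
        unfolding X_eps_def
      proof (intro CollectI conjI allI impI)
        show "?u \<in> Lp \<Omega> (\<lambda>x. q (t, x))" "weak_eps dir_x \<Omega> ?u \<in> Lp \<Omega> (\<lambda>x.
          p (t, x))"
          using L u0 by blast+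
        show "\<exists>E. has_weak_eps dir_x \<Omega> ?u E" using has_weak_eps_smooth[OF \<Omega>(1) us] by blast
        fix \<delta> :: ennreal assume "0 < \<delta>"
        then show "\<exists>\<phi>\<in>C0_infinity \<Omega>. lux_norm \<Omega> (\<lambda>x. q (t, x)) (\<lambda>x. ?u
          x - \<phi> x) + lux_norm \<Omega> (\<lambda>x. p (t, x)) (weak_eps dir_x \<Omega> (\<lambda>x. ?u x -
          \<phi> x)) < \<delta>"
          using F l0 by (intro bexI[of _ F]) simp_all
      qed
    qed
    then show "AE t in lebesgue_on {0<..<T}. (\<lambda>x. \<phi> (t, x)) \<in> X_eps \<Omega> (\<lambda>x. q (t, x))
      (\<lambda>x. p (t, x))"
      by (intro AE_I2) (simp add: space_restrict_space)
  qed
qed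

lemma smoothing_in_C_infinity_C0:
  fixes \<Omega> :: "(real ^ 'd) set"
  assumes \<Omega>: "open \<Omega>" "bounded \<Omega>" and h: "0 < h"
    and u: "integrable (lebesgue_on (cylinder T \<Omega>)) u"
  shows "smoothing T \<Omega> h u \<in> C_infinity_C0 T \<Omega>"
proof -
  \<comment> \<open>The cutoff vanishes at distances below \<open>2 * h\<close> from the frontier
    and the mollifier spreads by \<open>h\<close>, which leaves a margin of width
    \<open>h\<close>.\<close>
  let ?K = "{0..T} \<times> {x \<in> \<Omega>. h \<le> infdist x (frontier \<Omega>)}"
  have "smoothing T \<Omega> h u z = 0" if z: "z \<in> {0..T} \<times> \<Omega> - ?K" for z
  proof -
    have "mollifier h (z - w) *\<^sub>R (cutoff \<Omega> h (snd w) *\<^sub>R zero_ext (cylinder T \<Omega>) u w) = 0"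
      for w
    proof (cases "dist (snd z) (snd w) < h")
      case True
      have "infdist (snd w) (frontier \<Omega>) < 2 * h"
        using infdist_lipschitz[of "snd w" "frontier \<Omega>" "snd z"] True z by auto
      then show ?thesis using cutoff_eq_0[OF h, of "snd w" \<Omega>] by simp
    next
      case False
      then have "h \<le> norm (z - w)" using dist_snd_le[of z w] by (simp add: dist_norm)
      then have "mollifier h (z - w) = 0" by (rule mollifier_eq_0[OF h])
      then show ?thesis by simp
    qed
    then show ?thesis unfolding smoothing_def fun_conv_def by (simp only: Bochner_Integration.integral_zero)
  qed
  moreover have "smooth_on (UNIV \<times> \<Omega>) (smoothing T \<Omega> h u)"
    by (rule smooth_on_subset[OF smoothing_smooth(1)[OF \<Omega> h u]]) simp
  moreover have "compact ?K" by (intro compact_Times inner_closed_compact \<Omega> h) simp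
  moreover have "?K \<subseteq> {0..T} \<times> \<Omega>" by blast
  ultimately show ?thesis unfolding C_infinity_C0_def by blast
qed

section \<open>Pointwise bounds by ball averages\<close>

lemma ball_nn_integral_mono:
  fixes z :: "'a::euclidean_space"
  assumes "\<And>w. norm (f w) \<le> norm (g w)" "r \<le> R"
  shows "ball_integral f z r \<le> ball_integral g z R"
  using assms by (intro nn_integral_mono mult_mono ennreal_leI) (auto simp: indicator_def)

lemma cutoff_scaleR_le: "0 < h \<Longrightarrow> norm (cutoff \<Omega> h x *\<^sub>R v) \<le> norm v"
  using cutoff_nonneg[of h \<Omega> x] cutoff_le_1[of h \<Omega> x] by (simp add: mult_left_le_one_le)

text \<open>For the second bound, the cutoff differs from 1 only within \<open>3 * h\<close> of the
  frontier. This strip and the radius \<open>h\<close> are relaxed to those of the commutator bound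
  so that the two estimates can be added.\<close>

lemma conv_cutoff_bound:
  fixes \<Omega> :: "(real ^ 'd) set" and f :: "real \<times> (real ^ 'd) \<Rightarrow> 'b::euclidean_space"
  assumes \<Omega>: "open \<Omega>" "bounded \<Omega>" and h: "0 < h"
    and f: "integrable (lebesgue_on (cylinder T \<Omega>)) f"
  defines "F \<equiv> zero_ext (cylinder T \<Omega>) f"
  defines "A \<equiv> 1 / bump_mass TYPE(real \<times> (real ^ 'd))"
  shows "ennreal (norm (fun_conv (mollifier h) (\<lambda>w. cutoff \<Omega> h (snd w) *\<^sub>R F w) z)) \<le>
      ennreal (A / h ^ DIM(real \<times> (real ^ 'd))) * ball_integral F z h"
    "ennreal (norm (fun_conv (mollifier h) (\<lambda>w. cutoff \<Omega> h (snd w) *\<^sub>R F w) z - fun_conv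
      (mollifier h) F z)) \<le>
      ennreal (A / h ^ DIM(real \<times> (real ^ 'd))) * ball_integral (strip_part \<Omega> h F) z (8 * h)"
proof -
  have F: "integrable lebesgue F"
    using f by (simp add: F_def zero_ext_integrable sets_lebesgue_open[OF open_cylinder[OF \<Omega>(1)]])
  have cF: "integrable lebesgue (\<lambda>w. cutoff \<Omega> h (snd w) *\<^sub>R F w)"
    by (rule integrable_scaleR_snd[OF F cutoff_C0_infinity[OF \<Omega> h]])
  have "ennreal (norm (fun_conv (mollifier h) (\<lambda>w. cutoff \<Omega> h (snd w) *\<^sub>R F w) z)) \<le>
      ennreal (A / h ^ DIM(real \<times> (real ^ 'd))) * ball_integral (\<lambda>w. cutoff \<Omega> h (snd w)
        *\<^sub>R F w) z h"
    unfolding A_def by (rule mollifier_conv_norm_le[OF h borel_measurable_integrable[OF cF]])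
  also have "\<dots> \<le> ennreal (A / h ^ DIM(real \<times> (real ^ 'd))) * ball_integral F z h"
    by (intro mult_left_mono ball_nn_integral_mono cutoff_scaleR_le h) auto
  finally show "ennreal (norm (fun_conv (mollifier h) (\<lambda>w. cutoff \<Omega> h (snd w) *\<^sub>R F w) z)) \<le>
      ennreal (A / h ^ DIM(real \<times> (real ^ 'd))) * ball_integral F z h" .
  let ?d = "\<lambda>w. cutoff \<Omega> h (snd w) *\<^sub>R F w - F w"
  have dF: "integrable lebesgue ?d" using cF F by simp
  have le: "norm (?d w) \<le> norm (strip_part \<Omega> h F w)" for w
  proof (cases "w \<in> cylinder T \<Omega> \<and> 3 * h < infdist (snd w) (frontier \<Omega>)")
    case True
    then have "snd w \<in> \<Omega>" by (auto simp: cylinder_def)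
    then show ?thesis using True cutoff_eq_1[OF h, of "snd w" \<Omega>] by simp
  next
    case False
    show ?thesis
    proof (cases "w \<in> cylinder T \<Omega>")
      case True
      then have "strip_part \<Omega> h F w = F w" using False h by (simp add: strip_part_def)
      moreover have "norm (?d w) = norm ((1 - cutoff \<Omega> h (snd w)) *\<^sub>R F w)"
        by (simp add: scaleR_left_diff_distrib norm_minus_commute)
      moreover have "\<dots> \<le> norm (F w)"
        using cutoff_nonneg[OF h, of \<Omega> "snd w"] cutoff_le_1[OF h, of \<Omega> "snd w"]
          by (simp add: mult_left_le_one_le)
      ultimately show ?thesis by simp
    qed (simp add: F_def zero_ext_def)
  qed
  have "ennreal (norm (fun_conv (mollifier h) ?d z)) \<le>
      ennreal (A / h ^ DIM(real \<times> (real ^ 'd))) * ball_integral ?d z h"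
    unfolding A_def by (rule mollifier_conv_norm_le[OF h borel_measurable_integrable[OF dF]])
  also have "\<dots> \<le> ennreal (A / h ^ DIM(real \<times> (real ^ 'd))) *
    ball_integral (strip_part \<Omega> h F) z (8 * h)"
    by (intro mult_left_mono ball_nn_integral_mono le) (use h in auto)
  finally show "ennreal (norm (fun_conv (mollifier h) (\<lambda>w. cutoff \<Omega> h (snd w) *\<^sub>R F w) z -
    fun_conv (mollifier h) F z)) \<le>
      ennreal (A / h ^ DIM(real \<times> (real ^ 'd))) * ball_integral (strip_part \<Omega> h F) z (8 * h)"
    by (simp add: fun_conv_diff[OF mollifier_C0_infinity[OF h] cF F])
qed

lemma strip_part_le: "norm (strip_part \<Omega> h F w) \<le> norm (F w)"
  by (simp add: strip_part_def indicator_def)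

lemma eps_smoothing_bounds:
  fixes \<Omega> :: "(real ^ 'd) set"
  assumes \<Omega>: "open \<Omega>" "bounded \<Omega>" and be: "boundary_estimate \<Omega> h0 c0" and c0: "0 < c0"
  obtains A where "0 < A"
    "\<And>T q p u h z. q \<in> P_log (cylinder T \<Omega>) \<Longrightarrow>
      p \<in> P_log (cylinder T \<Omega>) \<Longrightarrow> u \<in> XX_eps T \<Omega> q p \<Longrightarrow>
      0 < h \<Longrightarrow> h < h0 / 4 \<Longrightarrow>
      ennreal (norm (classical_eps dir_tx (smoothing T \<Omega> h u) z)) \<le>
      ennreal (A / (8 * h) ^ DIM(real \<times> (real ^ 'd))) *
        ball_integral (zero_ext (cylinder T \<Omega>) (weak_eps dir_tx (cylinder T \<Omega>) u)) z (8 * h)"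
    "\<And>T q p u h z. q \<in> P_log (cylinder T \<Omega>) \<Longrightarrow>
      p \<in> P_log (cylinder T \<Omega>) \<Longrightarrow> u \<in> XX_eps T \<Omega> q p \<Longrightarrow>
      0 < h \<Longrightarrow> h < h0 / 4 \<Longrightarrow>
      ennreal (norm (classical_eps dir_tx (smoothing T \<Omega> h u) z - fun_conv (mollifier h) (zero_ext (cylinder T
        \<Omega>) (weak_eps dir_tx (cylinder T \<Omega>) u)) z)) \<le>
      ennreal (A / (8 * h) ^ DIM(real \<times> (real ^ 'd))) *
        ball_integral (strip_part \<Omega> h (zero_ext (cylinder T \<Omega>) (weak_eps dir_tx (cylinder T \<Omega>)
        u))) z (8 * h)"
proof -
  let ?n = "DIM(real \<times> (real ^ 'd))"
  obtain A2 where A2: "0 < A2" "\<And>T q p u h z. q \<in> P_log (cylinder T \<Omega>) \<Longrightarrow>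
    p \<in> P_log (cylinder T \<Omega>) \<Longrightarrow> u \<in> XX_eps T \<Omega> q p \<Longrightarrow>
    0 < h \<Longrightarrow> h < h0 / 4 \<Longrightarrow>
    ennreal (norm (fun_conv (mollifier h) (cutoff_commutator \<Omega> h (zero_ext (cylinder T \<Omega>) u)) z)) \<le>
    ennreal (A2 / h ^ ?n) * ball_integral (strip_part \<Omega> h (zero_ext (cylinder T \<Omega>) (weak_eps dir_tx
      (cylinder T \<Omega>) u))) z (8 * h)"
    using commutator_strip_bound[OF \<Omega> be c0] by blast
  define A1 where "A1 = 1 / bump_mass TYPE(real \<times> (real ^ 'd))"
  have A1: "0 < A1" unfolding A1_def using bump_mass_pos[where 'a="real \<times> (real ^ 'd)"] by simp
  \<comment> \<open>The factor \<open>8 ^ ?n\<close> passes from the normalisation at radius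
    \<open>h\<close> to the one at radius \<open>8 * h\<close>, the form expected by
    \<open>lux_norm_ball_average\<close> and by the maximal function.\<close>
  have sum: "ennreal (A1 / h ^ ?n) * I + ennreal (A2 / h ^ ?n) * I =
    ennreal ((A1 + A2) * 8 ^ ?n / (8 * h) ^ ?n) * I" if "0 < h" for h I
  proof -
    have "(A1 + A2) * 8 ^ ?n / (8 * h) ^ ?n = A1 / h ^ ?n + A2 / h ^ ?n"
      using that by (simp add: power_mult_distrib add_divide_distrib del: DIM_prod)
    moreover have "ennreal (A1 / h ^ ?n + A2 / h ^ ?n) = ennreal (A1 / h ^ ?n) + ennreal (A2 / h ^ ?n)"
      using A1 A2 that by (intro ennreal_plus) auto
    ultimately show ?thesis by (simp only: distrib_right)
  qed
  show ?thesis
  proof (rule that)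
    show "0 < (A1 + A2) * 8 ^ ?n" using A1 A2(1) by simp
    fix T q p u h z
    assume q: "q \<in> P_log (cylinder T \<Omega>)" and p: "p \<in> P_log (cylinder T \<Omega>)"
      and u: "u \<in> XX_eps T \<Omega> q p" and h: "0 < h" "h < h0 / 4"
    let ?E = "weak_eps dir_tx (cylinder T \<Omega>) u"
    let ?EE = "zero_ext (cylinder T \<Omega>) ?E"
    let ?c = "fun_conv (mollifier h) (\<lambda>w. cutoff \<Omega> h (snd w) *\<^sub>R ?EE w)"
    let ?g = "fun_conv (mollifier h) (cutoff_commutator \<Omega> h (zero_ext (cylinder T \<Omega>) u))"
    note ui = XX_eps_integrable[OF \<Omega> q p u]
    have we: "AE t in lebesgue_on {0<..<T}. has_weak_eps dir_x \<Omega> (\<lambda>x. u (t, x)) (\<lambda>x. ?E (t,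
      x))"
      using XX_eps_slices[OF \<Omega> be q p u] by (rule eventually_mono) blast
    have f: "classical_eps dir_tx (smoothing T \<Omega> h u) z = ?c z + ?g z"
      by (rule eps_smoothing[OF \<Omega> h(1) ui we])
    note cb = conv_cutoff_bound[OF \<Omega> h(1) ui(2), folded A1_def]
    note gb = A2(2)[OF q p u h]
    have tri: "ennreal (norm (a + b)) \<le> ennreal (norm a) + ennreal (norm b)" for a b :: "real ^ 'd ^ 'd"
      by (simp add: ennreal_plus[symmetric] ennreal_leI norm_triangle_ineq del: ennreal_plus)
    have "ennreal (norm (classical_eps dir_tx (smoothing T \<Omega> h u) z)) \<le>
      ennreal (norm (?c z)) + ennreal (norm (?g z))"
      unfolding f by (rule tri)
    also have "\<dots> \<le> ennreal (A1 / h ^ ?n) * ball_integral ?EE z (8 * h) +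
        ennreal (A2 / h ^ ?n) * ball_integral ?EE z (8 * h)"
      using h by (intro add_mono order_trans[OF cb(1)] order_trans[OF gb] mult_left_mono ball_nn_integral_mono
        strip_part_le) auto
    finally show "ennreal (norm (classical_eps dir_tx (smoothing T \<Omega> h u) z)) \<le>
      ennreal ((A1 + A2) * 8 ^ ?n / (8 * h) ^ ?n) * ball_integral ?EE z (8 * h)"
      unfolding sum[OF h(1)] .
    have "ennreal (norm (classical_eps dir_tx (smoothing T \<Omega> h u) z - fun_conv (mollifier h) ?EE z)) \<le>
        ennreal (norm (?c z - fun_conv (mollifier h) ?EE z)) + ennreal (norm (?g z))"
      using tri[of "?c z - fun_conv (mollifier h) ?EE z" "?g z"] unfolding f by (simp add: algebra_simps)
    also have "\<dots> \<le> ennreal (A1 / h ^ ?n) * ball_integral (strip_part \<Omega> h ?EE) z (8 * h) +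
        ennreal (A2 / h ^ ?n) * ball_integral (strip_part \<Omega> h ?EE) z (8 * h)"
      by (intro add_mono cb(2) gb)
    finally show "ennreal (norm (classical_eps dir_tx (smoothing T \<Omega> h u) z - fun_conv (mollifier h) ?EE z))
      \<le>
      ennreal ((A1 + A2) * 8 ^ ?n / (8 * h) ^ ?n) * ball_integral (strip_part \<Omega> h ?EE) z (8 * h)"
      unfolding sum[OF h(1)] .
  qed
qed

section \<open>Convergence in the Luxemburg norm\<close>

lemma lux_norm_dominated_small:
  fixes g :: "nat \<Rightarrow> 'a::euclidean_space \<Rightarrow> 'b::euclidean_space"
    and f :: "'a \<Rightarrow> 'c::euclidean_space"
  assumes p: "p \<in> P_log G" and f: "f \<in> Lp G p" and g: "\<And>n. g n \<in> borel_measurable (lebesgue_on G)"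
    and le: "\<And>n x. x \<in> G \<Longrightarrow> norm (g n x) \<le> norm (f x)"
    and ev: "\<And>x. x \<in> G \<Longrightarrow> \<forall>\<^sub>F n in sequentially. g n x = 0" and e: "0 < e"
  obtains n where "lux_norm G p (g n) < ennreal e"
proof -
  obtain P c where P: "\<And>x. x \<in> G \<Longrightarrow> p x \<le> P" by (rule P_logE[OF p]) blast
  have fm: "f \<in> borel_measurable (lebesgue_on G)" "modular G p f < \<infinity>" using f by (auto simp: Lp_def)
  \<comment> \<open>\<open>lux_norm_small\<close> asks for a bound of at most 1 and yields a weak
    inequality; hence a number strictly below \<open>e\<close>.\<close>
  define e' where "e' = min 1 (e / 2)"
  have e': "0 < e'" "e' \<le> 1" "e' < e" using e by (auto simp: e'_def)
  have sp: "x \<in> G" if "x \<in> space (lebesgue_on G)" for x using that by (simp add: space_restrict_space)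
  have "(\<lambda>n. \<integral>\<^sup>+x. ennreal (norm (g n x) powr p x) \<partial>lebesgue_on G)
    \<longlonglongrightarrow> (\<integral>\<^sup>+x. 0 \<partial>lebesgue_on G)"
  proof (rule nn_integral_dominated_convergence[where w = "\<lambda>x. ennreal (norm (f x) powr p x)"])
    show "(\<lambda>x. ennreal (norm (g n x) powr p x)) \<in> borel_measurable (lebesgue_on G)" for n
      by (rule powr_norm_measurable[OF p g])
    show "(\<lambda>x. ennreal (norm (f x) powr p x)) \<in> borel_measurable (lebesgue_on G)"
      by (rule powr_norm_measurable[OF p fm(1)])
    show "(\<integral>\<^sup>+x. ennreal (norm (f x) powr p x) \<partial>lebesgue_on G) < \<infinity>" using fm(2)
      by (simp add: modular_def)
    show "AE x in lebesgue_on G. ennreal (norm (g n x) powr p x) \<le> ennreal (norm (f x) powr p x)" for n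
      by (intro AE_I2 ennreal_leI powr_mono2 le P_log_nonneg[OF p] sp) simp_all
    show "AE x in lebesgue_on G. (\<lambda>n. ennreal (norm (g n x) powr p x)) \<longlonglongrightarrow> 0"
    proof (intro AE_I2 tendsto_eventually)
      fix x assume "x \<in> space (lebesgue_on G)"
      from ev[OF sp[OF this]] show "\<forall>\<^sub>F n in sequentially. ennreal (norm (g n x) powr p x) = 0"
        by eventually_elim simp
    qed
  qed simp
  then have "(\<lambda>n. modular G p (g n)) \<longlonglongrightarrow> 0" by (simp add: modular_def)
  from order_tendstoD(2)[OF this, of "ennreal (e' powr P)"]
  obtain n where "modular G p (g n) < ennreal (e' powr P)"
    using e' by (auto simp: eventually_sequentially)
  then have "lux_norm G p (g n) \<le> ennreal e'"
    by (intro lux_norm_small[OF p P g e'(1,2)]) auto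
  also have "\<dots> < ennreal e" using e' by (simp add: ennreal_less_iff)
  finally show ?thesis by (rule that)
qed

lemma zero_ext_Lp:
  assumes "f \<in> Lp G p"
  shows "zero_ext G f \<in> Lp G p"
proof -
  have f: "f \<in> borel_measurable (lebesgue_on G)" "modular G p f < \<infinity>" using assms by (auto simp: Lp_def)
  have "zero_ext G f \<in> borel_measurable (lebesgue_on G) \<longleftrightarrow> f \<in> borel_measurable
    (lebesgue_on G)"
    by (rule measurable_cong) (simp add: zero_ext_def space_restrict_space)
  moreover have "modular G p (zero_ext G f) = modular G p f"
    unfolding modular_def by (rule nn_integral_cong) (simp add: zero_ext_def space_restrict_space)
  ultimately show ?thesis using f by (simp add: Lp_def)
qed

lemma strip_part_small:
  fixes \<Omega> :: "(real ^ 'd) set" and f :: "real \<times> (real ^ 'd) \<Rightarrow> 'b::euclidean_space"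
  assumes \<Omega>: "open \<Omega>" "bounded \<Omega>" and p: "p \<in> P_log (cylinder T \<Omega>)"
    and f: "f \<in> Lp (cylinder T \<Omega>) p" and e: "0 < e"
  obtains d where "0 < d"
    "\<And>h. h < d \<Longrightarrow> lux_norm (cylinder T \<Omega>) p (strip_part \<Omega> h (zero_ext (cylinder T
      \<Omega>) f)) < ennreal e"
proof -
  let ?Q = "cylinder T \<Omega>"
  let ?F = "zero_ext ?Q f"
  note Qs = sets_lebesgue_open[OF open_cylinder[OF \<Omega>(1), of T]]
  have Fm: "?F \<in> borel_measurable lebesgue" using f by (simp add: zero_ext_measurable[OF Qs] Lp_def)
  obtain n where n: "lux_norm ?Q p (strip_part \<Omega> (1 / real (Suc n)) ?F) < ennreal e"
  proof (rule lux_norm_dominated_small[OF p zero_ext_Lp[OF f] _ _ _ e, of "\<lambda>n. strip_part \<Omega> (1 / real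
    (Suc n)) ?F"])
    show "strip_part \<Omega> (1 / real (Suc n)) ?F \<in> borel_measurable (lebesgue_on ?Q)" for n
      by (intro measurable_restrict_space1 strip_part_measurable Fm)
    show "norm (strip_part \<Omega> (1 / real (Suc n)) ?F x) \<le> norm (?F x)" for n x by (rule strip_part_le)
    \<comment> \<open>The spatial part of \<open>x\<close> has positive distance from the frontier,
      so \<open>x\<close> eventually leaves the shrinking strips.\<close>
    fix x assume "x \<in> ?Q"
    then have "0 < infdist (snd x) (frontier \<Omega>)"
      by (intro infdist_frontier_pos \<Omega>) (auto simp: cylinder_def)
    then obtain m where m: "1 / real (Suc m) < infdist (snd x) (frontier \<Omega>) / 9"
      using reals_Archimedean[of "infdist (snd x) (frontier \<Omega>) / 9"] by (auto simp: inverse_eq_divide)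
    show "\<forall>\<^sub>F n in sequentially. strip_part \<Omega> (1 / real (Suc n)) ?F x = 0"
    proof (rule eventually_sequentiallyI[of m])
      fix n assume "m \<le> n"
      then have "1 / real (Suc n) \<le> 1 / real (Suc m)" by (intro divide_left_mono) auto
      then have "\<not> infdist (snd x) (frontier \<Omega>) \<le> 9 * (1 / real (Suc n))" using m by linarith
      then show "strip_part \<Omega> (1 / real (Suc n)) ?F x = 0" by (simp add: strip_part_def)
    qed
  qed
  show ?thesis
  proof (rule that[of "1 / real (Suc n)"])
    fix h assume h: "h < 1 / real (Suc n)"
    have "norm (strip_part \<Omega> h ?F x) \<le> norm (strip_part \<Omega> (1 / real (Suc n)) ?F x)" for x
      using h by (auto simp: strip_part_def indicator_def)
    then have "lux_norm ?Q p (strip_part \<Omega> h ?F) \<le>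
      lux_norm ?Q p (strip_part \<Omega> (1 / real (Suc n)) ?F)"
      by (intro lux_norm_mono_AE AE_I2 P_log_nonneg[OF p])
    then show "lux_norm ?Q p (strip_part \<Omega> h ?F) < ennreal e" using n by simp
  qed simp
qed

text \<open>For values bounded by \<open>M \<ge> 1\<close> the power \<open>p x\<close> of the norm
  is at most \<open>M powr P\<close> times the norm itself, so smallness in L1 controls the
  modular.\<close>

lemma lux_norm_bounded_small:
  fixes g :: "'a::euclidean_space \<Rightarrow> 'b::euclidean_space"
  assumes p: "p \<in> P_log G" and P: "\<And>x. x \<in> G \<Longrightarrow> p x \<le> P"
    and g: "g \<in> borel_measurable lebesgue" and G: "G \<in> sets lebesgue"
    and M: "1 \<le> M" "\<And>x. norm (g x) \<le> M" and e: "0 < e" "e \<le> 1"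
    and i: "(\<integral>\<^sup>+x. ennreal (norm (g x)) \<partial>lebesgue) \<le> ennreal (e powr P / M powr P)"
  shows "lux_norm G p g \<le> ennreal e"
proof (rule lux_norm_small[OF p P measurable_restrict_space1[OF g] e])
  have "modular G p g \<le> (\<integral>\<^sup>+x. ennreal (M powr P) * ennreal (norm (g x)) \<partial>lebesgue)"
    unfolding modular_alt[OF G]
  proof (intro nn_integral_mono)
    fix x
    show "ennreal (norm (g x) powr p x) * indicator G x \<le> ennreal (M powr P) * ennreal (norm (g x))"
    proof (cases "x \<in> G \<and> g x \<noteq> 0")
      case True
      then have px: "1 \<le> p x" "p x \<le> P" using P_log_ge_1[OF p] P by auto
      have "norm (g x) powr p x = norm (g x) powr (p x - 1) * norm (g x)"
        using True powr_add[of "norm (g x)" "p x - 1" 1] by simp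
      also have "norm (g x) powr (p x - 1) \<le> M powr (p x - 1)" using px M by (intro powr_mono2) auto
      also have "M powr (p x - 1) \<le> M powr P" using px M by (intro powr_mono) auto
      finally have "norm (g x) powr p x \<le> M powr P * norm (g x)" by (simp add: mult_right_mono)
      then have "ennreal (norm (g x) powr p x) \<le> ennreal (M powr P * norm (g x))" by (rule ennreal_leI)
      also have "\<dots> = ennreal (M powr P) * ennreal (norm (g x))" by (rule ennreal_mult'') simp
      finally show ?thesis using True by simp
    qed (auto simp: indicator_def)
  qed
  also have "\<dots> = ennreal (M powr P) * (\<integral>\<^sup>+x. ennreal (norm (g x)) \<partial>lebesgue)"
    using g by (intro nn_integral_cmult) measurable
  also have "\<dots> \<le> ennreal (M powr P) * ennreal (e powr P / M powr P)" by (intro mult_left_mono i) simp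
  also have "\<dots> = ennreal (M powr P * (e powr P / M powr P))" by (rule ennreal_mult[symmetric]) simp_all
  also have "M powr P * (e powr P / M powr P) = e powr P" using M(1) by simp
  finally show "modular G p g \<le> ennreal (e powr P)" .
qed

lemma fun_conv_measurable:
  fixes g :: "'a::euclidean_space \<Rightarrow> 'b::euclidean_space"
  shows "0 < h \<Longrightarrow> integrable lebesgue g \<Longrightarrow>
    fun_conv (mollifier h) g \<in> borel_measurable lebesgue"
  by (intro continuous_imp_lebesgue smooth_on_continuous smooth_on_fun_conv[OF mollifier_C0_infinity])

text \<open>Dividing by \<open>C + 1\<close> instead of \<open>C\<close> makes the resulting
  inequality strict.\<close>

lemma lux_norm_less_mult:
  assumes "lux_norm G p f \<le> ennreal C * l" "l < ennreal (a / (C + 1))" "0 < C" "0 < a"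
  shows "lux_norm G p f < ennreal a"
proof -
  have "lux_norm G p f \<le> ennreal C * ennreal (a / (C + 1))"
    using assms by (intro order_trans[OF assms(1)] mult_left_mono) auto
  also have "\<dots> = ennreal (C * (a / (C + 1)))" using assms by (intro ennreal_mult[symmetric]) auto
  also have "\<dots> < ennreal a" using assms by (intro ennreal_lessI) (auto simp: field_simps)
  finally show ?thesis .
qed

lemma mollifier_tendsto_lux_norm:
  fixes G :: "'a::euclidean_space set" and f :: "'a \<Rightarrow> 'b::euclidean_space"
  assumes G: "G \<in> sets lebesgue" "bounded G" and p: "p \<in> P_log G" and f: "f \<in> Lp G p" and e: "0 < e"
  obtains d where "0 < d" "\<And>h. 0 < h \<Longrightarrow> h < d \<Longrightarrow>
    lux_norm G p (\<lambda>z. fun_conv (mollifier h) (zero_ext G f) z - zero_ext G f z) < ennreal e"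
proof -
  let ?F = "zero_ext G f"
  obtain P c where P: "\<And>x. x \<in> G \<Longrightarrow> p x \<le> P" by (rule P_logE[OF p]) blast
  have F: "integrable lebesgue ?F" using Lp_integrable[OF p G(2,1) f] by (simp add: zero_ext_integrable[OF G(1)])
  then have [measurable]: "?F \<in> borel_measurable lebesgue" by simp
  obtain R where R: "0 < R" "G \<subseteq> ball 0 R" using bounded_subset_ballD[OF G(2)] by blast
  define A where "A = 1 / bump_mass TYPE('a)"
  have A: "0 < A" unfolding A_def using bump_mass_pos[where 'a='a] by simp
  obtain C where C: "0 < C" "\<And>(f :: 'a \<Rightarrow> 'b) (g :: 'a \<Rightarrow> 'b) r.
       f \<in> borel_measurable lebesgue \<Longrightarrow> (\<And>y. y \<notin> G \<inter> ball 0 R \<Longrightarrow>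
         f y = 0) \<Longrightarrow> 0 < r \<Longrightarrow> r \<le> 1 \<Longrightarrow>
       g \<in> borel_measurable (lebesgue_on G) \<Longrightarrow>
       (\<And>x. x \<in> G \<Longrightarrow> ennreal (norm (g x)) \<le>
          ennreal (A / r ^ DIM('a)) * ball_integral f x r) \<Longrightarrow>
       lux_norm G p g \<le> ennreal C * lux_norm G p f"
    using lux_norm_ball_average[OF G(1) p A R(1) zero_less_one] by blast
  \<comment> \<open>The substitute for the triangle inequality is used twice: \<open>a\<close> grows
    to \<open>4 * a\<close>, and then \<open>5 * a\<close> grows to \<open>20 * a\<close>, which
    stays below \<open>24 * a = e\<close>.\<close>
  define a where "a = e / 24"
  have a: "0 < a" using e by (simp add: a_def)
  \<comment> \<open>Truncation of the values. The mollifications of the remainder \<open>D n\<close>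
    are controlled by \<open>lux_norm_ball_average\<close> uniformly in \<open>h\<close>, so that
    \<open>n\<close> can be fixed before \<open>h\<close>.\<close>
  define FN where "FN n z = (if norm (?F z) \<le> real (Suc n) then ?F z else 0)" for n z
  define D where "D n z = ?F z - FN n z" for n z
  have FNm [measurable]: "FN n \<in> borel_measurable lebesgue" for n unfolding FN_def by measurable
  have FNi: "integrable lebesgue (FN n)" for n
    by (rule Bochner_Integration.integrable_bound[OF F FNm]) (auto simp: FN_def)
  have Dm [measurable]: "D n \<in> borel_measurable lebesgue" for n unfolding D_def by measurable
  have Di: "integrable lebesgue (D n)" for n unfolding D_def using F FNi by simp
  have aC: "0 < a / (C + 1)" using a C by simp
  obtain n where n: "lux_norm G p (D n) < ennreal (a / (C + 1))"
  proof (rule lux_norm_dominated_small[OF p zero_ext_Lp[OF f] _ _ _ aC, of D])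
    show "D n \<in> borel_measurable (lebesgue_on G)" for n by (rule measurable_restrict_space1) measurable
    show "norm (D n x) \<le> norm (?F x)" for n x by (simp add: D_def FN_def)
    fix x
    obtain N :: nat where N: "norm (?F x) \<le> real N" using real_arch_simple by blast
    show "\<forall>\<^sub>F n in sequentially. D n x = 0"
      by (rule eventually_sequentiallyI[of N]) (use N in \<open>auto simp: D_def FN_def\<close>)
  qed blast
  \<comment> \<open>Twice the truncation level: once for the mollification and once for the
    function.\<close>
  define M where "M = 2 * real (Suc n)"
  have M: "1 \<le> M" by (simp add: M_def)
  define e' where "e' = min 1 (a / 2)"
  have e': "0 < e'" "e' \<le> 1" "e' < a" using a by (auto simp: e'_def)
  have "0 < e' powr P / M powr P" using e' M by simp
  then obtain d where d: "0 < d" "\<And>h. 0 < h \<Longrightarrow> h < d \<Longrightarrow>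
    (\<integral>\<^sup>+x. ennreal (norm (fun_conv (mollifier h) (FN n) x - FN n x)) \<partial>lebesgue) \<le>
      ennreal (e' powr P / M powr P)"
    using mollifier_tendsto_L1[OF FNi] by blast
  show ?thesis
  proof (rule that[of "min d 1"])
    show "0 < min d 1" using d by simp
    fix h :: real assume h: "0 < h" "h < min d 1"
    let ?m = "mollifier h :: 'a \<Rightarrow> real"
    note [measurable] = fun_conv_measurable[OF h(1) Di] fun_conv_measurable[OF h(1) FNi]
    have D0: "D n y = 0" if "y \<notin> G \<inter> ball 0 R" for y
      using that R(2) by (auto simp: D_def FN_def zero_ext_def)
    have "lux_norm G p (fun_conv ?m (D n)) \<le> ennreal C * lux_norm G p (D n)"
    proof (rule C(2)[OF Dm D0 h(1)])
      show "ennreal (norm (fun_conv ?m (D n) x)) \<le> ennreal (A / h ^ DIM('a)) * ball_integral (D n) x h" for x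
        unfolding A_def by (rule mollifier_conv_norm_le[OF h(1) Dm])
      show "fun_conv ?m (D n) \<in> borel_measurable (lebesgue_on G)" by (rule measurable_restrict_space1) measurable
    qed (use h in auto)
    then have l1: "lux_norm G p (fun_conv ?m (D n)) < ennreal a"
      by (rule lux_norm_less_mult[OF _ n C(1) a])
    let ?W = "\<lambda>z. fun_conv ?m (FN n) z - FN n z"
    have "lux_norm G p ?W \<le> ennreal e'"
    proof (rule lux_norm_bounded_small[OF p P _ G(1) M _ e'(1,2) d(2)])
      show "norm (?W z) \<le> M" for z
      proof -
        have "norm (fun_conv ?m (FN n) z - 0) \<le> real (Suc n)"
          by (rule mollifier_conv_minus_le[OF h(1) FNi]) (simp add: FN_def)
        moreover have "norm (FN n z) \<le> real (Suc n)" by (simp add: FN_def)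
        ultimately show ?thesis using norm_triangle_ineq4[of "fun_conv ?m (FN n) z" "FN n z"] by (simp add: M_def)
      qed
    qed (use h in simp_all)
    also have "\<dots> < ennreal a" using e' by (simp add: ennreal_less_iff)
    finally have l2: "lux_norm G p ?W < ennreal a" .
    have m1: "fun_conv ?m (D n) \<in> borel_measurable (lebesgue_on G)" "?W \<in> borel_measurable (lebesgue_on G)"
      "D n \<in> borel_measurable (lebesgue_on G)"
      by (rule measurable_restrict_space1, measurable)+
    have "lux_norm G p (\<lambda>z. fun_conv ?m (D n) z + ?W z) \<le> ennreal (4 * a)"
      by (rule lux_norm_small_add[OF p a m1(1,2) _ l1 l2]) (intro AE_I2 norm_triangle_ineq)
    also have "\<dots> < ennreal (5 * a)" using a by (simp add: ennreal_less_iff)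
    finally have l3: "lux_norm G p (\<lambda>z. fun_conv ?m (D n) z + ?W z) < ennreal (5 * a)" .
    have "a / (C + 1) \<le> 5 * a"
    proof -
      have "a / (C + 1) \<le> a / 1" using a C by (intro divide_left_mono) auto
      then show ?thesis using a by simp
    qed
    then have l4: "lux_norm G p (D n) < ennreal (5 * a)" using n by (intro less_le_trans[OF n] ennreal_leI)
    have "lux_norm G p (\<lambda>z. fun_conv ?m ?F z - ?F z) \<le> ennreal (4 * (5 * a))"
    proof (rule lux_norm_small_add[OF p _ _ m1(3) _ l3 l4])
      show "(\<lambda>z. fun_conv ?m (D n) z + ?W z) \<in> borel_measurable (lebesgue_on G)" using m1 by measurable
      have eq: "fun_conv ?m ?F z - ?F z = (fun_conv ?m (D n) z + ?W z) - D n z" for z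
        unfolding D_def fun_conv_diff[OF mollifier_C0_infinity[OF h(1)] F FNi] by simp
      show "AE z in lebesgue_on G. norm (fun_conv ?m ?F z - ?F z) \<le>
        norm (fun_conv ?m (D n) z + ?W z) + norm (D n z)"
        unfolding eq by (intro AE_I2 norm_triangle_ineq4)
    qed (use a in simp)
    also have "\<dots> < ennreal e" using e by (simp add: a_def ennreal_less_iff)
    finally show "lux_norm G p (\<lambda>z. fun_conv ?m ?F z - ?F z) < ennreal e" .
  qed
qed

text \<open>Stated for an abstract family \<open>g h\<close> that differs from the mollification by
  a strip average, since it is applied both to the smoothing with exponent \<open>q\<close> and to
  its gradient with exponent \<open>p\<close>.\<close>

lemma cutoff_mollification_tendsto:
  fixes \<Omega> :: "(real ^ 'd) set" and f :: "real \<times> (real ^ 'd) \<Rightarrow> 'b::euclidean_space"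
    and g :: "real \<Rightarrow> real \<times> (real ^ 'd) \<Rightarrow> 'b"
  assumes \<Omega>: "open \<Omega>" "bounded \<Omega>" and p: "p \<in> P_log (cylinder T \<Omega>)"
    and f: "f \<in> Lp (cylinder T \<Omega>) p"
    and A: "0 < A" and h1: "0 < h1"
    and gm: "\<And>h. 0 < h \<Longrightarrow> h < h1 \<Longrightarrow> g h \<in> borel_measurable lebesgue"
    and g: "\<And>h z. 0 < h \<Longrightarrow> h < h1 \<Longrightarrow> ennreal (norm (g h z - fun_conv (mollifier h)
      (zero_ext (cylinder T \<Omega>) f) z)) \<le>
      ennreal (A / (8 * h) ^ DIM(real \<times> (real ^ 'd))) *
        ball_integral (strip_part \<Omega> h (zero_ext (cylinder T \<Omega>) f)) z (8 * h)"
    and e: "0 < e"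
  obtains d where "0 < d" "d \<le> h1" "\<And>h. 0 < h \<Longrightarrow> h < d \<Longrightarrow>
    lux_norm (cylinder T \<Omega>) p (\<lambda>z. g h z - f z) < ennreal e"
proof -
  let ?Q = "cylinder T \<Omega>"
  let ?F = "zero_ext ?Q f"
  note Qs = sets_lebesgue_open[OF open_cylinder[OF \<Omega>(1), of T]] and Qb = bounded_cylinder[OF \<Omega>(2), of T]
  have F: "integrable lebesgue ?F" using Lp_integrable[OF p Qb Qs f] by (simp add: zero_ext_integrable[OF Qs])
  then have Fm: "?F \<in> borel_measurable lebesgue" by simp
  obtain R where R: "0 < R" "?Q \<subseteq> ball 0 R" using bounded_subset_ballD[OF Qb] by blast
  have h8: "0 < 8 * h1" using h1 by simp
  obtain C where C: "0 < C" "\<And>(f :: real \<times> (real ^ 'd) \<Rightarrow> 'b) (g :: real \<times> (real ^ 'd)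
    \<Rightarrow> 'b) r.
       f \<in> borel_measurable lebesgue \<Longrightarrow> (\<And>y. y \<notin> ?Q \<inter> ball 0 R
         \<Longrightarrow> f y = 0) \<Longrightarrow> 0 < r \<Longrightarrow> r \<le> 8 * h1 \<Longrightarrow>
       g \<in> borel_measurable (lebesgue_on ?Q) \<Longrightarrow>
       (\<And>x. x \<in> ?Q \<Longrightarrow> ennreal (norm (g x)) \<le>
          ennreal (A / r ^ DIM(real \<times> (real ^ 'd))) * ball_integral f x r) \<Longrightarrow>
       lux_norm ?Q p g \<le> ennreal C * lux_norm ?Q p f"
    using lux_norm_ball_average[OF Qs p A R(1) h8] by blast
  define a where "a = e / 5"
  have a: "0 < a" using e by (simp add: a_def)
  have a2: "0 < a / (C + 1)" using a C by simp
  obtain d1 where d1: "0 < d1" "\<And>h. h < d1 \<Longrightarrow> lux_norm ?Q p (strip_part \<Omega> h ?F) < ennreal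
    (a / (C + 1))"
    using strip_part_small[OF \<Omega> p f a2] by blast
  obtain d2 where d2: "0 < d2" "\<And>h. 0 < h \<Longrightarrow> h < d2 \<Longrightarrow>
    lux_norm ?Q p (\<lambda>z. fun_conv (mollifier h) ?F z - ?F z) < ennreal a"
    using mollifier_tendsto_lux_norm[OF Qs Qb p f a] by blast
  show ?thesis
  proof (rule that[of "min h1 (min d1 d2)"])
    fix h assume h: "0 < h" "h < min h1 (min d1 d2)"
    then have h': "h < h1" "h < d1" "h < d2" by auto
    let ?c = "fun_conv (mollifier h) ?F"
    have [measurable]: "?c \<in> borel_measurable lebesgue" "g h \<in> borel_measurable lebesgue"
      using fun_conv_measurable[OF h(1) F] gm[OF h(1) h'(1)] by auto
    note [measurable] = Fm
    have m1: "(\<lambda>z. g h z - ?c z) \<in> borel_measurable (lebesgue_on ?Q)" "(\<lambda>z. ?c z - ?F z) \<in>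
      borel_measurable (lebesgue_on ?Q)"
      by (rule measurable_restrict_space1, measurable)+
    have "lux_norm ?Q p (\<lambda>z. g h z - ?c z) \<le> ennreal C * lux_norm ?Q p (strip_part \<Omega> h ?F)"
    proof (rule C(2)[OF strip_part_measurable[OF Fm] _ _ _ m1(1) g[OF h(1) h'(1)]])
      show "strip_part \<Omega> h ?F y = 0" if "y \<notin> ?Q \<inter> ball 0 R" for y
        using that R(2) by (auto simp: strip_part_def zero_ext_def)
    qed (use h h' in auto)
    then have l1: "lux_norm ?Q p (\<lambda>z. g h z - ?c z) < ennreal a"
      by (rule lux_norm_less_mult[OF _ d1(2)[OF h'(2)] C(1) a])
    have "lux_norm ?Q p (\<lambda>z. g h z - f z) \<le> ennreal (4 * a)"
    proof (rule lux_norm_small_add[OF p a m1 _ l1 d2(2)[OF h(1) h'(3)]])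
      show "AE z in lebesgue_on ?Q. norm (g h z - f z) \<le> norm (g h z - ?c z) + norm (?c z - ?F z)"
      proof (intro AE_I2)
        fix z assume "z \<in> space (lebesgue_on ?Q)"
        then have "?F z = f z" by (simp add: space_restrict_space zero_ext_def)
        then show "norm (g h z - f z) \<le> norm (g h z - ?c z) + norm (?c z - ?F z)"
          using norm_triangle_ineq[of "g h z - ?c z" "?c z - f z"] by simp
      qed
    qed
    also have "\<dots> < ennreal e" using e by (simp add: a_def ennreal_less_iff)
    finally show "lux_norm ?Q p (\<lambda>z. g h z - f z) < ennreal e" .
  qed (use h1 d1 d2 in auto)
qed

section \<open>Norm bounds and norm convergence of the smoothing\<close>

lemma weak_eps_UNIV_smoothing:
  fixes \<Omega> :: "(real ^ 'd) set"
  assumes "open \<Omega>" "bounded \<Omega>" "0 < h" "integrable (lebesgue_on (cylinder T \<Omega>)) u"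
  shows "weak_eps dir_tx UNIV (smoothing T \<Omega> h u) = classical_eps dir_tx (smoothing T \<Omega> h u)"
  using weak_eps_smooth[OF open_UNIV smoothing_smooth(1)[OF assms]] by auto

lemma weak_eps_cylinder_smoothing:
  fixes \<Omega> :: "(real ^ 'd) set"
  assumes "open \<Omega>" "bounded \<Omega>" "0 < h" "integrable (lebesgue_on (cylinder T \<Omega>)) u" "z \<in>
    cylinder T \<Omega>"
  shows "weak_eps dir_tx (cylinder T \<Omega>) (smoothing T \<Omega> h u) z =
    classical_eps dir_tx (smoothing T \<Omega> h u) z"
  by (intro weak_eps_smooth open_cylinder smooth_on_subset[OF smoothing_smooth(1)] assms) simp

lemma ball_average_le_maximal_function:
  fixes f :: "'a::euclidean_space \<Rightarrow> 'b::euclidean_space"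
  assumes r: "0 < r" and A: "0 < A"
  shows "ennreal (A / r ^ DIM('a)) * ball_integral f z r \<le>
    ennreal (A * unit_ball_vol (real DIM('a))) * maximal_function f z"
proof -
  let ?\<omega> = "unit_ball_vol (real DIM('a))"
  let ?I = "\<integral>\<^sup>+w. ennreal (norm (f w)) * indicator (ball z r) w \<partial>lebesgue"
  have \<omega>: "0 < ?\<omega>" by simp
  have em: "emeasure lebesgue (ball z r) = ennreal (?\<omega> * r ^ DIM('a))" using emeasure_ball[of r z] r by simp
  have I: "(\<integral>\<^sup>+w. ennreal (norm (f w)) \<partial>lebesgue_on (ball z r)) = ?I"
    by (subst nn_integral_restrict_space) auto
  have "?I / ennreal (?\<omega> * r ^ DIM('a)) \<le> maximal_function f z"
    unfolding maximal_function_def using r by (intro SUP_upper2[of r]) (simp_all add: I em del: emeasure_completion)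
  then have "ennreal (A * ?\<omega>) * (?I / ennreal (?\<omega> * r ^ DIM('a))) \<le>
    ennreal (A * ?\<omega>) * maximal_function f z"
    by (intro mult_left_mono) auto
  moreover have "?I / ennreal (?\<omega> * r ^ DIM('a)) = ennreal (inverse (?\<omega> * r ^ DIM('a))) * ?I"
    using \<omega> r by (simp add: divide_ennreal_def inverse_ennreal mult.commute)
  moreover have "ennreal (A * ?\<omega>) * (ennreal (inverse (?\<omega> * r ^ DIM('a))) * ?I) =
    ennreal (A / r ^ DIM('a)) * ?I"
  proof -
    have "ennreal (A * ?\<omega>) * ennreal (inverse (?\<omega> * r ^ DIM('a))) =
      ennreal (A * ?\<omega> * inverse (?\<omega> * r ^ DIM('a)))"
      using \<omega> r A by (intro ennreal_mult[symmetric]) auto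
    also have "A * ?\<omega> * inverse (?\<omega> * r ^ DIM('a)) = A / r ^ DIM('a)"
      using less_imp_neq[OF \<omega>] r by (simp add: divide_inverse mult.assoc)
    finally show ?thesis by (simp only: mult.assoc[symmetric])
  qed
  ultimately show ?thesis by simp
qed

lemma lux_norm_smoothing_le:
  fixes \<Omega> :: "(real ^ 'd) set"
  assumes \<Omega>: "open \<Omega>" "bounded \<Omega>" "\<Omega> \<noteq> {}"
    and q: "q \<in> P_log (cylinder T \<Omega>)" and qbar: "log_extension (cylinder T \<Omega>) q qbar"
  obtains c where "0 < c" "\<And>v :: real \<times> (real ^ 'd) \<Rightarrow> real ^ 'd. \<And>h. v \<in> Lp
    (cylinder T \<Omega>) q \<Longrightarrow> 0 < h \<Longrightarrow>
    lux_norm UNIV qbar (smoothing T \<Omega> h v) \<le> ennreal c * lux_norm (cylinder T \<Omega>) q v"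
proof -
  let ?Q = "cylinder T \<Omega>"
  note Qs = sets_lebesgue_open[OF open_cylinder[OF \<Omega>(1), of T]] and Qb = bounded_cylinder[OF \<Omega>(2), of T]
  have qb: "qbar \<in> P_log UNIV" "\<And>z. z \<in> ?Q \<Longrightarrow> qbar z = q z" using qbar
    by (auto simp: log_extension_def)
  obtain R where R: "0 < R" "?Q \<subseteq> ball 0 R" using bounded_subset_ballD[OF Qb] by blast
  obtain H where H: "0 < H" "\<And>h x. H < h \<Longrightarrow> cutoff \<Omega> h x = 0"
    using cutoff_large_eq_0[OF \<Omega>(2,3)] by blast
  define A where "A = 1 / bump_mass TYPE(real \<times> (real ^ 'd))"
  have A: "0 < A" unfolding A_def using bump_mass_pos[where 'a="real \<times> (real ^ 'd)"] by simp
  define G :: "(real \<times> (real ^ 'd)) set" where "G = UNIV"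
  have Gs: "G \<in> sets lebesgue" and Gp: "qbar \<in> P_log G" using qb(1) by (simp_all add: G_def)
  obtain C where C: "0 < C" "\<And>(f :: real \<times> (real ^ 'd) \<Rightarrow> real ^ 'd) (g :: real \<times> (real
    ^ 'd) \<Rightarrow> real ^ 'd) r.
       f \<in> borel_measurable lebesgue \<Longrightarrow> (\<And>y. y \<notin> G \<inter> ball 0 R \<Longrightarrow>
         f y = 0) \<Longrightarrow> 0 < r \<Longrightarrow> r \<le> H \<Longrightarrow>
       g \<in> borel_measurable (lebesgue_on G) \<Longrightarrow>
       (\<And>x. x \<in> G \<Longrightarrow> ennreal (norm (g x)) \<le>
          ennreal (A / r ^ DIM(real \<times> (real ^ 'd))) * ball_integral f x r) \<Longrightarrow>
       lux_norm G qbar g \<le> ennreal C * lux_norm G qbar f"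
    using lux_norm_ball_average[OF Gs Gp A R(1) H(1)] by blast
  show ?thesis
  proof (rule that[OF C(1)])
    fix v :: "real \<times> (real ^ 'd) \<Rightarrow> real ^ 'd" and h :: real assume v: "v \<in> Lp ?Q q"
      and h: "0 < h"
    have vi: "integrable (lebesgue_on ?Q) v" by (rule Lp_integrable[OF q Qb Qs v])
    have Vm: "zero_ext ?Q v \<in> borel_measurable lebesgue" using v by (simp add: zero_ext_measurable[OF Qs] Lp_def)
    show "lux_norm UNIV qbar (smoothing T \<Omega> h v) \<le> ennreal C * lux_norm ?Q q v"
    proof (cases "h \<le> H")
      case True
      have "lux_norm UNIV qbar (smoothing T \<Omega> h v) \<le> ennreal C * lux_norm UNIV qbar (zero_ext ?Q v)"
      proof (rule C(2)[unfolded G_def, OF Vm _ h True])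
        show "zero_ext ?Q v y = 0" if "y \<notin> UNIV \<inter> ball 0 R" for y using that R(2)
          by (auto simp: zero_ext_def)
        show "smoothing T \<Omega> h v \<in> borel_measurable (lebesgue_on UNIV)"
          by (rule measurable_restrict_space1[OF continuous_imp_lebesgue[OF smooth_on_continuous[OF
            smoothing_smooth(1)[OF \<Omega>(1,2) h vi]]]])
        show "ennreal (norm (smoothing T \<Omega> h v x)) \<le> ennreal (A / h ^ DIM(real \<times> (real ^ 'd))) *
          ball_integral (zero_ext ?Q v) x h" for x
          unfolding A_def smoothing_def by (rule conv_cutoff_bound(1)[OF \<Omega>(1,2) h vi])
      qed
      then show ?thesis by (simp add: lux_norm_zero_ext[OF Qs qb(2)])
    next
      case False
      then have "smoothing T \<Omega> h v z = 0" for z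
        unfolding smoothing_def fun_conv_def using H(2)[of h] by simp
      then show ?thesis by (simp add: lux_norm_zero)
    qed
  qed
qed

lemma lux_norm_eps_smoothing_le:
  fixes \<Omega> :: "(real ^ 'd) set"
  assumes \<Omega>: "open \<Omega>" "bounded \<Omega>" and be: "boundary_estimate \<Omega> h0 c0"
    and c0: "0 < c0" and h0: "0 < h0"
    and p: "p \<in> P_log (cylinder T \<Omega>)" and pbar: "log_extension (cylinder T \<Omega>) p pbar"
  obtains c where "0 < c" "\<And>q u h. q \<in> P_log (cylinder T \<Omega>) \<Longrightarrow>
    u \<in> XX_eps T \<Omega> q p \<Longrightarrow> 0 < h \<Longrightarrow> h < h0 / 4 \<Longrightarrow>
    lux_norm UNIV pbar (weak_eps dir_tx UNIV (smoothing T \<Omega> h u)) \<le>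
      ennreal c * lux_norm (cylinder T \<Omega>) p (weak_eps dir_tx (cylinder T \<Omega>) u)"
proof -
  let ?Q = "cylinder T \<Omega>"
  note Qs = sets_lebesgue_open[OF open_cylinder[OF \<Omega>(1), of T]] and Qb = bounded_cylinder[OF \<Omega>(2), of T]
  have pb: "pbar \<in> P_log UNIV" "\<And>z. z \<in> ?Q \<Longrightarrow> pbar z = p z" using pbar
    by (auto simp: log_extension_def)
  obtain R where R: "0 < R" "?Q \<subseteq> ball 0 R" using bounded_subset_ballD[OF Qb] by blast
  obtain A where A: "0 < A"
    "\<And>T q p u h z. q \<in> P_log (cylinder T \<Omega>) \<Longrightarrow>
      p \<in> P_log (cylinder T \<Omega>) \<Longrightarrow> u \<in> XX_eps T \<Omega> q p \<Longrightarrow>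
      0 < h \<Longrightarrow> h < h0 / 4 \<Longrightarrow>
      ennreal (norm (classical_eps dir_tx (smoothing T \<Omega> h u) z)) \<le>
      ennreal (A / (8 * h) ^ DIM(real \<times> (real ^ 'd))) *
        ball_integral (zero_ext (cylinder T \<Omega>) (weak_eps dir_tx (cylinder T \<Omega>) u)) z (8 * h)"
    "\<And>T q p u h z. q \<in> P_log (cylinder T \<Omega>) \<Longrightarrow>
      p \<in> P_log (cylinder T \<Omega>) \<Longrightarrow> u \<in> XX_eps T \<Omega> q p \<Longrightarrow>
      0 < h \<Longrightarrow> h < h0 / 4 \<Longrightarrow>
      ennreal (norm (classical_eps dir_tx (smoothing T \<Omega> h u) z - fun_conv (mollifier h) (zero_ext (cylinder T
        \<Omega>) (weak_eps dir_tx (cylinder T \<Omega>) u)) z)) \<le>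
      ennreal (A / (8 * h) ^ DIM(real \<times> (real ^ 'd))) *
        ball_integral (strip_part \<Omega> h (zero_ext (cylinder T \<Omega>) (weak_eps dir_tx (cylinder T \<Omega>)
        u))) z (8 * h)"
    using eps_smoothing_bounds[OF \<Omega> be c0] by blast
  \<comment> \<open>The averages have radius \<open>8 * h\<close>, which is at most
    \<open>2 * h0\<close> for \<open>h < h0 / 4\<close>.\<close>
  have h8: "0 < 2 * h0" using h0 by simp
  define G :: "(real \<times> (real ^ 'd)) set" where "G = UNIV"
  have Gs: "G \<in> sets lebesgue" and Gp: "pbar \<in> P_log G" using pb(1) by (simp_all add: G_def)
  obtain C where C: "0 < C" "\<And>(f :: real \<times> (real ^ 'd) \<Rightarrow> real ^ 'd ^ 'd) (g :: real \<times>
    (real ^ 'd) \<Rightarrow> real ^ 'd ^ 'd) r.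
       f \<in> borel_measurable lebesgue \<Longrightarrow> (\<And>y. y \<notin> G \<inter> ball 0 R \<Longrightarrow>
         f y = 0) \<Longrightarrow> 0 < r \<Longrightarrow> r \<le> 2 * h0 \<Longrightarrow>
       g \<in> borel_measurable (lebesgue_on G) \<Longrightarrow>
       (\<And>x. x \<in> G \<Longrightarrow> ennreal (norm (g x)) \<le>
          ennreal (A / r ^ DIM(real \<times> (real ^ 'd))) * ball_integral f x r) \<Longrightarrow>
       lux_norm G pbar g \<le> ennreal C * lux_norm G pbar f"
    using lux_norm_ball_average[OF Gs Gp A(1) R(1) h8] by blast
  show ?thesis
  proof (rule that[OF C(1)])
    fix q u h assume q: "q \<in> P_log ?Q" and u: "u \<in> XX_eps T \<Omega> q p" and h: "0 < h" "h < h0 / 4"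
    let ?E = "weak_eps dir_tx ?Q u"
    note ui = XX_eps_integrable[OF \<Omega> q p u]
    have Em: "zero_ext ?Q ?E \<in> borel_measurable lebesgue"
      using ui(2) by (simp add: zero_ext_measurable[OF Qs] borel_measurable_integrable)
    have "lux_norm UNIV pbar (classical_eps dir_tx (smoothing T \<Omega> h u)) \<le>
      ennreal C * lux_norm UNIV pbar (zero_ext ?Q ?E)"
    proof (rule C(2)[unfolded G_def, OF Em _ _ _ _ A(2)[OF q p u h]])
      show "zero_ext ?Q ?E y = 0" if "y \<notin> UNIV \<inter> ball 0 R" for y using that R(2)
        by (auto simp: zero_ext_def)
      show "classical_eps dir_tx (smoothing T \<Omega> h u) \<in> borel_measurable (lebesgue_on UNIV)"
        by (rule measurable_restrict_space1[OF continuous_imp_lebesgue[OF continuous_classical_eps[OF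
          smoothing_smooth(1)[OF \<Omega> h(1) ui(1)]]]])
    qed (use h in auto)
    then show "lux_norm UNIV pbar (weak_eps dir_tx UNIV (smoothing T \<Omega> h u)) \<le>
      ennreal C * lux_norm ?Q p ?E"
      by (simp add: lux_norm_zero_ext[OF Qs pb(2)] weak_eps_UNIV_smoothing[OF \<Omega> h(1) ui(1)])
  qed
qed

text \<open>The gradients of the smoothing over \<open>UNIV\<close> and over the cylinder are
  separate choices; on the cylinder both equal the classical gradient, so the norm over the whole
  space dominates.\<close>

lemma XX_norm_smoothing_le:
  fixes \<Omega> :: "(real ^ 'd) set"
  assumes \<Omega>: "open \<Omega>" "bounded \<Omega>" and h: "0 < h"
    and q: "q \<in> P_log (cylinder T \<Omega>)" and p: "p \<in> P_log (cylinder T \<Omega>)"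
    and u: "u \<in> XX_eps T \<Omega> q p" and cq: "0 < c_q" and cp: "0 < c_p"
    and pbar: "log_extension (cylinder T \<Omega>) p pbar" and qbar: "log_extension (cylinder T \<Omega>) q qbar"
    and lq: "lux_norm UNIV qbar (smoothing T \<Omega> h u) \<le> ennreal c_q * lux_norm (cylinder T \<Omega>) q u"
    and lp: "lux_norm UNIV pbar (weak_eps dir_tx UNIV (smoothing T \<Omega> h u)) \<le>
      ennreal c_p * lux_norm (cylinder T \<Omega>) p (weak_eps dir_tx (cylinder T \<Omega>) u)"
  shows "XX_norm T \<Omega> q p (smoothing T \<Omega> h u) \<le> ennreal (c_q + c_p) * XX_norm T \<Omega> q p u"
proof -
  let ?Q = "cylinder T \<Omega>"
  let ?s = "smoothing T \<Omega> h u"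
  note Qs = sets_lebesgue_open[OF open_cylinder[OF \<Omega>(1), of T]]
  note ui = XX_eps_integrable[OF \<Omega> q p u]
  have pb: "\<And>z. z \<in> ?Q \<Longrightarrow> pbar z = p z" "\<And>z. z \<in> ?Q \<Longrightarrow>
    qbar z = q z" using pbar qbar by (auto simp: log_extension_def)
  have "lux_norm ?Q p (weak_eps dir_tx ?Q ?s) \<le> lux_norm ?Q p (weak_eps dir_tx UNIV ?s)"
    by (intro lux_norm_mono_AE AE_I2 P_log_nonneg[OF p])
      (simp add: space_restrict_space weak_eps_cylinder_smoothing[OF \<Omega> h ui(1)] weak_eps_UNIV_smoothing[OF
        \<Omega> h ui(1)])
  also have "\<dots> \<le> lux_norm UNIV pbar (weak_eps dir_tx UNIV ?s)" by (rule lux_norm_restrict_le[OF Qs pb(1)])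
  also note lp
  finally have 1: "lux_norm ?Q p (weak_eps dir_tx ?Q ?s) \<le> ennreal c_p * lux_norm ?Q p (weak_eps dir_tx ?Q u)" .
  have 2: "lux_norm ?Q q ?s \<le> ennreal c_q * lux_norm ?Q q u"
    by (rule order_trans[OF lux_norm_restrict_le[OF Qs pb(2)] lq])
  have "XX_norm T \<Omega> q p ?s \<le> ennreal c_q * lux_norm ?Q q u +
    ennreal c_p * lux_norm ?Q p (weak_eps dir_tx ?Q u)"
    unfolding XX_norm_def by (intro add_mono 1 2)
  also have "\<dots> \<le> ennreal (c_q + c_p) * lux_norm ?Q q u + ennreal (c_q +
    c_p) * lux_norm ?Q p (weak_eps dir_tx ?Q u)"
    using cq cp by (intro add_mono mult_right_mono ennreal_leI) auto
  also have "\<dots> = ennreal (c_q + c_p) * XX_norm T \<Omega> q p u" by (simp only: XX_norm_def distrib_left)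
  finally show ?thesis .
qed

lemma smoothing_tendsto_XX_norm:
  fixes \<Omega> :: "(real ^ 'd) set"
  assumes \<Omega>: "open \<Omega>" "bounded \<Omega>" and be: "boundary_estimate \<Omega> h0 c0"
    and c0: "0 < c0" and h0: "0 < h0"
    and q: "q \<in> P_log (cylinder T \<Omega>)" and p: "p \<in> P_log (cylinder T \<Omega>)"
    and u: "u \<in> XX_eps T \<Omega> q p" and e: "0 < e"
  obtains d where "0 < d" "d \<le> h0 / 4"
    "\<And>h. 0 < h \<Longrightarrow> h < d \<Longrightarrow> XX_norm T \<Omega> q p (\<lambda>z. smoothing T
      \<Omega> h u z - u z) < ennreal e"
    "\<And>h. 0 < h \<Longrightarrow> h < d \<Longrightarrow> XX_norm T \<Omega> q p (\<lambda>z. u z - smoothing T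
      \<Omega> h u z) < ennreal e"
proof -
  let ?Q = "cylinder T \<Omega>"
  let ?E = "weak_eps dir_tx ?Q u"
  let ?n = "DIM(real \<times> (real ^ 'd))"
  note Q = open_cylinder[OF \<Omega>(1), of T]
  note ui = XX_eps_integrable[OF \<Omega> q p u]
  have uL: "u \<in> Lp ?Q q" "?E \<in> Lp ?Q p" using u by (auto simp: XX_eps_def)
  obtain A where A: "0 < A"
    "\<And>T q p u h z. q \<in> P_log (cylinder T \<Omega>) \<Longrightarrow>
      p \<in> P_log (cylinder T \<Omega>) \<Longrightarrow> u \<in> XX_eps T \<Omega> q p \<Longrightarrow>
      0 < h \<Longrightarrow> h < h0 / 4 \<Longrightarrow>
      ennreal (norm (classical_eps dir_tx (smoothing T \<Omega> h u) z)) \<le>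
      ennreal (A / (8 * h) ^ DIM(real \<times> (real ^ 'd))) *
        ball_integral (zero_ext (cylinder T \<Omega>) (weak_eps dir_tx (cylinder T \<Omega>) u)) z (8 * h)"
    "\<And>T q p u h z. q \<in> P_log (cylinder T \<Omega>) \<Longrightarrow>
      p \<in> P_log (cylinder T \<Omega>) \<Longrightarrow> u \<in> XX_eps T \<Omega> q p \<Longrightarrow>
      0 < h \<Longrightarrow> h < h0 / 4 \<Longrightarrow>
      ennreal (norm (classical_eps dir_tx (smoothing T \<Omega> h u) z - fun_conv (mollifier h) (zero_ext (cylinder T
        \<Omega>) (weak_eps dir_tx (cylinder T \<Omega>) u)) z)) \<le>
      ennreal (A / (8 * h) ^ DIM(real \<times> (real ^ 'd))) *
        ball_integral (strip_part \<Omega> h (zero_ext (cylinder T \<Omega>) (weak_eps dir_tx (cylinder T \<Omega>)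
        u))) z (8 * h)"
    using eps_smoothing_bounds[OF \<Omega> be c0] by blast
  have h4: "0 < h0 / 4" using h0 by simp
  have e2: "0 < e / 2" using e by simp
  define g where "g h = classical_eps dir_tx (smoothing T \<Omega> h u)" for h
  obtain d1 where d1: "0 < d1" "d1 \<le> h0 / 4"
    "\<And>h. 0 < h \<Longrightarrow> h < d1 \<Longrightarrow> lux_norm ?Q p (\<lambda>z. g h z - ?E z) < ennreal (e
      / 2)"
  proof (rule cutoff_mollification_tendsto[OF \<Omega> p uL(2) A(1) h4 _ A(3)[OF q p u, folded g_def] e2])
    show "g h \<in> borel_measurable lebesgue" if "0 < h" for h
      unfolding g_def by (rule continuous_imp_lebesgue[OF continuous_classical_eps[OF smoothing_smooth(1)[OF \<Omega>
        that ui(1)]]])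
    fix d assume d: "0 < d" "d \<le> h0 / 4"
      "\<And>h. 0 < h \<Longrightarrow> h < d \<Longrightarrow> lux_norm ?Q p (\<lambda>z. g h z - ?E z) < ennreal (e
        / 2)"
    show thesis by (rule that[OF d(1,2)]) (rule d(3))
  qed
  define A1 where "A1 = 1 / bump_mass TYPE(real \<times> (real ^ 'd))"
  have A1: "0 < A1 * 8 ^ ?n" unfolding A1_def using bump_mass_pos[where 'a="real \<times> (real ^ 'd)"] by simp
  obtain d2 where d2: "0 < d2" "d2 \<le> h0 / 4"
    "\<And>h. 0 < h \<Longrightarrow> h < d2 \<Longrightarrow> lux_norm ?Q q (\<lambda>z. smoothing T \<Omega> h u z
      - u z) < ennreal (e / 2)"
  proof (rule cutoff_mollification_tendsto[OF \<Omega> q uL(1) A1 h4 _ _ e2, where g =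
    "\<lambda>h. smoothing T \<Omega> h u"])
    fix h :: real and z assume h: "0 < h"
    show "smoothing T \<Omega> h u \<in> borel_measurable lebesgue"
      by (rule continuous_imp_lebesgue[OF smooth_on_continuous[OF smoothing_smooth(1)[OF \<Omega> h ui(1)]]])
    have "A1 * 8 ^ ?n / (8 * h) ^ ?n = A1 / h ^ ?n"
      using h by (simp add: power_mult_distrib del: DIM_prod)
    then show "ennreal (norm (smoothing T \<Omega> h u z - fun_conv (mollifier h) (zero_ext ?Q u) z)) \<le>
      ennreal (A1 * 8 ^ ?n / (8 * h) ^ ?n) * ball_integral (strip_part \<Omega> h (zero_ext ?Q u)) z (8 * h)"
      using conv_cutoff_bound(2)[OF \<Omega> h ui(1), of z] by (simp only: A1_def smoothing_def)
  qed blast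
  \<comment> \<open>Both orders of the difference are wanted, one for the convergence and one for
    the density. Since \<open>weak_eps\<close> is chosen for each function separately, changing the
    sign of the function need not literally change the sign of the choice; \<open>main\<close>
    therefore uses only norms and some weak gradient \<open>E'\<close>, with which the chosen one
    agrees almost everywhere.\<close>
  have main: "XX_norm T \<Omega> q p w < ennreal e"
    if h: "0 < h" "h < min d1 d2" and w: "\<And>z. norm (w z) = norm (smoothing T \<Omega> h u z - u z)"
      and E': "has_weak_eps dir_tx ?Q w E'" "\<And>z. norm (E' z) =
        norm (classical_eps dir_tx (smoothing T \<Omega> h u) z - ?E z)" for h w E'
  proof -
    have "lux_norm ?Q q w \<le> lux_norm ?Q q (\<lambda>z. smoothing T \<Omega> h u z - u z)"
      by (intro lux_norm_mono_AE AE_I2 P_log_nonneg[OF q]) (simp add: w)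
    also have "\<dots> < ennreal (e / 2)" using h by (intro d2(3)) auto
    finally have 1: "lux_norm ?Q q w < ennreal (e / 2)" .
    have "lux_norm ?Q p (weak_eps dir_tx ?Q w) \<le> lux_norm ?Q p (\<lambda>z. classical_eps dir_tx (smoothing T
      \<Omega> h u) z - ?E z)"
      using weak_eps_AE[OF Q E'(1)] by (intro lux_norm_mono_AE P_log_nonneg[OF p]) (auto elim!: eventually_mono simp:
        E'(2))
    also have "\<dots> < ennreal (e / 2)" using h using d1(3)[of h] by (auto simp: g_def)
    finally have 2: "lux_norm ?Q p (weak_eps dir_tx ?Q w) < ennreal (e / 2)" .
    have "XX_norm T \<Omega> q p w < ennreal (e / 2) + ennreal (e / 2)"
      unfolding XX_norm_def by (intro add_strict_mono 1 2)
    also have "\<dots> = ennreal e" using e by (simp add: ennreal_plus[symmetric] del: ennreal_plus)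
    finally show ?thesis .
  qed
  have ws: "has_weak_eps dir_tx ?Q (smoothing T \<Omega> h u) (classical_eps dir_tx (smoothing T \<Omega> h u))" if
    "0 < h" for h
    by (rule has_weak_eps_smooth[OF Q smooth_on_subset[OF smoothing_smooth(1)[OF \<Omega> that ui(1)]]]) simp
  note wu = XX_eps_weak_eps[OF u]
  show ?thesis
  proof (rule that[of "min d1 d2"])
    fix h assume h: "0 < h" "h < min d1 d2"
    show "XX_norm T \<Omega> q p (\<lambda>z. smoothing T \<Omega> h u z - u z) < ennreal e"
      by (rule main[OF h _ has_weak_eps_diff[OF Q ws[OF h(1)] wu]]) simp_all
    show "XX_norm T \<Omega> q p (\<lambda>z. u z - smoothing T \<Omega> h u z) < ennreal e"
      by (rule main[OF h _ has_weak_eps_diff[OF Q wu ws[OF h(1)]]]) (rule norm_minus_commute)+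
  qed (use d1 d2 in auto)
qed

theorem proposition5p9:
  fixes \<Omega> :: "(real ^ 'd::finite) set" and T h0 h1 c0 :: real
  assumes "2 \<le> CARD('d)"
    and "bounded_lipschitz_domain \<Omega>"
    and "0 < T"
    and "0 < h0" and "0 < c0" and "boundary_estimate \<Omega> h0 c0"
    and "h1 = h0 / 4"
  shows
    "(\<exists>c_d>0. \<forall>q\<in>P_log (cylinder T \<Omega>). \<forall>p\<in>P_log (cylinder T \<Omega>).
       1 < exp_minus (cylinder T \<Omega>) q \<longrightarrow> 1 < exp_minus (cylinder T \<Omega>) p \<longrightarrow>
       (\<forall>u\<in>XX_eps T \<Omega> q p. AE z in lebesgue.
          (SUP h\<in>{0<..<h1}. ennreal (norm (weak_eps dir_tx UNIV (smoothing T \<Omega> h u) z)))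
          \<le> ennreal c_d *
             maximal_function (zero_ext (cylinder T \<Omega>) (weak_eps dir_tx (cylinder T \<Omega>) u)) z)) \<and>
     (\<forall>p\<in>P_log (cylinder T \<Omega>). 1 < exp_minus (cylinder T \<Omega>) p \<longrightarrow>
       (\<forall>pbar. log_extension (cylinder T \<Omega>) p pbar \<longrightarrow>
         (\<exists>c_p>0. \<forall>q\<in>P_log (cylinder T \<Omega>). 1 < exp_minus (cylinder T \<Omega>) q \<longrightarrow>
            (\<forall>u\<in>XX_eps T \<Omega> q p.
               (SUP h\<in>{0<..<h1}. lux_norm UNIV pbar (weak_eps dir_tx UNIV (smoothing T \<Omega> h u)))
               \<le> ennreal c_p * lux_norm (cylinder T \<Omega>) p (weak_eps dir_tx (cylinder T \<Omega>) u)) \<and>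
            (\<forall>qbar. log_extension (cylinder T \<Omega>) q qbar \<longrightarrow>
               (\<exists>c_q>0. \<forall>v\<in>Lp (cylinder T \<Omega>) q.
                  (SUP h\<in>{0<..}. lux_norm UNIV qbar (smoothing T \<Omega> h v))
                  \<le> ennreal c_q * lux_norm (cylinder T \<Omega>) q v) \<and>
               (\<forall>c_q>0.
                  (\<forall>v\<in>Lp (cylinder T \<Omega>) q.
                     (SUP h\<in>{0<..}. lux_norm UNIV qbar (smoothing T \<Omega> h v))
                     \<le> ennreal c_q * lux_norm (cylinder T \<Omega>) q v) \<longrightarrow>
                  (\<forall>u\<in>XX_eps T \<Omega> q p.
                     (\<forall>h\<in>{0<..<h1}. smoothing T \<Omega> h u \<in> XX_eps T \<Omega> q p) \<and>
                     (SUP h\<in>{0<..<h1}. XX_norm T \<Omega> q p (smoothing T \<Omega> h u))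
                     \<le> ennreal (c_q + c_p) * XX_norm T \<Omega> q p u)))))) \<and>
     (\<forall>q\<in>P_log (cylinder T \<Omega>). \<forall>p\<in>P_log (cylinder T \<Omega>).
       1 < exp_minus (cylinder T \<Omega>) q \<longrightarrow> 1 < exp_minus (cylinder T \<Omega>) p \<longrightarrow>
       (\<forall>u\<in>XX_eps T \<Omega> q p.
          (\<forall>h\<in>{0<..<h1}. smoothing T \<Omega> h u \<in> XX_eps T \<Omega> q p) \<and>
          ((\<lambda>h. XX_norm T \<Omega> q p (\<lambda>z. smoothing T \<Omega> h u z - u z)) \<longlongrightarrow> 0) (at_right 0)) \<and>
       C_infinity_C0 T \<Omega> \<subseteq> XX_eps T \<Omega> q p \<and>
       (\<forall>u\<in>XX_eps T \<Omega> q p. \<forall>\<delta>>0. \<exists>\<phi>\<in>C_infinity_C0 T \<Omega>.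
          XX_norm T \<Omega> q p (\<lambda>z. u z - \<phi> z) < \<delta>))"
proof -
  have \<Omega>: "open \<Omega>" "bounded \<Omega>" "\<Omega> \<noteq> {}" using assms(2)
    by (auto simp: bounded_lipschitz_domain_def)
  note be = assms(6) and c0 = assms(5) and h0 = assms(4)
  let ?Q = "cylinder T \<Omega>"
  have smooth_XX: "smoothing T \<Omega> h u \<in> XX_eps T \<Omega> q p"
    if "q \<in> P_log ?Q" "p \<in> P_log ?Q" "u \<in> XX_eps T \<Omega> q p" "0 < h" for q p u h
    using smoothing_in_C_infinity_C0[OF \<Omega>(1,2) that(4) XX_eps_integrable(1)[OF \<Omega>(1,2) that(1-3)]]
      C_infinity_C0_subset_XX_eps[OF \<Omega>(1,2) that(1,2)] by blast
  have part1: "\<exists>c_d>0. \<forall>q\<in>P_log ?Q. \<forall>p\<in>P_log ?Q. 1 < exp_minus ?Q q \<longrightarrow>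
    1 < exp_minus ?Q p \<longrightarrow>
       (\<forall>u\<in>XX_eps T \<Omega> q p. AE z in lebesgue.
          (SUP h\<in>{0<..<h1}. ennreal (norm (weak_eps dir_tx UNIV (smoothing T \<Omega> h u) z)))
          \<le> ennreal c_d * maximal_function (zero_ext ?Q (weak_eps dir_tx ?Q u)) z)"
  proof -
    obtain A where A: "0 < A"
      "\<And>T q p u h z. q \<in> P_log (cylinder T \<Omega>) \<Longrightarrow>
        p \<in> P_log (cylinder T \<Omega>) \<Longrightarrow> u \<in> XX_eps T \<Omega> q p \<Longrightarrow>
        0 < h \<Longrightarrow> h < h0 / 4 \<Longrightarrow>
        ennreal (norm (classical_eps dir_tx (smoothing T \<Omega> h u) z)) \<le>
        ennreal (A / (8 * h) ^ DIM(real \<times> (real ^ 'd))) *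
          ball_integral (zero_ext (cylinder T \<Omega>) (weak_eps dir_tx (cylinder T \<Omega>) u)) z (8 * h)"
      "\<And>T q p u h z. q \<in> P_log (cylinder T \<Omega>) \<Longrightarrow>
        p \<in> P_log (cylinder T \<Omega>) \<Longrightarrow> u \<in> XX_eps T \<Omega> q p \<Longrightarrow>
        0 < h \<Longrightarrow> h < h0 / 4 \<Longrightarrow>
        ennreal (norm (classical_eps dir_tx (smoothing T \<Omega> h u) z - fun_conv (mollifier h) (zero_ext (cylinder
          T \<Omega>) (weak_eps dir_tx (cylinder T \<Omega>) u)) z)) \<le>
        ennreal (A / (8 * h) ^ DIM(real \<times> (real ^ 'd))) *
          ball_integral (strip_part \<Omega> h (zero_ext (cylinder T \<Omega>) (weak_eps dir_tx (cylinder T \<Omega>)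
          u))) z (8 * h)"
      using eps_smoothing_bounds[OF \<Omega>(1,2) be c0] by blast
    \<comment> \<open>For each single \<open>h\<close> the estimate holds at every \<open>z\<close>,
      so the almost-everywhere claim and the supremum can be treated pointwise. The volume of the
      unit ball turns the factor \<open>A\<close> into one for normalised averages.\<close>
    show ?thesis
    proof (intro exI[of _ "A * unit_ball_vol (real DIM(real \<times> (real ^ 'd)))"] conjI ballI impI AE_I2 SUP_least)
      show "0 < A * unit_ball_vol (real DIM(real \<times> (real ^ 'd)))"
        by (rule mult_pos_pos[OF A(1)]) (simp del: DIM_prod)
      fix q p u z h
      assume qp: "q \<in> P_log ?Q" "p \<in> P_log ?Q" "u \<in> XX_eps T \<Omega> q p" and "h \<in> {0<..<h1}"
      then have h: "0 < h" "h < h0 / 4" "0 < 8 * h" using assms(7) by auto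
      show "ennreal (norm (weak_eps dir_tx UNIV (smoothing T \<Omega> h u) z)) \<le>
          ennreal (A * unit_ball_vol (real DIM(real \<times> (real ^ 'd)))) *
            maximal_function (zero_ext ?Q (weak_eps dir_tx ?Q u)) z"
        unfolding weak_eps_UNIV_smoothing[OF \<Omega>(1,2) h(1) XX_eps_integrable(1)[OF \<Omega>(1,2) qp]]
        by (rule order_trans[OF A(2)[OF qp h(1,2)] ball_average_le_maximal_function[OF h(3) A(1)]])
    qed
  qed
  have part2: "\<exists>c_p>0. \<forall>q\<in>P_log ?Q. 1 < exp_minus ?Q q \<longrightarrow>
      (\<forall>u\<in>XX_eps T \<Omega> q p.
         (SUP h\<in>{0<..<h1}. lux_norm UNIV pbar (weak_eps dir_tx UNIV (smoothing T \<Omega> h u)))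
         \<le> ennreal c_p * lux_norm ?Q p (weak_eps dir_tx ?Q u)) \<and>
      (\<forall>qbar. log_extension ?Q q qbar \<longrightarrow>
         (\<exists>c_q>0. \<forall>v\<in>Lp ?Q q.
            (SUP h\<in>{0<..}. lux_norm UNIV qbar (smoothing T \<Omega> h v)) \<le>
              ennreal c_q * lux_norm ?Q q v) \<and>
         (\<forall>c_q>0.
            (\<forall>v\<in>Lp ?Q q.
               (SUP h\<in>{0<..}. lux_norm UNIV qbar (smoothing T \<Omega> h v)) \<le>
                 ennreal c_q * lux_norm ?Q q v) \<longrightarrow>
            (\<forall>u\<in>XX_eps T \<Omega> q p.
               (\<forall>h\<in>{0<..<h1}. smoothing T \<Omega> h u \<in> XX_eps T \<Omega> q p) \<and>
               (SUP h\<in>{0<..<h1}. XX_norm T \<Omega> q p (smoothing T \<Omega> h u))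
               \<le> ennreal (c_q + c_p) * XX_norm T \<Omega> q p u)))"
    if p: "p \<in> P_log ?Q" and pbar: "log_extension ?Q p pbar" for p pbar
  proof -
    obtain c_p where c_p: "0 < c_p" "\<And>q u h. q \<in> P_log ?Q \<Longrightarrow>
      u \<in> XX_eps T \<Omega> q p \<Longrightarrow> 0 < h \<Longrightarrow> h < h0 / 4 \<Longrightarrow>
        lux_norm UNIV pbar (weak_eps dir_tx UNIV (smoothing T \<Omega> h u)) \<le>
          ennreal c_p * lux_norm ?Q p (weak_eps dir_tx ?Q u)"
      using lux_norm_eps_smoothing_le[OF \<Omega>(1,2) be c0 h0 p pbar] by blast
    show ?thesis
    proof (rule exI[of _ c_p], intro conjI ballI allI impI SUP_least)
      show "0 < c_p" by (rule c_p(1))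
      fix q assume q: "q \<in> P_log ?Q"
      show "lux_norm UNIV pbar (weak_eps dir_tx UNIV (smoothing T \<Omega> h u)) \<le>
        ennreal c_p * lux_norm ?Q p (weak_eps dir_tx ?Q u)"
        if "u \<in> XX_eps T \<Omega> q p" "h \<in> {0<..<h1}" for u h
        using that assms(7) by (intro c_p(2)[OF q]) auto
      fix qbar assume qbar: "log_extension ?Q q qbar"
      obtain c where c: "0 < c" "\<And>v :: real \<times> (real ^ 'd) \<Rightarrow> real ^ 'd. \<And>h. v \<in> Lp ?Q
        q \<Longrightarrow> 0 < h \<Longrightarrow>
          lux_norm UNIV qbar (smoothing T \<Omega> h v) \<le> ennreal c * lux_norm ?Q q v"
        using lux_norm_smoothing_le[OF \<Omega> q qbar] by blast
      show "\<exists>c_q>0. \<forall>v\<in>Lp ?Q q. (SUP h\<in>{0<..}. lux_norm UNIV qbar (smoothing T \<Omega> h v))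
        \<le> ennreal c_q * lux_norm ?Q q v"
      proof (intro exI[of _ c] conjI ballI SUP_least)
        show "lux_norm UNIV qbar (smoothing T \<Omega> h v) \<le> ennreal c * lux_norm ?Q q v"
          if "v \<in> Lp ?Q q" "h \<in> {0<..}" for v :: "real \<times> (real ^ 'd) \<Rightarrow> real ^ 'd" and h
          by (rule c(2)[OF that(1)]) (use that in simp)
      qed (rule c(1))
      fix c_q :: real and u assume c_q: "0 < c_q"
        and cq: "\<forall>v\<in>Lp ?Q q. (SUP h\<in>{0<..}. lux_norm UNIV qbar (smoothing T \<Omega> h v)) \<le>
          ennreal c_q * lux_norm ?Q q v"
        and u: "u \<in> XX_eps T \<Omega> q p"
      fix h assume "h \<in> {0<..<h1}"
      then have h: "0 < h" "h < h0 / 4" using assms(7) by auto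
      show "smoothing T \<Omega> h u \<in> XX_eps T \<Omega> q p" by (rule smooth_XX[OF q p u h(1)])
      have uL: "u \<in> Lp ?Q q" using u by (simp add: XX_eps_def)
      \<comment> \<open>Here \<open>c_q\<close> is any constant with the stated property and not the
        one constructed above; the bound at the single \<open>h\<close> is read off from the
        supremum in \<open>cq\<close>.\<close>
      have lq: "lux_norm UNIV qbar (smoothing T \<Omega> h u) \<le> ennreal c_q * lux_norm ?Q q u"
        by (rule order_trans[OF SUP_upper bspec[OF cq uL]]) (use h in simp)
      show "XX_norm T \<Omega> q p (smoothing T \<Omega> h u) \<le> ennreal (c_q + c_p) * XX_norm T \<Omega> q p u"
        by (rule XX_norm_smoothing_le[OF \<Omega>(1,2) h(1) q p u c_q c_p(1) pbar qbar lq c_p(2)[OF q u h]])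
    qed
  qed
  have part3: "(\<forall>u\<in>XX_eps T \<Omega> q p.
          (\<forall>h\<in>{0<..<h1}. smoothing T \<Omega> h u \<in> XX_eps T \<Omega> q p) \<and>
          ((\<lambda>h. XX_norm T \<Omega> q p (\<lambda>z. smoothing T \<Omega> h u z - u z)) \<longlongrightarrow>
            0) (at_right 0)) \<and>
       C_infinity_C0 T \<Omega> \<subseteq> XX_eps T \<Omega> q p \<and>
       (\<forall>u\<in>XX_eps T \<Omega> q p. \<forall>\<delta>>0. \<exists>\<phi>\<in>C_infinity_C0 T \<Omega>.
         XX_norm T \<Omega> q p (\<lambda>z. u z - \<phi> z) < \<delta>)"
    if q: "q \<in> P_log ?Q" and p: "p \<in> P_log ?Q" for q p
  proof (intro conjI ballI allI impI)
    show "C_infinity_C0 T \<Omega> \<subseteq> XX_eps T \<Omega> q p"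
      by (rule C_infinity_C0_subset_XX_eps[OF \<Omega>(1,2) q p])
    \<comment> \<open>Tolerances are extended reals and may be \<infinity>; a positive real below
      them is enough.\<close>
    have pos_real: "\<exists>e>0. ennreal e \<le> a" if "0 < a" for a :: ennreal
      using that by (cases a) (auto intro: exI[of _ "1::real"])
    fix u assume u: "u \<in> XX_eps T \<Omega> q p"
    show "smoothing T \<Omega> h u \<in> XX_eps T \<Omega> q p" if "h \<in> {0<..<h1}" for h
      using that by (intro smooth_XX[OF q p u]) simp
    show "((\<lambda>h. XX_norm T \<Omega> q p (\<lambda>z. smoothing T \<Omega> h u z - u z)) \<longlongrightarrow>
      0) (at_right 0)"
    proof (rule order_tendstoI)
      fix a :: ennreal assume "0 < a"
      then obtain e where e: "0 < e" "ennreal e \<le> a" using pos_real by blast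
      obtain d where d: "0 < d" "\<And>h. 0 < h \<Longrightarrow> h < d \<Longrightarrow>
        XX_norm T \<Omega> q p (\<lambda>z. smoothing T \<Omega> h u z - u z) < ennreal e"
        by (rule smoothing_tendsto_XX_norm[OF \<Omega>(1,2) be c0 h0 q p u e(1)]) blast
      show "\<forall>\<^sub>F h in at_right 0. XX_norm T \<Omega> q p (\<lambda>z. smoothing T \<Omega> h u z - u z)
        < a"
        unfolding eventually_at_right_field using d e(2) by (intro exI[of _ d]) (auto intro: less_le_trans)
    qed simp
    fix \<delta> :: ennreal assume "0 < \<delta>"
    then obtain e where e: "0 < e" "ennreal e \<le> \<delta>" using pos_real by blast
    obtain d where d: "0 < d" "\<And>h. 0 < h \<Longrightarrow> h < d \<Longrightarrow>
      XX_norm T \<Omega> q p (\<lambda>z. u z - smoothing T \<Omega> h u z) < ennreal e"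
      by (rule smoothing_tendsto_XX_norm[OF \<Omega>(1,2) be c0 h0 q p u e(1)]) blast
    have d2: "0 < d / 2" "d / 2 < d" using d(1) by auto
    show "\<exists>\<phi>\<in>C_infinity_C0 T \<Omega>. XX_norm T \<Omega> q p (\<lambda>z. u z - \<phi> z) <
      \<delta>"
      by (rule bexI[OF _ smoothing_in_C_infinity_C0[OF \<Omega>(1,2) d2(1) XX_eps_integrable(1)[OF \<Omega>(1,2) q p
        u]]])
        (rule less_le_trans[OF d(2)[OF d2] e(2)])
  qed
  show ?thesis
    by (rule conjI[OF part1 conjI]) (intro ballI allI impI, rule part2 part3; assumption)+
qed

end
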